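(* For each prime number $p>0$, there exist a polynomial ring $R$ (in finitely many indeterminates) over the finite field $\mathbb{F}_p$, and an elementary abelian extension $L$ of the fraction field $\operatorname{frac}(R)$ of order $p^2$, such that the integral closure of $R$ in $L$ is not a Cohen-Macaulay ring.
   Context: An elementary abelian extension of order $p^2$ of a field $K$ is a finite Galois extension $L/K$ whose Galois group is isomorphic to $\mathbb{Z}/p\mathbb{Z}\times\mathbb{Z}/p\mathbb{Z}$. *)

theory Defs
  imports
    "HOL-Algebra.Algebra"
    "HOL-Number_Theory.Residues"
    "HOL-Library.Extended_Nat"
begin

section \<open>Polynomial rings in finitely many indeterminates\<close>

text \<open>The carrier is the set of indexed polynomials of \<^theory>\<open>HOL-Algebra.Indexed_Polynomials\<close>,
  with monomials in the indeterminates \<open>X\<^sub>i\<close>, \<open>i < n\<close>, represented by multisets of indices. That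
  theory has no product of two indexed polynomials; the product below is the usual convolution.\<close>

definition mpoly_ring :: "('a, 'm) ring_scheme \<Rightarrow> nat \<Rightarrow> (nat multiset \<Rightarrow> 'a) ring" where
  "mpoly_ring A n =
    \<lparr>carrier = ring.indexed_pset A {..<n} (carrier A),
     monoid.mult = \<lambda>f g m. \<Oplus>\<^bsub>A\<^esub>a\<in>{a. a \<subseteq># m}. f a \<otimes>\<^bsub>A\<^esub> g (m - a),
     monoid.one = ring.indexed_const A \<one>\<^bsub>A\<^esub>,
     ring.zero = ring.indexed_const A \<zero>\<^bsub>A\<^esub>,
     ring.add = ring.indexed_padd A\<rparr>"


section \<open>Localization\<close>

text \<open>Localization of a commutative ring at a multiplicative set \<open>S\<close>. The fraction \<open>a / s\<close> is the
  class of all pairs \<open>(b, t)\<close> such that \<open>u (a t - b s) = 0\<close> for some \<open>u \<in> S\<close>.\<close>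

definition loc_rel :: "('a, 'm) ring_scheme \<Rightarrow> 'a set \<Rightarrow> (('a \<times> 'a) \<times> ('a \<times> 'a)) set" where
  "loc_rel R S = {((a, s), (b, t)). a \<in> carrier R \<and> s \<in> S \<and> b \<in> carrier R \<and> t \<in> S \<and>
     (\<exists>u\<in>S. u \<otimes>\<^bsub>R\<^esub> (a \<otimes>\<^bsub>R\<^esub> t \<ominus>\<^bsub>R\<^esub> b \<otimes>\<^bsub>R\<^esub> s) = \<zero>\<^bsub>R\<^esub>)}"

definition loc_frac :: "('a, 'm) ring_scheme \<Rightarrow> 'a set \<Rightarrow> 'a \<Rightarrow> 'a \<Rightarrow> ('a \<times> 'a) set" where
  "loc_frac R S a s = loc_rel R S `` {(a, s)}"

definition localization :: "('a, 'm) ring_scheme \<Rightarrow> 'a set \<Rightarrow> (('a \<times> 'a) set) ring" where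
  "localization R S =
    \<lparr>carrier = {loc_frac R S a s | a s. a \<in> carrier R \<and> s \<in> S},
     monoid.mult = \<lambda>U V. \<Union>(a, s)\<in>U. \<Union>(b, t)\<in>V. loc_frac R S (a \<otimes>\<^bsub>R\<^esub> b) (s \<otimes>\<^bsub>R\<^esub> t),
     monoid.one = loc_frac R S \<one>\<^bsub>R\<^esub> \<one>\<^bsub>R\<^esub>,
     ring.zero = loc_frac R S \<zero>\<^bsub>R\<^esub> \<one>\<^bsub>R\<^esub>,
     ring.add = \<lambda>U V. \<Union>(a, s)\<in>U. \<Union>(b, t)\<in>V.
       loc_frac R S (a \<otimes>\<^bsub>R\<^esub> t \<oplus>\<^bsub>R\<^esub> b \<otimes>\<^bsub>R\<^esub> s) (s \<otimes>\<^bsub>R\<^esub> t)\<rparr>"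

text \<open>Only meaningful for an integral domain \<open>R\<close>.\<close>

definition fraction_field :: "('a, 'm) ring_scheme \<Rightarrow> (('a \<times> 'a) set) ring" where
  "fraction_field R = localization R (carrier R - {\<zero>\<^bsub>R\<^esub>})"

definition to_fraction_field :: "('a, 'm) ring_scheme \<Rightarrow> 'a \<Rightarrow> ('a \<times> 'a) set" where
  "to_fraction_field R a = loc_frac R (carrier R - {\<zero>\<^bsub>R\<^esub>}) a \<one>\<^bsub>R\<^esub>"


section \<open>Field extensions\<close>

definition galois_group :: "('b, 'n) ring_scheme \<Rightarrow> 'b set \<Rightarrow> ('b \<Rightarrow> 'b) monoid" where
  "galois_group L K = BijGroup (carrier L)
     \<lparr>carrier := {\<sigma> \<in> ring_hom L L \<inter> Bij (carrier L). \<forall>x\<in>K. \<sigma> x = x}\<rparr>"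

text \<open>An extension of \<open>K\<close> is a field \<open>L\<close> together with an embedding \<open>\<iota>\<close> of \<open>K\<close> into \<open>L\<close>. It is finite
  Galois if it has finite degree and the fixed field of its automorphism group is the base field.
  When \<open>K\<close> is countable, so is every finite extension of it; hence, up to isomorphism, all of them
  can be found on any infinite element type.\<close>

definition finite_galois_extension ::
    "('a, 'm) ring_scheme \<Rightarrow> ('b, 'n) ring_scheme \<Rightarrow> ('a \<Rightarrow> 'b) \<Rightarrow> bool" where
  "finite_galois_extension K L \<iota> \<longleftrightarrow>
     field K \<and> field L \<and> \<iota> \<in> ring_hom K L \<and>
     ring.finite_dimension L (\<iota> ` carrier K) (carrier L) \<and>
     {x \<in> carrier L. \<forall>\<sigma>\<in>carrier (galois_group L (\<iota> ` carrier K)). \<sigma> x = x} = \<iota> ` carrier K"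

definition elementary_abelian_extension_p2 ::
    "nat \<Rightarrow> ('a, 'm) ring_scheme \<Rightarrow> ('b, 'n) ring_scheme \<Rightarrow> ('a \<Rightarrow> 'b) \<Rightarrow> bool" where
  "elementary_abelian_extension_p2 p K L \<iota> \<longleftrightarrow>
     finite_galois_extension K L \<iota> \<and>
     galois_group L (\<iota> ` carrier K) \<cong> integer_mod_group p \<times>\<times> integer_mod_group p"


section \<open>Integral closure\<close>

text \<open>\<open>A\<close> is (the carrier of) a subring of \<open>L\<close>. In \<^theory>\<open>HOL-Algebra.Polynomials\<close> a univariate
  polynomial is its list of coefficients, leading coefficient first, so \<open>hd f = \<one>\<close> says that
  \<open>f\<close> is monic.\<close>

definition integral_over :: "('b, 'n) ring_scheme \<Rightarrow> 'b set \<Rightarrow> 'b \<Rightarrow> bool" where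
  "integral_over L A x \<longleftrightarrow>
     (\<exists>f. polynomial\<^bsub>L\<^esub> A f \<and> f \<noteq> [] \<and> hd f = \<one>\<^bsub>L\<^esub> \<and> ring.eval L f x = \<zero>\<^bsub>L\<^esub>)"

definition integral_closure :: "('b, 'n) ring_scheme \<Rightarrow> 'b set \<Rightarrow> ('b, 'n) ring_scheme" where
  "integral_closure L A = L\<lparr>carrier := {x \<in> carrier L. integral_over L A x}\<rparr>"


section \<open>Cohen-Macaulay rings\<close>

definition krull_dim :: "('a, 'm) ring_scheme \<Rightarrow> enat" where
  "krull_dim R = Sup {enat n | n. \<exists>P :: nat \<Rightarrow> 'a set.
     (\<forall>i\<le>n. primeideal (P i) R) \<and> (\<forall>i<n. P i \<subset> P (Suc i))}"

definition regular_sequence :: "('a, 'm) ring_scheme \<Rightarrow> 'a list \<Rightarrow> bool" where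
  "regular_sequence R xs \<longleftrightarrow>
     set xs \<subseteq> carrier R \<and> Idl\<^bsub>R\<^esub> (set xs) \<noteq> carrier R \<and>
     (\<forall>i<length xs. \<forall>a\<in>carrier R.
        xs ! i \<otimes>\<^bsub>R\<^esub> a \<in> Idl\<^bsub>R\<^esub> (set (take i xs)) \<longrightarrow> a \<in> Idl\<^bsub>R\<^esub> (set (take i xs)))"

definition depth :: "('a, 'm) ring_scheme \<Rightarrow> 'a set \<Rightarrow> enat" where
  "depth R I = Sup {enat (length xs) | xs. set xs \<subseteq> I \<and> regular_sequence R xs}"

definition cohen_macaulay_local :: "('a, 'm) ring_scheme \<Rightarrow> bool" where
  "cohen_macaulay_local R \<longleftrightarrow> cring R \<and> noetherian_ring R \<and>
     (\<exists>M. {I. maximalideal I R} = {M} \<and> depth R M = krull_dim R)"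

text \<open>A Noetherian ring is Cohen-Macaulay if all its localizations at prime ideals are
  Cohen-Macaulay local rings.\<close>

definition cohen_macaulay_ring :: "('a, 'm) ring_scheme \<Rightarrow> bool" where
  "cohen_macaulay_ring R \<longleftrightarrow> cring R \<and> noetherian_ring R \<and>
     (\<forall>P. primeideal P R \<longrightarrow> cohen_macaulay_local (localization R (carrier R - P)))"

end

theory Submission
  imports Defs "HOL-Library.Poly_Mapping" "HOL-Library.Multiset_Order"
begin

text \<open>Let \<open>L = \<bbbF>\<^sub>p(c, a, b, g)\<close> and let \<open>(\<int>/p)\<^sup>2\<close> act on \<open>L\<close> by \<open>g \<mapsto> g + i a + j b\<close>. Put
  \<open>\<Delta> = a b\<^sup>p - b a\<^sup>p\<close>, \<open>h = (a g\<^sup>p - a\<^sup>p g) / \<Delta>\<close> and \<open>k = (b g\<^sup>p - b\<^sup>p g) / \<Delta>\<close>. The action translates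
  \<open>h\<close> by \<open>j\<close> and \<open>k\<close> by \<open>-i\<close>, so \<open>u = (h\<^sup>p - h) / a\<^sup>p = (k\<^sup>p - k) / b\<^sup>p\<close> is invariant, and the
  fixed field is the field of fractions of the polynomial ring \<open>R = \<bbbF>\<^sub>p[c, y, z, u]\<close> with
  \<open>y = c\<^sup>p a\<close> and \<open>z = c\<^sup>p b\<close>.

  In the integral closure \<open>A\<close> of \<open>R\<close> put \<open>\<alpha> = c\<^sup>p h\<close>, \<open>\<beta> = c\<^sup>p k\<close>. The relation \<open>b h - a k = g\<close>
  gives \<open>z \<alpha> \<in> (c, y)\<close>, so a power of the prime \<open>P\<close> of \<open>A\<close> over \<open>(c, y, z)\<close>, cut out by the
  \<open>c\<close>-adic place of \<open>L\<close>, multiplies \<open>\<alpha>\<close> into \<open>(c, y) A\<^sub>P\<close>. But \<open>\<alpha> \<notin> (c, y) A\<^sub>P\<close>: otherwise \<open>\<alpha>\<^sup>p \<equiv> y\<^sup>p u\<close>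
  would make the residue of \<open>u\<close> at the \<open>c\<close>-adic place a \<open>p\<close>-th power, and \<open>u\<close> vanishes to the first
  order at \<open>g = 0\<close>. Hence \<open>(c, y)\<close> is a maximal regular sequence in \<open>A\<^sub>P\<close>, a ring of dimension at least \<open>3\<close>.\<close>

section \<open>Polynomials over a prime field\<close>

text \<open>The factor \<open>c^p\<close> comes from one inequality. Scaling by \<open>c^e\<close>
  turns \<open>h^p - h = a^p u\<close> into \<open>\<alpha>^p - c^(e(p-1)) \<alpha> = y^p u\<close>,
  and \<open>e (p-1) \<ge> p\<close> makes this purely inseparable modulo \<open>c^p\<close>. The
  same inequality leaves a nonnegative exponent in
  \<open>\<gamma>^p = c^(ep-e-p) (z^p \<alpha> - y^p \<beta>)\<close>, so that
  \<open>\<gamma> = c^(2e-1) g\<close> is integral. The choice \<open>e = p\<close> works for every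
  prime. The obstacle on the side of depth is that it is a supremum over all regular sequences, so a
  single maximal one decides nothing by itself. What excludes every regular sequence of length three
  is an element outside \<open>(x, y)\<close> that powers of each element of the maximal ideal carry
  into \<open>(x, y)\<close>. That the integral elements form a ring is part of the Cohen-Macaulay
  property to be refuted; this is why the lemmas on \<open>A\<close> assume \<open>cring A\<close>.
  Base field and extension are one and the same structure, the fraction field of the polynomial ring
  in four variables; the extension is an endomorphism of it.\<close>

lemma residue_ring_finsum:
  assumes "m > 1" and "\<And>x. x \<in> A \<Longrightarrow> h x \<in> {0..m - 1}"
  shows "finsum (residue_ring m) h A = sum h A mod m"
proof -
  interpret residues m "residue_ring m" by (rule residues.intro) (use assms in auto)
  interpret cring "residue_ring m" by (rule cring)
  have c: "carrier (residue_ring m) = {0..m - 1}" by (simp add: residue_ring_def)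
  show ?thesis
  proof (cases "finite A")
    case True
    then show ?thesis using assms(2)
    proof (induction A)
      case empty then show ?case by (simp only: finsum_empty) (simp add: residue_ring_def)
    next
      case (insert x F)
      have "finsum (residue_ring m) h (insert x F) = h x \<oplus>\<^bsub>residue_ring m\<^esub> finsum (residue_ring m) h F"
        using insert by (intro finsum_insert) (auto simp: c)
      then show ?case using insert by (simp add: residue_ring_def mod_add_right_eq)
    qed
  \<comment> \<open>On an infinite set both sums take their default value 0.\<close>
  qed (simp add: finsum_def finprod_def residue_ring_def)
qed

lemma finite_submultisets: "finite {a. a \<subseteq># m}"
proof (rule finite_subset)
  show "{a. a \<subseteq># m} \<subseteq> mset ` {xs. set xs \<subseteq> set_mset m \<and> length xs \<le> size m}"
  proof
    fix a assume "a \<in> {a. a \<subseteq># m}"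
    moreover obtain xs where "mset xs = a" using ex_mset by blast
    ultimately show "a \<in> mset ` {xs. set xs \<subseteq> set_mset m \<and> length xs \<le> size m}"
      using size_mset_mono[of a m] set_mset_mono[of a m] by force
  qed
qed (auto intro: finite_lists_length_le)

text \<open>The product of \<open>poly_mapping\<close> is the same convolution as in
  \<open>mpoly_ring\<close>. This lets the ring laws be inherited from a type class
  instance.\<close>

lemma lookup_times_multiset:
  fixes f g :: "'b multiset \<Rightarrow>\<^sub>0 'a::semiring_0"
  shows "Poly_Mapping.lookup (f * g) m = (\<Sum>a | a \<subseteq># m. Poly_Mapping.lookup f a * Poly_Mapping.lookup g (m - a))"
proof -
  have in1: "Sum_any (\<lambda>q. (Poly_Mapping.lookup g q when m = l + q)) = (Poly_Mapping.lookup g (m - l) when l \<subseteq># m)" for l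
  proof (cases "l \<subseteq># m")
    case True
    then have "m = l + q \<longleftrightarrow> q = m - l" for q by (metis subset_mset.add_diff_inverse add_diff_cancel_left')
    then show ?thesis using True by simp
  next
    case False
    then have "m \<noteq> l + q" for q by auto
    then show ?thesis using False by simp
  qed
  have "Poly_Mapping.lookup (f * g) m = Sum_any (\<lambda>l. Poly_Mapping.lookup f l * (Poly_Mapping.lookup g (m - l) when l \<subseteq># m))"
    by (simp add: times_poly_mapping.rep_eq prod_fun_def in1)
  also have "\<dots> = Sum_any (\<lambda>l. (Poly_Mapping.lookup f l * Poly_Mapping.lookup g (m - l)) when l \<subseteq># m)"
    by (simp add: mult_when)
  also have "\<dots> = (\<Sum>l\<in>{a. a \<subseteq># m}. (Poly_Mapping.lookup f l * Poly_Mapping.lookup g (m - l)) when l \<subseteq># m)"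
    by (intro Sum_any.expand_superset finite_submultisets) auto
  also have "\<dots> = (\<Sum>a | a \<subseteq># m. Poly_Mapping.lookup f a * Poly_Mapping.lookup g (m - a))"
    by (intro sum.cong) auto
  finally show ?thesis .
qed

section \<open>The ring laws of the polynomial ring over the prime field\<close>

locale fp_mpoly =
  fixes p :: nat and n :: nat
  assumes prime_p: "Factorial_Ring.prime p"
begin

abbreviation Fp :: "int ring" where "Fp \<equiv> residue_ring (int p)"
abbreviation M :: "(nat multiset \<Rightarrow> int) ring" where "M \<equiv> mpoly_ring Fp n"

lemma p_gt_1: "int p > 1"
  using prime_gt_1_nat[OF prime_p] by simp

sublocale Fp: residues "int p" "residue_ring (int p)"
  by (rule residues.intro) (use p_gt_1 in auto)

sublocale Fp: cring Fp by (rule Fp.cring)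

lemma Fp_simps:
  "carrier Fp = {0..int p - 1}" "\<zero>\<^bsub>Fp\<^esub> = 0" "\<one>\<^bsub>Fp\<^esub> = 1"
  "x \<oplus>\<^bsub>Fp\<^esub> y = (x + y) mod int p" "x \<otimes>\<^bsub>Fp\<^esub> y = (x * y) mod int p"
  by (simp_all add: residue_ring_def)

text \<open>Trades the inductive carrier for a finite-support condition that can be checked
  coefficientwise. A function on the right is rebuilt by removing one monomial of its support at a
  time.\<close>

lemma carrier_M:
  "carrier M = {f. (\<forall>m. f m \<in> {0..<int p}) \<and> finite {m. f m \<noteq> 0} \<and> (\<forall>m. f m \<noteq> 0 \<longrightarrow> set_mset m \<subseteq> {..<n})}"
  (is "_ = ?S")
proof -
  have pos: "0 < int p" using p_gt_1 by simp
  have eq: "carrier M = Fp.indexed_pset {..<n} (carrier Fp)" by (simp add: mpoly_ring_def)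
  have "f \<in> ?S" if "f \<in> Fp.indexed_pset {..<n} (carrier Fp)" for f using that
  proof induction
    case (indexed_const k)
    have "{m. (if m = {#} then k else 0) \<noteq> 0} \<subseteq> {{#}}" by (auto split: if_splits)
    from finite_subset[OF this] show ?case using indexed_const pos
      by (auto simp: Fp.indexed_const_def Fp_simps)
  next
    case (indexed_padd P Q)
    have "{m. (P m + Q m) mod int p \<noteq> 0} \<subseteq> {m. P m \<noteq> 0} \<union> {m. Q m \<noteq> 0}" by auto
    from finite_subset[OF this] indexed_padd.IH show ?case using pos
      apply (auto simp: Fp.indexed_padd_def Fp_simps)
      by (metis (no_types, lifting) add.right_neutral lessThan_iff mod_0 subset_iff)
  next
    case (indexed_pmult P i)
    have "{m. (if i \<in># m then P (m - {#i#}) else 0) \<noteq> 0} \<subseteq> add_mset i ` {m. P m \<noteq> 0}"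
      by (auto split: if_splits) (metis (mono_tags, lifting) imageI insert_DiffM mem_Collect_eq)
    then have fin: "finite {m. (if i \<in># m then P (m - {#i#}) else 0) \<noteq> 0}"
      by (rule finite_subset) (use indexed_pmult.IH in simp)
    have "set_mset m \<subseteq> {..<n}" if "i \<in># m" "P (m - {#i#}) \<noteq> 0" for m
    proof -
      have "set_mset (m - {#i#}) \<subseteq> {..<n}" using that indexed_pmult.IH by blast
      moreover have "set_mset m = insert i (set_mset (m - {#i#}))"
        by (metis insert_DiffM set_mset_add_mset_insert that(1))
      ultimately show ?thesis using indexed_pmult.hyps by auto
    qed
    moreover have "Fp.indexed_pmult P i = (\<lambda>m. if i \<in># m then P (m - {#i#}) else 0)"
      unfolding Fp.indexed_pmult_def Fp_simps ..
    ultimately show ?case using pos fin indexed_pmult.IH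
      by (intro CollectI conjI) (auto split: if_splits)
  qed
  moreover have "f \<in> Fp.indexed_pset {..<n} (carrier Fp)" if "f \<in> ?S" for f
  proof -
    have mono: "(\<lambda>m'. if m' = m then k else 0) \<in> Fp.indexed_pset {..<n} (carrier Fp)"
      if "k \<in> {0..<int p}" "set_mset m \<subseteq> {..<n}" for k m using that(2)
    proof (induction m)
      case empty
      have "k \<in> carrier Fp" using that(1) by (simp add: Fp_simps)
      from Fp.indexed_pset.indexed_const[OF this] show ?case
        unfolding Fp.indexed_const_def Fp_simps(2) .
    next
      case (add i m)
      have "Fp.indexed_pmult (\<lambda>m'. if m' = m then k else 0) i = (\<lambda>m'. if m' = add_mset i m then k else 0)"
        by (auto simp: Fp.indexed_pmult_def Fp_simps fun_eq_iff)
      with Fp.indexed_pset.indexed_pmult[of "\<lambda>m'. if m' = m then k else 0" "{..<n}" "carrier Fp" i] add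
      show ?case by auto
    qed
    have "finite {m. f m \<noteq> 0}" using that by simp
    then show ?thesis using that
    proof (induction "{m. f m \<noteq> 0}" arbitrary: f rule: finite_induct)
      case empty
      then have "f = (\<lambda>m'. if m' = {#} then 0 else 0)" by auto
      then show ?case using mono[of 0 "{#}"] pos by simp
    next
      case (insert m F)
      let ?g = "f(m := 0)"
      have F: "F = {m. ?g m \<noteq> 0}" using insert.hyps by auto
      have "?g \<in> ?S" using insert.prems F insert.hyps(1) pos by auto
      then have 1: "?g \<in> Fp.indexed_pset {..<n} (carrier Fp)" using insert.hyps(3)[OF F] by blast
      have "f m \<noteq> 0" using insert.hyps by auto
      then have 2: "(\<lambda>m'. if m' = m then f m else 0) \<in> Fp.indexed_pset {..<n} (carrier Fp)"
        using insert.prems by (intro mono) auto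
      have "Fp.indexed_padd ?g (\<lambda>m'. if m' = m then f m else 0) = f"
        using insert.prems by (auto simp: Fp.indexed_padd_def Fp_simps fun_eq_iff)
      then show ?case using Fp.indexed_pset.indexed_padd[OF 1 2] by simp
    qed
  qed
  ultimately show ?thesis using eq by blast
qed

lemma M_add: "(f \<oplus>\<^bsub>M\<^esub> g) m = (f m + g m) mod int p"
  by (simp add: mpoly_ring_def Fp.indexed_padd_def Fp_simps)

lemma M_zero: "\<zero>\<^bsub>M\<^esub> = (\<lambda>_. 0)"
  by (simp add: mpoly_ring_def Fp.indexed_const_def Fp_simps fun_eq_iff)

lemma M_one: "\<one>\<^bsub>M\<^esub> = (\<lambda>m. if m = {#} then 1 else 0)"
  by (simp add: mpoly_ring_def Fp.indexed_const_def Fp_simps fun_eq_iff)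

lemma M_mult: "(f \<otimes>\<^bsub>M\<^esub> g) m = (\<Sum>a | a \<subseteq># m. f a * g (m - a)) mod int p"
proof -
  have "(f \<otimes>\<^bsub>M\<^esub> g) m = (\<Sum>a | a \<subseteq># m. (f a * g (m - a)) mod int p) mod int p"
    unfolding mpoly_ring_def using p_gt_1
    by (simp add: residue_ring_finsum Fp_simps)
  then show ?thesis by (simp add: mod_sum_eq)
qed

text \<open>Integral lifts of the elements of \<open>M\<close>: \<open>red\<close> maps them onto
  \<open>M\<close>, and every ring law of \<open>M\<close> is the image of a law between
  lifts.\<close>

definition zpolys :: "(nat multiset \<Rightarrow>\<^sub>0 int) set" where
  "zpolys = {f. \<forall>m. Poly_Mapping.lookup f m \<noteq> 0 \<longrightarrow> set_mset m \<subseteq> {..<n}}"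

definition red :: "(nat multiset \<Rightarrow>\<^sub>0 int) \<Rightarrow> nat multiset \<Rightarrow> int" where
  "red f = (\<lambda>m. Poly_Mapping.lookup f m mod int p)"

lemma red_in: "f \<in> zpolys \<Longrightarrow> red f \<in> carrier M"
proof -
  assume f: "f \<in> zpolys"
  have "{m. red f m \<noteq> 0} \<subseteq> Poly_Mapping.keys f" by (auto simp: red_def in_keys_iff)
  then have "finite {m. red f m \<noteq> 0}" by (rule finite_subset) simp
  moreover have "red f m \<in> {0..<int p}" for m using p_gt_1 by (simp add: red_def)
  moreover have "set_mset m \<subseteq> {..<n}" if "red f m \<noteq> 0" for m
  proof -
    have "Poly_Mapping.lookup f m \<noteq> 0" using that by (auto simp: red_def)
    then show ?thesis using f unfolding zpolys_def by blast
  qed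
  ultimately show ?thesis unfolding carrier_M by blast
qed

lemma red_surj: "g \<in> carrier M \<Longrightarrow> \<exists>f\<in>zpolys. red f = g"
  by (rule bexI[of _ "Abs_poly_mapping g"]) (auto simp: red_def carrier_M zpolys_def fun_eq_iff)

lemma zpolys_closed:
  "0 \<in> zpolys" "1 \<in> zpolys" "f \<in> zpolys \<Longrightarrow> g \<in> zpolys \<Longrightarrow> f + g \<in> zpolys"
  "f \<in> zpolys \<Longrightarrow> - f \<in> zpolys"
  "f \<in> zpolys \<Longrightarrow> g \<in> zpolys \<Longrightarrow> f * g \<in> zpolys"
proof -
  show "0 \<in> zpolys" "1 \<in> zpolys" by (auto simp: zpolys_def lookup_one when_def)
  show "f \<in> zpolys \<Longrightarrow> - f \<in> zpolys" by (auto simp: zpolys_def)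
  show "f \<in> zpolys \<Longrightarrow> g \<in> zpolys \<Longrightarrow> f + g \<in> zpolys"
    by (auto simp: zpolys_def lookup_add) (metis add.right_neutral lessThan_iff subset_iff)
  assume fg: "f \<in> zpolys" "g \<in> zpolys"
  show "f * g \<in> zpolys" unfolding zpolys_def
  proof (rule CollectI, intro allI impI)
    fix m assume "Poly_Mapping.lookup (f * g) m \<noteq> 0"
    then have "\<exists>a. a \<subseteq># m \<and> Poly_Mapping.lookup f a * Poly_Mapping.lookup g (m - a) \<noteq> 0"
      unfolding lookup_times_multiset by (metis (mono_tags, lifting) mem_Collect_eq sum.neutral)
    then obtain a where a: "a \<subseteq># m" "Poly_Mapping.lookup f a \<noteq> 0" "Poly_Mapping.lookup g (m - a) \<noteq> 0" by auto
    have "set_mset a \<subseteq> {..<n}" "set_mset (m - a) \<subseteq> {..<n}" using fg a by (auto simp: zpolys_def)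
    moreover have "m = a + (m - a)" using a by simp
    ultimately show "set_mset m \<subseteq> {..<n}" by (metis Un_least set_mset_union)
  qed
qed

lemma red_hom:
  "red 0 = \<zero>\<^bsub>M\<^esub>" "red 1 = \<one>\<^bsub>M\<^esub>" "red (f + g) = red f \<oplus>\<^bsub>M\<^esub> red g" "red (f * g) = red f \<otimes>\<^bsub>M\<^esub> red g"
proof -
  show "red 0 = \<zero>\<^bsub>M\<^esub>" "red 1 = \<one>\<^bsub>M\<^esub>" using p_gt_1
    by (auto simp: red_def M_zero M_one lookup_one when_def fun_eq_iff)
  show "red (f + g) = red f \<oplus>\<^bsub>M\<^esub> red g"
    by (auto simp: red_def fun_eq_iff M_add lookup_add mod_add_eq)
  have "(\<Sum>a | a \<subseteq># m. Poly_Mapping.lookup f a * Poly_Mapping.lookup g (m - a)) mod int p =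
    (\<Sum>a | a \<subseteq># m. (Poly_Mapping.lookup f a mod int p) * (Poly_Mapping.lookup g (m - a) mod int p)) mod int p" for m
    by (subst (1 2) mod_sum_eq[symmetric]) (simp add: mod_mult_eq)
  then show "red (f * g) = red f \<otimes>\<^bsub>M\<^esub> red g"
    by (auto simp: red_def fun_eq_iff M_mult lookup_times_multiset)
qed

lemma M_ring_laws:
  assumes "x \<in> carrier M" "y \<in> carrier M" "z \<in> carrier M"
  shows "x \<oplus>\<^bsub>M\<^esub> y \<in> carrier M" "x \<otimes>\<^bsub>M\<^esub> y \<in> carrier M"
    "x \<oplus>\<^bsub>M\<^esub> y \<oplus>\<^bsub>M\<^esub> z = x \<oplus>\<^bsub>M\<^esub> (y \<oplus>\<^bsub>M\<^esub> z)" "x \<oplus>\<^bsub>M\<^esub> y = y \<oplus>\<^bsub>M\<^esub> x" "\<zero>\<^bsub>M\<^esub> \<oplus>\<^bsub>M\<^esub> x = x"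
    "\<exists>y\<in>carrier M. y \<oplus>\<^bsub>M\<^esub> x = \<zero>\<^bsub>M\<^esub>"
    "x \<otimes>\<^bsub>M\<^esub> y \<otimes>\<^bsub>M\<^esub> z = x \<otimes>\<^bsub>M\<^esub> (y \<otimes>\<^bsub>M\<^esub> z)" "x \<otimes>\<^bsub>M\<^esub> y = y \<otimes>\<^bsub>M\<^esub> x" "\<one>\<^bsub>M\<^esub> \<otimes>\<^bsub>M\<^esub> x = x"
    "(x \<oplus>\<^bsub>M\<^esub> y) \<otimes>\<^bsub>M\<^esub> z = x \<otimes>\<^bsub>M\<^esub> z \<oplus>\<^bsub>M\<^esub> y \<otimes>\<^bsub>M\<^esub> z"
proof -
  obtain f g h where fgh: "f \<in> zpolys" "g \<in> zpolys" "h \<in> zpolys" "x = red f" "y = red g" "z = red h"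
    using assms by (metis red_surj)
  note R = fgh(4-6) red_hom(3,4)[symmetric]
  show "x \<oplus>\<^bsub>M\<^esub> y \<in> carrier M" unfolding R by (rule red_in, rule zpolys_closed(3)) fact+
  show "x \<otimes>\<^bsub>M\<^esub> y \<in> carrier M" unfolding R by (rule red_in, rule zpolys_closed(5)) fact+
  show "x \<oplus>\<^bsub>M\<^esub> y \<oplus>\<^bsub>M\<^esub> z = x \<oplus>\<^bsub>M\<^esub> (y \<oplus>\<^bsub>M\<^esub> z)" unfolding R by (simp only: add.assoc)
  show "x \<oplus>\<^bsub>M\<^esub> y = y \<oplus>\<^bsub>M\<^esub> x" unfolding R by (simp only: add.commute)
  show "\<zero>\<^bsub>M\<^esub> \<oplus>\<^bsub>M\<^esub> x = x" unfolding R red_hom(1)[symmetric] by (simp only: add_0_left)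
  show "x \<otimes>\<^bsub>M\<^esub> y \<otimes>\<^bsub>M\<^esub> z = x \<otimes>\<^bsub>M\<^esub> (y \<otimes>\<^bsub>M\<^esub> z)" unfolding R by (simp only: mult.assoc)
  show "x \<otimes>\<^bsub>M\<^esub> y = y \<otimes>\<^bsub>M\<^esub> x" unfolding R by (simp only: mult.commute)
  show "\<one>\<^bsub>M\<^esub> \<otimes>\<^bsub>M\<^esub> x = x" unfolding R red_hom(2)[symmetric] by (simp only: mult_1_left)
  show "(x \<oplus>\<^bsub>M\<^esub> y) \<otimes>\<^bsub>M\<^esub> z = x \<otimes>\<^bsub>M\<^esub> z \<oplus>\<^bsub>M\<^esub> y \<otimes>\<^bsub>M\<^esub> z" unfolding R by (simp only: distrib_right)
  have "red (- f) \<oplus>\<^bsub>M\<^esub> x = \<zero>\<^bsub>M\<^esub>" unfolding fgh(4) red_hom(1,3)[symmetric] by simp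
  then show "\<exists>y\<in>carrier M. y \<oplus>\<^bsub>M\<^esub> x = \<zero>\<^bsub>M\<^esub>"
    using red_in[OF zpolys_closed(4)[OF fgh(1)]] by (rule bexI)
qed

lemma M_consts: "\<zero>\<^bsub>M\<^esub> \<in> carrier M" "\<one>\<^bsub>M\<^esub> \<in> carrier M"
  by (metis red_hom(1,2) red_in zpolys_closed(1,2))+

lemma cring_M: "cring M"
proof (rule cringI)
  show "abelian_group M"
  proof (rule abelian_groupI)
    fix x y z assume xyz: "x \<in> carrier M" "y \<in> carrier M" "z \<in> carrier M"
    show "x \<oplus>\<^bsub>M\<^esub> y \<oplus>\<^bsub>M\<^esub> z = x \<oplus>\<^bsub>M\<^esub> (y \<oplus>\<^bsub>M\<^esub> z)" using M_ring_laws(3)[OF xyz] .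
  next
    fix x y assume xy: "x \<in> carrier M" "y \<in> carrier M"
    show "x \<oplus>\<^bsub>M\<^esub> y \<in> carrier M" "x \<oplus>\<^bsub>M\<^esub> y = y \<oplus>\<^bsub>M\<^esub> x" using M_ring_laws(1,4)[OF xy xy(1)] .
  next
    fix x assume x: "x \<in> carrier M"
    show "\<zero>\<^bsub>M\<^esub> \<oplus>\<^bsub>M\<^esub> x = x" "\<exists>y\<in>carrier M. y \<oplus>\<^bsub>M\<^esub> x = \<zero>\<^bsub>M\<^esub>" using M_ring_laws(5,6)[OF x x x] .
  qed (rule M_consts)
  show "comm_monoid M"
  proof (rule comm_monoidI)
    fix x y z assume xyz: "x \<in> carrier M" "y \<in> carrier M" "z \<in> carrier M"
    show "x \<otimes>\<^bsub>M\<^esub> y \<otimes>\<^bsub>M\<^esub> z = x \<otimes>\<^bsub>M\<^esub> (y \<otimes>\<^bsub>M\<^esub> z)" using M_ring_laws(7)[OF xyz] .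
  next
    fix x y assume xy: "x \<in> carrier M" "y \<in> carrier M"
    show "x \<otimes>\<^bsub>M\<^esub> y \<in> carrier M" "x \<otimes>\<^bsub>M\<^esub> y = y \<otimes>\<^bsub>M\<^esub> x" using M_ring_laws(2,8)[OF xy xy(1)] .
  next
    fix x assume x: "x \<in> carrier M"
    show "\<one>\<^bsub>M\<^esub> \<otimes>\<^bsub>M\<^esub> x = x" using M_ring_laws(9)[OF x x x] .
  qed (rule M_consts)
  fix x y z assume xyz: "x \<in> carrier M" "y \<in> carrier M" "z \<in> carrier M"
  show "(x \<oplus>\<^bsub>M\<^esub> y) \<otimes>\<^bsub>M\<^esub> z = x \<otimes>\<^bsub>M\<^esub> z \<oplus>\<^bsub>M\<^esub> y \<otimes>\<^bsub>M\<^esub> z" using M_ring_laws(10)[OF xyz] .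
qed

end

section \<open>Evaluation of integral polynomials in a commutative ring\<close>

lemma poly_mapping_induct_add [case_names zero single add]:
  assumes "P 0" "\<And>m a. P (Poly_Mapping.single m a)" "\<And>f g. P f \<Longrightarrow> P g \<Longrightarrow> P (f + g)"
  shows "P (f :: 'b \<Rightarrow>\<^sub>0 'a::ab_group_add)"
proof (induction f rule: Poly_Mapping.update_induct)
  case const
  then show ?case by (rule assms(1))
next
  case (update f a b)
  have "Poly_Mapping.update a b f = f + Poly_Mapping.single a b"
    using update(1) by (intro poly_mapping_eqI) (auto simp: lookup_update lookup_add lookup_single in_keys_iff when_def)
  then show ?case using update assms by simp
qed

context cring
begin

definition mon_eval :: "('v \<Rightarrow> 'a) \<Rightarrow> 'v multiset \<Rightarrow> 'a" where
  "mon_eval x m = (\<Otimes>i\<in>set_mset m. x i [^] count m i)"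

text \<open>Takes a bare coefficient function, so that one definition serves both integral
  polynomials, through \<open>lookup\<close>, and elements of \<open>M\<close>, whose residues are
  stored as integers.\<close>

definition mpoly_eval :: "('v \<Rightarrow> 'a) \<Rightarrow> ('v multiset \<Rightarrow> int) \<Rightarrow> 'a" where
  "mpoly_eval x f = (\<Oplus>m\<in>{m. f m \<noteq> 0}. add_pow R (f m) (mon_eval x m))"

abbreviation zeval :: "('v \<Rightarrow> 'a) \<Rightarrow> ('v multiset \<Rightarrow>\<^sub>0 int) \<Rightarrow> 'a" where
  "zeval x f \<equiv> mpoly_eval x (Poly_Mapping.lookup f)"

lemma int_add_pow_closed [simp, intro]: "a \<in> carrier R \<Longrightarrow> add_pow R ((k::int)) a \<in> carrier R"
  by (rule add.int_pow_closed)

lemma int_add_pow_zero [simp]: "add_pow R ((0::int)) a = \<zero>"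
  by (simp add: add_pow_def)

lemma int_add_pow_mult:
  assumes "a \<in> carrier R" "b \<in> carrier R"
  shows "add_pow R ((k::int)) a \<otimes> add_pow R ((l::int)) b = add_pow R (k * l) (a \<otimes> b)"
  using assms by (simp add: add_pow_ldistr_int add_pow_rdistr_int add.int_pow_pow mult.commute)

context
  fixes x :: "'v \<Rightarrow> 'a"
  assumes x: "\<And>i. x i \<in> carrier R"
begin

lemma mon_eval_closed [simp]: "mon_eval x m \<in> carrier R"
  unfolding mon_eval_def by (rule finprod_closed) (auto simp: x)

lemma mon_eval_empty [simp]: "mon_eval x {#} = \<one>"
  by (simp add: mon_eval_def)

lemma mon_eval_superset:
  assumes "finite T" "set_mset m \<subseteq> T"
  shows "mon_eval x m = (\<Otimes>i\<in>T. x i [^] count m i)"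
  unfolding mon_eval_def using assms x
  by (intro finprod_mono_neutral_cong_left) (auto simp: not_in_iff)

lemma mon_eval_add: "mon_eval x (m + m') = mon_eval x m \<otimes> mon_eval x m'"
proof -
  let ?T = "set_mset (m + m')"
  have "mon_eval x (m + m') = (\<Otimes>i\<in>?T. x i [^] count m i \<otimes> x i [^] count m' i)"
    unfolding mon_eval_def by (intro finprod_cong') (auto simp: x nat_pow_mult)
  also have "\<dots> = (\<Otimes>i\<in>?T. x i [^] count m i) \<otimes> (\<Otimes>i\<in>?T. x i [^] count m' i)"
    by (intro finprod_multf) (auto simp: x)
  also have "(\<Otimes>i\<in>?T. x i [^] count m i) = mon_eval x m"
    by (rule mon_eval_superset[symmetric]) auto
  also have "(\<Otimes>i\<in>?T. x i [^] count m' i) = mon_eval x m'"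
    by (rule mon_eval_superset[symmetric]) auto
  finally show ?thesis .
qed

lemma mon_eval_var: "mon_eval x {#i#} = x i"
  by (simp add: mon_eval_def x)

lemma mpoly_eval_superset:
  assumes "finite T" "{m. f m \<noteq> 0} \<subseteq> T"
  shows "mpoly_eval x f = (\<Oplus>m\<in>T. add_pow R (f m) (mon_eval x m))"
  unfolding mpoly_eval_def using assms by (intro add.finprod_mono_neutral_cong_left) auto

lemma mpoly_eval_closed: "mpoly_eval x f \<in> carrier R"
  unfolding mpoly_eval_def by (rule finsum_closed) auto

lemma zeval_zero: "zeval x 0 = \<zero>"
  by (simp add: mpoly_eval_def)

lemma zeval_single: "zeval x (Poly_Mapping.single m a) = add_pow R (a) (mon_eval x m)"
  by (subst mpoly_eval_superset[of "{m}"]) (auto simp: lookup_single when_def split: if_splits)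

lemma zeval_one: "zeval x 1 = \<one>"
  unfolding single_one[symmetric] zeval_single by (simp add: add.int_pow_1)

lemma zeval_add: "zeval x (f + g) = zeval x f \<oplus> zeval x g"
proof -
  let ?T = "Poly_Mapping.keys f \<union> Poly_Mapping.keys g"
  have "zeval x (f + g) = (\<Oplus>m\<in>?T. add_pow R (Poly_Mapping.lookup (f + g) m) (mon_eval x m))"
    by (rule mpoly_eval_superset) (auto simp: lookup_add in_keys_iff)
  also have "\<dots> = (\<Oplus>m\<in>?T. add_pow R (Poly_Mapping.lookup f m) (mon_eval x m) \<oplus> add_pow R (Poly_Mapping.lookup g m) (mon_eval x m))"
    by (intro finsum_cong') (auto simp: lookup_add add.int_pow_mult)
  also have "\<dots> = (\<Oplus>m\<in>?T. add_pow R (Poly_Mapping.lookup f m) (mon_eval x m)) \<oplus> (\<Oplus>m\<in>?T. add_pow R (Poly_Mapping.lookup g m) (mon_eval x m))"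
    by (rule finsum_addf) auto
  also have "(\<Oplus>m\<in>?T. add_pow R (Poly_Mapping.lookup f m) (mon_eval x m)) = zeval x f"
    by (rule mpoly_eval_superset[symmetric]) (auto simp: in_keys_iff)
  also have "(\<Oplus>m\<in>?T. add_pow R (Poly_Mapping.lookup g m) (mon_eval x m)) = zeval x g"
    by (rule mpoly_eval_superset[symmetric]) (auto simp: in_keys_iff)
  finally show ?thesis .
qed

lemma zeval_mult: "zeval x (f * g) = zeval x f \<otimes> zeval x g"
proof (induction f rule: poly_mapping_induct_add)
  case zero
  then show ?case unfolding mult_zero_left mult_zero_right zeval_zero by (simp add: mpoly_eval_closed)
next
  case (add f1 f2)
  then show ?case by (simp add: distrib_right zeval_add l_distr mpoly_eval_closed)
next
  case (single m a)
  show ?case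
  proof (induction g rule: poly_mapping_induct_add)
    case zero
    then show ?case unfolding mult_zero_left mult_zero_right zeval_zero by (simp add: mpoly_eval_closed)
  next
    case (add f1 f2)
    then show ?case by (simp add: distrib_left zeval_add r_distr mpoly_eval_closed)
  next
    case (single m' a')
    then show ?case by (simp add: mult_single zeval_single mon_eval_add int_add_pow_mult)
  qed
qed

lemma zeval_power: "zeval x (f ^ k) = zeval x f [^] k"
  by (induction k) (simp_all add: zeval_one zeval_mult mpoly_eval_closed m_comm)

lemma zeval_var: "zeval x (Poly_Mapping.single {#i#} 1) = x i"
  unfolding zeval_single by (simp add: mon_eval_var x add.int_pow_1)

lemma zeval_of_int: "zeval x (of_int k) = add_pow R (k) \<one>"
  unfolding single_of_int[symmetric] zeval_single by simp

end

end

text \<open>Every element of a commutative ring is the value of an integral polynomial, with the elements of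
  the ring themselves as variables. Rewriting all elements in this way reduces ring identities to
  identities in the type class \<^class>\<open>comm_ring_1\<close>.\<close>

definition (in cring) rep :: "('a multiset \<Rightarrow>\<^sub>0 int) \<Rightarrow> 'a" where
  "rep = zeval (\<lambda>i. if i \<in> carrier R then i else \<one>)"

context cring
begin

lemma rep_var_closed: "(if i \<in> carrier R then i else \<one>) \<in> carrier R" by simp

lemma rep_closed [simp]: "rep f \<in> carrier R"
  unfolding rep_def by (rule mpoly_eval_closed[OF rep_var_closed])

lemma rep_zero: "\<zero> = rep 0" and rep_one: "\<one> = rep 1"
  and rep_add: "rep f \<oplus> rep g = rep (f + g)" and rep_mult: "rep f \<otimes> rep g = rep (f * g)"
  and rep_pow: "rep f [^] k = rep (f ^ k)"
  unfolding rep_def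
  by (rule zeval_zero[OF rep_var_closed, symmetric] zeval_one[OF rep_var_closed, symmetric]
      zeval_add[OF rep_var_closed, symmetric] zeval_mult[OF rep_var_closed, symmetric]
      zeval_power[OF rep_var_closed, symmetric])+

lemma rep_uminus: "\<ominus> rep f = rep (- f)"
  by (rule minus_equality) (simp_all add: rep_add flip: rep_zero)

lemma rep_minus: "rep f \<ominus> rep g = rep (f - g)"
  by (simp add: minus_eq rep_uminus rep_add)

lemmas rep_hom = rep_zero rep_one rep_add rep_mult rep_pow rep_uminus rep_minus

lemma rep_cases:
  assumes "x \<in> carrier R" obtains f where "x = rep f"
proof
  show "x = rep (Poly_Mapping.single {#x#} 1)"
    unfolding rep_def by (subst zeval_var) (use assms in simp_all)
qed

end

text \<open>The multiple of \<open>p\<close> is kept explicit, so that the statement applies to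
  integral polynomials in two variables; that identity can then be evaluated in every ring where
  \<open>p\<close> vanishes.\<close>

lemma freshman_dream_exact:
  fixes a b :: "'a::comm_ring_1"
  assumes "Factorial_Ring.prime p"
  shows "\<exists>c. (a + b) ^ p = a ^ p + b ^ p + of_int (int p) * c"
proof -
  have p0: "p > 0" using assms prime_gt_0_nat by blast
  let ?t = "\<lambda>k. of_nat (p choose k) * a ^ k * b ^ (p - k)"
  have "(a + b) ^ p = (\<Sum>k\<le>p. ?t k)" by (rule binomial_ring)
  also have "{..p} = insert 0 (insert p {1..<p})" using p0 by auto
  also have "sum ?t \<dots> = b ^ p + a ^ p + (\<Sum>k=1..<p. ?t k)" using p0 by simp
  also have "(\<Sum>k=1..<p. ?t k) = (\<Sum>k=1..<p. of_int (int p) * (of_nat ((p choose k) div p) * a ^ k * b ^ (p - k)))"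
  proof (rule sum.cong)
    fix k assume "k \<in> {1..<p}"
    then have "p dvd p choose k" using assms by (intro dvd_choose_prime) auto
    then obtain q where "p choose k = p * q" by blast
    then show "?t k = of_int (int p) * (of_nat ((p choose k) div p) * a ^ k * b ^ (p - k))"
      using p0 by (simp add: algebra_simps)
  qed simp
  also have "\<dots> = of_int (int p) * (\<Sum>k=1..<p. of_nat ((p choose k) div p) * a ^ k * b ^ (p - k))"
    by (simp add: sum_distrib_left)
  finally show ?thesis by (metis add.commute)
qed

lemma (in cring) frobenius_add:
  assumes p: "Factorial_Ring.prime p" and char: "add_pow R (int p) \<one> = \<zero>"
    and ab: "a \<in> carrier R" "b \<in> carrier R"
  shows "(a \<oplus> b) [^] p = a [^] p \<oplus> b [^] p"
proof -
  let ?x = "\<lambda>i::nat. if i = 0 then a else b"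
  have x: "\<And>i. ?x i \<in> carrier R" using ab by auto
  let ?A = "Poly_Mapping.single {#0#} 1 :: nat multiset \<Rightarrow>\<^sub>0 int"
  let ?B = "Poly_Mapping.single {#1#} 1 :: nat multiset \<Rightarrow>\<^sub>0 int"
  obtain c where c: "(?A + ?B) ^ p = ?A ^ p + ?B ^ p + of_int (int p) * c"
    using freshman_dream_exact[OF p] by blast
  have "zeval ?x ((?A + ?B) ^ p) = (a \<oplus> b) [^] p"
    using zeval_var[of ?x 0] zeval_var[of ?x 1] x
    by (simp add: zeval_power[OF x] zeval_add[OF x])
  moreover have "zeval ?x (?A ^ p + ?B ^ p + of_int (int p) * c) = a [^] p \<oplus> b [^] p"
    using zeval_var[of ?x 0] zeval_var[of ?x 1] x ab mpoly_eval_closed[of ?x]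
    by (simp only: zeval_power[OF x] zeval_add[OF x] zeval_mult[OF x] zeval_of_int[OF x] char) simp
  ultimately show ?thesis using c by metis
qed

lemma (in cring) frobenius_pow_add:
  assumes p: "Factorial_Ring.prime p" and char: "add_pow R (int p) \<one> = \<zero>"
    and ab: "a \<in> carrier R" "b \<in> carrier R"
  shows "(a \<oplus> b) [^] (p ^ e) = a [^] (p ^ e) \<oplus> b [^] (p ^ e)"
proof (induction e)
  case 0
  then show ?case using ab by simp
next
  case (Suc e)
  have "(a \<oplus> b) [^] (p ^ Suc e) = ((a \<oplus> b) [^] (p ^ e)) [^] p"
    using ab by (simp add: nat_pow_pow mult.commute)
  also have "\<dots> = (a [^] (p ^ e)) [^] p \<oplus> (b [^] (p ^ e)) [^] p"
    unfolding Suc by (rule frobenius_add[OF p char]) (simp_all add: ab)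
  finally show ?case using ab by (simp add: nat_pow_pow mult.commute)
qed

section \<open>Variables, integrality, divisibility by a variable, and substitution\<close>

context fp_mpoly
begin

definition xpow :: "nat multiset \<Rightarrow> nat multiset \<Rightarrow> int" where
  "xpow b = (\<lambda>m. if m = b then 1 else 0)"

abbreviation Var :: "nat \<Rightarrow> nat multiset \<Rightarrow> int" where "Var i \<equiv> xpow {#i#}"

lemma coeff_range: "f \<in> carrier M \<Longrightarrow> 0 \<le> f m \<and> f m < int p"
  by (simp add: carrier_M)

lemma coeff_mod [simp]: "f \<in> carrier M \<Longrightarrow> f m mod int p = f m"
  using coeff_range[of f m] by simp

lemma xpow_closed:
  assumes "set_mset b \<subseteq> {..<n}" shows "xpow b \<in> carrier M"
proof -
  have "{m. xpow b m \<noteq> 0} \<subseteq> {b}" by (auto simp: xpow_def)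
  then have "finite {m. xpow b m \<noteq> 0}" by (rule finite_subset) simp
  then show ?thesis using assms p_gt_1 unfolding carrier_M by (auto simp: xpow_def)
qed

lemma X_closed: "i < n \<Longrightarrow> Var i \<in> carrier M"
  by (rule xpow_closed) simp

lemma xpow_mult:
  assumes "f \<in> carrier M"
  shows "(xpow b \<otimes>\<^bsub>M\<^esub> f) m = (if b \<subseteq># m then f (m - b) else 0)"
proof -
  have "(\<Sum>a | a \<subseteq># m. xpow b a * f (m - a)) = (\<Sum>a | a \<subseteq># m. if a = b then f (m - a) else 0)"
    by (rule sum.cong) (auto simp: xpow_def)
  also have "\<dots> = (if b \<subseteq># m then f (m - b) else 0)"
    by (subst sum.delta) (auto simp: finite_submultisets)
  finally show ?thesis using assms by (auto simp: M_mult)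
qed

lemma X_mult:
  assumes "f \<in> carrier M"
  shows "(Var i \<otimes>\<^bsub>M\<^esub> f) m = (if i \<in># m then f (m - {#i#}) else 0)"
  using xpow_mult[OF assms, of "{#i#}" m] by simp

lemma xpow_empty: "xpow {#} = \<one>\<^bsub>M\<^esub>"
  by (auto simp: xpow_def M_one)

lemma red_single: "red (Poly_Mapping.single b 1) = xpow b"
  using p_gt_1 by (auto simp: red_def xpow_def lookup_single when_def fun_eq_iff)

lemma xpow_add:
  shows "xpow (a + b) = xpow a \<otimes>\<^bsub>M\<^esub> xpow b"
  by (simp flip: red_single red_hom add: mult_single)

sublocale M: cring M by (rule cring_M)

text \<open>Constants are reached by adding 1 repeatedly, which is where the prime field enters.
  Hence homomorphisms out of \<open>M\<close> are determined by the variables alone.\<close>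

lemma M_induct [consumes 1, case_names zero one add var]:
  assumes "f \<in> carrier M" and P0: "P \<zero>\<^bsub>M\<^esub>" and P1: "P \<one>\<^bsub>M\<^esub>"
    and Padd: "\<And>f g. f \<in> carrier M \<Longrightarrow> g \<in> carrier M \<Longrightarrow> P f \<Longrightarrow> P g \<Longrightarrow> P (f \<oplus>\<^bsub>M\<^esub> g)"
    and PX: "\<And>i f. i < n \<Longrightarrow> f \<in> carrier M \<Longrightarrow> P f \<Longrightarrow> P (Var i \<otimes>\<^bsub>M\<^esub> f)"
  shows "P f"
proof -
  have c: "carrier M = Fp.indexed_pset {..<n} (carrier Fp)" by (simp add: mpoly_ring_def)
  have const: "Fp.indexed_const (int k) \<in> carrier M \<and> P (Fp.indexed_const (int k))" if "k < p" for k
    using that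
  proof (induction k)
    case 0
    have "Fp.indexed_const (int 0) = \<zero>\<^bsub>M\<^esub>" by (auto simp: Fp.indexed_const_def M_zero Fp_simps)
    then show ?case using P0 by simp
  next
    case (Suc k)
    have "Fp.indexed_const (int (Suc k)) = \<one>\<^bsub>M\<^esub> \<oplus>\<^bsub>M\<^esub> Fp.indexed_const (int k)"
      using Suc.prems by (auto simp: Fp.indexed_const_def M_one M_add Fp_simps fun_eq_iff)
    then show ?case using Suc Padd[OF M.one_closed _ P1] by (metis M.add.m_closed M.one_closed Suc_lessD)
  qed
  have "f \<in> Fp.indexed_pset {..<n} (carrier Fp)" using assms(1) c by simp
  then show ?thesis
  proof induction
    case (indexed_const k)
    then show ?case using const[of "nat k"] by (auto simp: Fp_simps)
  next
    case (indexed_padd f g)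
    have "Fp.indexed_padd f g = f \<oplus>\<^bsub>M\<^esub> g" by (simp add: mpoly_ring_def)
    then show ?case using indexed_padd c Padd by metis
  next
    case (indexed_pmult f i)
    have f: "f \<in> carrier M" using indexed_pmult c by simp
    have "Fp.indexed_pmult f i = Var i \<otimes>\<^bsub>M\<^esub> f"
      by (rule ext) (simp add: X_mult[OF f] Fp.indexed_pmult_def Fp_simps)
    then show ?case using indexed_pmult f PX by simp
  qed
qed

text \<open>Leading terms multiply. The multiset order is total and compatible with sums, so at the
  sum of the two greatest monomials the convolution has a single nonzero term, a product of two
  coefficients prime to \<open>p\<close>.\<close>

lemma M_integral:
  assumes f: "f \<in> carrier M" and g: "g \<in> carrier M" and nz: "f \<noteq> \<zero>\<^bsub>M\<^esub>" "g \<noteq> \<zero>\<^bsub>M\<^esub>"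
  shows "f \<otimes>\<^bsub>M\<^esub> g \<noteq> \<zero>\<^bsub>M\<^esub>"
proof -
  let ?S = "\<lambda>f :: nat multiset \<Rightarrow> int. {m. f m \<noteq> 0}"
  have fin: "finite (?S f)" "finite (?S g)" using f g by (auto simp: carrier_M)
  have ne: "?S f \<noteq> {}" "?S g \<noteq> {}" using nz by (auto simp: M_zero)
  have max: "Max (?S f) \<in> ?S f" "Max (?S g) \<in> ?S g"
    using Max_in[OF fin(1) ne(1)] Max_in[OF fin(2) ne(2)] .
  have mx: "\<And>m. f m \<noteq> 0 \<Longrightarrow> m \<le> Max (?S f)" "\<And>m. g m \<noteq> 0 \<Longrightarrow> m \<le> Max (?S g)"
    using fin by auto
  define a b where "a = Max (?S f)" and "b = Max (?S g)"
  have "f l * g (a + b - l) = (if l = a then f a * g b else 0)" if "l \<subseteq># a + b" for l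
  proof (cases "l = a")
    case False
    have "f l = 0 \<or> g (a + b - l) = 0"
    proof (rule ccontr)
      assume "\<not> ?thesis"
      then have "l \<le> a" "a + b - l \<le> b" using mx unfolding a_def b_def by auto
      with False have "l < a" by simp
      then have "l + (a + b - l) < a + b" using \<open>a + b - l \<le> b\<close> by (rule add_less_le_mono)
      then show False using that by simp
    qed
    then show ?thesis using False by auto
  qed simp
  then have "(\<Sum>l | l \<subseteq># a + b. f l * g (a + b - l)) = (\<Sum>l | l \<subseteq># a + b. if l = a then f a * g b else 0)"
    by (intro sum.cong) auto
  also have "\<dots> = f a * g b" by (subst sum.delta) (auto simp: finite_submultisets)
  finally have "(f \<otimes>\<^bsub>M\<^esub> g) (a + b) = (f a * g b) mod int p" by (simp add: M_mult)
  moreover have "\<not> int p dvd f a" "\<not> int p dvd g b"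
    using max coeff_range[OF f, of a] coeff_range[OF g, of b] zdvd_not_zless
    unfolding a_def b_def by (metis (mono_tags, lifting) le_neq_trans mem_Collect_eq)+
  moreover have "Factorial_Ring.prime (int p)" using prime_p by simp
  ultimately have "(f \<otimes>\<^bsub>M\<^esub> g) (a + b) \<noteq> 0"
    by (metis dvd_eq_mod_eq_0 prime_dvd_mult_iff)
  then show ?thesis by (auto simp: M_zero)
qed

sublocale M: domain M
proof (rule domain.intro[OF cring_M], unfold_locales)
  show "\<one>\<^bsub>M\<^esub> \<noteq> \<zero>\<^bsub>M\<^esub>" by (auto simp: M_one M_zero fun_eq_iff)
  show "a = \<zero>\<^bsub>M\<^esub> \<or> b = \<zero>\<^bsub>M\<^esub>" if "a \<otimes>\<^bsub>M\<^esub> b = \<zero>\<^bsub>M\<^esub>" "a \<in> carrier M" "b \<in> carrier M" for a b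
    using M_integral that by blast
qed

text \<open>Reduction modulo the \<open>i\<close>-th variable, with the residue ring realized inside
  \<open>M\<close> as the polynomials free of that variable.\<close>

definition set_zero :: "nat \<Rightarrow> (nat multiset \<Rightarrow> int) \<Rightarrow> nat multiset \<Rightarrow> int" where
  "set_zero i f = (\<lambda>m. if i \<in># m then 0 else f m)"

lemma set_zero_closed: "f \<in> carrier M \<Longrightarrow> set_zero i f \<in> carrier M"
proof -
  assume f: "f \<in> carrier M"
  have "{m. set_zero i f m \<noteq> 0} \<subseteq> {m. f m \<noteq> 0}" by (auto simp: set_zero_def)
  then have "finite {m. set_zero i f m \<noteq> 0}" by (rule finite_subset) (use f in \<open>simp add: carrier_M\<close>)
  then show ?thesis using f p_gt_1 by (auto simp: carrier_M set_zero_def)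
qed

lemma set_zero_hom: "set_zero i \<in> ring_hom M M"
proof (rule ring_hom_memI)
  fix f g assume f: "f \<in> carrier M" and g: "g \<in> carrier M"
  show "set_zero i f \<in> carrier M" using f by (rule set_zero_closed)
  show "set_zero i (f \<oplus>\<^bsub>M\<^esub> g) = set_zero i f \<oplus>\<^bsub>M\<^esub> set_zero i g"
    by (auto simp: set_zero_def M_add fun_eq_iff)
  show "set_zero i (f \<otimes>\<^bsub>M\<^esub> g) = set_zero i f \<otimes>\<^bsub>M\<^esub> set_zero i g"
  proof
    fix m
    show "set_zero i (f \<otimes>\<^bsub>M\<^esub> g) m = (set_zero i f \<otimes>\<^bsub>M\<^esub> set_zero i g) m"
    proof (cases "i \<in># m")
      case True
      have "(\<Sum>a | a \<subseteq># m. set_zero i f a * set_zero i g (m - a)) = 0"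
      proof (rule sum.neutral, rule ballI)
        fix a assume "a \<in> {a. a \<subseteq># m}"
        then have "m = a + (m - a)" by simp
        then have "i \<in># a \<or> i \<in># m - a" using True by (metis union_iff)
        then show "set_zero i f a * set_zero i g (m - a) = 0" by (auto simp: set_zero_def)
      qed
      then show ?thesis using True by (simp add: set_zero_def M_mult)
    next
      case False
      have "(\<Sum>a | a \<subseteq># m. set_zero i f a * set_zero i g (m - a)) = (\<Sum>a | a \<subseteq># m. f a * g (m - a))"
        using False by (intro sum.cong) (auto simp: set_zero_def dest: mset_subset_eqD in_diffD)
      then show ?thesis using False by (simp add: set_zero_def M_mult)
    qed
  qed
qed (auto simp: set_zero_def M_one)

lemma set_zero_X: "set_zero i (Var j) = (if i = j then \<zero>\<^bsub>M\<^esub> else Var j)"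
  by (auto simp: set_zero_def xpow_def M_zero fun_eq_iff)

lemma set_zero_eq_zero_iff:
  assumes f: "f \<in> carrier M" and i: "i < n"
  shows "set_zero i f = \<zero>\<^bsub>M\<^esub> \<longleftrightarrow> (\<exists>g\<in>carrier M. f = Var i \<otimes>\<^bsub>M\<^esub> g)"
proof
  assume z: "set_zero i f = \<zero>\<^bsub>M\<^esub>"
  have fm: "f m = 0" if "i \<notin># m" for m using fun_cong[OF z, of m] that by (simp add: set_zero_def M_zero)
  let ?g = "\<lambda>m. f (add_mset i m)"
  have "finite (add_mset i -` {m. f m \<noteq> 0})"
    by (rule finite_vimageI) (use f in \<open>auto simp: carrier_M inj_def\<close>)
  then have "finite {m. ?g m \<noteq> 0}" by (simp add: vimage_def)
  then have g: "?g \<in> carrier M" using f unfolding carrier_M by fastforce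
  have "f = Var i \<otimes>\<^bsub>M\<^esub> ?g" by (rule ext) (simp add: X_mult[OF g] fm)
  then show "\<exists>g\<in>carrier M. f = Var i \<otimes>\<^bsub>M\<^esub> g" using g by blast
next
  assume "\<exists>g\<in>carrier M. f = Var i \<otimes>\<^bsub>M\<^esub> g"
  then obtain g where g: "g \<in> carrier M" "f = Var i \<otimes>\<^bsub>M\<^esub> g" by blast
  then show "set_zero i f = \<zero>\<^bsub>M\<^esub>" by (auto simp: set_zero_def X_mult M_zero)
qed

text \<open>The exponent of the variable in one fixed monomial of \<open>f\<close> drops with every
  factor taken out, so the division stops. The number \<open>k\<close> is the valuation along the
  \<open>i\<close>-th variable.\<close>

lemma factor_var_power:
  assumes f: "f \<in> carrier M" "f \<noteq> \<zero>\<^bsub>M\<^esub>" and i: "i < n"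
  shows "\<exists>k. \<exists>g\<in>carrier M. f = Var i [^]\<^bsub>M\<^esub> (k::nat) \<otimes>\<^bsub>M\<^esub> g \<and> set_zero i g \<noteq> \<zero>\<^bsub>M\<^esub>"
proof -
  obtain m where "f m \<noteq> 0" using f by (auto simp: M_zero)
  then show ?thesis using f
  proof (induction "count m i" arbitrary: f m)
    case 0
    then have "set_zero i f m \<noteq> 0" by (auto simp: set_zero_def count_eq_zero_iff)
    then have "set_zero i f \<noteq> \<zero>\<^bsub>M\<^esub>" by (auto simp: M_zero)
    then show ?case using 0 X_closed[OF i] by (intro exI[of _ 0] bexI[of _ f]) auto
  next
    case (Suc c)
    show ?case
    proof (cases "set_zero i f = \<zero>\<^bsub>M\<^esub>")
      case False
      then show ?thesis using Suc X_closed[OF i] by (intro exI[of _ 0] bexI[of _ f]) auto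
    next
      case True
      then obtain g where g: "g \<in> carrier M" "f = Var i \<otimes>\<^bsub>M\<^esub> g"
        using set_zero_eq_zero_iff[OF Suc.prems(2) i] by blast
      have "i \<in># m" using Suc.hyps(2) by (metis count_inI zero_neq_one nat.distinct(1))
      then have "g (m - {#i#}) \<noteq> 0" using g X_mult[OF g(1), of i m] Suc.prems by simp
      moreover have "c = count (m - {#i#}) i" using Suc.hyps(2) by simp
      moreover have "g \<noteq> \<zero>\<^bsub>M\<^esub>" using g Suc.prems X_closed[OF i] by auto
      ultimately obtain k h where h: "h \<in> carrier M" "g = Var i [^]\<^bsub>M\<^esub> (k::nat) \<otimes>\<^bsub>M\<^esub> h" "set_zero i h \<noteq> \<zero>\<^bsub>M\<^esub>"
        using Suc.hyps(1) g(1) by blast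
      then have "f = Var i [^]\<^bsub>M\<^esub> (Suc k) \<otimes>\<^bsub>M\<^esub> h"
        using g X_closed[OF i] by (simp add: M.m_assoc M.m_comm[of "Var i"] M.m_lcomm)
      then show ?thesis using h by blast
    qed
  qed
qed

lemma M_char: "add_pow M (int p) \<one>\<^bsub>M\<^esub> = \<zero>\<^bsub>M\<^esub>"
proof -
  have "add_pow M (int k) \<one>\<^bsub>M\<^esub> = red (of_nat k)" for k
  proof (induction k)
    case 0
    show ?case by (simp add: M.int_add_pow_zero red_hom)
  next
    case (Suc k)
    have "add_pow M (int (Suc k)) \<one>\<^bsub>M\<^esub> = \<one>\<^bsub>M\<^esub> \<oplus>\<^bsub>M\<^esub> add_pow M (int k) \<one>\<^bsub>M\<^esub>"
      by (simp add: M.add.int_pow_mult M.add.int_pow_1)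
    then show ?case using Suc by (simp add: red_hom)
  qed
  moreover have "red (of_nat p) = \<zero>\<^bsub>M\<^esub>"
    unfolding single_of_nat[symmetric]
    by (auto simp: red_def M_zero lookup_single when_def fun_eq_iff simp del: single_of_nat)
  ultimately show ?thesis by simp
qed

context
  fixes S :: "('s, 'k) ring_scheme" (structure) and x :: "nat \<Rightarrow> 's"
  assumes S: "cring S" and char: "add_pow S (int p) \<one> = \<zero>"
    and x: "\<And>i. x i \<in> carrier S"
begin

interpretation S: cring S by (rule S)

lemma add_pow_mod_char:
  assumes a: "a \<in> carrier S"
  shows "add_pow S (k mod int p) a = add_pow S k a"
proof -
  have "add_pow S (int p) a = add_pow S (int p) \<one> \<otimes> a" using a by (simp add: S.add_pow_ldistr_int)
  then have p0: "add_pow S (int p) a = \<zero>" using a char by simp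
  have "add_pow S k a = add_pow S (int p * (k div int p) + k mod int p) a" by simp
  also have "\<dots> = add_pow S (int p * (k div int p)) a \<oplus> add_pow S (k mod int p) a"
    using a by (simp only: S.add.int_pow_mult)
  also have "add_pow S (int p * (k div int p)) a = add_pow S (k div int p) (add_pow S (int p) a)"
    using a by (simp add: S.add.int_pow_pow mult.commute)
  also have "\<dots> = \<zero>" by (simp add: p0 S.add.int_pow_one)
  finally show ?thesis using a by simp
qed

lemma mpoly_eval_red: "cring.mpoly_eval S x (red f) = S.zeval x f"
proof -
  have "S.mpoly_eval x (red f) = (\<Oplus>m\<in>Poly_Mapping.keys f. add_pow S (red f m) (S.mon_eval x m))"
    by (rule S.mpoly_eval_superset[OF x]) (auto simp: red_def in_keys_iff)
  also have "\<dots> = (\<Oplus>m\<in>Poly_Mapping.keys f. add_pow S (Poly_Mapping.lookup f m) (S.mon_eval x m))"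
    by (rule S.finsum_cong') (auto simp: red_def add_pow_mod_char x S.mon_eval_closed[OF x])
  also have "\<dots> = S.zeval x f"
    by (rule S.mpoly_eval_superset[OF x, symmetric]) (auto simp: in_keys_iff)
  finally show ?thesis .
qed

text \<open>The universal property of \<open>M\<close> among commutative rings in which
  \<open>p\<close> vanishes. Evaluation can be carried out on integral lifts, since changing
  coefficients by multiples of \<open>p\<close> does not change the value
  (\<open>mpoly_eval_red\<close>).\<close>

lemma mpoly_eval_hom: "cring.mpoly_eval S x \<in> ring_hom M S"
proof (rule ring_hom_memI)
  fix f g assume "f \<in> carrier M" "g \<in> carrier M"
  then obtain f' g' where [simp]: "f = red f'" "g = red g'" by (metis red_surj)
  show "S.mpoly_eval x (f \<oplus>\<^bsub>M\<^esub> g) = S.mpoly_eval x f \<oplus> S.mpoly_eval x g"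
    unfolding \<open>f = red f'\<close> \<open>g = red g'\<close> red_hom[symmetric] mpoly_eval_red by (rule S.zeval_add[OF x])
  show "S.mpoly_eval x (f \<otimes>\<^bsub>M\<^esub> g) = S.mpoly_eval x f \<otimes> S.mpoly_eval x g"
    unfolding \<open>f = red f'\<close> \<open>g = red g'\<close> red_hom[symmetric] mpoly_eval_red by (rule S.zeval_mult[OF x])
next
  show "S.mpoly_eval x \<one>\<^bsub>M\<^esub> = \<one>"
    unfolding red_hom[symmetric] mpoly_eval_red by (rule S.zeval_one[OF x])
qed (rule S.mpoly_eval_closed[OF x])

lemma mpoly_eval_X: "cring.mpoly_eval S x (Var i) = x i"
  unfolding red_single[symmetric] mpoly_eval_red by (rule S.zeval_var[OF x])

end

lemma mpoly_hom_unique: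
  assumes S: "ring S" and h: "h \<in> ring_hom M S" "h' \<in> ring_hom M S"
    and eq: "\<And>i. i < n \<Longrightarrow> h (Var i) = h' (Var i)" and f: "f \<in> carrier M"
  shows "h f = h' f"
  using f
proof (induction f rule: M_induct)
  case zero
  show ?case using ring_hom_zero[OF h(1) M.ring_axioms S] ring_hom_zero[OF h(2) M.ring_axioms S] by simp
next
  case one
  show ?case using ring_hom_one[OF h(1)] ring_hom_one[OF h(2)] by simp
next
  case (add f g)
  then show ?case using ring_hom_add[OF h(1)] ring_hom_add[OF h(2)] by simp
next
  case (var i f)
  then show ?case using ring_hom_mult[OF h(1) X_closed] ring_hom_mult[OF h(2) X_closed] eq by simp
qed

end

section \<open>Inverse Frobenius maps and complete integral closedness\<close>

context fp_mpoly
begin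

text \<open>Over the subring of \<open>q\<close>-th powers, \<open>M\<close> is free on the
  monomials with all exponents below \<open>q\<close>. For such an \<open>m0\<close> this is the
  coordinate at \<open>m0\<close> followed by the \<open>q\<close>-th root; coefficients are their
  own roots because they lie in the prime field.\<close>

definition froot :: "nat \<Rightarrow> nat multiset \<Rightarrow> (nat multiset \<Rightarrow> int) \<Rightarrow> nat multiset \<Rightarrow> int" where
  "froot q m0 r = (\<lambda>m. r (repeat_mset q m + m0))"

lemma froot_closed:
  assumes r: "r \<in> carrier M" and q: "q > 0"
  shows "froot q m0 r \<in> carrier M"
proof -
  have inj: "inj (\<lambda>m. repeat_mset q m + m0)"
    using q by (auto simp: inj_def multiset_eq_iff)
  have "finite ((\<lambda>m. repeat_mset q m + m0) -` {m. r m \<noteq> 0})"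
    by (rule finite_vimageI[OF _ inj]) (use r in \<open>auto simp: carrier_M\<close>)
  then have "finite {m. froot q m0 r m \<noteq> 0}" by (simp add: vimage_def froot_def)
  moreover have "set_mset m \<subseteq> {..<n}" if "froot q m0 r m \<noteq> 0" for m
  proof -
    have "set_mset (repeat_mset q m + m0) \<subseteq> {..<n}"
      using r that unfolding carrier_M froot_def by blast
    moreover have "set_mset m \<subseteq> set_mset (repeat_mset q m)"
      using q by (auto simp flip: count_greater_zero_iff)
    ultimately show ?thesis by auto
  qed
  ultimately show ?thesis using coeff_range[OF r] unfolding carrier_M by (auto simp: froot_def)
qed

lemma froot_add: "froot q m0 (r \<oplus>\<^bsub>M\<^esub> s) = froot q m0 r \<oplus>\<^bsub>M\<^esub> froot q m0 s"
  by (auto simp: froot_def M_add)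

lemma Var_pow: "Var i [^]\<^bsub>M\<^esub> k = xpow (replicate_mset k i)"
proof (induction k)
  case 0
  then show ?case by (simp add: xpow_empty)
next
  case (Suc k)
  have "xpow (replicate_mset (Suc k) i) = xpow (replicate_mset k i + {#i#})" by simp
  then show ?case unfolding xpow_add using Suc by simp
qed

text \<open>A \<open>q\<close>-th power of the variable that divides the monomial
  \<open>q m + m0\<close> must come from \<open>m\<close>, since \<open>m0\<close> contains fewer
  than \<open>q\<close> copies of \<open>i\<close>.\<close>

lemma froot_Var_pow_mult:
  assumes s: "s \<in> carrier M" and q: "q > count m0 i"
  shows "froot q m0 (Var i [^]\<^bsub>M\<^esub> q \<otimes>\<^bsub>M\<^esub> s) = Var i \<otimes>\<^bsub>M\<^esub> froot q m0 s"
proof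
  fix m
  have "replicate_mset q i \<subseteq># repeat_mset q m + m0 \<longleftrightarrow> i \<in># m"
  proof
    assume "replicate_mset q i \<subseteq># repeat_mset q m + m0"
    then have "q \<le> q * count m i + count m0 i"
      by (metis count_replicate_mset count_union mset_subset_eq_count repeat_mset.rep_eq)
    then show "i \<in># m" using q by (metis add_0 count_eq_zero_iff leD mult_0_right)
  next
    assume "i \<in># m"
    then have "1 \<le> count m i" by (simp add: Suc_le_eq)
    then have "q \<le> q * count m i + count m0 i" by (metis mult.right_neutral mult_le_mono2 trans_le_add1)
    then show "replicate_mset q i \<subseteq># repeat_mset q m + m0"
      unfolding subseteq_mset_def by (auto simp del: count_eq_zero_iff)
  qed
  moreover have "repeat_mset q m + m0 - replicate_mset q i = repeat_mset q (m - {#i#}) + m0" if "i \<in># m"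
  proof -
    from multi_member_split[OF that] obtain m' where "m = add_mset i m'" by blast
    then show ?thesis by (auto simp: multiset_eq_iff)
  qed
  moreover have "froot q m0 s \<in> carrier M" using q by (intro froot_closed s) simp
  ultimately show "froot q m0 (Var i [^]\<^bsub>M\<^esub> q \<otimes>\<^bsub>M\<^esub> s) m = (Var i \<otimes>\<^bsub>M\<^esub> froot q m0 s) m"
    unfolding Var_pow by (simp add: froot_def xpow_mult[OF s] X_mult)
qed

text \<open>Both sides are additive in \<open>f\<close> because \<open>q\<close> is a power of
  \<open>p\<close>, which leaves multiplication by one variable as the only case with
  content.\<close>

lemma froot_pow_mult:
  assumes q: "q = p ^ e" "q > size m0" and f: "f \<in> carrier M" and "r \<in> carrier M"
  shows "froot q m0 (f [^]\<^bsub>M\<^esub> q \<otimes>\<^bsub>M\<^esub> r) = f \<otimes>\<^bsub>M\<^esub> froot q m0 r"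
proof -
  have q0: "q > 0" using q(2) by simp
  from f \<open>r \<in> carrier M\<close> show ?thesis
  proof (induction f arbitrary: r rule: M_induct)
  case zero
  have "q > 0" using q(2) by simp
  then have "\<zero>\<^bsub>M\<^esub> [^]\<^bsub>M\<^esub> q = \<zero>\<^bsub>M\<^esub>" by (simp add: M.nat_pow_zero)
  moreover have "froot q m0 \<zero>\<^bsub>M\<^esub> = \<zero>\<^bsub>M\<^esub>" by (simp add: froot_def M_zero)
  ultimately show ?case using zero froot_closed[OF zero \<open>q > 0\<close>, of m0] by simp
next
  case one
  then have "froot q m0 r \<in> carrier M" by (intro froot_closed q0)
  then show ?case using one by simp
next
  case (add f g)
  have "(f \<oplus>\<^bsub>M\<^esub> g) [^]\<^bsub>M\<^esub> q = f [^]\<^bsub>M\<^esub> q \<oplus>\<^bsub>M\<^esub> g [^]\<^bsub>M\<^esub> q"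
    unfolding q(1) by (rule M.frobenius_pow_add[OF prime_p M_char]) fact+
  moreover have "froot q m0 r \<in> carrier M" by (intro froot_closed add q0)
  ultimately show ?case using add by (simp add: M.l_distr froot_add)
next
  case (var i f)
  have X: "Var i \<in> carrier M" using var by (simp add: X_closed)
  have "count m0 i < q" using q(2) count_le_size[of m0 i] by linarith
  then have "froot q m0 (Var i [^]\<^bsub>M\<^esub> q \<otimes>\<^bsub>M\<^esub> (f [^]\<^bsub>M\<^esub> q \<otimes>\<^bsub>M\<^esub> r)) = Var i \<otimes>\<^bsub>M\<^esub> froot q m0 (f [^]\<^bsub>M\<^esub> q \<otimes>\<^bsub>M\<^esub> r)"
    using var by (intro froot_Var_pow_mult) auto
  moreover have "froot q m0 r \<in> carrier M" by (intro froot_closed var q0)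
  ultimately show ?case using var X by (simp add: M.nat_pow_distrib M.m_assoc)
qed
qed

lemma const_unit:
  assumes "k \<in> {0<..<int p}"
  shows "\<exists>v\<in>carrier M. red (of_int k) \<otimes>\<^bsub>M\<^esub> v = \<one>\<^bsub>M\<^esub>"
proof -
  have "coprime k (int p)"
    using assms prime_p by (metis coprime_commute greaterThanLessThan_iff prime_imp_coprime prime_nat_int_transfer zdvd_not_zless)
  then obtain l where l: "[k * l = 1] (mod int p)" using cong_solve_coprime_int by blast
  have "red (of_int k) \<otimes>\<^bsub>M\<^esub> red (of_int l) = red (of_int (k * l))" by (simp add: red_hom)
  also have "\<dots> = red (of_int 1)"
    unfolding single_of_int[symmetric] using l
    by (auto simp: red_def lookup_single when_def cong_def fun_eq_iff simp del: single_of_int single_one)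
  also have "\<dots> = \<one>\<^bsub>M\<^esub>" by (simp add: red_hom)
  finally have "red (of_int k) \<otimes>\<^bsub>M\<^esub> red (of_int l) = \<one>\<^bsub>M\<^esub>" .
  moreover have "of_int l \<in> zpolys" unfolding single_of_int[symmetric]
    by (auto simp: zpolys_def lookup_single when_def simp del: single_of_int)
  ultimately show ?thesis using red_in by blast
qed

text \<open>For \<open>q\<close> a power of \<open>p\<close> exceeding the
  degree of \<open>d\<close>, the \<open>q\<close>-inverse-linear map \<open>froot q m0\<close> takes \<open>d\<close> to a nonzero constant and
  \<open>d f\<^sup>q = h\<^sup>q r\<close> to an equation \<open>k f = h r'\<close>.\<close>

lemma M_completely_integrally_closed:
  assumes f: "f \<in> carrier M" and h: "h \<in> carrier M" and d: "d \<in> carrier M" "d \<noteq> \<zero>\<^bsub>M\<^esub>"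
    and div: "\<And>m. \<exists>r\<in>carrier M. d \<otimes>\<^bsub>M\<^esub> f [^]\<^bsub>M\<^esub> m = h [^]\<^bsub>M\<^esub> (m::nat) \<otimes>\<^bsub>M\<^esub> r"
  shows "\<exists>g\<in>carrier M. f = h \<otimes>\<^bsub>M\<^esub> g"
proof -
  obtain m0 where m0: "d m0 \<noteq> 0" using d by (auto simp: M_zero)
  have fin: "finite (size ` {m. d m \<noteq> 0})" using d by (simp add: carrier_M)
  define e where "e = Suc (Max (size ` {m. d m \<noteq> 0}))"
  define q where "q = p ^ e"
  have "e < 2 ^ e" by (rule less_exp)
  also have "2 ^ e \<le> q" unfolding q_def using prime_ge_2_nat[OF prime_p] by (rule power_mono) simp
  finally have eq: "e < q" .
  have sz: "size m < q" if "d m \<noteq> 0" for m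
    using Max_ge[OF fin, of "size m"] that eq unfolding e_def by auto
  have q0: "q > 0" using eq by simp
  obtain r where r: "r \<in> carrier M" "d \<otimes>\<^bsub>M\<^esub> f [^]\<^bsub>M\<^esub> q = h [^]\<^bsub>M\<^esub> q \<otimes>\<^bsub>M\<^esub> r" using div by blast
  have "froot q m0 (f [^]\<^bsub>M\<^esub> q \<otimes>\<^bsub>M\<^esub> d) = froot q m0 (h [^]\<^bsub>M\<^esub> q \<otimes>\<^bsub>M\<^esub> r)"
    using r(2) d f by (simp add: M.m_comm)
  then have eq1: "f \<otimes>\<^bsub>M\<^esub> froot q m0 d = h \<otimes>\<^bsub>M\<^esub> froot q m0 r"
    using froot_pow_mult[OF q_def sz[OF m0]] f h d(1) r(1) by simp
  have "froot q m0 d m = (if m = {#} then d m0 else 0)" for m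
  proof (cases "m = {#}")
    case False
    then have "size m > 0" by (simp add: nonempty_has_size)
    then have "q \<le> size (repeat_mset q m + m0)" by (simp add: trans_le_add1)
    then have "d (repeat_mset q m + m0) = 0" using sz by (meson leD)
    then show ?thesis using False by (simp add: froot_def)
  qed (simp add: froot_def)
  then have "froot q m0 d = red (of_int (d m0))"
    unfolding single_of_int[symmetric] using d(1)
    by (auto simp: red_def lookup_single when_def fun_eq_iff simp del: single_of_int)
  moreover have "d m0 \<in> {0<..<int p}" using m0 coeff_range[OF d(1), of m0] by auto
  ultimately obtain v where v: "v \<in> carrier M" "froot q m0 d \<otimes>\<^bsub>M\<^esub> v = \<one>\<^bsub>M\<^esub>" using const_unit by metis
  have "f = f \<otimes>\<^bsub>M\<^esub> froot q m0 d \<otimes>\<^bsub>M\<^esub> v"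
    using v f froot_closed[OF d(1) q0] by (simp add: M.m_assoc)
  also have "\<dots> = h \<otimes>\<^bsub>M\<^esub> (froot q m0 r \<otimes>\<^bsub>M\<^esub> v)"
    unfolding eq1 using v h froot_closed[OF r(1) q0] by (simp add: M.m_assoc)
  finally show ?thesis using v froot_closed[OF r(1) q0] by blast
qed

end

section \<open>Localizations of domains\<close>

locale domain_localization = domain R for R (structure) +
  fixes S :: "'a set"
  assumes S_sub: "S \<subseteq> carrier R" and S_one: "\<one> \<in> S" and S_zero: "\<zero> \<notin> S"
    and S_mult: "\<And>s t. s \<in> S \<Longrightarrow> t \<in> S \<Longrightarrow> s \<otimes> t \<in> S"
begin

abbreviation fr :: "'a \<Rightarrow> 'a \<Rightarrow> ('a \<times> 'a) set" where "fr \<equiv> loc_frac R S"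
abbreviation Q :: "('a \<times> 'a) set ring" where "Q \<equiv> localization R S"

lemma S_carr: "s \<in> S \<Longrightarrow> s \<in> carrier R" using S_sub by blast

lemma S_nz: "s \<in> S \<Longrightarrow> s \<noteq> \<zero>" using S_zero by blast

text \<open>In a domain the auxiliary factor \<open>u\<close> of the definition cancels, so equality
  of fractions is plain cross multiplication.\<close>

lemma loc_rel_iff:
  "((a, s), (b, t)) \<in> loc_rel R S \<longleftrightarrow>
    a \<in> carrier R \<and> s \<in> S \<and> b \<in> carrier R \<and> t \<in> S \<and> a \<otimes> t = b \<otimes> s"
proof -
  have "(\<exists>u\<in>S. u \<otimes> (a \<otimes> t \<ominus> b \<otimes> s) = \<zero>) \<longleftrightarrow> a \<otimes> t = b \<otimes> s"
    if "a \<in> carrier R" "s \<in> S" "b \<in> carrier R" "t \<in> S"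
  proof
    assume "\<exists>u\<in>S. u \<otimes> (a \<otimes> t \<ominus> b \<otimes> s) = \<zero>"
    then have "a \<otimes> t \<ominus> b \<otimes> s = \<zero>"
      using that S_carr S_nz integral by (metis m_closed minus_closed)
    then show "a \<otimes> t = b \<otimes> s" using that S_carr by simp
  next
    assume "a \<otimes> t = b \<otimes> s"
    then show "\<exists>u\<in>S. u \<otimes> (a \<otimes> t \<ominus> b \<otimes> s) = \<zero>"
      using that S_one S_carr by (intro bexI[of _ \<one>]) auto
  qed
  then show ?thesis unfolding loc_rel_def by auto
qed

lemma loc_rel_equiv: "equiv (carrier R \<times> S) (loc_rel R S)"
proof (rule equivI)
  show "loc_rel R S \<subseteq> (carrier R \<times> S) \<times> (carrier R \<times> S)" by (auto simp: loc_rel_iff)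
  show "refl_on (carrier R \<times> S) (loc_rel R S)"
    by (rule refl_onI) (auto simp: loc_rel_iff)
  show "sym (loc_rel R S)" by (rule symI) (auto simp: loc_rel_iff)
  show "trans (loc_rel R S)"
  proof (rule transI, clarify)
    fix a s b t c u assume "((a, s), (b, t)) \<in> loc_rel R S" "((b, t), (c, u)) \<in> loc_rel R S"
    then have *: "a \<in> carrier R" "s \<in> S" "b \<in> carrier R" "t \<in> S" "c \<in> carrier R" "u \<in> S"
      "a \<otimes> t = b \<otimes> s" "b \<otimes> u = c \<otimes> t" by (auto simp: loc_rel_iff)
    note carr = *(1,3,5) S_carr[OF *(2)] S_carr[OF *(4)] S_carr[OF *(6)]
    have "t \<otimes> (a \<otimes> u) = (a \<otimes> t) \<otimes> u" using carr by (simp add: m_ac)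
    also have "\<dots> = s \<otimes> (b \<otimes> u)" using carr *(7) by (simp add: m_ac)
    also have "\<dots> = t \<otimes> (c \<otimes> s)" using carr *(8) by (simp add: m_ac)
    finally have "a \<otimes> u = c \<otimes> s" using carr S_nz[OF *(4)] by (simp add: m_lcancel)
    then show "((a, s), (c, u)) \<in> loc_rel R S" using * by (simp add: loc_rel_iff)
  qed
qed

lemma fr_eq_iff:
  assumes "a \<in> carrier R" "s \<in> S" "b \<in> carrier R" "t \<in> S"
  shows "fr a s = fr b t \<longleftrightarrow> a \<otimes> t = b \<otimes> s"
  unfolding loc_frac_def using assms
  by (subst eq_equiv_class_iff[OF loc_rel_equiv]) (auto simp: loc_rel_iff)

lemma mem_fr_iff: "(b, t) \<in> fr a s \<longleftrightarrow> ((a, s), (b, t)) \<in> loc_rel R S"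
  by (simp add: loc_frac_def)

lemma carrier_Q: "carrier Q = {fr a s | a s. a \<in> carrier R \<and> s \<in> S}"
  by (simp add: localization_def)

lemma fr_closed: "a \<in> carrier R \<Longrightarrow> s \<in> S \<Longrightarrow> fr a s \<in> carrier Q"
  by (auto simp: carrier_Q)

lemma Q_cases:
  assumes "x \<in> carrier Q" obtains a s where "a \<in> carrier R" "s \<in> S" "x = fr a s"
  using assms by (auto simp: carrier_Q)

lemma one_Q: "\<one>\<^bsub>Q\<^esub> = fr \<one> \<one>" and zero_Q: "\<zero>\<^bsub>Q\<^esub> = fr \<zero> \<one>"
  by (simp_all add: localization_def)

text \<open>The operations of \<open>localization\<close> are unions over all representatives. Once
  well-definedness is known, such a union is over a nonempty family of equal sets.\<close>

lemma union_const: "A \<noteq> {} \<Longrightarrow> (\<And>x. x \<in> A \<Longrightarrow> F x = c) \<Longrightarrow> \<Union> (F ` A) = c"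
  by auto

lemma fr_mult:
  assumes "a \<in> carrier R" "s \<in> S" "b \<in> carrier R" "t \<in> S"
  shows "fr a s \<otimes>\<^bsub>Q\<^esub> fr b t = fr (a \<otimes> b) (s \<otimes> t)"
proof -
  have ne: "(a, s) \<in> fr a s" "(b, t) \<in> fr b t" using assms by (auto simp: mem_fr_iff loc_rel_iff)
  have "fr (a' \<otimes> b') (s' \<otimes> t') = fr (a \<otimes> b) (s \<otimes> t)"
    if "(a', s') \<in> fr a s" "(b', t') \<in> fr b t" for a' s' b' t'
  proof -
    from that have *: "a' \<in> carrier R" "s' \<in> S" "b' \<in> carrier R" "t' \<in> S" "a \<otimes> s' = a' \<otimes> s" "b \<otimes> t' = b' \<otimes> t"
      by (auto simp: mem_fr_iff loc_rel_iff)
    note carr = *(1,3) assms(1,3) S_carr[OF *(2)] S_carr[OF *(4)] S_carr[OF assms(2)] S_carr[OF assms(4)]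
    have "a' \<otimes> b' \<otimes> (s \<otimes> t) = (a' \<otimes> s) \<otimes> (b' \<otimes> t)" using carr by (simp add: m_ac)
    also have "\<dots> = a \<otimes> b \<otimes> (s' \<otimes> t')" unfolding *(5,6)[symmetric] using carr by (simp add: m_ac)
    finally show ?thesis using * assms by (subst fr_eq_iff) (auto intro: S_mult)
  qed
  then show ?thesis unfolding localization_def monoid.simps
    by (auto intro!: union_const ne simp: split_beta)
qed

lemma fr_add:
  assumes "a \<in> carrier R" "s \<in> S" "b \<in> carrier R" "t \<in> S"
  shows "fr a s \<oplus>\<^bsub>Q\<^esub> fr b t = fr (a \<otimes> t \<oplus> b \<otimes> s) (s \<otimes> t)"
proof -
  have ne: "(a, s) \<in> fr a s" "(b, t) \<in> fr b t" using assms by (auto simp: mem_fr_iff loc_rel_iff)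
  have "fr (a' \<otimes> t' \<oplus> b' \<otimes> s') (s' \<otimes> t') = fr (a \<otimes> t \<oplus> b \<otimes> s) (s \<otimes> t)"
    if "(a', s') \<in> fr a s" "(b', t') \<in> fr b t" for a' s' b' t'
  proof -
    from that have *: "a' \<in> carrier R" "s' \<in> S" "b' \<in> carrier R" "t' \<in> S" "a \<otimes> s' = a' \<otimes> s" "b \<otimes> t' = b' \<otimes> t"
      by (auto simp: mem_fr_iff loc_rel_iff)
    note carr = *(1,3) assms(1,3) S_carr[OF *(2)] S_carr[OF *(4)] S_carr[OF assms(2)] S_carr[OF assms(4)]
    have "(a' \<otimes> t' \<oplus> b' \<otimes> s') \<otimes> (s \<otimes> t) = (a' \<otimes> s) \<otimes> (t' \<otimes> t) \<oplus> (b' \<otimes> t) \<otimes> (s' \<otimes> s)"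
      using carr by (simp add: l_distr r_distr m_ac)
    also have "\<dots> = (a \<otimes> t \<oplus> b \<otimes> s) \<otimes> (s' \<otimes> t')"
      unfolding *(5,6)[symmetric] using carr by (simp add: l_distr r_distr m_ac)
    finally show ?thesis using * assms S_carr by (subst fr_eq_iff) (auto intro: S_mult)
  qed
  then show ?thesis unfolding localization_def ring_record_simps
    by (auto intro!: union_const ne simp: split_beta)
qed

lemma fr_cancel:
  assumes "a \<in> carrier R" "s \<in> S" "t \<in> S"
  shows "fr (a \<otimes> t) (s \<otimes> t) = fr a s"
  using assms S_carr by (subst fr_eq_iff) (auto intro: S_mult simp: m_ac)

lemma fr_add_same:
  assumes "a \<in> carrier R" "s \<in> S" "b \<in> carrier R"
  shows "fr a s \<oplus>\<^bsub>Q\<^esub> fr b s = fr (a \<oplus> b) s"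
proof -
  have "fr a s \<oplus>\<^bsub>Q\<^esub> fr b s = fr ((a \<oplus> b) \<otimes> s) (s \<otimes> s)"
    using assms S_carr by (simp add: fr_add l_distr)
  then show ?thesis using assms by (simp add: fr_cancel)
qed

text \<open>Three elements at once because the ring laws involve three; for fewer, one of them is
  repeated.\<close>

lemma common_denominator:
  assumes "x \<in> carrier Q" "y \<in> carrier Q" "z \<in> carrier Q"
  obtains a b c s where "a \<in> carrier R" "b \<in> carrier R" "c \<in> carrier R" "s \<in> S"
    "x = fr a s" "y = fr b s" "z = fr c s"
proof -
  obtain a s b t c u where *: "a \<in> carrier R" "s \<in> S" "b \<in> carrier R" "t \<in> S" "c \<in> carrier R" "u \<in> S"
    "x = fr a s" "y = fr b t" "z = fr c u" using assms by (metis Q_cases)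
  note carr = S_carr[OF *(2)] S_carr[OF *(4)] S_carr[OF *(6)]
  have "x = fr (a \<otimes> (t \<otimes> u)) (s \<otimes> (t \<otimes> u))" using * by (simp add: fr_cancel S_mult)
  moreover have "y = fr (b \<otimes> (s \<otimes> u)) (t \<otimes> (s \<otimes> u))" using * by (simp add: fr_cancel S_mult)
  moreover have "z = fr (c \<otimes> (s \<otimes> t)) (u \<otimes> (s \<otimes> t))" using * by (simp add: fr_cancel S_mult)
  moreover have "t \<otimes> (s \<otimes> u) = s \<otimes> (t \<otimes> u)" "u \<otimes> (s \<otimes> t) = s \<otimes> (t \<otimes> u)" using carr by (simp_all add: m_ac)
  ultimately show ?thesis using * carr by (intro that) (auto intro!: S_mult)
qed

lemma fr_zero: "s \<in> S \<Longrightarrow> fr \<zero> s = \<zero>\<^bsub>Q\<^esub>"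
  unfolding zero_Q using S_one S_carr by (subst fr_eq_iff) auto

lemma fr_one: "s \<in> S \<Longrightarrow> fr s s = \<one>\<^bsub>Q\<^esub>"
  unfolding one_Q using S_one S_carr by (subst fr_eq_iff) auto

lemma fr_eq_zero_iff: "a \<in> carrier R \<Longrightarrow> s \<in> S \<Longrightarrow> fr a s = \<zero>\<^bsub>Q\<^esub> \<longleftrightarrow> a = \<zero>"
  unfolding zero_Q using S_one S_carr by (subst fr_eq_iff) auto

lemma localization_cring: "cring Q"
proof (rule cringI)
  show "abelian_group Q"
  proof (rule abelian_groupI)
    fix x y z assume xyz: "x \<in> carrier Q" "y \<in> carrier Q" "z \<in> carrier Q"
    obtain a b c s where "a \<in> carrier R" "b \<in> carrier R" "c \<in> carrier R" "s \<in> S"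
      "x = fr a s" "y = fr b s" "z = fr c s" using common_denominator[OF xyz] .
    then show "x \<oplus>\<^bsub>Q\<^esub> y \<oplus>\<^bsub>Q\<^esub> z = x \<oplus>\<^bsub>Q\<^esub> (y \<oplus>\<^bsub>Q\<^esub> z)" by (simp add: fr_add_same a_assoc)
  next
    fix x y assume xy: "x \<in> carrier Q" "y \<in> carrier Q"
    obtain a b c s where "a \<in> carrier R" "b \<in> carrier R" "c \<in> carrier R" "s \<in> S"
      "x = fr a s" "y = fr b s" "y = fr c s" using common_denominator[OF xy xy(2)] .
    then show "x \<oplus>\<^bsub>Q\<^esub> y \<in> carrier Q" "x \<oplus>\<^bsub>Q\<^esub> y = y \<oplus>\<^bsub>Q\<^esub> x"
      by (simp_all add: fr_add_same fr_closed a_comm)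
  next
    show "\<zero>\<^bsub>Q\<^esub> \<in> carrier Q" unfolding zero_Q using S_one by (intro fr_closed) auto
  next
    fix x assume "x \<in> carrier Q"
    then obtain a s where as: "a \<in> carrier R" "s \<in> S" "x = fr a s" by (rule Q_cases)
    then show "\<zero>\<^bsub>Q\<^esub> \<oplus>\<^bsub>Q\<^esub> x = x" by (simp add: fr_zero[OF as(2), symmetric] fr_add_same)
    have "fr (\<ominus> a) s \<oplus>\<^bsub>Q\<^esub> x = \<zero>\<^bsub>Q\<^esub>" using as by (simp add: fr_add_same l_neg fr_zero)
    then show "\<exists>y\<in>carrier Q. y \<oplus>\<^bsub>Q\<^esub> x = \<zero>\<^bsub>Q\<^esub>"
      by (rule bexI) (intro fr_closed a_inv_closed as)
  qed
  show "comm_monoid Q"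
  proof (rule comm_monoidI)
    fix x y z assume xyz: "x \<in> carrier Q" "y \<in> carrier Q" "z \<in> carrier Q"
    obtain a b c s where "a \<in> carrier R" "b \<in> carrier R" "c \<in> carrier R" "s \<in> S"
      "x = fr a s" "y = fr b s" "z = fr c s" using common_denominator[OF xyz] .
    then show "x \<otimes>\<^bsub>Q\<^esub> y \<otimes>\<^bsub>Q\<^esub> z = x \<otimes>\<^bsub>Q\<^esub> (y \<otimes>\<^bsub>Q\<^esub> z)" using S_carr by (simp add: fr_mult m_assoc S_mult)
  next
    fix x y assume xy: "x \<in> carrier Q" "y \<in> carrier Q"
    obtain a b c s where "a \<in> carrier R" "b \<in> carrier R" "c \<in> carrier R" "s \<in> S"
      "x = fr a s" "y = fr b s" "y = fr c s" using common_denominator[OF xy xy(2)] .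
    then show "x \<otimes>\<^bsub>Q\<^esub> y \<in> carrier Q" "x \<otimes>\<^bsub>Q\<^esub> y = y \<otimes>\<^bsub>Q\<^esub> x"
      by (simp_all add: fr_mult fr_closed m_comm S_mult)
  next
    show "\<one>\<^bsub>Q\<^esub> \<in> carrier Q" unfolding one_Q using S_one by (intro fr_closed) auto
  next
    fix x assume "x \<in> carrier Q"
    then obtain a s where as: "a \<in> carrier R" "s \<in> S" "x = fr a s" by (rule Q_cases)
    then show "\<one>\<^bsub>Q\<^esub> \<otimes>\<^bsub>Q\<^esub> x = x" unfolding one_Q using S_one S_carr by (simp add: fr_mult)
  qed
  fix x y z assume xyz: "x \<in> carrier Q" "y \<in> carrier Q" "z \<in> carrier Q"
  obtain a b c s where "a \<in> carrier R" "b \<in> carrier R" "c \<in> carrier R" "s \<in> S"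
    "x = fr a s" "y = fr b s" "z = fr c s" using common_denominator[OF xyz] .
  then show "(x \<oplus>\<^bsub>Q\<^esub> y) \<otimes>\<^bsub>Q\<^esub> z = x \<otimes>\<^bsub>Q\<^esub> z \<oplus>\<^bsub>Q\<^esub> y \<otimes>\<^bsub>Q\<^esub> z"
    by (simp add: fr_add_same fr_mult l_distr S_mult)
qed

sublocale Q: cring Q by (rule localization_cring)

lemma localization_domain: "domain Q"
proof (rule domain.intro[OF localization_cring], unfold_locales)
  show "\<one>\<^bsub>Q\<^esub> \<noteq> \<zero>\<^bsub>Q\<^esub>" unfolding one_Q using fr_eq_zero_iff[OF _ S_one, of \<one>] by simp
  fix x y assume xy: "x \<otimes>\<^bsub>Q\<^esub> y = \<zero>\<^bsub>Q\<^esub>" "x \<in> carrier Q" "y \<in> carrier Q"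
  obtain a s b t where "a \<in> carrier R" "s \<in> S" "b \<in> carrier R" "t \<in> S" "x = fr a s" "y = fr b t"
    using xy by (metis Q_cases)
  then show "x = \<zero>\<^bsub>Q\<^esub> \<or> y = \<zero>\<^bsub>Q\<^esub>"
    using xy(1) by (simp add: fr_mult fr_eq_zero_iff S_mult integral_iff)
qed

sublocale Q: domain Q by (rule localization_domain)

lemma fr_inverse: "s \<in> S \<Longrightarrow> t \<in> S \<Longrightarrow> fr s t \<otimes>\<^bsub>Q\<^esub> fr t s = \<one>\<^bsub>Q\<^esub>"
  using S_carr by (simp add: fr_mult m_comm[of s t] fr_one S_mult)

lemma fr_hom: "(\<lambda>a. fr a \<one>) \<in> ring_hom R Q"
  using S_one by (intro ring_hom_memI) (auto simp: fr_closed fr_mult fr_add_same one_Q)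

lemma fr_decomp: "a \<in> carrier R \<Longrightarrow> s \<in> S \<Longrightarrow> fr a \<one> = fr a s \<otimes>\<^bsub>Q\<^esub> fr s \<one>"
  using S_one S_carr by (subst fr_mult) (auto simp: fr_eq_iff S_mult)

text \<open>The extension of \<open>\<phi>\<close> to those fractions that have a denominator
  outside its kernel. As a partial map it covers two uses: field homomorphisms, when
  \<open>\<phi>\<close> does not vanish on \<open>S\<close>, and residue maps of places, when
  \<open>\<phi>\<close> has a kernel.\<close>

definition frac_map :: "('f, 'k) ring_scheme \<Rightarrow> ('a \<Rightarrow> 'f) \<Rightarrow> ('a \<times> 'a) set \<Rightarrow> 'f" where
  "frac_map F \<phi> x = (THE y. \<exists>a\<in>carrier R. \<exists>s\<in>S. x = fr a s \<and> \<phi> s \<noteq> \<zero>\<^bsub>F\<^esub> \<and> y = \<phi> a \<otimes>\<^bsub>F\<^esub> inv\<^bsub>F\<^esub> \<phi> s)"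

definition frac_dom :: "('f, 'k) ring_scheme \<Rightarrow> ('a \<Rightarrow> 'f) \<Rightarrow> ('a \<times> 'a) set set" where
  "frac_dom F \<phi> = {fr a s | a s. a \<in> carrier R \<and> s \<in> S \<and> \<phi> s \<noteq> \<zero>\<^bsub>F\<^esub>}"

context
  fixes F :: "('f, 'k) ring_scheme" and \<phi>
  assumes F: "field F" and hom: "\<phi> \<in> ring_hom R F"
begin

interpretation F: field F by (rule F)
interpretation \<phi>: ring_hom_cring R F \<phi> by (rule UnivPoly.ring_hom_cringI[OF is_cring F.is_cring hom])

lemma frac_map_fr:
  assumes "a \<in> carrier R" "s \<in> S" "\<phi> s \<noteq> \<zero>\<^bsub>F\<^esub>"
  shows "frac_map F \<phi> (fr a s) = \<phi> a \<otimes>\<^bsub>F\<^esub> inv\<^bsub>F\<^esub> \<phi> s"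
  unfolding frac_map_def
proof (rule the_equality)
  show "\<exists>a'\<in>carrier R. \<exists>s'\<in>S. fr a s = fr a' s' \<and> \<phi> s' \<noteq> \<zero>\<^bsub>F\<^esub> \<and>
      \<phi> a \<otimes>\<^bsub>F\<^esub> inv\<^bsub>F\<^esub> \<phi> s = \<phi> a' \<otimes>\<^bsub>F\<^esub> inv\<^bsub>F\<^esub> \<phi> s'" using assms by blast
  fix y assume "\<exists>a'\<in>carrier R. \<exists>s'\<in>S. fr a s = fr a' s' \<and> \<phi> s' \<noteq> \<zero>\<^bsub>F\<^esub> \<and> y = \<phi> a' \<otimes>\<^bsub>F\<^esub> inv\<^bsub>F\<^esub> \<phi> s'"
  then obtain a' s' where *: "a' \<in> carrier R" "s' \<in> S" "fr a s = fr a' s'" "\<phi> s' \<noteq> \<zero>\<^bsub>F\<^esub>" "y = \<phi> a' \<otimes>\<^bsub>F\<^esub> inv\<^bsub>F\<^esub> \<phi> s'"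
    by blast
  then have "a \<otimes> s' = a' \<otimes> s" using assms by (simp add: fr_eq_iff)
  then have e: "\<phi> a \<otimes>\<^bsub>F\<^esub> \<phi> s' = \<phi> a' \<otimes>\<^bsub>F\<^esub> \<phi> s" using assms * S_carr by (metis \<phi>.hom_mult)
  have carr: "\<phi> a \<in> carrier F" "\<phi> s \<in> carrier F" "\<phi> a' \<in> carrier F" "\<phi> s' \<in> carrier F"
    using assms * S_carr by auto
  have u: "\<phi> s \<in> Units F" "\<phi> s' \<in> Units F" using carr assms * by (auto simp: F.field_Units)
  have "y = \<phi> a' \<otimes>\<^bsub>F\<^esub> \<phi> s \<otimes>\<^bsub>F\<^esub> (inv\<^bsub>F\<^esub> \<phi> s \<otimes>\<^bsub>F\<^esub> inv\<^bsub>F\<^esub> \<phi> s')"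
    using * carr u by (simp add: F.m_assoc) (simp add: F.m_assoc[symmetric])
  also have "\<dots> = \<phi> a \<otimes>\<^bsub>F\<^esub> (\<phi> s' \<otimes>\<^bsub>F\<^esub> inv\<^bsub>F\<^esub> \<phi> s') \<otimes>\<^bsub>F\<^esub> inv\<^bsub>F\<^esub> \<phi> s"
    unfolding e[symmetric] using carr u by (simp add: F.m_ac del: F.Units_r_inv)
  also have "\<dots> = \<phi> a \<otimes>\<^bsub>F\<^esub> inv\<^bsub>F\<^esub> \<phi> s" using carr u by simp
  finally show "y = \<phi> a \<otimes>\<^bsub>F\<^esub> inv\<^bsub>F\<^esub> \<phi> s" .
qed

lemma frac_dom_props:
  assumes "x \<in> frac_dom F \<phi>" "y \<in> frac_dom F \<phi>"
  shows frac_map_closed: "frac_map F \<phi> x \<in> carrier F"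
    and frac_dom_add: "x \<oplus>\<^bsub>Q\<^esub> y \<in> frac_dom F \<phi>"
    and frac_dom_mult: "x \<otimes>\<^bsub>Q\<^esub> y \<in> frac_dom F \<phi>"
    and frac_map_add: "frac_map F \<phi> (x \<oplus>\<^bsub>Q\<^esub> y) = frac_map F \<phi> x \<oplus>\<^bsub>F\<^esub> frac_map F \<phi> y"
    and frac_map_mult: "frac_map F \<phi> (x \<otimes>\<^bsub>Q\<^esub> y) = frac_map F \<phi> x \<otimes>\<^bsub>F\<^esub> frac_map F \<phi> y"
proof -
  obtain a s b t where *: "a \<in> carrier R" "s \<in> S" "\<phi> s \<noteq> \<zero>\<^bsub>F\<^esub>" "x = fr a s"
      "b \<in> carrier R" "t \<in> S" "\<phi> t \<noteq> \<zero>\<^bsub>F\<^esub>" "y = fr b t"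
    using assms by (auto simp: frac_dom_def)
  have carr: "\<phi> a \<in> carrier F" "\<phi> s \<in> carrier F" "\<phi> b \<in> carrier F" "\<phi> t \<in> carrier F"
    using * S_carr by auto
  have u: "\<phi> s \<in> Units F" "\<phi> t \<in> Units F" using carr * by (auto simp: F.field_Units)
  have st: "s \<otimes> t \<in> S" "\<phi> (s \<otimes> t) = \<phi> s \<otimes>\<^bsub>F\<^esub> \<phi> t" "\<phi> (s \<otimes> t) \<noteq> \<zero>\<^bsub>F\<^esub>"
    using * carr S_carr S_mult by (auto simp: F.integral_iff)
  have inv: "inv\<^bsub>F\<^esub> \<phi> (s \<otimes> t) = inv\<^bsub>F\<^esub> \<phi> s \<otimes>\<^bsub>F\<^esub> inv\<^bsub>F\<^esub> \<phi> t"
  proof (rule F.comm_inv_char)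
    have "\<phi> (s \<otimes> t) \<otimes>\<^bsub>F\<^esub> (inv\<^bsub>F\<^esub> \<phi> s \<otimes>\<^bsub>F\<^esub> inv\<^bsub>F\<^esub> \<phi> t) =
      (\<phi> s \<otimes>\<^bsub>F\<^esub> inv\<^bsub>F\<^esub> \<phi> s) \<otimes>\<^bsub>F\<^esub> (\<phi> t \<otimes>\<^bsub>F\<^esub> inv\<^bsub>F\<^esub> \<phi> t)"
      unfolding st(2) using u carr by (simp add: F.m_ac del: F.Units_r_inv)
    then show "\<phi> (s \<otimes> t) \<otimes>\<^bsub>F\<^esub> (inv\<^bsub>F\<^esub> \<phi> s \<otimes>\<^bsub>F\<^esub> inv\<^bsub>F\<^esub> \<phi> t) = \<one>\<^bsub>F\<^esub>" using u carr by simp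
  qed (use u carr S_carr * in auto)
  show "frac_map F \<phi> x \<in> carrier F" using * carr u by (simp add: frac_map_fr)
  have xy: "x \<oplus>\<^bsub>Q\<^esub> y = fr (a \<otimes> t \<oplus> b \<otimes> s) (s \<otimes> t)" "x \<otimes>\<^bsub>Q\<^esub> y = fr (a \<otimes> b) (s \<otimes> t)"
    using * by (simp_all add: fr_add fr_mult)
  have c2: "a \<otimes> t \<oplus> b \<otimes> s \<in> carrier R" "a \<otimes> b \<in> carrier R" using * S_carr by auto
  show "x \<oplus>\<^bsub>Q\<^esub> y \<in> frac_dom F \<phi>" "x \<otimes>\<^bsub>Q\<^esub> y \<in> frac_dom F \<phi>"
    unfolding xy frac_dom_def using st c2 by blast+
  have "\<phi> (a \<otimes> t \<oplus> b \<otimes> s) \<otimes>\<^bsub>F\<^esub> (inv\<^bsub>F\<^esub> \<phi> s \<otimes>\<^bsub>F\<^esub> inv\<^bsub>F\<^esub> \<phi> t) =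
    \<phi> a \<otimes>\<^bsub>F\<^esub> inv\<^bsub>F\<^esub> \<phi> s \<otimes>\<^bsub>F\<^esub> (\<phi> t \<otimes>\<^bsub>F\<^esub> inv\<^bsub>F\<^esub> \<phi> t) \<oplus>\<^bsub>F\<^esub> \<phi> b \<otimes>\<^bsub>F\<^esub> inv\<^bsub>F\<^esub> \<phi> t \<otimes>\<^bsub>F\<^esub> (\<phi> s \<otimes>\<^bsub>F\<^esub> inv\<^bsub>F\<^esub> \<phi> s)"
    using * S_carr carr u by (simp add: F.l_distr F.r_distr F.m_ac del: F.Units_r_inv)
  then show "frac_map F \<phi> (x \<oplus>\<^bsub>Q\<^esub> y) = frac_map F \<phi> x \<oplus>\<^bsub>F\<^esub> frac_map F \<phi> y"
    unfolding xy frac_map_fr[OF c2(1) st(1,3)] inv using * carr u by (simp add: frac_map_fr)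
  have "\<phi> (a \<otimes> b) \<otimes>\<^bsub>F\<^esub> (inv\<^bsub>F\<^esub> \<phi> s \<otimes>\<^bsub>F\<^esub> inv\<^bsub>F\<^esub> \<phi> t) = (\<phi> a \<otimes>\<^bsub>F\<^esub> inv\<^bsub>F\<^esub> \<phi> s) \<otimes>\<^bsub>F\<^esub> (\<phi> b \<otimes>\<^bsub>F\<^esub> inv\<^bsub>F\<^esub> \<phi> t)"
    using * S_carr carr u by (simp add: F.m_ac)
  then show "frac_map F \<phi> (x \<otimes>\<^bsub>Q\<^esub> y) = frac_map F \<phi> x \<otimes>\<^bsub>F\<^esub> frac_map F \<phi> y"
    unfolding xy frac_map_fr[OF c2(2) st(1,3)] inv using * by (simp add: frac_map_fr)
qed

lemma frac_dom_base: "a \<in> carrier R \<Longrightarrow> fr a \<one> \<in> frac_dom F \<phi>"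
  unfolding frac_dom_def using S_one by force

lemma frac_map_base: "a \<in> carrier R \<Longrightarrow> frac_map F \<phi> (fr a \<one>) = \<phi> a"
  using S_one by (subst frac_map_fr) auto

lemma frac_map_hom:
  assumes inj: "\<And>s. s \<in> S \<Longrightarrow> \<phi> s \<noteq> \<zero>\<^bsub>F\<^esub>"
  shows "frac_map F \<phi> \<in> ring_hom Q F"
proof -
  have "carrier Q = frac_dom F \<phi>" using inj by (auto simp: carrier_Q frac_dom_def)
  then show ?thesis
    by (intro ring_hom_memI) (auto simp: frac_map_closed frac_map_add frac_map_mult frac_map_base one_Q)
qed

end

end

lemma (in domain) fraction_localization: "domain_localization R (carrier R - {\<zero>})"
  by unfold_locales (auto simp: integral_iff)

lemma (in domain) fraction_field_field: "field (fraction_field R)"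
proof -
  interpret Q: domain_localization R "carrier R - {\<zero>}" by (rule fraction_localization)
  show ?thesis unfolding fraction_field_def
  proof (rule cring.cring_fieldI2[OF Q.localization_cring])
    show "\<zero>\<^bsub>Q.Q\<^esub> \<noteq> \<one>\<^bsub>Q.Q\<^esub>" using Q.Q.one_not_zero by simp
    fix x assume x: "x \<in> carrier Q.Q" "x \<noteq> \<zero>\<^bsub>Q.Q\<^esub>"
    then obtain a s where as: "a \<in> carrier R" "s \<in> carrier R - {\<zero>}" "x = Q.fr a s" by (metis Q.Q_cases)
    with x have "a \<noteq> \<zero>" by (simp add: Q.fr_eq_zero_iff)
    then show "\<exists>y\<in>carrier Q.Q. x \<otimes>\<^bsub>Q.Q\<^esub> y = \<one>\<^bsub>Q.Q\<^esub>"
      using as Q.fr_inverse[of a s] Q.fr_closed by (intro bexI[of _ "Q.fr s a"]) auto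
  qed
qed

section \<open>Depth and Cohen-Macaulay rings\<close>

text \<open>If \<open>w\<close> is killed by \<open>u, v, t\<close> modulo the regular sequence \<open>x, y\<close>, then multiplication by \<open>w\<close> gives
  an alternating 2-cocycle \<open>s\<close> on \<open>u, v, t\<close>, the obstruction to \<open>w \<in> (x, y)\<close>. It vanishes when
  \<open>u, v, t\<close> is a regular sequence.\<close>

lemma (in domain) mem_ideal2_if_regular_triple:
  assumes xy: "x \<in> carrier R" "y \<in> carrier R" "y \<noteq> \<zero>"
    and reg: "\<And>a b. a \<in> carrier R \<Longrightarrow> b \<in> carrier R \<Longrightarrow> x \<otimes> a = y \<otimes> b \<Longrightarrow> \<exists>e\<in>carrier R. a = y \<otimes> e \<and> b = x \<otimes> e"
    and uvt: "u \<in> carrier R" "v \<in> carrier R" "t \<in> carrier R" "u \<noteq> \<zero>"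
    and R2: "\<And>a b. a \<in> carrier R \<Longrightarrow> b \<in> carrier R \<Longrightarrow> v \<otimes> a = u \<otimes> b \<Longrightarrow> \<exists>e\<in>carrier R. a = u \<otimes> e"
    and R3: "\<And>s a b. s \<in> carrier R \<Longrightarrow> a \<in> carrier R \<Longrightarrow> b \<in> carrier R \<Longrightarrow> t \<otimes> s = u \<otimes> a \<oplus> v \<otimes> b \<Longrightarrow>
        \<exists>a'\<in>carrier R. \<exists>b'\<in>carrier R. s = u \<otimes> a' \<oplus> v \<otimes> b'"
    and w: "w \<in> carrier R"
    and uw: "\<exists>a\<in>carrier R. \<exists>b\<in>carrier R. u \<otimes> w = x \<otimes> a \<oplus> y \<otimes> b"
    and vw: "\<exists>a\<in>carrier R. \<exists>b\<in>carrier R. v \<otimes> w = x \<otimes> a \<oplus> y \<otimes> b"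
    and tw: "\<exists>a\<in>carrier R. \<exists>b\<in>carrier R. t \<otimes> w = x \<otimes> a \<oplus> y \<otimes> b"
  shows "\<exists>a\<in>carrier R. \<exists>b\<in>carrier R. w = x \<otimes> a \<oplus> y \<otimes> b"
proof -
  obtain au bu where u: "au \<in> carrier R" "bu \<in> carrier R" "u \<otimes> w = x \<otimes> au \<oplus> y \<otimes> bu" using uw by blast
  obtain av bv where v: "av \<in> carrier R" "bv \<in> carrier R" "v \<otimes> w = x \<otimes> av \<oplus> y \<otimes> bv" using vw by blast
  obtain a_t b_t where t: "a_t \<in> carrier R" "b_t \<in> carrier R" "t \<otimes> w = x \<otimes> a_t \<oplus> y \<otimes> b_t" using tw by blast
  note carr = xy(1,2) uvt(1-3) w u(1,2) v(1,2) t(1,2)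
  \<comment> \<open>Comparing the two expressions for \<open>r \<otimes> r' \<otimes> w\<close>
    leaves a syzygy of \<open>x, y\<close>. By \<open>reg\<close> it is a multiple of the Koszul
    syzygy, and the multiplier is the value of the cocycle at \<open>(r, r')\<close>.\<close>
  have cocycle: "\<exists>s\<in>carrier R. r' \<otimes> a \<ominus> r \<otimes> a' = y \<otimes> s \<and> r \<otimes> b' \<ominus> r' \<otimes> b = x \<otimes> s"
    if c: "r \<in> carrier R" "r' \<in> carrier R" "a \<in> carrier R" "b \<in> carrier R" "a' \<in> carrier R" "b' \<in> carrier R"
      and e: "r \<otimes> w = x \<otimes> a \<oplus> y \<otimes> b" "r' \<otimes> w = x \<otimes> a' \<oplus> y \<otimes> b'" for r r' a b a' b'
  proof (rule reg)
    have "x \<otimes> (r' \<otimes> a \<ominus> r \<otimes> a') = r' \<otimes> (x \<otimes> a \<oplus> y \<otimes> b) \<ominus> r \<otimes> (x \<otimes> a' \<oplus> y \<otimes> b') \<oplus> y \<otimes> (r \<otimes> b' \<ominus> r' \<otimes> b)"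
      using carr c by (elim rep_cases) (simp add: rep_hom algebra_simps)
    also have "\<dots> = y \<otimes> (r \<otimes> b' \<ominus> r' \<otimes> b)"
      unfolding e[symmetric] using carr c by (elim rep_cases) (simp add: rep_hom algebra_simps)
    finally show "x \<otimes> (r' \<otimes> a \<ominus> r \<otimes> a') = y \<otimes> (r \<otimes> b' \<ominus> r' \<otimes> b)" .
  qed (use c in simp_all)
  obtain s where s: "s \<in> carrier R" "v \<otimes> au \<ominus> u \<otimes> av = y \<otimes> s" "u \<otimes> bv \<ominus> v \<otimes> bu = x \<otimes> s"
    using cocycle[OF uvt(1,2) u(1,2) v(1,2) u(3) v(3)] by blast
  obtain s1 where s1: "s1 \<in> carrier R" "t \<otimes> au \<ominus> u \<otimes> a_t = y \<otimes> s1"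
    using cocycle[OF uvt(1,3) u(1,2) t(1,2) u(3) t(3)] by blast
  obtain s2 where s2: "s2 \<in> carrier R" "t \<otimes> av \<ominus> v \<otimes> a_t = y \<otimes> s2"
    using cocycle[OF uvt(2,3) v(1,2) t(1,2) v(3) t(3)] by blast
  \<comment> \<open>The cocycle condition for \<open>s\<close>, \<open>s1\<close>,
    \<open>s2\<close>, obtained after multiplication by \<open>y\<close>. It puts
    \<open>t \<otimes> s\<close> into the ideal of \<open>u, v\<close>, so that \<open>R3\<close>
    applies.\<close>
  have "y \<otimes> (t \<otimes> s) = t \<otimes> (y \<otimes> s)"
    using carr s(1) by (simp add: m_ac)
  also have "\<dots> = v \<otimes> (t \<otimes> au \<ominus> u \<otimes> a_t) \<ominus> u \<otimes> (t \<otimes> av \<ominus> v \<otimes> a_t)"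
    unfolding s(2)[symmetric] using carr by (elim rep_cases) (simp add: rep_hom algebra_simps)
  also have "\<dots> = y \<otimes> (u \<otimes> (\<ominus> s2) \<oplus> v \<otimes> s1)"
    unfolding s1(2) s2(2) using carr s1(1) s2(1) by (elim rep_cases) (simp add: rep_hom algebra_simps)
  finally have "t \<otimes> s = u \<otimes> (\<ominus> s2) \<oplus> v \<otimes> s1"
    using carr s(1) s1(1) s2(1) xy(3) by (simp add: m_lcancel)
  then obtain \<alpha> \<beta> where ab: "\<alpha> \<in> carrier R" "\<beta> \<in> carrier R" "s = u \<otimes> \<alpha> \<oplus> v \<otimes> \<beta>"
    using R3[OF s(1) a_inv_closed[OF s2(1)] s1(1)] by blast
  \<comment> \<open>Now \<open>s\<close> is a coboundary. Changing the coefficients of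
    \<open>u \<otimes> w\<close> by the Koszul syzygy with factor \<open>\<beta>\<close> keeps their
    combination and makes both divisible by \<open>u\<close>.\<close>
  have "v \<otimes> (au \<ominus> y \<otimes> \<beta>) = (v \<otimes> au \<ominus> u \<otimes> av) \<oplus> u \<otimes> av \<ominus> v \<otimes> (y \<otimes> \<beta>)"
    using carr ab(1,2) by (elim rep_cases) (simp add: rep_hom algebra_simps)
  also have "\<dots> = u \<otimes> (av \<oplus> y \<otimes> \<alpha>)"
    unfolding s(2) ab(3) using carr ab(1,2) by (elim rep_cases) (simp add: rep_hom algebra_simps)
  finally obtain c where c: "c \<in> carrier R" "au \<ominus> y \<otimes> \<beta> = u \<otimes> c"
    using R2[of "au \<ominus> y \<otimes> \<beta>" "av \<oplus> y \<otimes> \<alpha>"] carr ab by auto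
  have "v \<otimes> (bu \<oplus> x \<otimes> \<beta>) = u \<otimes> bv \<ominus> (u \<otimes> bv \<ominus> v \<otimes> bu) \<oplus> v \<otimes> (x \<otimes> \<beta>)"
    using carr ab(1,2) by (elim rep_cases) (simp add: rep_hom algebra_simps)
  also have "\<dots> = u \<otimes> (bv \<ominus> x \<otimes> \<alpha>)"
    unfolding s(3) ab(3) using carr ab(1,2) by (elim rep_cases) (simp add: rep_hom algebra_simps)
  finally obtain d where d: "d \<in> carrier R" "bu \<oplus> x \<otimes> \<beta> = u \<otimes> d"
    using R2[of "bu \<oplus> x \<otimes> \<beta>" "bv \<ominus> x \<otimes> \<alpha>"] carr ab by auto
  have "u \<otimes> w = x \<otimes> (au \<ominus> y \<otimes> \<beta>) \<oplus> y \<otimes> (bu \<oplus> x \<otimes> \<beta>)"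
    unfolding u(3) using carr ab(1,2) by (elim rep_cases) (simp add: rep_hom algebra_simps)
  also have "\<dots> = u \<otimes> (x \<otimes> c \<oplus> y \<otimes> d)"
    unfolding c(2) d(2) using carr c(1) d(1) by (elim rep_cases) (simp add: rep_hom algebra_simps)
  finally have "w = x \<otimes> c \<oplus> y \<otimes> d"
    using carr c(1) d(1) uvt(4) by (simp add: m_lcancel)
  then show ?thesis using c(1) d(1) by blast
qed

section \<open>Regular triples and socle elements, in terms of elements\<close>

lemma (in cring) genideal_empty: "Idl {} = {\<zero>}"
proof
  show "Idl {} \<subseteq> {\<zero>}" by (rule genideal_minimal[OF zeroideal]) simp
  interpret ideal "Idl {}" R by (rule genideal_ideal) simp
  show "{\<zero>} \<subseteq> Idl {}" by simp
qed

lemma (in cring) genideal_single_iff: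
  assumes "u \<in> carrier R"
  shows "a \<in> Idl {u} \<longleftrightarrow> (\<exists>b\<in>carrier R. a = u \<otimes> b)"
  using assms unfolding cgenideal_eq_genideal[OF assms, symmetric] cgenideal_def
  by (auto simp: m_comm)

lemma (in cring) genideal_pair_iff:
  assumes uv: "u \<in> carrier R" "v \<in> carrier R"
  shows "a \<in> Idl {u, v} \<longleftrightarrow> (\<exists>b\<in>carrier R. \<exists>c\<in>carrier R. a = u \<otimes> b \<oplus> v \<otimes> c)"
proof
  have "ideal (PIdl u <+> PIdl v) R" by (intro add_ideals cgenideal_ideal uv)
  moreover have "u \<in> PIdl u <+> PIdl v"
    unfolding set_add_def set_mult_def cgenideal_def using uv
    by simp (metis l_null l_one one_closed r_zero zero_closed)
  moreover have "v \<in> PIdl u <+> PIdl v"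
    unfolding set_add_def set_mult_def cgenideal_def using uv
    by simp (metis l_null l_one one_closed l_zero zero_closed)
  ultimately have sub: "Idl {u, v} \<subseteq> PIdl u <+> PIdl v"
    by (intro genideal_minimal) auto
  assume "a \<in> Idl {u, v}"
  with sub have "a \<in> PIdl u <+> PIdl v" by blast
  then obtain b c where "b \<in> carrier R" "c \<in> carrier R" "a = b \<otimes> u \<oplus> c \<otimes> v"
    unfolding set_add_def set_mult_def cgenideal_def by auto
  then show "\<exists>b\<in>carrier R. \<exists>c\<in>carrier R. a = u \<otimes> b \<oplus> v \<otimes> c"
    using uv m_comm by metis
next
  interpret I: ideal "Idl {u, v}" R by (rule genideal_ideal) (use uv in simp)
  assume "\<exists>b\<in>carrier R. \<exists>c\<in>carrier R. a = u \<otimes> b \<oplus> v \<otimes> c"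
  then show "a \<in> Idl {u, v}"
    using genideal_self[of "{u, v}"] uv by (auto intro!: I.a_closed I.I_r_closed)
qed

lemma (in domain) regular_sequence_triple:
  assumes reg: "regular_sequence R xs" and len: "length xs \<ge> 3"
  obtains u v t where "u \<in> set xs" "v \<in> set xs" "t \<in> set xs" "u \<noteq> \<zero>"
    "\<And>a b. a \<in> carrier R \<Longrightarrow> b \<in> carrier R \<Longrightarrow> v \<otimes> a = u \<otimes> b \<Longrightarrow> \<exists>e\<in>carrier R. a = u \<otimes> e"
    "\<And>s a b. s \<in> carrier R \<Longrightarrow> a \<in> carrier R \<Longrightarrow> b \<in> carrier R \<Longrightarrow> t \<otimes> s = u \<otimes> a \<oplus> v \<otimes> b \<Longrightarrow>
        \<exists>a'\<in>carrier R. \<exists>b'\<in>carrier R. s = u \<otimes> a' \<oplus> v \<otimes> b'"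
proof -
  obtain u v t ys where xs: "xs = u # v # t # ys"
    using len by (metis One_nat_def Suc_le_length_iff numeral_3_eq_3)
  have c: "u \<in> carrier R" "v \<in> carrier R" "t \<in> carrier R"
    using reg unfolding regular_sequence_def xs by auto
  have ex: "xs ! i \<otimes> a \<in> Idl (set (take i xs)) \<Longrightarrow> a \<in> Idl (set (take i xs))"
    if "i < length xs" "a \<in> carrier R" for i a using reg that unfolding regular_sequence_def by blast
  \<comment> \<open>If \<open>u\<close> were zero, then \<open>u \<otimes> \<one>\<close> would lie
    in the ideal of the empty set, and regularity would put \<open>\<one>\<close> into the zero
    ideal.\<close>
  have "u \<noteq> \<zero>"
    using ex[of 0 \<one>] genideal_empty c one_not_zero unfolding xs by auto
  moreover have "\<exists>e\<in>carrier R. a = u \<otimes> e" if "a \<in> carrier R" "b \<in> carrier R" "v \<otimes> a = u \<otimes> b" for a b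
    using ex[of 1 a] that genideal_single_iff[OF c(1)] unfolding xs by auto
  moreover have "\<exists>a'\<in>carrier R. \<exists>b'\<in>carrier R. s = u \<otimes> a' \<oplus> v \<otimes> b'"
    if "s \<in> carrier R" "a \<in> carrier R" "b \<in> carrier R" "t \<otimes> s = u \<otimes> a \<oplus> v \<otimes> b" for s a b
  proof -
    have "take 2 xs = [u, v]" "xs ! 2 = t" by (simp_all add: xs numeral_2_eq_2)
    then show ?thesis using ex[of 2 s] that genideal_pair_iff[OF c(1,2)] by (auto simp: xs)
  qed
  ultimately show ?thesis using that[of u v t] xs by auto
qed

lemma (in ideal) power_descent:
  assumes w: "w \<in> carrier R" "w \<notin> I" and u: "u \<in> carrier R" "u [^] (k::nat) \<otimes> w \<in> I"
  shows "\<exists>j::nat. u [^] j \<otimes> w \<notin> I \<and> u \<otimes> (u [^] j \<otimes> w) \<in> I"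
  using u(2)
proof (induction k)
  case 0
  then show ?case using w u by simp
next
  case (Suc k)
  show ?case
  proof (cases "u [^] k \<otimes> w \<in> I")
    case False
    have "u [^] Suc k \<otimes> w = u \<otimes> (u [^] k \<otimes> w)"
      unfolding nat_pow_Suc2[OF u(1)] using u(1) w(1) by (simp add: m_assoc)
    then show ?thesis using False Suc.prems by auto
  qed (rule Suc.IH)
qed

text \<open>Multiply \<open>w\<close> in turn by the highest power of \<open>u\<close>, then of
  \<open>v\<close>, then of \<open>t\<close> that keeps it outside \<open>I\<close>. What has been
  carried into \<open>I\<close> at one stage stays there at the next, since the later factors
  commute with it.\<close>

lemma (in cring) socle_element:
  assumes I: "ideal I R" and w: "w \<in> carrier R" "w \<notin> I"
    and uvt: "u \<in> carrier R" "v \<in> carrier R" "t \<in> carrier R"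
    and nil: "u [^] (k::nat) \<otimes> w \<in> I" "v [^] (l::nat) \<otimes> w \<in> I" "t [^] (m::nat) \<otimes> w \<in> I"
  shows "\<exists>w'\<in>carrier R. w' \<notin> I \<and> u \<otimes> w' \<in> I \<and> v \<otimes> w' \<in> I \<and> t \<otimes> w' \<in> I"
proof -
  interpret ideal I R by (rule I)
  obtain j1 :: nat where 1: "u [^] j1 \<otimes> w \<notin> I" "u \<otimes> (u [^] j1 \<otimes> w) \<in> I"
    using power_descent[OF w uvt(1) nil(1)] by blast
  let ?w1 = "u [^] j1 \<otimes> w"
  have w1: "?w1 \<in> carrier R" using uvt w by simp
  have "v [^] l \<otimes> ?w1 = u [^] j1 \<otimes> (v [^] l \<otimes> w)" using uvt w by (simp add: m_lcomm)
  then have "v [^] l \<otimes> ?w1 \<in> I" using I_l_closed[OF nil(2)] uvt by simp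
  then obtain j2 :: nat where 2: "v [^] j2 \<otimes> ?w1 \<notin> I" "v \<otimes> (v [^] j2 \<otimes> ?w1) \<in> I"
    using power_descent[OF w1 1(1) uvt(2)] by blast
  let ?w2 = "v [^] j2 \<otimes> ?w1"
  have w2: "?w2 \<in> carrier R" using uvt w1 by simp
  have "t [^] m \<otimes> ?w2 = v [^] j2 \<otimes> u [^] j1 \<otimes> (t [^] m \<otimes> w)" using uvt w by (simp add: m_ac)
  then have "t [^] m \<otimes> ?w2 \<in> I" using I_l_closed[OF nil(3)] uvt by simp
  then obtain j3 :: nat where 3: "t [^] j3 \<otimes> ?w2 \<notin> I" "t \<otimes> (t [^] j3 \<otimes> ?w2) \<in> I"
    using power_descent[OF w2 2(1) uvt(3)] by blast
  let ?w3 = "t [^] j3 \<otimes> ?w2"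
  have "v \<otimes> ?w3 = t [^] j3 \<otimes> (v \<otimes> ?w2)" using uvt w2 by (simp add: m_lcomm)
  then have "v \<otimes> ?w3 \<in> I" using I_l_closed[OF 2(2)] uvt by simp
  moreover have "u \<otimes> ?w3 = t [^] j3 \<otimes> v [^] j2 \<otimes> (u \<otimes> ?w1)" using uvt w by (simp add: m_ac)
  then have "u \<otimes> ?w3 \<in> I" using I_l_closed[OF 1(2)] uvt by simp
  ultimately show ?thesis using 3 uvt w2 by (intro bexI[of _ ?w3]) auto
qed

lemma (in primeideal) localization_at_prime: "domain R \<Longrightarrow> domain_localization R (carrier R - I)"
proof -
  assume "domain R"
  then interpret domain R .
  show ?thesis
    by unfold_locales (use I_prime I_notcarr one_imp_carrier in \<open>auto dest: I_prime\<close>)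
qed

section \<open>Extension of prime ideals to a localization\<close>

context domain_localization
begin

definition ext_ideal :: "'a set \<Rightarrow> ('a \<times> 'a) set set" where
  "ext_ideal J = {fr a s | a s. a \<in> J \<and> s \<in> S}"

context
  fixes J assumes J: "primeideal J R" and disj: "J \<inter> S = {}"
begin

interpretation J: primeideal J R by (rule J)

lemma fr_mem_ext_ideal_iff:
  assumes "a \<in> carrier R" "s \<in> S"
  shows "fr a s \<in> ext_ideal J \<longleftrightarrow> a \<in> J"
proof
  assume "fr a s \<in> ext_ideal J"
  then obtain b t where bt: "b \<in> J" "t \<in> S" "fr a s = fr b t" by (auto simp: ext_ideal_def)
  have "a \<otimes> t = b \<otimes> s" using bt assms J.Icarr by (simp add: fr_eq_iff)
  also have "\<dots> \<in> J" using bt assms S_carr by (simp add: J.I_r_closed)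
  finally show "a \<in> J" using J.I_prime[of a t] assms bt disj S_carr by blast
qed (use assms in \<open>auto simp: ext_ideal_def\<close>)

lemma ext_ideal_sub: "ext_ideal J \<subseteq> carrier Q"
  by (auto simp: ext_ideal_def intro!: fr_closed J.Icarr)

lemma primeideal_ext_ideal: "primeideal (ext_ideal J) Q"
proof (rule primeidealI)
  show "ideal (ext_ideal J) Q"
  proof (rule idealI)
    show "subgroup (ext_ideal J) (add_monoid Q)"
    proof (rule Q.add.subgroupI)
      show "ext_ideal J \<subseteq> carrier Q" by (rule ext_ideal_sub)
      have "fr \<zero> \<one> \<in> ext_ideal J" using S_one by (subst fr_mem_ext_ideal_iff) auto
      then show "ext_ideal J \<noteq> {}" by blast
    next
      fix x assume x: "x \<in> ext_ideal J"
      then obtain a s where as: "a \<in> J" "s \<in> S" "x = fr a s" by (auto simp: ext_ideal_def)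
      have "fr (\<ominus> a) s \<oplus>\<^bsub>Q\<^esub> x = \<zero>\<^bsub>Q\<^esub>" using as J.Icarr by (simp add: fr_add_same l_neg fr_zero)
      then have "\<ominus>\<^bsub>Q\<^esub> x = fr (\<ominus> a) s"
        using as J.Icarr by (intro Q.minus_equality) (auto simp: fr_closed)
      then show "\<ominus>\<^bsub>Q\<^esub> x \<in> ext_ideal J" using as J.Icarr by (simp add: fr_mem_ext_ideal_iff)
    next
      fix x y assume "x \<in> ext_ideal J" "y \<in> ext_ideal J"
      then obtain a s b t where as: "a \<in> J" "s \<in> S" "x = fr a s" "b \<in> J" "t \<in> S" "y = fr b t"
        by (auto simp: ext_ideal_def)
      then have "x \<oplus>\<^bsub>Q\<^esub> y = fr (a \<otimes> t \<oplus> b \<otimes> s) (s \<otimes> t)" using J.Icarr by (simp add: fr_add)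
      moreover have "a \<otimes> t \<oplus> b \<otimes> s \<in> J" using as S_carr by (simp add: J.I_r_closed)
      moreover have "s \<otimes> t \<in> S" using as S_mult by blast
      ultimately show "x \<oplus>\<^bsub>Q\<^esub> y \<in> ext_ideal J" unfolding ext_ideal_def by blast
    qed
    show "ring Q" by (rule Q.ring_axioms)
    fix x y assume "x \<in> ext_ideal J" "y \<in> carrier Q"
    then obtain a s b t where as: "a \<in> J" "s \<in> S" "x = fr a s" "b \<in> carrier R" "t \<in> S" "y = fr b t"
      by (auto simp: ext_ideal_def carrier_Q)
    have xy: "x \<otimes>\<^bsub>Q\<^esub> y = fr (a \<otimes> b) (s \<otimes> t)" using as J.Icarr by (simp add: fr_mult)
    show 1: "x \<otimes>\<^bsub>Q\<^esub> y \<in> ext_ideal J" unfolding xy ext_ideal_def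
      using as S_mult J.I_r_closed by blast
    have "y \<otimes>\<^bsub>Q\<^esub> x = x \<otimes>\<^bsub>Q\<^esub> y"
      using \<open>y \<in> carrier Q\<close> \<open>x \<in> ext_ideal J\<close> ext_ideal_sub by (intro Q.m_comm) auto
    with 1 show "y \<otimes>\<^bsub>Q\<^esub> x \<in> ext_ideal J" by simp
  qed
  show "cring Q" by (rule localization_cring)
  have "\<one> \<notin> J" using J.I_notcarr J.one_imp_carrier by blast
  then have "\<one>\<^bsub>Q\<^esub> \<notin> ext_ideal J" unfolding one_Q using S_one by (subst fr_mem_ext_ideal_iff) auto
  then show "carrier Q \<noteq> ext_ideal J" using Q.one_closed by blast
  fix x y assume xy: "x \<in> carrier Q" "y \<in> carrier Q" "x \<otimes>\<^bsub>Q\<^esub> y \<in> ext_ideal J"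
  then obtain a s b t where as: "a \<in> carrier R" "s \<in> S" "x = fr a s" "b \<in> carrier R" "t \<in> S" "y = fr b t"
    by (auto simp: carrier_Q)
  then have "a \<otimes> b \<in> J" using xy(3) by (simp add: fr_mult fr_mem_ext_ideal_iff S_mult)
  then show "x \<in> ext_ideal J \<or> y \<in> ext_ideal J"
    using as J.I_prime by (auto simp: fr_mem_ext_ideal_iff)
qed

end

end

text \<open>The contradiction arises in the localization at \<open>P 3\<close>. The chain gives
  dimension at least 3 there. By \<open>notin\<close> and \<open>nil\<close>, the class of
  \<open>w\<close> modulo \<open>(x, y)\<close> is nonzero and is annihilated by a power of each
  element of the maximal ideal; \<open>socle_element\<close> and
  \<open>mem_ideal2_if_regular_triple\<close> then rule out depth 3.\<close>

lemma not_cohen_macaulay_ring: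
  fixes A :: "('a, 'm) ring_scheme" (structure)
  assumes "domain A"
    and chain: "\<And>i. i \<le> 3 \<Longrightarrow> primeideal (P i) A" "\<And>i. i < 3 \<Longrightarrow> P i \<subset> P (Suc i)"
    and xyw: "x \<in> carrier A" "y \<in> carrier A" "y \<noteq> \<zero>" "w \<in> carrier A"
    and reg: "\<And>a b. a \<in> carrier A \<Longrightarrow> b \<in> carrier A \<Longrightarrow> x \<otimes> a = y \<otimes> b \<Longrightarrow> \<exists>e\<in>carrier A. a = y \<otimes> e \<and> b = x \<otimes> e"
    and notin: "\<And>s a b. s \<in> carrier A - P 3 \<Longrightarrow> a \<in> carrier A \<Longrightarrow> b \<in> carrier A \<Longrightarrow> s \<otimes> w \<noteq> x \<otimes> a \<oplus> y \<otimes> b"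
    and nil: "\<And>f. f \<in> P 3 \<Longrightarrow> \<exists>k::nat. \<exists>t\<in>carrier A - P 3. \<exists>a\<in>carrier A. \<exists>b\<in>carrier A.
      t \<otimes> (f [^] k \<otimes> w) = x \<otimes> a \<oplus> y \<otimes> b"
  shows "\<not> cohen_macaulay_ring A"
proof
  assume CM: "cohen_macaulay_ring A"
  interpret A: domain A by fact
  define p where "p = P 3"
  have pp: "primeideal p A" unfolding p_def by (rule chain(1)) simp
  interpret p: primeideal p A by (rule pp)
  interpret D: domain_localization A "carrier A - p" by (rule p.localization_at_prime) fact
  have "cohen_macaulay_local D.Q" using CM pp unfolding cohen_macaulay_ring_def by blast
  then obtain m where m: "{I. maximalideal I D.Q} = {m}" and dep: "depth D.Q m = krull_dim D.Q"
    unfolding cohen_macaulay_local_def by blast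
  from m have "maximalideal m D.Q" by blast
  then interpret m: maximalideal m D.Q .
  have "P 0 \<subset> P 1" "P 1 \<subset> P 2" "P 2 \<subset> P 3"
    using chain(2)[of 0] chain(2)[of 1] chain(2)[of 2] by (simp_all add: numeral_2_eq_2 numeral_3_eq_3)
  then have sub: "P i \<subseteq> p" if "i \<le> 3" for i
  proof -
    have "i = 0 \<or> i = 1 \<or> i = 2 \<or> i = 3" using that by linarith
    then show ?thesis using \<open>P 0 \<subset> P 1\<close> \<open>P 1 \<subset> P 2\<close> \<open>P 2 \<subset> P 3\<close> unfolding p_def by blast
  qed
  have disj: "P i \<inter> (carrier A - p) = {}" if "i \<le> 3" for i using sub[OF that] by blast
  have dim: "krull_dim D.Q \<ge> enat 3"
    unfolding krull_dim_def
  proof (rule Sup_upper, rule CollectI, intro exI conjI)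
    show "\<forall>i\<le>3. primeideal (D.ext_ideal (P i)) D.Q"
      using D.primeideal_ext_ideal[OF chain(1) disj] by blast
    show "\<forall>i<3. D.ext_ideal (P i) \<subset> D.ext_ideal (P (Suc i))"
    proof (intro allI impI)
      fix i :: nat assume i: "i < 3"
      then have i': "i \<le> 3" "Suc i \<le> 3" by auto
      obtain a where a: "a \<in> P (Suc i)" "a \<notin> P i" using chain(2)[OF i] by blast
      interpret Pi: primeideal "P (Suc i)" A by (rule chain(1)) fact
      have "D.fr a \<one> \<in> D.ext_ideal (P (Suc i))" "D.fr a \<one> \<notin> D.ext_ideal (P i)"
        using D.fr_mem_ext_ideal_iff[OF chain(1)[OF i'(1)] disj[OF i'(1)] Pi.Icarr[OF a(1)] D.S_one]
          D.fr_mem_ext_ideal_iff[OF chain(1)[OF i'(2)] disj[OF i'(2)] Pi.Icarr[OF a(1)] D.S_one] a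
        by blast+
      moreover have "D.ext_ideal (P i) \<subseteq> D.ext_ideal (P (Suc i))"
        using chain(2)[OF i] unfolding D.ext_ideal_def by blast
      ultimately show "D.ext_ideal (P i) \<subset> D.ext_ideal (P (Suc i))" by blast
    qed
  qed simp
  \<comment> \<open>Depth is only a supremum and need not be attained in the extended naturals;
    exceeding 2, however, it exceeds 2 through an actual sequence.\<close>
  have "enat 2 < enat 3" by simp
  also note dim
  finally have "enat 2 < Sup {enat (length xs) | xs. set xs \<subseteq> m \<and> regular_sequence D.Q xs}"
    unfolding dep[symmetric] depth_def .
  then obtain xs where xs: "set xs \<subseteq> m" "regular_sequence D.Q xs" "length xs > 2"
    unfolding less_Sup_iff by auto
  have len: "length xs \<ge> 3" using xs(3) by simp
  obtain u v t where uvt: "u \<in> set xs" "v \<in> set xs" "t \<in> set xs" "u \<noteq> \<zero>\<^bsub>D.Q\<^esub>"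
    and R2: "\<And>a b. a \<in> carrier D.Q \<Longrightarrow> b \<in> carrier D.Q \<Longrightarrow> v \<otimes>\<^bsub>D.Q\<^esub> a = u \<otimes>\<^bsub>D.Q\<^esub> b \<Longrightarrow> \<exists>e\<in>carrier D.Q. a = u \<otimes>\<^bsub>D.Q\<^esub> e"
    and R3: "\<And>s a b. s \<in> carrier D.Q \<Longrightarrow> a \<in> carrier D.Q \<Longrightarrow> b \<in> carrier D.Q \<Longrightarrow>
        t \<otimes>\<^bsub>D.Q\<^esub> s = u \<otimes>\<^bsub>D.Q\<^esub> a \<oplus>\<^bsub>D.Q\<^esub> v \<otimes>\<^bsub>D.Q\<^esub> b \<Longrightarrow>
        \<exists>a'\<in>carrier D.Q. \<exists>b'\<in>carrier D.Q. s = u \<otimes>\<^bsub>D.Q\<^esub> a' \<oplus>\<^bsub>D.Q\<^esub> v \<otimes>\<^bsub>D.Q\<^esub> b'"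
    by (rule D.Q.regular_sequence_triple[OF xs(2) len]) blast
  have um: "u \<in> m" "v \<in> m" "t \<in> m" using uvt xs(1) by auto
  have uc: "u \<in> carrier D.Q" "v \<in> carrier D.Q" "t \<in> carrier D.Q" using um m.Icarr by auto
  define xq yq wq where "xq = D.fr x \<one>" and "yq = D.fr y \<one>" and "wq = D.fr w \<one>"
  have XYW: "xq \<in> carrier D.Q" "yq \<in> carrier D.Q" "wq \<in> carrier D.Q"
    unfolding xq_def yq_def wq_def using xyw D.S_one by (auto intro: D.fr_closed)
  define I where "I = Idl\<^bsub>D.Q\<^esub> {xq, yq}"
  have I: "ideal I D.Q" unfolding I_def by (rule D.Q.genideal_ideal) (use XYW in simp)
  have I_iff: "a \<in> I \<longleftrightarrow> (\<exists>b\<in>carrier D.Q. \<exists>c\<in>carrier D.Q. a = xq \<otimes>\<^bsub>D.Q\<^esub> b \<oplus>\<^bsub>D.Q\<^esub> yq \<otimes>\<^bsub>D.Q\<^esub> c)" for a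
    unfolding I_def by (rule D.Q.genideal_pair_iff) (use XYW in auto)
  have comb: "xq \<otimes>\<^bsub>D.Q\<^esub> D.fr a s \<oplus>\<^bsub>D.Q\<^esub> yq \<otimes>\<^bsub>D.Q\<^esub> D.fr b s = D.fr (x \<otimes> a \<oplus> y \<otimes> b) s"
    if "a \<in> carrier A" "b \<in> carrier A" "s \<in> carrier A - p" for a b s
    unfolding xq_def yq_def using that xyw D.S_one D.S_carr by (simp add: D.fr_mult D.fr_add_same)
  have WI: "wq \<notin> I"
  proof
    assume "wq \<in> I"
    then obtain b c where bc: "b \<in> carrier D.Q" "c \<in> carrier D.Q" "wq = xq \<otimes>\<^bsub>D.Q\<^esub> b \<oplus>\<^bsub>D.Q\<^esub> yq \<otimes>\<^bsub>D.Q\<^esub> c"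
      unfolding I_iff by blast
    obtain a1 b1 c1 s where *: "a1 \<in> carrier A" "b1 \<in> carrier A" "c1 \<in> carrier A" "s \<in> carrier A - p"
      "b = D.fr a1 s" "c = D.fr b1 s" "c = D.fr c1 s" using D.common_denominator[OF bc(1,2,2)] .
    have "D.fr w \<one> = D.fr (x \<otimes> a1 \<oplus> y \<otimes> b1) s"
      using bc(3) comb[OF *(1,2,4)] unfolding *(5,6) wq_def by simp
    then have "w \<otimes> s = (x \<otimes> a1 \<oplus> y \<otimes> b1) \<otimes> \<one>"
      using * xyw D.S_one by (subst (asm) D.fr_eq_iff) auto
    then have "s \<otimes> w = x \<otimes> a1 \<oplus> y \<otimes> b1" using * xyw by (simp add: A.m_comm)
    then show False using notin * unfolding p_def by blast
  qed
  have powI: "\<exists>k::nat. r [^]\<^bsub>D.Q\<^esub> k \<otimes>\<^bsub>D.Q\<^esub> wq \<in> I" if r: "r \<in> m" for r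
  proof -
    obtain f s where fs: "f \<in> carrier A" "s \<in> carrier A - p" "r = D.fr f s"
      using m.Icarr[OF r] by (metis D.Q_cases)
    \<comment> \<open>The ideal \<open>m\<close> is known only as a maximal ideal. Being proper, it
      contains no fraction with numerator outside \<open>p\<close>, as these are units.\<close>
    have "f \<in> p"
    proof (rule ccontr)
      assume "f \<notin> p"
      then have "r \<otimes>\<^bsub>D.Q\<^esub> D.fr s f = \<one>\<^bsub>D.Q\<^esub>" "D.fr s f \<in> carrier D.Q"
        using fs D.fr_inverse[of f s] D.fr_closed[of s f] by auto
      then have "\<one>\<^bsub>D.Q\<^esub> \<in> m" using m.I_r_closed[OF r] by metis
      then show False using m.one_imp_carrier m.I_notcarr by blast
    qed
    then obtain k :: nat and t' a b where *: "t' \<in> carrier A - p" "a \<in> carrier A" "b \<in> carrier A"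
      "t' \<otimes> (f [^] k \<otimes> w) = x \<otimes> a \<oplus> y \<otimes> b" using nil unfolding p_def by blast
    have pow: "r [^]\<^bsub>D.Q\<^esub> j = D.fr (f [^] j) (s [^] j) \<and> s [^] j \<in> carrier A - p" for j :: nat
    proof (induction j)
      case 0
      then show ?case using D.S_one D.one_Q by simp
    next
      case (Suc j)
      then show ?case using fs D.S_mult by (simp add: D.fr_mult)
    qed
    have "r [^]\<^bsub>D.Q\<^esub> k \<otimes>\<^bsub>D.Q\<^esub> wq = D.fr (f [^] k \<otimes> w) (s [^] k)"
      unfolding wq_def using pow[of k] fs xyw D.S_one by (simp add: D.fr_mult)
    also have "\<dots> = D.fr (f [^] k \<otimes> w \<otimes> t') (s [^] k \<otimes> t')"
      using pow[of k] fs xyw *(1) by (subst D.fr_cancel) auto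
    also have "f [^] k \<otimes> w \<otimes> t' = x \<otimes> a \<oplus> y \<otimes> b"
      unfolding *(4)[symmetric] using fs xyw *(1) by (simp add: A.m_ac)
    also have "D.fr (x \<otimes> a \<oplus> y \<otimes> b) (s [^] k \<otimes> t') =
        xq \<otimes>\<^bsub>D.Q\<^esub> D.fr a (s [^] k \<otimes> t') \<oplus>\<^bsub>D.Q\<^esub> yq \<otimes>\<^bsub>D.Q\<^esub> D.fr b (s [^] k \<otimes> t')"
      using pow[of k] *(1-3) D.S_mult by (intro comb[symmetric]) auto
    finally have "r [^]\<^bsub>D.Q\<^esub> k \<otimes>\<^bsub>D.Q\<^esub> wq = \<dots>" .
    moreover have "D.fr a (s [^] k \<otimes> t') \<in> carrier D.Q" "D.fr b (s [^] k \<otimes> t') \<in> carrier D.Q"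
      using pow[of k] *(1-3) D.S_mult by (auto intro!: D.fr_closed)
    ultimately show ?thesis unfolding I_iff by blast
  qed
  obtain k l n :: nat where "u [^]\<^bsub>D.Q\<^esub> k \<otimes>\<^bsub>D.Q\<^esub> wq \<in> I" "v [^]\<^bsub>D.Q\<^esub> l \<otimes>\<^bsub>D.Q\<^esub> wq \<in> I" "t [^]\<^bsub>D.Q\<^esub> n \<otimes>\<^bsub>D.Q\<^esub> wq \<in> I"
    using powI[OF um(1)] powI[OF um(2)] powI[OF um(3)] by blast
  from D.Q.socle_element[OF I XYW(3) WI uc this]
  obtain wq' where wq': "wq' \<in> carrier D.Q" "wq' \<notin> I" "u \<otimes>\<^bsub>D.Q\<^esub> wq' \<in> I" "v \<otimes>\<^bsub>D.Q\<^esub> wq' \<in> I" "t \<otimes>\<^bsub>D.Q\<^esub> wq' \<in> I"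
    by blast
  have Ynz: "yq \<noteq> \<zero>\<^bsub>D.Q\<^esub>" unfolding yq_def using xyw D.S_one by (simp add: D.fr_eq_zero_iff)
  have regQ: "\<exists>e\<in>carrier D.Q. a = yq \<otimes>\<^bsub>D.Q\<^esub> e \<and> b = xq \<otimes>\<^bsub>D.Q\<^esub> e"
    if ab: "a \<in> carrier D.Q" "b \<in> carrier D.Q" "xq \<otimes>\<^bsub>D.Q\<^esub> a = yq \<otimes>\<^bsub>D.Q\<^esub> b" for a b
  proof -
    obtain a1 b1 c1 s where *: "a1 \<in> carrier A" "b1 \<in> carrier A" "c1 \<in> carrier A" "s \<in> carrier A - p"
      "a = D.fr a1 s" "b = D.fr b1 s" "b = D.fr c1 s" using D.common_denominator[OF ab(1,2,2)] .
    have Xf: "xq \<otimes>\<^bsub>D.Q\<^esub> D.fr e s = D.fr (x \<otimes> e) s" "yq \<otimes>\<^bsub>D.Q\<^esub> D.fr e s = D.fr (y \<otimes> e) s"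
      if "e \<in> carrier A" for e
      unfolding xq_def yq_def using that xyw D.S_one *(4) by (simp_all add: D.fr_mult)
    have "D.fr (x \<otimes> a1) s = D.fr (y \<otimes> b1) s" using ab(3) * Xf by simp
    then have "x \<otimes> a1 \<otimes> s = y \<otimes> b1 \<otimes> s" using * xyw by (subst (asm) D.fr_eq_iff) auto
    then have "x \<otimes> a1 = y \<otimes> b1" using * xyw D.S_nz[of s] by (simp add: A.m_rcancel)
    then obtain e where e: "e \<in> carrier A" "a1 = y \<otimes> e" "b1 = x \<otimes> e" using reg * by blast
    then show ?thesis using * Xf by (intro bexI[of _ "D.fr e s"]) (auto intro: D.fr_closed)
  qed
  have "wq' \<in> I" unfolding I_iff
    by (rule D.Q.mem_ideal2_if_regular_triple[OF XYW(1,2) Ynz regQ uc uvt(4) R2 R3 wq'(1) wq'(3-5)[unfolded I_iff]])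
  then show False using wq'(2) by blast
qed

section \<open>Integral closures\<close>

text \<open>The coefficients of \<open>\<Prod>r\<in>rs. (T - r)\<close>, counted from the leading one.\<close>

primrec (in ring) root_coeff :: "'a list \<Rightarrow> nat \<Rightarrow> 'a" where
  "root_coeff [] = (\<lambda>i. if i = 0 then \<one> else \<zero>)"
| "root_coeff (r # rs) = (\<lambda>i. root_coeff rs i \<ominus> r \<otimes> (case i of 0 \<Rightarrow> \<zero> | Suc j \<Rightarrow> root_coeff rs j))"

context cring
begin

lemma root_coeff_closed: "set rs \<subseteq> carrier R \<Longrightarrow> root_coeff rs i \<in> carrier R"
  by (induction rs arbitrary: i) (auto split: nat.split)

lemma root_coeff_0: "set rs \<subseteq> carrier R \<Longrightarrow> root_coeff rs 0 = \<one>"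
  by (induction rs) (auto simp: minus_eq)

lemma root_coeff_ge: "set rs \<subseteq> carrier R \<Longrightarrow> i > length rs \<Longrightarrow> root_coeff rs i = \<zero>"
  by (induction rs arbitrary: i) (auto split: nat.split simp: minus_eq)

lemma root_coeff_scale:
  assumes "a \<in> carrier R" "set rs \<subseteq> carrier R"
  shows "root_coeff (map (\<lambda>r. a \<otimes> r) rs) i = a [^] i \<otimes> root_coeff rs i"
  using assms(2)
proof (induction rs arbitrary: i)
  case Nil
  then show ?case using assms(1) by auto
next
  case (Cons r rs)
  show ?case
  proof (cases i)
    case 0
    then show ?thesis using Cons assms(1) root_coeff_closed by (auto simp: minus_eq)
  next
    case (Suc j)
    have c: "a \<in> carrier R" "r \<in> carrier R" "root_coeff rs j \<in> carrier R" "root_coeff rs (Suc j) \<in> carrier R"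
      using Cons assms(1) root_coeff_closed by auto
    have "a [^] Suc j \<otimes> root_coeff rs (Suc j) \<ominus> (a \<otimes> r) \<otimes> (a [^] j \<otimes> root_coeff rs j) =
      a [^] Suc j \<otimes> (root_coeff rs (Suc j) \<ominus> r \<otimes> root_coeff rs j)"
      using c by (elim rep_cases) (simp add: rep_hom algebra_simps)
    then show ?thesis using Cons Suc by simp
  qed
qed

lemma root_coeff_swap:
  assumes "set xs \<subseteq> carrier R" "r \<in> carrier R" "set ys \<subseteq> carrier R"
  shows "root_coeff (xs @ r # ys) = root_coeff (r # xs @ ys)"
  using assms(1)
proof (induction xs)
  case Nil
  then show ?case by simp
next
  case (Cons s xs)
  let ?f = "root_coeff (xs @ ys)"
  have f: "?f i \<in> carrier R" for i using Cons assms by (intro root_coeff_closed) auto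
  have s: "s \<in> carrier R" using Cons by simp
  have IH: "root_coeff (xs @ r # ys) = root_coeff (r # xs @ ys)" using Cons by simp
  have "root_coeff (s # xs @ r # ys) i = root_coeff (r # s # xs @ ys) i" for i
  proof (cases i)
    case 0
    then show ?thesis using f[of 0] s assms(2) unfolding root_coeff.simps(2)[of s] IH
      by (simp add: minus_eq)
  next
    case (Suc j)
    show ?thesis
    proof (cases j)
      case 0
      have "?f (Suc 0) \<ominus> r \<otimes> ?f 0 \<ominus> s \<otimes> (?f 0 \<ominus> r \<otimes> \<zero>) = ?f (Suc 0) \<ominus> s \<otimes> ?f 0 \<ominus> r \<otimes> (?f 0 \<ominus> s \<otimes> \<zero>)"
        using f[of 0] f[of "Suc 0"] s assms(2) by (elim rep_cases) (simp add: rep_hom algebra_simps)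
      then show ?thesis unfolding root_coeff.simps(2)[of s "xs @ r # ys"] IH Suc 0 by simp
    next
      case (Suc k)
      have "?f (Suc j) \<ominus> r \<otimes> ?f j \<ominus> s \<otimes> (?f j \<ominus> r \<otimes> ?f k) = ?f (Suc j) \<ominus> s \<otimes> ?f j \<ominus> r \<otimes> (?f j \<ominus> s \<otimes> ?f k)"
        using f[of j] f[of "Suc j"] f[of k] s assms(2) by (elim rep_cases) (simp add: rep_hom algebra_simps)
      then show ?thesis unfolding root_coeff.simps(2)[of s "xs @ r # ys"] IH \<open>i = Suc j\<close> Suc by simp
    qed
  qed
  then show ?case by auto
qed

text \<open>The coefficients are symmetric in the roots; hence an automorphism that permutes the
  roots fixes every coefficient.\<close>

lemma root_coeff_mset:
  assumes "mset xs = mset ys" "set xs \<subseteq> carrier R"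
  shows "root_coeff xs = root_coeff ys"
  using assms
proof (induction xs arbitrary: ys)
  case (Cons x xs)
  have "x \<in> set ys" using Cons.prems(1) by (metis list.set_intros(1) mset_eq_setD)
  then obtain ys1 ys2 where ys: "ys = ys1 @ x # ys2" by (meson split_list)
  have "set ys \<subseteq> carrier R" using Cons.prems mset_eq_setD by metis
  then have "root_coeff ys = root_coeff (x # ys1 @ ys2)"
    unfolding ys using Cons.prems by (intro root_coeff_swap) auto
  moreover have "root_coeff xs = root_coeff (ys1 @ ys2)"
    using Cons.prems ys by (intro Cons.IH) auto
  ultimately show ?case by (simp only: root_coeff.simps)
qed simp

lemma root_coeff_hom:
  assumes h: "h \<in> ring_hom R R" and rs: "set rs \<subseteq> carrier R"
  shows "h (root_coeff rs i) = root_coeff (map h rs) i"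
proof -
  interpret h: ring_hom_cring R R h by (rule UnivPoly.ring_hom_cringI[OF is_cring is_cring h])
  have minus: "h (a \<ominus> b) = h a \<ominus> h b" if "a \<in> carrier R" "b \<in> carrier R" for a b
    using that by (simp add: minus_eq)
  show ?thesis using rs
    by (induction rs arbitrary: i) (auto split: nat.split simp: minus root_coeff_closed)
qed

lemma eval_root_coeff:
  assumes "set rs \<subseteq> carrier R" "t \<in> set rs"
  shows "eval (map (root_coeff rs) [0..<Suc (length rs)]) t = \<zero>"
proof -
  have t: "t \<in> carrier R" using assms by blast
  \<comment> \<open>\<open>H f n\<close> is the Horner value of the first \<open>n\<close>
    coefficients. The recursion of \<open>root_coeff\<close> carries over to these partial values
    (\<open>step\<close>), and at full length it says that a new root \<open>r\<close> contributes
    the factor \<open>t - r\<close>.\<close>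
  define H where "H = (\<lambda>f n. eval (map f [0..<n]) t)"
  have H_closed: "H f n \<in> carrier R" if "\<And>i. f i \<in> carrier R" for f n
    unfolding H_def by (rule eval_in_carrier) (use that t in auto)
  have H_Suc: "H f (Suc n) = H f n \<otimes> t \<oplus> f n" if "\<And>i. f i \<in> carrier R" for f n
    unfolding H_def by (simp add: eval_append_aux that t image_subset_iff)
  have step: "H (root_coeff (r # xs)) (Suc n) = H (root_coeff xs) (Suc n) \<ominus> r \<otimes> H (root_coeff xs) n"
    if c: "set xs \<subseteq> carrier R" "r \<in> carrier R" for r xs n
  proof (induction n)
    case 0
    show ?case using c root_coeff_closed[of xs 0] t root_coeff_closed[of "r # xs"]
      by (simp add: H_def minus_eq)
  next
    case (Suc n)
    have cl: "\<And>i. root_coeff (r # xs) i \<in> carrier R" "\<And>i. root_coeff xs i \<in> carrier R"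
      using root_coeff_closed[of "r # xs"] root_coeff_closed[of xs] c by auto
    have cc: "H (root_coeff xs) n \<in> carrier R" "H (root_coeff xs) (Suc n) \<in> carrier R"
      "root_coeff xs (Suc n) \<in> carrier R" "root_coeff xs n \<in> carrier R"
      using cl H_closed by blast+
    have "H (root_coeff (r # xs)) (Suc (Suc n)) =
      (H (root_coeff xs) (Suc n) \<ominus> r \<otimes> H (root_coeff xs) n) \<otimes> t \<oplus> (root_coeff xs (Suc n) \<ominus> r \<otimes> root_coeff xs n)"
      unfolding H_Suc[of "root_coeff (r # xs)" "Suc n", OF cl(1)] Suc by simp
    also have "\<dots> = (H (root_coeff xs) (Suc n) \<otimes> t \<oplus> root_coeff xs (Suc n)) \<ominus>
        r \<otimes> (H (root_coeff xs) n \<otimes> t \<oplus> root_coeff xs n)"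
      using cc c(2) t by (elim rep_cases) (simp add: rep_hom algebra_simps)
    also have "\<dots> = H (root_coeff xs) (Suc (Suc n)) \<ominus> r \<otimes> H (root_coeff xs) (Suc n)"
      unfolding H_Suc[of "root_coeff xs", OF cl(2)] ..
    finally show ?case .
  qed
  have "H (root_coeff rs) (Suc (length rs)) = \<zero>" using assms
  proof (induction rs)
    case (Cons r xs)
    have c: "set xs \<subseteq> carrier R" "r \<in> carrier R" using Cons by auto
    have cl: "\<And>i. root_coeff xs i \<in> carrier R" using root_coeff_closed c by auto
    let ?h = "H (root_coeff xs) (Suc (length xs))"
    have h: "?h \<in> carrier R" using H_closed cl by blast
    have "H (root_coeff (r # xs)) (Suc (length (r # xs))) =
      H (root_coeff xs) (Suc (Suc (length xs))) \<ominus> r \<otimes> ?h"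
      using step[OF c, of "Suc (length xs)"] by simp
    also have "H (root_coeff xs) (Suc (Suc (length xs))) = ?h \<otimes> t"
      unfolding H_Suc[of "root_coeff xs" "Suc (length xs)", OF cl]
      using root_coeff_ge[OF c(1)] h t by simp
    also have "?h \<otimes> t \<ominus> r \<otimes> ?h = \<zero>"
    proof (cases "t = r")
      case True
      then show ?thesis using h t by (simp add: m_comm)
    next
      case False
      then have "?h = \<zero>" using Cons by auto
      then show ?thesis using t c by (simp add: minus_eq)
    qed
    finally show ?case .
  qed simp
  then show ?thesis unfolding H_def .
qed

end

section \<open>Integral elements over a subring of a field\<close>

locale field_subring = field L for L (structure) +
  fixes B :: "'a set"
  assumes sub: "subring B L"
begin

abbreviation A where "A \<equiv> integral_closure L B"

lemma B_carr: "b \<in> B \<Longrightarrow> b \<in> carrier L" using subringE(1)[OF sub] by blast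

lemmas B_closed [simp] = subringE(2,3,5,6,7)[OF sub]

lemma B_pow [simp]: "b \<in> B \<Longrightarrow> b [^] (k::nat) \<in> B"
  by (induction k) auto

lemma set_B_carr: "set as \<subseteq> B \<Longrightarrow> set as \<subseteq> carrier L" using B_carr by blast

lemma integral_over_iff:
  assumes "x \<in> carrier L"
  shows "integral_over L B x \<longleftrightarrow> (\<exists>as. set as \<subseteq> B \<and> eval (\<one> # as) x = \<zero>)"
proof
  assume "integral_over L B x"
  then obtain f where f: "polynomial\<^bsub>L\<^esub> B f" "f \<noteq> []" "hd f = \<one>" "eval f x = \<zero>"
    unfolding integral_over_def by blast
  then have "f = \<one> # tl f" by (metis list.collapse)
  moreover have "set (tl f) \<subseteq> B" using f(1,2) unfolding polynomial_def by (meson list.set_sel(2) subset_iff)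
  ultimately show "\<exists>as. set as \<subseteq> B \<and> eval (\<one> # as) x = \<zero>" using f(4) by metis
next
  assume "\<exists>as. set as \<subseteq> B \<and> eval (\<one> # as) x = \<zero>"
  then show "integral_over L B x" unfolding integral_over_def polynomial_def
    by (metis B_closed(2) insert_subset list.discI list.sel(1) list.simps(15) one_not_zero)
qed

lemma carrier_A: "carrier A = {x \<in> carrier L. \<exists>as. set as \<subseteq> B \<and> eval (\<one> # as) x = \<zero>}"
  unfolding integral_closure_def using integral_over_iff by (simp cong: conj_cong del: eval.simps)

lemma A_carr: "x \<in> carrier A \<Longrightarrow> x \<in> carrier L" by (simp add: carrier_A)

lemma A_I: "x \<in> carrier L \<Longrightarrow> set as \<subseteq> B \<Longrightarrow> eval (\<one> # as) x = \<zero> \<Longrightarrow> x \<in> carrier A"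
  unfolding carrier_A by blast

lemma A_E:
  assumes "x \<in> carrier A" obtains as where "set as \<subseteq> B" "eval (\<one> # as) x = \<zero>"
  using assms unfolding carrier_A by blast

lemma B_sub_A: "b \<in> B \<Longrightarrow> b \<in> carrier A"
  by (rule A_I[of _ "[\<ominus> b]"]) (use B_carr in \<open>auto simp: r_neg\<close>)

lemma A_ops: "x \<oplus>\<^bsub>A\<^esub> y = x \<oplus> y" "x \<otimes>\<^bsub>A\<^esub> y = x \<otimes> y" "\<zero>\<^bsub>A\<^esub> = \<zero>" "\<one>\<^bsub>A\<^esub> = \<one>"
  by (simp_all add: integral_closure_def)

lemma A_pow: "x [^]\<^bsub>A\<^esub> (k::nat) = x [^] k"
  by (simp add: integral_closure_def nat_pow_def)

text \<open>Closure under sums and products is read off from \<open>cring A\<close>, which the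
  Cohen-Macaulay assumption supplies. Negatives agree with those of \<open>L\<close> because they
  are determined by addition.\<close>

lemma subring_A:
  assumes "cring A" shows "subring (carrier A) L"
proof -
  interpret A: cring A by (rule assms)
  show ?thesis
  proof (rule subringI)
    show "carrier A \<subseteq> carrier L" using A_carr by blast
    show "\<one> \<in> carrier A" using A.one_closed unfolding A_ops .
    fix x assume x: "x \<in> carrier A"
    have "\<ominus>\<^bsub>A\<^esub> x \<oplus> x = \<zero>" using A.l_neg[OF x] unfolding A_ops .
    then have "\<ominus> x = \<ominus>\<^bsub>A\<^esub> x" using x A_carr A.a_inv_closed by (metis minus_equality)
    then show "\<ominus> x \<in> carrier A" using x by simp
    fix y assume y: "y \<in> carrier A"
    show "x \<otimes> y \<in> carrier A" using A.m_closed[OF x y] unfolding A_ops .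
    show "x \<oplus> y \<in> carrier A" using A.a_closed[OF x y] unfolding A_ops .
  qed
qed

lemma integral_root:
  assumes "x \<in> carrier L" "x [^] (k::nat) \<in> carrier A" "k > 0"
  shows "x \<in> carrier A"
proof -
  obtain as where as: "set as \<subseteq> B" "eval (\<one> # as) (x [^] k) = \<zero>" using assms(2) by (rule A_E)
  \<comment> \<open>The lower coefficients of \<open>f(T^k)\<close>: every coefficient is preceded
    by \<open>k - 1\<close> zeros, while the leading \<open>\<one>\<close> is left in front of the
    list.\<close>
  define stretch where "stretch = (\<lambda>as. concat (map (\<lambda>a. replicate (k - 1) \<zero> @ [a]) as))"
  have len: "length (stretch bs) = k * length bs" for bs :: "'a list"
    unfolding stretch_def using assms(3) by (induction bs) auto
  have sub: "set (stretch bs) \<subseteq> B" if "set bs \<subseteq> B" for bs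
    using that unfolding stretch_def by (induction bs) (auto simp: set_replicate_conv_if)
  have ev: "eval (stretch bs) x = eval bs (x [^] k)" if "set bs \<subseteq> B" for bs
    using that
  proof (induction bs)
    case (Cons b bs)
    have "eval (stretch (b # bs)) x = eval (replicate (k - 1) \<zero> @ (b # stretch bs)) x"
      by (simp add: stretch_def)
    also have "\<dots> = eval (b # stretch bs) x"
      using Cons.prems sub[of bs] set_B_carr B_carr assms(1) by (intro eval_replicate) auto
    also have "\<dots> = eval (b # bs) (x [^] k)"
      using Cons assms(1) by (simp add: len nat_pow_pow)
    finally show ?case .
  qed (simp add: stretch_def)
  have "eval (\<one> # stretch as) x = \<zero>"
    using as ev[OF as(1)] assms(1) by (simp add: len nat_pow_pow)
  then show ?thesis by (intro A_I[OF assms(1) sub[OF as(1)]])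
qed

text \<open>If \<open>x\<close> lies outside \<open>V\<close>, then \<open>t = inv x\<close> lies in
  \<open>m\<close>. Multiplying the monic equation of degree \<open>n\<close> by \<open>t^n\<close>
  turns the leading term into 1 and all other terms into multiples of \<open>t\<close>, so that 1
  would lie in \<open>m\<close>.\<close>

lemma integral_in_valuation_ring:
  assumes V: "subring V L" "B \<subseteq> V" and m: "m \<subseteq> V" "\<one> \<notin> m" "\<zero> \<in> m"
    "\<And>a b. a \<in> m \<Longrightarrow> b \<in> m \<Longrightarrow> a \<oplus> b \<in> m" "\<And>a b. a \<in> V \<Longrightarrow> b \<in> m \<Longrightarrow> a \<otimes> b \<in> m"
    and val: "\<And>x. x \<in> carrier L \<Longrightarrow> x \<notin> V \<Longrightarrow> inv x \<in> m"
    and x: "x \<in> carrier A"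
  shows "x \<in> V"
proof (rule ccontr)
  assume nV: "x \<notin> V"
  have xL: "x \<in> carrier L" using x A_carr by blast
  have "x \<noteq> \<zero>" using nV subringE(2)[OF V(1)] by blast
  then have u: "x \<in> Units L" using xL by (simp add: field_Units)
  define t where "t = inv x"
  have t: "t \<in> m" "t \<in> carrier L" "x \<otimes> t = \<one>" unfolding t_def using val xL nV u by auto
  have tV: "t \<in> V" using t m by blast
  have tp: "t [^] (k::nat) \<in> V" for k
    by (induction k) (use tV subringE(3,6)[OF V(1)] in auto)
  have pt: "x [^] (k::nat) \<otimes> t [^] k = \<one>" for k
    using t xL nat_pow_distrib[of x t k] by simp
  have low: "t [^] length as \<otimes> eval as x \<in> m" if "set as \<subseteq> B" for as
    using that
  proof (induction as)
    case (Cons a as)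
    have c: "a \<in> carrier L" "eval as x \<in> carrier L" "t [^] length as \<in> carrier L" "x [^] length as \<in> carrier L"
      using Cons.prems B_carr set_B_carr xL t by (auto intro!: eval_in_carrier)
    have "t [^] length (a # as) \<otimes> eval (a # as) x =
      t \<otimes> (a \<otimes> (x [^] length as \<otimes> t [^] length as)) \<oplus> t \<otimes> (t [^] length as \<otimes> eval as x)"
      using c t by (simp add: r_distr m_ac)
    also have "\<dots> = a \<otimes> t \<oplus> t \<otimes> (t [^] length as \<otimes> eval as x)" unfolding pt using c t by (simp add: m_comm)
    finally show ?case using Cons V m t(1) tV by auto
  qed (use t m in simp)
  obtain as where as: "set as \<subseteq> B" "eval (\<one> # as) x = \<zero>" using x by (rule A_E)
  have c: "eval as x \<in> carrier L" using as set_B_carr xL by (auto intro!: eval_in_carrier)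
  have "\<zero> = t [^] length as \<otimes> eval (\<one> # as) x" using as t by simp
  also have "\<dots> = x [^] length as \<otimes> t [^] length as \<oplus> t [^] length as \<otimes> eval as x"
    using c t xL by (simp add: r_distr m_comm)
  finally have "\<one> = \<ominus> (t [^] length as \<otimes> eval as x)"
    unfolding pt using c t by (metis minus_equality m_closed nat_pow_closed one_closed minus_minus a_inv_closed)
  also have "\<dots> = (\<ominus> \<one>) \<otimes> (t [^] length as \<otimes> eval as x)" using c t by (simp add: l_minus)
  also have "\<dots> \<in> m" using low[OF as(1)] m(5) subringE(3,5)[OF V(1)] by blast
  finally show False using m(2) by blast
qed

text \<open>Integral elements are almost integral. Below the degree \<open>n\<close> of the
  equation, \<open>h^n\<close> clears the denominator of \<open>x^m\<close>; from \<open>n\<close>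
  on, the equation rewrites \<open>x^m\<close> by lower powers.\<close>

lemma integral_bounded_denominators:
  assumes x: "x \<in> carrier A" and h: "h \<in> B" "h \<otimes> x \<in> B"
  shows "\<exists>n::nat. \<forall>m::nat. h [^] n \<otimes> x [^] m \<in> B"
proof -
  have xL: "x \<in> carrier L" using x A_carr by blast
  obtain as where as: "set as \<subseteq> B" "eval (\<one> # as) x = \<zero>" using x by (rule A_E)
  define n where "n = length as"
  define d where "d = h [^] n"
  have d: "d \<in> B" "d \<in> carrier L" unfolding d_def using h B_carr by auto
  have lin: "d \<otimes> (x [^] e \<otimes> eval bs x) \<in> B"
    if "set bs \<subseteq> B" "\<And>j. j < e + length bs \<Longrightarrow> d \<otimes> x [^] j \<in> B" for bs e
    using that
  proof (induction bs)
    case Nil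
    then show ?case using d xL by simp
  next
    case (Cons b bs)
    have c: "b \<in> carrier L" "eval bs x \<in> carrier L" using Cons.prems B_carr set_B_carr xL by (auto intro!: eval_in_carrier)
    have "d \<otimes> (x [^] e \<otimes> eval (b # bs) x) =
      b \<otimes> (d \<otimes> (x [^] e \<otimes> x [^] length bs)) \<oplus> d \<otimes> (x [^] e \<otimes> eval bs x)"
      using c d xL by (simp add: r_distr m_ac)
    also have "x [^] e \<otimes> x [^] length bs = x [^] (e + length bs)" using xL by (simp add: nat_pow_mult)
    finally show ?case using Cons by simp
  qed
  have "d \<otimes> x [^] m \<in> B" for m :: nat
  proof (induction m rule: less_induct)
    case (less m)
    show ?case
    proof (cases "m < n")
      case True
      have hL: "h \<in> carrier L" using h B_carr by blast
      have "h [^] n = h [^] (n - m) \<otimes> h [^] m" using hL True by (simp add: nat_pow_mult)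
      then have "d \<otimes> x [^] m = h [^] (n - m) \<otimes> (h \<otimes> x) [^] m"
        unfolding d_def using hL xL by (simp add: nat_pow_distrib m_assoc)
      then show ?thesis using h by simp
    next
      case False
      have c: "eval as x \<in> carrier L" using as set_B_carr xL by (auto intro!: eval_in_carrier)
      have "x [^] n \<oplus> eval as x = \<zero>" using as xL unfolding n_def by simp
      then have xn: "x [^] n = \<ominus> eval as x" using c xL by (metis minus_equality a_comm minus_minus nat_pow_closed)
      have "x [^] m = x [^] (m - n) \<otimes> x [^] n" using xL False by (simp add: nat_pow_mult)
      then have "d \<otimes> x [^] m = \<ominus> (d \<otimes> (x [^] (m - n) \<otimes> eval as x))"
        unfolding xn using c xL d by (simp add: r_minus)
      moreover have "d \<otimes> (x [^] (m - n) \<otimes> eval as x) \<in> B"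
        using less False by (intro lin[OF as(1)]) (auto simp: n_def)
      ultimately show ?thesis by simp
    qed
  qed
  then show ?thesis unfolding d_def by blast
qed

end

text \<open>Ideals and primes of a subring expressed with the operations of the surrounding ring, so
  that base ring, integral closure and valuation ring can be compared inside one structure.
  Negatives come from multiplication by \<open>\<ominus> \<one>\<close>, an element of every
  subring.\<close>

definition (in ring) ideal_of :: "'a set \<Rightarrow> 'a set \<Rightarrow> bool" where
  "ideal_of V J \<longleftrightarrow> J \<subseteq> V \<and> \<zero> \<in> J \<and> (\<forall>a\<in>J. \<forall>b\<in>J. a \<oplus> b \<in> J) \<and> (\<forall>a\<in>V. \<forall>b\<in>J. a \<otimes> b \<in> J)"

definition (in ring) prime_of :: "'a set \<Rightarrow> 'a set \<Rightarrow> bool" where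
  "prime_of V J \<longleftrightarrow> ideal_of V J \<and> \<one> \<notin> J \<and> (\<forall>a\<in>V. \<forall>b\<in>V. a \<otimes> b \<in> J \<longrightarrow> a \<in> J \<or> b \<in> J)"

context domain
begin

lemma ideal_ofD:
  assumes "ideal_of V J"
  shows "J \<subseteq> V" "\<zero> \<in> J" "\<And>a b. a \<in> J \<Longrightarrow> b \<in> J \<Longrightarrow> a \<oplus> b \<in> J" "\<And>a b. a \<in> V \<Longrightarrow> b \<in> J \<Longrightarrow> a \<otimes> b \<in> J"
  using assms unfolding ideal_of_def by blast+

lemma prime_ofD:
  assumes "prime_of V J"
  shows "ideal_of V J" "\<one> \<notin> J" "\<And>a b. a \<in> V \<Longrightarrow> b \<in> V \<Longrightarrow> a \<otimes> b \<in> J \<Longrightarrow> a \<in> J \<or> b \<in> J"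
  using assms unfolding prime_of_def by blast+

lemma ideal_of_uminus:
  assumes V: "subring V R" and J: "ideal_of V J" and a: "a \<in> J"
  shows "\<ominus> a \<in> J"
proof -
  have "a \<in> carrier R" using ideal_ofD(1)[OF J] subringE(1)[OF V] a by blast
  then have "\<ominus> a = (\<ominus> \<one>) \<otimes> a" by (simp add: l_minus)
  then show ?thesis using ideal_ofD(4)[OF J _ a] subringE(3,5)[OF V] by metis
qed

lemma ideal_of_minus:
  assumes V: "subring V R" and J: "ideal_of V J" and "a \<in> J" "b \<in> J"
  shows "a \<ominus> b \<in> J"
  unfolding minus_eq using ideal_ofD(3)[OF J] ideal_of_uminus[OF V J] assms by blast

lemma prime_of_pow:
  assumes V: "subring V R" and J: "prime_of V J" and a: "a \<in> V" "a [^] (k::nat) \<in> J"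
  shows "a \<in> J"
  using a(2)
proof (induction k)
  case (Suc k)
  have "a [^] k \<in> V" by (induction k) (use subringE(3,6)[OF V] a in auto)
  then show ?case using Suc prime_ofD(3)[OF J, of "a [^] k" a] a by auto
qed (use prime_ofD[OF J] in simp)

lemma primeideal_if_prime_of:
  assumes V: "subring V R" and J: "prime_of V J"
  shows "primeideal J (R\<lparr>carrier := V\<rparr>)"
proof -
  let ?V = "R\<lparr>carrier := V\<rparr>"
  interpret V: domain ?V by (rule subring_is_domain[OF V])
  note JI = ideal_ofD[OF prime_ofD(1)[OF J]]
  have "ideal J ?V"
  proof (rule idealI)
    show "subgroup J (add_monoid ?V)"
    proof (rule V.add.subgroupI)
      show "J \<subseteq> carrier ?V" "J \<noteq> {}" using JI(1,2) by auto
      fix a assume a: "a \<in> J"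
      have aV: "a \<in> carrier ?V" "\<ominus> a \<in> carrier ?V" "a \<in> carrier R"
        using a JI(1) subringE(1,5)[OF V] by auto
      have "\<ominus> a \<oplus>\<^bsub>?V\<^esub> a = \<zero>\<^bsub>?V\<^esub>" using aV by (simp add: l_neg)
      then have "\<ominus>\<^bsub>?V\<^esub> a = \<ominus> a" using aV by (intro V.minus_equality) auto
      then show "\<ominus>\<^bsub>?V\<^esub> a \<in> J" using ideal_of_uminus[OF V prime_ofD(1)[OF J] a] by simp
    next
      fix a b assume "a \<in> J" "b \<in> J"
      then show "a \<oplus>\<^bsub>?V\<^esub> b \<in> J" using JI(3) by simp
    qed
    show "ring ?V" by (rule V.ring_axioms)
    fix a x assume "a \<in> J" "x \<in> carrier ?V"
    then show "x \<otimes>\<^bsub>?V\<^esub> a \<in> J" "a \<otimes>\<^bsub>?V\<^esub> x \<in> J"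
      using JI(1,4) V.m_comm[of a x] by auto
  qed
  then show ?thesis
  proof (rule primeidealI)
    show "cring ?V" by (rule V.is_cring)
    show "carrier ?V \<noteq> J" using prime_ofD(2)[OF J] subringE(3)[OF V] by auto
  qed (use prime_ofD(3)[OF J] in simp)
qed

lemma ideal_of_add_multiples:
  assumes V: "subring V R" and J: "ideal_of V J" and a: "a \<in> V"
  shows "ideal_of V {j \<oplus> a \<otimes> r | j r. j \<in> J \<and> r \<in> V}" (is "ideal_of V ?S")
  unfolding ideal_of_def
proof (intro conjI ballI)
  note VE = subringE[OF V] and JI = ideal_ofD[OF J]
  have VR: "x \<in> V \<Longrightarrow> x \<in> carrier R" for x using VE(1) by blast
  have JV: "x \<in> J \<Longrightarrow> x \<in> V" for x using JI(1) by blast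
  show "?S \<subseteq> V" using JV VE a by auto
  have "\<zero> = \<zero> \<oplus> a \<otimes> \<zero>" using a VR by simp
  then show "\<zero> \<in> ?S" using JI(2) VE(2) by blast
  fix x y assume "x \<in> ?S" "y \<in> ?S"
  then obtain j r j' r' where *: "x = j \<oplus> a \<otimes> r" "y = j' \<oplus> a \<otimes> r'" "j \<in> J" "j' \<in> J" "r \<in> V" "r' \<in> V" by blast
  have "x \<oplus> y = (j \<oplus> j') \<oplus> a \<otimes> (r \<oplus> r')" unfolding *(1,2)
    using VR[OF JV[OF *(3)]] VR[OF JV[OF *(4)]] VR[OF *(5)] VR[OF *(6)] VR[OF a]
    by (elim rep_cases) (simp add: rep_hom algebra_simps)
  then show "x \<oplus> y \<in> ?S" using JI(3) VE(7) * by blast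
next
  note VE = subringE[OF V] and JI = ideal_ofD[OF J]
  have VR: "x \<in> V \<Longrightarrow> x \<in> carrier R" for x using VE(1) by blast
  have JV: "x \<in> J \<Longrightarrow> x \<in> V" for x using JI(1) by blast
  fix x y assume x: "x \<in> V" "y \<in> ?S"
  then obtain j r where *: "y = j \<oplus> a \<otimes> r" "j \<in> J" "r \<in> V" by blast
  have "x \<otimes> y = x \<otimes> j \<oplus> a \<otimes> (x \<otimes> r)" unfolding *(1)
    using VR[OF JV[OF *(2)]] VR[OF *(3)] VR[OF a] VR[OF x(1)] by (simp add: r_distr m_lcomm)
  then show "x \<otimes> y \<in> ?S" using JI(4) VE(6) * x(1) by blast
qed

end

section \<open>Primes of the integral closure over primes of the base\<close>

context field_subring
begin

lemma prime_of_A_primeideal: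
  assumes "cring A" "prime_of (carrier A) J" shows "primeideal J A"
proof -
  have "A = L\<lparr>carrier := carrier A\<rparr>" by (simp add: integral_closure_def)
  then show ?thesis using primeideal_if_prime_of[OF subring_A[OF assms(1)] assms(2)] by simp
qed

text \<open>\<open>Q\<close> is taken maximal among the ideals that contain \<open>Q0\<close> and
  meet \<open>B\<close> inside \<open>q\<close>. Maximality makes \<open>Q\<close> prime, and
  integrality forces \<open>q\<close> into \<open>Q\<close>.\<close>

lemma going_up:
  assumes cr: "cring A" and Q0: "prime_of (carrier A) Q0" "Q0 \<inter> B \<subseteq> q" and q: "prime_of B q"
  shows "\<exists>Q. prime_of (carrier A) Q \<and> Q0 \<subseteq> Q \<and> Q \<inter> B = q"
proof -
  note sA = subring_A[OF cr] and AE = subringE[OF subring_A[OF cr]]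
  note qI = ideal_ofD[OF prime_ofD(1)[OF q]]
  define \<C> where "\<C> = {J. ideal_of (carrier A) J \<and> Q0 \<subseteq> J \<and> J \<inter> B \<subseteq> q}"
  have "Q0 \<in> \<C>" unfolding \<C>_def using Q0 prime_ofD(1) by auto
  have "\<exists>Q\<in>\<C>. \<forall>J\<in>\<C>. Q \<subseteq> J \<longrightarrow> J = Q"
  proof (rule subset_Zorn_nonempty)
    show "\<C> \<noteq> {}" using \<open>Q0 \<in> \<C>\<close> by blast
    fix C assume C: "C \<noteq> {}" "subset.chain \<C> C"
    have CC: "J \<in> \<C>" if "J \<in> C" for J using C(2) that unfolding subset.chain_def by blast
    have id: "ideal_of (carrier A) J" if "J \<in> C" for J using CC[OF that] unfolding \<C>_def by blast
    have "ideal_of (carrier A) (\<Union>C)" unfolding ideal_of_def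
    proof (intro conjI ballI)
      show "\<Union>C \<subseteq> carrier A" using ideal_ofD(1)[OF id] by blast
      show "\<zero> \<in> \<Union>C" using C(1) ideal_ofD(2)[OF id] by blast
      fix a b assume "a \<in> \<Union>C" "b \<in> \<Union>C"
      then obtain J J' where JJ: "J \<in> C" "J' \<in> C" "a \<in> J" "b \<in> J'" by blast
      then have "J \<subseteq> J' \<or> J' \<subseteq> J" using C(2) unfolding subset.chain_def by blast
      then show "a \<oplus> b \<in> \<Union>C" using JJ ideal_ofD(3)[OF id] by blast
    next
      fix a b assume "a \<in> carrier A" "b \<in> \<Union>C"
      then show "a \<otimes> b \<in> \<Union>C" using ideal_ofD(4)[OF id] by blast
    qed
    moreover have "Q0 \<subseteq> \<Union>C" using C(1) CC unfolding \<C>_def by blast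
    moreover have "\<Union>C \<inter> B \<subseteq> q" using CC unfolding \<C>_def by blast
    ultimately show "\<Union>C \<in> \<C>" unfolding \<C>_def by blast
  qed
  then obtain Q where Q: "Q \<in> \<C>" and max: "\<And>J. J \<in> \<C> \<Longrightarrow> Q \<subseteq> J \<Longrightarrow> J = Q" by blast
  have Qi: "ideal_of (carrier A) Q" "Q0 \<subseteq> Q" "Q \<inter> B \<subseteq> q" using Q unfolding \<C>_def by auto
  note QI = ideal_ofD[OF Qi(1)]
  have QA: "x \<in> Q \<Longrightarrow> x \<in> carrier A" for x using QI(1) by blast
  have BA: "x \<in> B \<Longrightarrow> x \<in> carrier A" for x by (rule B_sub_A)
  \<comment> \<open>By maximality, adding the multiples of \<open>a\<close> to \<open>Q\<close>
    produces an ideal that meets \<open>B\<close> outside \<open>q\<close>.\<close>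
  have enlarge: "\<exists>j r. j \<in> Q \<and> r \<in> carrier A \<and> j \<oplus> a \<otimes> r \<in> B - q" if a: "a \<in> carrier A" "a \<notin> Q" for a
  proof (rule ccontr)
    let ?J = "{j \<oplus> a \<otimes> r | j r. j \<in> Q \<and> r \<in> carrier A}"
    assume "\<not> ?thesis"
    then have "?J \<inter> B \<subseteq> q" by blast
    moreover have QJ: "Q \<subseteq> ?J"
    proof
      fix x assume x: "x \<in> Q"
      then have "x = x \<oplus> a \<otimes> \<zero>" using QA A_carr a by simp
      then show "x \<in> ?J" using x AE(2) by blast
    qed
    moreover have "ideal_of (carrier A) ?J" by (rule ideal_of_add_multiples[OF sA Qi(1) a(1)])
    ultimately have "?J \<in> \<C>" unfolding \<C>_def using Qi(2) by blast
    then have "?J = Q" using max QJ by blast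
    moreover have "a = \<zero> \<oplus> a \<otimes> \<one>" using A_carr[OF a(1)] by simp
    then have "a \<in> ?J" using QI(2) AE(3) by blast
    ultimately show False using a(2) by blast
  qed
  have "prime_of (carrier A) Q" unfolding prime_of_def
  proof (intro conjI ballI impI)
    show "ideal_of (carrier A) Q" by fact
    show "\<one> \<notin> Q" using Qi(3) prime_ofD(2)[OF q] by auto
    fix a b assume ab: "a \<in> carrier A" "b \<in> carrier A" "a \<otimes> b \<in> Q"
    show "a \<in> Q \<or> b \<in> Q"
    proof (rule ccontr)
      assume "\<not> (a \<in> Q \<or> b \<in> Q)"
      then obtain j r j' r' where *: "j \<in> Q" "r \<in> carrier A" "j \<oplus> a \<otimes> r \<in> B - q"
        "j' \<in> Q" "r' \<in> carrier A" "j' \<oplus> b \<otimes> r' \<in> B - q"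
        using enlarge ab by meson
      have c: "a \<in> carrier L" "b \<in> carrier L" "j \<in> carrier L" "j' \<in> carrier L" "r \<in> carrier L" "r' \<in> carrier L"
        using * ab QA A_carr by auto
      have "(j \<oplus> a \<otimes> r) \<otimes> (j' \<oplus> b \<otimes> r') = (j' \<oplus> b \<otimes> r') \<otimes> j \<oplus> (a \<otimes> r \<otimes> j' \<oplus> r \<otimes> r' \<otimes> (a \<otimes> b))"
        using c by (elim rep_cases) (simp add: rep_hom algebra_simps)
      also have "\<dots> \<in> Q"
        using * ab AE(6) BA by (intro QI(3) QI(4)[OF _ ab(3)] QI(4)[OF _ *(1)] QI(4)[OF _ *(4)]) auto
      finally have "(j \<oplus> a \<otimes> r) \<otimes> (j' \<oplus> b \<otimes> r') \<in> q" using Qi(3) * by auto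
      then show False using prime_ofD(3)[OF q] * by blast
    qed
  qed
  moreover have "r \<in> Q" if r: "r \<in> q" for r
  proof (rule ccontr)
    assume "r \<notin> Q"
    have rB: "r \<in> B" using r qI(1) by blast
    then obtain j a where *: "j \<in> Q" "a \<in> carrier A" "j \<oplus> r \<otimes> a \<in> B - q"
      using enlarge[OF BA[OF rB] \<open>r \<notin> Q\<close>] by blast
    define s where "s = j \<oplus> r \<otimes> a"
    have s: "s \<in> B" "s \<notin> q" using * unfolding s_def by auto
    have c: "r \<in> carrier L" "j \<in> carrier L" "a \<in> carrier L" "s \<in> carrier L"
      using rB s B_carr QA A_carr * by auto
    obtain as where as: "set as \<subseteq> B" "eval (\<one> # as) a = \<zero>" using *(2) by (rule A_E)
    \<comment> \<open>Modulo \<open>Q\<close> the element \<open>s\<close> equals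
      \<open>r \<otimes> a\<close>. So \<open>r^n\<close> times the monic polynomial at
      \<open>a\<close> is its homogenization at \<open>(s, r)\<close>, that is \<open>s^n\<close>
      plus a multiple of \<open>r\<close> with cofactor in \<open>B\<close>. As the polynomial
      vanishes at \<open>a\<close>, a power of \<open>s\<close> lands in \<open>q\<close>.\<close>
    have "\<exists>e\<in>B. (s [^] length as \<oplus> r \<otimes> e) \<ominus> r [^] length as \<otimes> eval (\<one> # as) a \<in> Q"
      using as(1)
    proof (induction as rule: rev_induct)
      case Nil
      have "s [^] length [] \<oplus> r \<otimes> \<zero> \<ominus> r [^] length [] \<otimes> eval [\<one>] a = \<zero>"
        using c by (simp add: minus_eq r_neg)
      then show ?case using QI(2) B_closed(1) by metis
    next
      case (snoc b bs)
      define E where "E = eval (\<one> # bs) a"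
      have bB: "b \<in> B" "set bs \<subseteq> B" using snoc.prems by auto
      have E: "E \<in> carrier L" unfolding E_def using set_B_carr[OF bB(2)] c by (intro eval_in_carrier) auto
      have bL: "b \<in> carrier L" using bB B_carr by blast
      let ?l = "length bs"
      obtain e where e: "e \<in> B" "(s [^] ?l \<oplus> r \<otimes> e) \<ominus> r [^] ?l \<otimes> E \<in> Q"
        using snoc.IH[OF bB(2)] unfolding E_def by blast
      have eL: "e \<in> carrier L" using e B_carr by blast
      have EA: "s [^] ?l \<oplus> r \<otimes> e \<in> carrier A" using s(1) rB e(1) BA by simp
      have "eval (\<one> # bs @ [b]) a = E \<otimes> a \<oplus> b"
        unfolding E_def using eval_append_aux[of "\<one> # bs" b a] set_B_carr[OF bB(2)] bL c by simp
      then have "(s [^] Suc ?l \<oplus> r \<otimes> (s \<otimes> e \<oplus> r [^] ?l \<otimes> b)) \<ominus> r [^] Suc ?l \<otimes> eval (\<one> # bs @ [b]) a =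
        (s [^] ?l \<oplus> r \<otimes> e) \<otimes> j \<oplus> (r \<otimes> a) \<otimes> ((s [^] ?l \<oplus> r \<otimes> e) \<ominus> r [^] ?l \<otimes> E)"
      proof -
        have "r [^] Suc ?l \<otimes> (E \<otimes> a \<oplus> b) = (r \<otimes> a) \<otimes> (r [^] ?l \<otimes> E) \<oplus> r \<otimes> (r [^] ?l \<otimes> b)"
          using c E bL by (elim rep_cases) (simp add: rep_hom algebra_simps)
        moreover have "s [^] Suc ?l \<oplus> r \<otimes> (s \<otimes> e \<oplus> r [^] ?l \<otimes> b) = (j \<oplus> r \<otimes> a) \<otimes> (s [^] ?l \<oplus> r \<otimes> e) \<oplus> r \<otimes> (r [^] ?l \<otimes> b)"
          unfolding s_def[symmetric] using c E bL eL by (elim rep_cases) (simp add: rep_hom algebra_simps)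
        ultimately show ?thesis unfolding \<open>eval (\<one> # bs @ [b]) a = E \<otimes> a \<oplus> b\<close>
          using c E bL eL by (elim rep_cases) (simp add: rep_hom algebra_simps)
      qed
      also have "\<dots> \<in> Q"
        using EA *(2) BA[OF rB] AE(6) by (intro QI(3) QI(4)[OF _ e(2)] QI(4)[OF _ *(1)]) auto
      finally have "(s [^] Suc ?l \<oplus> r \<otimes> (s \<otimes> e \<oplus> r [^] ?l \<otimes> b)) \<ominus> r [^] Suc ?l \<otimes> eval (\<one> # bs @ [b]) a \<in> Q" .
      then show ?case using e(1) s(1) rB bB by (intro bexI[of _ "s \<otimes> e \<oplus> r [^] ?l \<otimes> b"]) auto
    qed
    then obtain e where e: "e \<in> B" "s [^] length as \<oplus> r \<otimes> e \<in> Q"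
      unfolding as(2) using c B_carr by (auto simp: minus_eq)
    then have "s [^] length as \<oplus> r \<otimes> e \<in> q" using Qi(3) s(1) rB by auto
    moreover have "r \<otimes> e \<in> q" using qI(4)[OF e(1) r] e(1) B_carr c(1) by (simp add: m_comm)
    ultimately have "(s [^] length as \<oplus> r \<otimes> e) \<ominus> r \<otimes> e \<in> q"
      using ideal_of_minus[OF sub prime_ofD(1)[OF q]] by blast
    moreover have "(s [^] length as \<oplus> r \<otimes> e) \<ominus> r \<otimes> e = s [^] length as"
      using c B_carr[OF e(1)] by (elim rep_cases) (simp add: rep_hom algebra_simps)
    ultimately show False using prime_of_pow[OF sub q s(1)] s(2) by simp
  qed
  ultimately show ?thesis using Qi qI(1) by blast
qed

text \<open>Cut the monic equation of \<open>x\<close> after its last coefficient outside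
  \<open>q\<close>. The value \<open>t\<close> of this part is congruent to that coefficient modulo
  \<open>x\<close>, hence lies outside \<open>P\<close>, and the remaining coefficients lie in
  \<open>q\<close>; so \<open>x^k t\<close> lies in \<open>I\<close>. In the localization at
  \<open>P\<close>, this makes every element of \<open>P\<close> nilpotent modulo
  \<open>q\<close>.\<close>

lemma integral_nilpotent_mod:
  assumes cr: "cring A" and P: "prime_of (carrier A) P" "P \<inter> B \<subseteq> q"
    and I: "ideal_of (carrier A) I" "q \<subseteq> I" and x: "x \<in> P"
  shows "\<exists>k. \<exists>t\<in>carrier A - P. x [^] (k::nat) \<otimes> t \<in> I"
proof -
  note sA = subring_A[OF cr] and AE = subringE[OF subring_A[OF cr]]
  note II = ideal_ofD[OF I(1)] and PI = ideal_ofD[OF prime_ofD(1)[OF P(1)]]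
  have xA: "x \<in> carrier A" "x \<in> carrier L" using x PI(1) A_carr by auto
  have pA: "x [^] (k::nat) \<in> carrier A" for k by (induction k) (use xA AE in auto)
  have main: "\<exists>k. \<exists>t\<in>carrier A - P. \<exists>e\<in>I. eval (\<one> # as) x = x [^] (k::nat) \<otimes> t \<oplus> e" if "set as \<subseteq> B" for as
    using that
  proof (induction as rule: rev_induct)
    case Nil
    have "eval [\<one>] x = x [^] (0::nat) \<otimes> \<one> \<oplus> \<zero>" by simp
    then show ?case using prime_ofD(2)[OF P(1)] AE(3) II(2) by blast
  next
    case (snoc r bs)
    have rB: "r \<in> B" "set bs \<subseteq> B" using snoc.prems by auto
    then have rA: "r \<in> carrier A" "r \<in> carrier L" using B_sub_A A_carr by auto
    obtain k :: nat and t e where IH: "t \<in> carrier A - P" "e \<in> I" "eval (\<one> # bs) x = x [^] k \<otimes> t \<oplus> e"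
      using snoc.IH[OF rB(2)] by blast
    have c: "t \<in> carrier L" "e \<in> carrier L" using IH II(1) A_carr by auto
    have ev: "eval (\<one> # bs @ [r]) x = (x [^] k \<otimes> t \<oplus> e) \<otimes> x \<oplus> r"
      unfolding IH(3)[symmetric] using eval_append_aux[of "\<one> # bs" r x] set_B_carr[OF rB(2)] rA xA by simp
    show ?case
    proof (cases "r \<in> q")
      case True
      have "eval (\<one> # bs @ [r]) x = x [^] Suc k \<otimes> t \<oplus> (x \<otimes> e \<oplus> r)"
        unfolding ev using c rA xA by (elim rep_cases) (simp add: rep_hom algebra_simps)
      moreover have "x \<otimes> e \<oplus> r \<in> I" using II(3,4) IH(2) xA True I(2) by blast
      ultimately show ?thesis using IH(1) by blast
    next
      case False
      have 1: "x [^] k \<otimes> t \<oplus> e \<in> carrier A" using pA IH II(1) AE(6,7) by blast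
      then have yA: "(x [^] k \<otimes> t \<oplus> e) \<otimes> x \<oplus> r \<in> carrier A" using xA rA AE(6,7) by blast
      have "(x [^] k \<otimes> t \<oplus> e) \<otimes> x \<oplus> r \<notin> P"
      proof
        assume a: "(x [^] k \<otimes> t \<oplus> e) \<otimes> x \<oplus> r \<in> P"
        have "(x [^] k \<otimes> t \<oplus> e) \<otimes> x \<in> P" using PI(4)[OF 1 x] .
        with a have "((x [^] k \<otimes> t \<oplus> e) \<otimes> x \<oplus> r) \<ominus> (x [^] k \<otimes> t \<oplus> e) \<otimes> x \<in> P"
          by (rule ideal_of_minus[OF sA prime_ofD(1)[OF P(1)]])
        also have "((x [^] k \<otimes> t \<oplus> e) \<otimes> x \<oplus> r) \<ominus> (x [^] k \<otimes> t \<oplus> e) \<otimes> x = r"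
          using c rA xA by (elim rep_cases) (simp add: rep_hom algebra_simps)
        finally show False using P(2) False rB by blast
      qed
      moreover have "eval (\<one> # bs @ [r]) x = x [^] (0::nat) \<otimes> ((x [^] k \<otimes> t \<oplus> e) \<otimes> x \<oplus> r) \<oplus> \<zero>"
        unfolding ev using c rA xA by simp
      ultimately show ?thesis using yA II(2) by blast
    qed
  qed
  obtain as where as: "set as \<subseteq> B" "eval (\<one> # as) x = \<zero>" using xA(1) by (rule A_E)
  obtain k :: nat and t e where *: "t \<in> carrier A - P" "e \<in> I" "\<zero> = x [^] k \<otimes> t \<oplus> e"
    using main[OF as(1)] as(2) by auto
  have c: "t \<in> carrier L" "e \<in> carrier L" using * II(1) A_carr by auto
  have "x [^] k \<otimes> t = \<ominus> e" using *(3) c xA by (metis minus_equality m_closed nat_pow_closed)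
  also have "\<dots> \<in> I" by (rule ideal_of_uminus[OF sA I(1) *(2)])
  finally show ?thesis using *(1) by blast
qed

end

section \<open>A criterion for the failure of depth three\<close>

text \<open>The data that the argument uses, free of coordinates. \<open>V\<close> and
  \<open>m\<close> are the valuation ring and the ideal of the \<open>c\<close>-adic place, whose
  centre on \<open>B\<close> is \<open>q 3 = (c, y, z)\<close>; \<open>\<sigma>\<close> is an
  indexed family that composition permutes; \<open>inv_A\<close> is normality of \<open>B\<close>
  combined with Galois theory; \<open>inv_coprime\<close> is the coprimality of \<open>c\<close> and
  \<open>y\<close>; and \<open>pth\<close> says that the residue of \<open>u\<close> is not a
  \<open>p\<close>-th power. Membership of \<open>\<gamma>\<close> and \<open>\<delta>\<close> in
  \<open>A\<close> depends on sums and products of integral elements, hence the premise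
  \<open>cring A\<close>.\<close>

locale wild_cover = field_subring L B for L (structure) and B +
  fixes p :: nat and V m :: "'a set" and I :: "'i set" and \<sigma> :: "'i \<Rightarrow> 'a \<Rightarrow> 'a"
    and c y z u \<alpha> \<beta> \<gamma> \<delta> :: 'a and q :: "nat \<Rightarrow> 'a set"
  assumes p: "Factorial_Ring.prime p" and char: "add_pow L (int p) \<one> = \<zero>"
    and V: "subring V L" "B \<subseteq> V" and m: "prime_of V m"
    and val: "\<And>x. x \<in> carrier L \<Longrightarrow> x \<notin> V \<Longrightarrow> inv x \<in> m"
    and I: "finite I" and \<sigma>_id: "\<exists>i\<in>I. \<forall>x\<in>carrier L. \<sigma> i x = x"
    and \<sigma>_hom: "\<And>i. i \<in> I \<Longrightarrow> \<sigma> i \<in> ring_hom L L"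
    and \<sigma>_B: "\<And>i b. i \<in> I \<Longrightarrow> b \<in> B \<Longrightarrow> \<sigma> i b = b"
    and \<sigma>_V: "\<And>i x. i \<in> I \<Longrightarrow> x \<in> V \<Longrightarrow> \<sigma> i x \<in> V"
    and \<sigma>_m: "\<And>i x. i \<in> I \<Longrightarrow> x \<in> V \<Longrightarrow> \<sigma> i x \<in> m \<Longrightarrow> x \<in> m"
    and \<sigma>_comp: "\<And>j. j \<in> I \<Longrightarrow> \<exists>\<pi>. bij_betw \<pi> I I \<and> (\<forall>i\<in>I. \<forall>x\<in>carrier L. \<sigma> j (\<sigma> i x) = \<sigma> (\<pi> i) x)"
    and inv_A: "\<And>x. x \<in> carrier A \<Longrightarrow> (\<And>i. i \<in> I \<Longrightarrow> \<sigma> i x = x) \<Longrightarrow> x \<in> B"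
    and inv_coprime: "\<And>x k. x \<in> carrier L \<Longrightarrow> (\<And>i. i \<in> I \<Longrightarrow> \<sigma> i x = x) \<Longrightarrow>
      c [^] (k::nat) \<otimes> x \<in> B \<Longrightarrow> y [^] k \<otimes> x \<in> B \<Longrightarrow> x \<in> B"
    and q: "\<And>i. i \<le> 3 \<Longrightarrow> prime_of B (q i)" "\<And>i. i < 3 \<Longrightarrow> q i \<subset> q (Suc i)" "q 0 = {\<zero>}"
    and q3: "\<And>x. x \<in> q 3 \<Longrightarrow> \<exists>r1\<in>B. \<exists>r2\<in>B. \<exists>r3\<in>B. x = c \<otimes> r1 \<oplus> y \<otimes> r2 \<oplus> z \<otimes> r3"
    and c_q3: "c \<in> q 3" and m_B: "\<And>b. b \<in> B \<Longrightarrow> b \<in> m \<longleftrightarrow> b \<in> q 3"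
    and cyzu: "c \<in> B" "y \<in> B" "z \<in> B" "u \<in> B" "c \<noteq> \<zero>" "y \<noteq> \<zero>"
    and \<alpha>\<beta>\<gamma>: "cring A \<Longrightarrow> \<alpha> \<in> carrier A" "cring A \<Longrightarrow> \<beta> \<in> carrier A"
      "cring A \<Longrightarrow> \<gamma> \<in> carrier A" "cring A \<Longrightarrow> \<delta> \<in> carrier A"
    and rel: "z \<otimes> \<alpha> = y \<otimes> \<beta> \<oplus> c \<otimes> \<gamma>" and \<alpha>_pow: "\<alpha> [^] p = y [^] p \<otimes> u \<oplus> c [^] p \<otimes> \<delta>"
    and pth: "\<And>s b. s \<in> V \<Longrightarrow> b \<in> V \<Longrightarrow> s [^] p \<otimes> u \<ominus> b [^] p \<in> m \<Longrightarrow> s \<in> m"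
begin

lemma A_sub_V: "x \<in> carrier A \<Longrightarrow> x \<in> V"
  using ideal_ofD[OF prime_ofD(1)[OF m]] prime_ofD(2)[OF m]
  by (intro integral_in_valuation_ring[OF V _ _ _ _ _ val]) auto

lemma \<sigma>_closed: "i \<in> I \<Longrightarrow> x \<in> carrier L \<Longrightarrow> \<sigma> i x \<in> carrier L"
  using ring_hom_closed[OF \<sigma>_hom] .

lemma \<sigma>_A: "i \<in> I \<Longrightarrow> x \<in> carrier A \<Longrightarrow> \<sigma> i x \<in> carrier A"
proof -
  assume i: "i \<in> I" and x: "x \<in> carrier A"
  interpret h: ring_hom_ring L L "\<sigma> i"
    by (rule ring_hom_ringI2[OF ring_axioms ring_axioms \<sigma>_hom[OF i]])
  obtain as where as: "set as \<subseteq> B" "eval (\<one> # as) x = \<zero>" using x by (rule A_E)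
  have "eval (map (\<sigma> i) (\<one> # as)) (\<sigma> i x) = \<sigma> i (eval (\<one> # as) x)"
    using set_B_carr[OF as(1)] A_carr[OF x] by (intro h.eval_hom'[symmetric]) auto
  moreover have "map (\<sigma> i) (\<one> # as) = \<one> # as"
    using as(1) \<sigma>_B[OF i] by (auto intro!: map_idI)
  ultimately have "eval (\<one> # as) (\<sigma> i x) = \<zero>" unfolding as(2) by simp
  then show ?thesis using as(1) \<sigma>_closed[OF i A_carr[OF x]] by (intro A_I)
qed

text \<open>A list, so that \<open>root_coeff\<close> applies and conjugates count with
  multiplicity. The enumeration of \<open>I\<close> does not depend on \<open>x\<close>, which makes
  scaling of \<open>x\<close> act entrywise.\<close>

definition conj_list :: "'a \<Rightarrow> 'a list" where
  "conj_list x = map (\<lambda>i. \<sigma> i x) (SOME js. set js = I \<and> distinct js)"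

lemma conj_list_props:
  shows "set (conj_list x) = (\<lambda>i. \<sigma> i x) ` I"
    and "j \<in> I \<Longrightarrow> x \<in> carrier L \<Longrightarrow> mset (map (\<sigma> j) (conj_list x)) = mset (conj_list x)"
    and "a \<in> B \<Longrightarrow> x \<in> carrier L \<Longrightarrow> conj_list (a \<otimes> x) = map (\<lambda>r. a \<otimes> r) (conj_list x)"
proof -
  define js where "js = (SOME js. set js = I \<and> distinct js)"
  have "set js = I \<and> distinct js"
    unfolding js_def by (rule someI_ex) (rule finite_distinct_list[OF I])
  then have js: "set js = I" "distinct js" by auto
  have cl: "conj_list x = map (\<lambda>i. \<sigma> i x) js" for x unfolding conj_list_def js_def ..
  show "set (conj_list x) = (\<lambda>i. \<sigma> i x) ` I" unfolding cl using js by simp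
  show "mset (map (\<sigma> j) (conj_list x)) = mset (conj_list x)" if j: "j \<in> I" and x: "x \<in> carrier L"
  proof -
    obtain \<pi> where \<pi>: "bij_betw \<pi> I I" "\<And>i. i \<in> I \<Longrightarrow> \<sigma> j (\<sigma> i x) = \<sigma> (\<pi> i) x"
      using \<sigma>_comp[OF j] x by blast
    have "map (\<sigma> j) (conj_list x) = map (\<lambda>i. \<sigma> i x) (map \<pi> js)"
      unfolding cl using \<pi>(2) js(1) by auto
    moreover have "mset (map \<pi> js) = mset js"
    proof (rule set_eq_iff_mset_eq_distinct[THEN iffD1])
      show "distinct (map \<pi> js)" using \<pi>(1) js by (simp add: distinct_map bij_betw_def)
      show "set (map \<pi> js) = set js" using \<pi>(1) js by (simp add: bij_betw_def)
    qed (rule js)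
    ultimately show ?thesis unfolding cl by (metis mset_map)
  qed
  show "conj_list (a \<otimes> x) = map (\<lambda>r. a \<otimes> r) (conj_list x)" if a: "a \<in> B" and x: "x \<in> carrier L"
    unfolding cl using js(1) a x B_carr \<sigma>_B ring_hom_mult[OF \<sigma>_hom] by auto
qed

lemma conj_list_closed: "x \<in> carrier L \<Longrightarrow> set (conj_list x) \<subseteq> carrier L"
  unfolding conj_list_props(1) using \<sigma>_closed by blast

lemma conj_list_self: "x \<in> carrier L \<Longrightarrow> x \<in> set (conj_list x)"
  unfolding conj_list_props(1) using \<sigma>_id by force

lemma \<sigma>_root_coeff:
  assumes "i \<in> I" "x \<in> carrier L"
  shows "\<sigma> i (root_coeff (conj_list x) k) = root_coeff (conj_list x) k"
proof -
  have "\<sigma> i (root_coeff (conj_list x) k) = root_coeff (map (\<sigma> i) (conj_list x)) k"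
    by (rule root_coeff_hom[OF \<sigma>_hom[OF assms(1)] conj_list_closed[OF assms(2)]])
  also have "root_coeff (map (\<sigma> i) (conj_list x)) = root_coeff (conj_list x)"
    using conj_list_props(2)[OF assms] conj_list_closed[OF assms(2)] \<sigma>_closed[OF assms(1)]
    by (intro root_coeff_mset) auto
  finally show ?thesis by simp
qed

context
  assumes cr: "cring A"
begin

lemma root_coeff_A: "set rs \<subseteq> carrier A \<Longrightarrow> root_coeff rs k \<in> carrier A"
  using subringE(2,3,5,6,7)[OF subring_A[OF cr]]
  by (induction rs arbitrary: k) (auto split: nat.split simp: minus_eq)

text \<open>The coefficients are integral as polynomials in integral conjugates, and invariant as
  symmetric functions; invariant integral elements lie in \<open>B\<close>.\<close>

lemma conj_coeff_B:
  assumes x: "x \<in> carrier A" shows "root_coeff (conj_list x) k \<in> B"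
proof (rule inv_A)
  show "root_coeff (conj_list x) k \<in> carrier A"
    by (rule root_coeff_A) (use \<sigma>_A[OF _ x] in \<open>auto simp: conj_list_props(1)\<close>)
qed (rule \<sigma>_root_coeff[OF _ A_carr[OF x]])

text \<open>The depth of \<open>A\<close> along \<open>(c, y)\<close> is at least two.\<close>

lemma A_mem_if_coprime_multiples:
  assumes x: "x \<in> carrier L" and cx: "c [^] (k::nat) \<otimes> x \<in> carrier A" "y [^] k \<otimes> x \<in> carrier A"
  shows "x \<in> carrier A"
proof -
  let ?e = "root_coeff (conj_list x)"
  \<comment> \<open>The \<open>j\<close>-th coefficient is homogeneous of degree \<open>j\<close> in
    the conjugates, so scaling \<open>x\<close> by \<open>a^k\<close> multiplies it by
    \<open>a^(jk)\<close>. Taking \<open>a = c\<close> and \<open>a = y\<close> gives the two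
    multiples that \<open>inv_coprime\<close> compares.\<close>
  have scale: "(a [^] (j * k)) \<otimes> ?e j \<in> B" if a: "a \<in> B" and ax: "a [^] k \<otimes> x \<in> carrier A" for a j
  proof -
    have "conj_list (a [^] k \<otimes> x) = map (\<lambda>r. a [^] k \<otimes> r) (conj_list x)"
      using a x by (intro conj_list_props(3)) auto
    then have "root_coeff (conj_list (a [^] k \<otimes> x)) j = (a [^] k) [^] j \<otimes> ?e j"
      using a x B_carr conj_list_closed root_coeff_scale by simp
    then show ?thesis using conj_coeff_B[OF ax, of j] a B_carr by (simp add: nat_pow_pow mult.commute)
  qed
  have eB: "?e j \<in> B" for j
    by (rule inv_coprime[OF _ _ scale[OF cyzu(1) cx(1)] scale[OF cyzu(2) cx(2)]])
      (use x conj_list_closed root_coeff_closed \<sigma>_root_coeff in auto)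
  have "[0..<Suc n] = 0 # [1..<Suc n]" for n by (simp add: upt_conv_Cons)
  then have "map ?e [0..<Suc (length (conj_list x))] = \<one> # map ?e [1..<Suc (length (conj_list x))]"
    using root_coeff_0[OF conj_list_closed[OF x]] by simp
  then have "eval (\<one> # map ?e [1..<Suc (length (conj_list x))]) x = \<zero>"
    using eval_root_coeff[OF conj_list_closed[OF x] conj_list_self[OF x]] by metis
  then show ?thesis using eB by (intro A_I[OF x, of "map ?e [1..<Suc (length (conj_list x))]"]) auto
qed

text \<open>The centre of the place on \<open>A\<close>.\<close>

definition P0 :: "'a set" where "P0 = carrier A \<inter> m"

lemma prime_P0: "prime_of (carrier A) P0"
proof -
  note sA = subringE[OF subring_A[OF cr]]
  note mI = ideal_ofD[OF prime_ofD(1)[OF m]] and mP = prime_ofD(2,3)[OF m]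
  show ?thesis unfolding prime_of_def ideal_of_def P0_def
    using sA(2,6,7) mI(2-4) mP A_sub_V by auto
qed

lemma P0_B: "P0 \<inter> B = q 3"
  unfolding P0_def using m_B B_sub_A q(1)[of 3] unfolding prime_of_def ideal_of_def by auto

lemma root_coeff_Cons_last:
  assumes "set (r # rs) \<subseteq> carrier L"
  shows "root_coeff (r # rs) (length (r # rs)) = \<ominus> (r \<otimes> root_coeff rs (length rs))"
  using assms root_coeff_ge[of rs "Suc (length rs)"] root_coeff_closed[of rs "length rs"] by (simp add: minus_eq)

text \<open>The last coefficient is the product of all roots up to sign, the norm when the roots are
  conjugates.\<close>

lemma root_coeff_last_in_prime:
  assumes "set rs \<subseteq> V" "root_coeff rs (length rs) \<in> m"
  shows "\<exists>r\<in>set rs. r \<in> m"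
  using assms
proof (induction rs)
  case Nil
  then show ?case using prime_ofD(2)[OF m] by simp
next
  case (Cons r rs)
  have c: "set (r # rs) \<subseteq> carrier L" using Cons.prems(1) subringE(1)[OF V(1)] by blast
  have rV: "root_coeff rs (length rs) \<in> V"
  proof -
    have "root_coeff xs k \<in> V" if "set xs \<subseteq> V" for xs k
      using that subringE(2,3,5,6,7)[OF V(1)]
      by (induction xs arbitrary: k) (auto split: nat.split simp: minus_eq)
    then show ?thesis using Cons.prems(1) by simp
  qed
  have "\<ominus> (r \<otimes> root_coeff rs (length rs)) \<in> m"
    using Cons.prems(2) unfolding root_coeff_Cons_last[OF c] .
  then have "\<ominus> (\<ominus> (r \<otimes> root_coeff rs (length rs))) \<in> m"
    by (rule ideal_of_uminus[OF V(1) prime_ofD(1)[OF m]])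
  then have "r \<otimes> root_coeff rs (length rs) \<in> m"
    using c root_coeff_closed[of rs "length rs"] by simp
  then have "r \<in> m \<or> root_coeff rs (length rs) \<in> m"
    using Cons.prems(1) rV by (intro prime_ofD(3)[OF m]) auto
  then show ?case using Cons by auto
qed

text \<open>The norm of an element of \<open>P\<close> lies in \<open>P \<inter> B\<close>, hence in
  \<open>m\<close>; so one conjugate lies in \<open>m\<close>, and then the element itself, because
  the place is invariant. The other inclusion holds because elements of \<open>P0\<close> are
  nilpotent modulo \<open>q 3\<close> after localization. This identifies the top of a chain
  delivered by going up, of which otherwise only the trace on \<open>B\<close> is known.\<close>

lemma prime_over_unique:
  assumes P: "prime_of (carrier A) P" "P \<inter> B = q 3"
  shows "P = P0"
proof -
  note PI = ideal_ofD[OF prime_ofD(1)[OF P(1)]]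
  have sub: "P \<subseteq> P0"
  proof
    fix x assume x: "x \<in> P"
    then have xA: "x \<in> carrier A" using PI(1) by blast
    then have xL: "x \<in> carrier L" by (rule A_carr)
    let ?e = "root_coeff (conj_list x) (length (conj_list x))"
    obtain ys zs where ys: "conj_list x = ys @ x # zs"
      using conj_list_self[OF xL] by (meson split_list)
    have "set (conj_list x) \<subseteq> carrier A"
      unfolding conj_list_props(1) using \<sigma>_A[OF _ xA] by blast
    then have yz: "set (ys @ zs) \<subseteq> carrier A" "set (x # ys @ zs) \<subseteq> carrier L"
      using conj_list_closed[OF xL] unfolding ys by auto
    have "root_coeff (conj_list x) = root_coeff (x # ys @ zs)"
      unfolding ys using yz(2) by (intro root_coeff_swap) auto
    then have "?e = root_coeff (x # ys @ zs) (length (x # ys @ zs))"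
      using ys by simp
    also have "\<dots> = \<ominus> (x \<otimes> root_coeff (ys @ zs) (length (ys @ zs)))"
      by (rule root_coeff_Cons_last[OF yz(2)])
    also have "\<dots> = \<ominus> (root_coeff (ys @ zs) (length (ys @ zs)) \<otimes> x)"
      using yz(2) root_coeff_closed[of "ys @ zs"] by (simp add: m_comm)
    also have "\<dots> \<in> P"
      by (intro ideal_of_uminus[OF subring_A[OF cr] prime_ofD(1)[OF P(1)]] PI(4) root_coeff_A yz(1) x)
    finally have "?e \<in> q 3" using conj_coeff_B[OF xA] P(2) by blast
    then have "?e \<in> m" using m_B[OF conj_coeff_B[OF xA]] by blast
    then obtain r where "r \<in> set (conj_list x)" "r \<in> m"
      using root_coeff_last_in_prime[of "conj_list x"] A_sub_V \<sigma>_V conj_list_props(1)[of x] xA by auto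
    then have "x \<in> m" using \<sigma>_m A_sub_V[OF xA] unfolding conj_list_props(1) by blast
    then show "x \<in> P0" using xA unfolding P0_def by blast
  qed
  moreover have "x \<in> P" if x: "x \<in> P0" for x
  proof -
    have "q 3 \<subseteq> P" using P(2) by blast
    then obtain k :: nat and t where t: "t \<in> carrier A - P0" "x [^] k \<otimes> t \<in> P"
      using integral_nilpotent_mod[OF cr prime_P0 _ prime_ofD(1)[OF P(1)] _ x, of "q 3"] P0_B by blast
    have xA: "x \<in> carrier A" using x unfolding P0_def by blast
    have "x [^] k \<in> carrier A" by (induction k) (use xA subringE(3,6)[OF subring_A[OF cr]] in auto)
    then have "x [^] k \<in> P" using prime_ofD(3)[OF P(1)] t sub by blast
    then show ?thesis by (rule prime_of_pow[OF subring_A[OF cr] P(1) xA])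
  qed
  ultimately show ?thesis by blast
qed

lemma chain_of_primes:
  "\<exists>P. (\<forall>i\<le>3. prime_of (carrier A) (P i)) \<and> (\<forall>i<3. P i \<subset> P (Suc i)) \<and> P (3::nat) = P0"
proof -
  have up: "\<exists>Q'. prime_of (carrier A) Q' \<and> Q \<subseteq> Q' \<and> Q' \<inter> B = q (Suc i)"
    if "prime_of (carrier A) Q" "Q \<inter> B = q i" "i < 3" for Q i
    using going_up[OF cr that(1) _ q(1)[of "Suc i"]] that q(2)[of i] by auto
  have p0: "prime_of (carrier A) {\<zero>}"
    unfolding prime_of_def ideal_of_def using subringE(2)[OF subring_A[OF cr]] A_carr
    by (auto simp: integral_iff)
  have b0: "{\<zero>} \<inter> B = q 0" using q(3) by auto
  obtain P1 where P1: "prime_of (carrier A) P1" "{\<zero>} \<subseteq> P1" "P1 \<inter> B = q 1"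
    using up[OF p0 b0] by auto
  obtain P2 where P2: "prime_of (carrier A) P2" "P1 \<subseteq> P2" "P2 \<inter> B = q 2"
    using up[OF P1(1,3)] by (auto simp: numeral_2_eq_2)
  obtain P3 where P3: "prime_of (carrier A) P3" "P2 \<subseteq> P3" "P3 \<inter> B = q 3"
    using up[OF P2(1,3)] by (auto simp: numeral_3_eq_3 numeral_2_eq_2)
  define P where "P = (\<lambda>i::nat. if i = 0 then {\<zero>} else if i = 1 then P1 else if i = 2 then P2 else P3)"
  have PB: "P i \<inter> B = q i" if "i \<le> 3" for i
  proof -
    have "i = 0 \<or> i = 1 \<or> i = 2 \<or> i = 3" using that by linarith
    moreover have "P 0 = {\<zero>}" "P 1 = P1" "P 2 = P2" "P 3 = P3" by (simp_all add: P_def)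
    ultimately show ?thesis using b0 P1(3) P2(3) P3(3) by (elim disjE) (simp_all only:)
  qed
  have "P i \<subset> P (Suc i)" if i: "i < 3" for i
  proof -
    have "i = 0 \<or> i = 1 \<or> i = 2" using i by linarith
    then have "P i \<subseteq> P (Suc i)" using P1(2) P2(2) P3(2) by (auto simp: P_def)
    moreover have "P i \<noteq> P (Suc i)" using PB[of i] PB[of "Suc i"] q(2)[OF i] i by auto
    ultimately show ?thesis by blast
  qed
  moreover have "prime_of (carrier A) (P i)" for i using p0 P1 P2 P3 by (auto simp: P_def)
  moreover have "P 3 = P0" using prime_over_unique[OF P3(1,3)] by (simp add: P_def)
  ultimately show ?thesis by blast
qed

lemma \<alpha>_not_in_ideal:
  assumes s: "s \<in> carrier A - P0" and ab: "a \<in> carrier A" "b \<in> carrier A"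
  shows "s \<otimes> \<alpha> \<noteq> c \<otimes> a \<oplus> y \<otimes> b"
proof
  assume e: "s \<otimes> \<alpha> = c \<otimes> a \<oplus> y \<otimes> b"
  note sA = subringE[OF subring_A[OF cr]]
  have pA: "x [^] (k::nat) \<in> carrier A" if "x \<in> carrier A" for x k
    by (induction k) (use that sA in auto)
  have carr: "s \<in> carrier L" "a \<in> carrier L" "b \<in> carrier L" "c \<in> carrier L" "y \<in> carrier L" "u \<in> carrier L"
    "\<alpha> \<in> carrier L" "\<delta> \<in> carrier L"
    using s ab \<alpha>\<beta>\<gamma>[OF cr] A_carr cyzu B_carr by auto
  have cp: "c [^] p \<in> Units L"
    using cyzu(5) carr by (intro Units_pow_closed) (simp add: field_Units)
  have "s [^] p \<otimes> (y [^] p \<otimes> u \<oplus> c [^] p \<otimes> \<delta>) = (s \<otimes> \<alpha>) [^] p"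
    unfolding \<alpha>_pow[symmetric] using carr by (simp add: nat_pow_distrib)
  also have "\<dots> = (c \<otimes> a) [^] p \<oplus> (y \<otimes> b) [^] p"
    unfolding e by (rule frobenius_add[OF p char]) (use carr in auto)
  also have "\<dots> = c [^] p \<otimes> a [^] p \<oplus> y [^] p \<otimes> b [^] p"
    using carr by (simp add: nat_pow_distrib)
  finally have eq: "s [^] p \<otimes> (y [^] p \<otimes> u \<oplus> c [^] p \<otimes> \<delta>) = c [^] p \<otimes> a [^] p \<oplus> y [^] p \<otimes> b [^] p" .
  let ?d = "s [^] p \<otimes> u \<ominus> b [^] p"
  have dA: "?d \<in> carrier A" unfolding minus_eq using s ab cyzu(4) pA B_sub_A sA by simp
  \<comment> \<open>The quotient \<open>?d / c^p\<close>. Its multiples by \<open>c^p\<close> and by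
    \<open>y^p\<close> are both in \<open>A\<close>, the second because of \<open>yd\<close>;
    coprimality then puts \<open>f\<close> itself into \<open>A\<close>. So \<open>?d\<close> is
    divisible by \<open>c^p\<close> in \<open>A\<close>, and \<open>pth\<close> applies.\<close>
  define f where "f = inv (c [^] p) \<otimes> ?d"
  have fL: "f \<in> carrier L" unfolding f_def using cp carr by simp
  have cf: "c [^] p \<otimes> f = ?d" unfolding f_def using cp carr by (simp add: m_assoc[symmetric])
  have "y [^] p \<otimes> ?d = s [^] p \<otimes> (y [^] p \<otimes> u \<oplus> c [^] p \<otimes> \<delta>) \<ominus> c [^] p \<otimes> (s [^] p \<otimes> \<delta>) \<ominus> y [^] p \<otimes> b [^] p"
    using carr by (elim rep_cases) (simp add: rep_hom algebra_simps)
  also have "\<dots> = c [^] p \<otimes> (a [^] p \<ominus> s [^] p \<otimes> \<delta>)"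
    unfolding eq using carr by (elim rep_cases) (simp add: rep_hom algebra_simps)
  finally have yd: "y [^] p \<otimes> ?d = c [^] p \<otimes> (a [^] p \<ominus> s [^] p \<otimes> \<delta>)" .
  have "y [^] p \<otimes> f = inv (c [^] p) \<otimes> (y [^] p \<otimes> ?d)"
    unfolding f_def using cp carr by (simp add: m_lcomm)
  also have "\<dots> = a [^] p \<ominus> s [^] p \<otimes> \<delta>"
    unfolding yd using cp carr by (simp add: m_assoc[symmetric])
  finally have yf: "y [^] p \<otimes> f = a [^] p \<ominus> s [^] p \<otimes> \<delta>" .
  have "f \<in> carrier A"
  proof (rule A_mem_if_coprime_multiples[OF fL])
    show "c [^] p \<otimes> f \<in> carrier A" unfolding cf by (rule dA)
    show "y [^] p \<otimes> f \<in> carrier A" unfolding yf minus_eq using s ab \<alpha>\<beta>\<gamma>[OF cr] pA sA by simp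
  qed
  then have fV: "f \<in> V" by (rule A_sub_V)
  note mI = ideal_ofD[OF prime_ofD(1)[OF m]]
  have cm: "c \<in> m" using m_B[OF cyzu(1)] c_q3 by blast
  have "p > 0" using p prime_gt_0_nat by blast
  then obtain k where k: "p = Suc k" by (metis gr0_implies_Suc)
  have cV: "c [^] (k::nat) \<in> V" using cyzu(1) V(2) B_pow by blast
  have "c [^] p = c [^] k \<otimes> c" unfolding k by simp
  then have "?d = (f \<otimes> c [^] k) \<otimes> c" unfolding cf[symmetric] using carr fL by (simp add: m_ac)
  also have "\<dots> \<in> m" using mI(4) cm fV cV subringE(6)[OF V(1)] by blast
  finally have "s \<in> m" using pth A_sub_V s ab by blast
  then show False using s unfolding P0_def by blast
qed

end

theorem not_CM: "\<not> cohen_macaulay_ring A"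
proof
  assume CM: "cohen_macaulay_ring A"
  then have cr: "cring A" unfolding cohen_macaulay_ring_def by blast
  note sA = subringE[OF subring_A[OF cr]]
  obtain P where P: "\<And>i. i \<le> 3 \<Longrightarrow> prime_of (carrier A) (P i)" "\<And>i. i < 3 \<Longrightarrow> P i \<subset> P (Suc i)" "P (3::nat) = P0"
    using chain_of_primes[OF cr] by blast
  have cL: "c \<in> carrier L" "y \<in> carrier L" "z \<in> carrier L" using cyzu B_carr by auto
  have "\<not> cohen_macaulay_ring A"
  proof (rule not_cohen_macaulay_ring)
    have "A = L\<lparr>carrier := carrier A\<rparr>" by (simp add: integral_closure_def)
    then show "domain A" using subring_is_domain[OF subring_A[OF cr]] by simp
    show "primeideal (P i) A" if "i \<le> 3" for i by (rule prime_of_A_primeideal[OF cr P(1)[OF that]])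
    show "P i \<subset> P (Suc i)" if "i < 3" for i by (rule P(2)[OF that])
    show "c \<in> carrier A" "y \<in> carrier A" using cyzu B_sub_A by auto
    show "\<alpha> \<in> carrier A" by (rule \<alpha>\<beta>\<gamma>[OF cr])
    show "y \<noteq> \<zero>\<^bsub>A\<^esub>" unfolding A_ops by (rule cyzu)
    show "\<exists>e\<in>carrier A. a = y \<otimes>\<^bsub>A\<^esub> e \<and> b = c \<otimes>\<^bsub>A\<^esub> e"
      if ab: "a \<in> carrier A" "b \<in> carrier A" "c \<otimes>\<^bsub>A\<^esub> a = y \<otimes>\<^bsub>A\<^esub> b" for a b
      unfolding A_ops
    proof
      have abL: "a \<in> carrier L" "b \<in> carrier L" "c \<otimes> a = y \<otimes> b" using ab A_carr unfolding A_ops by auto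
      have yU: "y \<in> Units L" using cyzu(6) cL by (simp add: field_Units)
      let ?e = "inv y \<otimes> a"
      have eL: "?e \<in> carrier L" using yU abL by simp
      have "c \<otimes> ?e = inv y \<otimes> (c \<otimes> a)" using yU abL(1,2) cL by (simp add: m_lcomm)
      also have "\<dots> = b" unfolding abL(3) using yU abL cL by (simp add: m_assoc[symmetric])
      finally have ce: "c \<otimes> ?e = b" .
      have ye: "y \<otimes> ?e = a" using yU abL cL by (simp add: m_assoc[symmetric])
      show "a = y \<otimes> ?e \<and> b = c \<otimes> ?e" using ce ye by simp
      show "?e \<in> carrier A"
        using A_mem_if_coprime_multiples[OF cr eL, of 1] ce ye ab cL by simp
    qed
    show "s \<otimes>\<^bsub>A\<^esub> \<alpha> \<noteq> c \<otimes>\<^bsub>A\<^esub> a \<oplus>\<^bsub>A\<^esub> y \<otimes>\<^bsub>A\<^esub> b"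
      if "s \<in> carrier A - P 3" "a \<in> carrier A" "b \<in> carrier A" for s a b
      unfolding A_ops using \<alpha>_not_in_ideal[OF cr] that unfolding P(3) by blast
    show "\<exists>k::nat. \<exists>t\<in>carrier A - P 3. \<exists>a\<in>carrier A. \<exists>b\<in>carrier A.
        t \<otimes>\<^bsub>A\<^esub> (f [^]\<^bsub>A\<^esub> k \<otimes>\<^bsub>A\<^esub> \<alpha>) = c \<otimes>\<^bsub>A\<^esub> a \<oplus>\<^bsub>A\<^esub> y \<otimes>\<^bsub>A\<^esub> b" if f: "f \<in> P 3" for f
    proof -
      \<comment> \<open>The ideal that multiplies \<open>\<alpha>\<close> into
        \<open>(c, y)\<close>. It contains \<open>c\<close> and \<open>y\<close> trivially and
        \<open>z\<close> by \<open>rel\<close>, hence \<open>q 3\<close>, so powers of elements of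
        \<open>P0\<close> fall into it up to a factor outside \<open>P0\<close>.\<close>
      let ?J = "{x \<in> carrier A. \<exists>a\<in>carrier A. \<exists>b\<in>carrier A. x \<otimes> \<alpha> = c \<otimes> a \<oplus> y \<otimes> b}"
      have \<alpha>L: "\<alpha> \<in> carrier L" "\<beta> \<in> carrier L" "\<gamma> \<in> carrier L" using \<alpha>\<beta>\<gamma>[OF cr] A_carr by auto
      have J: "ideal_of (carrier A) ?J" unfolding ideal_of_def
      proof (intro conjI ballI)
        show "?J \<subseteq> carrier A" by blast
        have "\<zero> \<otimes> \<alpha> = c \<otimes> \<zero> \<oplus> y \<otimes> \<zero>" using cL \<alpha>L by simp
        then show "\<zero> \<in> ?J" using sA(2) by blast
      next
        fix x x' assume "x \<in> ?J" "x' \<in> ?J"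
        then obtain a b a' b' where *: "x \<in> carrier A" "x' \<in> carrier A" "a \<in> carrier A" "b \<in> carrier A"
          "a' \<in> carrier A" "b' \<in> carrier A" "x \<otimes> \<alpha> = c \<otimes> a \<oplus> y \<otimes> b" "x' \<otimes> \<alpha> = c \<otimes> a' \<oplus> y \<otimes> b'" by blast
        note l = *(1-6)[THEN A_carr]
        have "(x \<oplus> x') \<otimes> \<alpha> = x \<otimes> \<alpha> \<oplus> x' \<otimes> \<alpha>" using l \<alpha>L by (simp add: l_distr)
        also have "\<dots> = c \<otimes> (a \<oplus> a') \<oplus> y \<otimes> (b \<oplus> b')"
          unfolding *(7,8) using l cL by (elim rep_cases) (simp add: rep_hom algebra_simps)
        finally show "x \<oplus> x' \<in> ?J" using * sA(7) by blast
      next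
        fix r x assume r: "r \<in> carrier A" and "x \<in> ?J"
        then obtain a b where *: "x \<in> carrier A" "a \<in> carrier A" "b \<in> carrier A" "x \<otimes> \<alpha> = c \<otimes> a \<oplus> y \<otimes> b" by blast
        note l = *(1-3)[THEN A_carr] A_carr[OF r]
        have "(r \<otimes> x) \<otimes> \<alpha> = r \<otimes> (x \<otimes> \<alpha>)" using l \<alpha>L by (simp add: m_assoc)
        also have "\<dots> = c \<otimes> (r \<otimes> a) \<oplus> y \<otimes> (r \<otimes> b)"
          unfolding *(4) using l cL by (elim rep_cases) (simp add: rep_hom algebra_simps)
        finally show "r \<otimes> x \<in> ?J" using * r sA(6) by blast
      qed
      have "q 3 \<subseteq> ?J"
      proof
        fix x assume x: "x \<in> q 3"
        then obtain r1 r2 r3 where r: "r1 \<in> B" "r2 \<in> B" "r3 \<in> B" "x = c \<otimes> r1 \<oplus> y \<otimes> r2 \<oplus> z \<otimes> r3"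
          using q3 by blast
        note l = r(1-3)[THEN B_carr]
        have "x \<otimes> \<alpha> = c \<otimes> (r1 \<otimes> \<alpha>) \<oplus> y \<otimes> (r2 \<otimes> \<alpha>) \<oplus> r3 \<otimes> (z \<otimes> \<alpha>)"
          unfolding r(4) using l cL \<alpha>L by (elim rep_cases) (simp add: rep_hom algebra_simps)
        also have "\<dots> = c \<otimes> (r1 \<otimes> \<alpha> \<oplus> r3 \<otimes> \<gamma>) \<oplus> y \<otimes> (r2 \<otimes> \<alpha> \<oplus> r3 \<otimes> \<beta>)"
          unfolding rel using l cL \<alpha>L by (elim rep_cases) (simp add: rep_hom algebra_simps)
        finally have "x \<otimes> \<alpha> = \<dots>" .
        moreover have "r1 \<otimes> \<alpha> \<oplus> r3 \<otimes> \<gamma> \<in> carrier A" "r2 \<otimes> \<alpha> \<oplus> r3 \<otimes> \<beta> \<in> carrier A"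
          using r(1-3) B_sub_A \<alpha>\<beta>\<gamma>[OF cr] sA(6,7) by auto
        moreover have "x \<in> carrier A" using x P0_B[OF cr] unfolding P0_def[OF cr] by blast
        ultimately show "x \<in> ?J" by blast
      qed
      then obtain k :: nat and t where t: "t \<in> carrier A - P0" "f [^] k \<otimes> t \<in> ?J"
        using integral_nilpotent_mod[OF cr prime_P0[OF cr] _ J _ f[unfolded P(3)], of "q 3"] P0_B[OF cr] by blast
      have fL: "f \<in> carrier L" using f unfolding P(3) P0_def[OF cr] using A_carr by blast
      have "t \<otimes> (f [^] k \<otimes> \<alpha>) = f [^] k \<otimes> t \<otimes> \<alpha>" using t A_carr fL \<alpha>L by (simp add: m_ac)
      moreover obtain a b where "a \<in> carrier A" "b \<in> carrier A" "f [^] k \<otimes> t \<otimes> \<alpha> = c \<otimes> a \<oplus> y \<otimes> b"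
        using t(2) by blast
      ultimately show ?thesis using t(1) unfolding A_ops A_pow P(3) by metis
    qed
  qed
  then show False using CM by blast
qed

end

section \<open>Roots of polynomials and places\<close>

text \<open>Coefficient lists may begin with zeros. The last clause therefore records how the
  vanishing of the quotient descends to the dividend, which the count of roots passes on from step
  to step.\<close>

lemma (in domain) synthetic_division:
  assumes "set as \<subseteq> carrier R" "r \<in> carrier R" "as \<noteq> []"
  shows "\<exists>q. Suc (length q) = length as \<and> set q \<subseteq> carrier R \<and>
    (\<forall>t\<in>carrier R. eval as t = (t \<ominus> r) \<otimes> eval q t \<oplus> eval as r) \<and> (set q \<subseteq> {\<zero>} \<longrightarrow> set (butlast as) \<subseteq> {\<zero>})"
  using assms(1,3)
proof (induction as rule: rev_induct)
  case (snoc b bs)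
  show ?case
  proof (cases "bs = []")
    case True
    then show ?thesis using snoc assms(2) by (intro exI[of _ "[]"]) auto
  next
    case False
    have c: "set bs \<subseteq> carrier R" "b \<in> carrier R" using snoc.prems by auto
    obtain q where q: "Suc (length q) = length bs" "set q \<subseteq> carrier R"
      "\<And>t. t \<in> carrier R \<Longrightarrow> eval bs t = (t \<ominus> r) \<otimes> eval q t \<oplus> eval bs r"
      "set q \<subseteq> {\<zero>} \<Longrightarrow> set (butlast bs) \<subseteq> {\<zero>}"
      using snoc.IH[OF c(1) False] by blast
    have er: "eval bs r \<in> carrier R" using c assms(2) by (intro eval_in_carrier)
    let ?q = "q @ [eval bs r]"
    have "eval (bs @ [b]) t = (t \<ominus> r) \<otimes> eval ?q t \<oplus> eval (bs @ [b]) r" if t: "t \<in> carrier R" for t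
    proof -
      have eq: "eval q t \<in> carrier R" using q(2) t by (intro eval_in_carrier)
      have "eval (bs @ [b]) t = ((t \<ominus> r) \<otimes> eval q t \<oplus> eval bs r) \<otimes> t \<oplus> b"
        unfolding eval_append_aux[OF c t] q(3)[OF t, symmetric] ..
      also have "\<dots> = (t \<ominus> r) \<otimes> (eval q t \<otimes> t \<oplus> eval bs r) \<oplus> (eval bs r \<otimes> r \<oplus> b)"
        using c(2) t eq er assms(2) by (elim rep_cases) (simp add: rep_hom algebra_simps)
      also have "\<dots> = (t \<ominus> r) \<otimes> eval ?q t \<oplus> eval (bs @ [b]) r"
        unfolding eval_append_aux[OF c assms(2)] eval_append_aux[OF q(2) er t] ..
      finally show ?thesis .
    qed
    moreover have "set (butlast (bs @ [b])) \<subseteq> {\<zero>}" if z: "set ?q \<subseteq> {\<zero>}"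
    proof -
      have bl: "set (butlast bs) \<subseteq> {\<zero>}" "eval bs r = \<zero>" using z q(4) by auto
      have bb: "bs = butlast bs @ [last bs]" using False by simp
      have l: "last bs \<in> carrier R" using c(1) False by auto
      have rep0: "butlast bs = replicate (length (butlast bs)) \<zero>" using bl(1)
        by (intro replicate_length_same[symmetric]) auto
      have "eval bs r = eval (replicate (length (butlast bs)) \<zero> @ [last bs]) r" using bb rep0 by metis
      also have "\<dots> = eval [last bs] r" using l assms(2) by (intro eval_replicate) auto
      also have "\<dots> = last bs" using l by simp
      finally have "last bs = \<zero>" using bl(2) by simp
      then have "set (butlast bs @ [last bs]) \<subseteq> {\<zero>}" using bl(1) by simp
      then show ?thesis using bb by simp
    qed
    ultimately show ?thesis using q(1,2) er by (intro exI[of _ ?q]) auto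
  qed
qed simp

text \<open>With leading zeros allowed, the length of the list stands for a bound on the degree plus
  one.\<close>

lemma (in domain) too_many_roots:
  assumes "set as \<subseteq> carrier R" "finite T" "T \<subseteq> carrier R" "length as \<le> card T"
    and "\<And>t. t \<in> T \<Longrightarrow> eval as t = \<zero>"
  shows "set as \<subseteq> {\<zero>}"
  using assms
proof (induction "length as" arbitrary: as T)
  case (Suc n)
  then have ne: "as \<noteq> []" "T \<noteq> {}" by auto
  then obtain r where r: "r \<in> T" by blast
  have rc: "r \<in> carrier R" using r Suc.prems by blast
  obtain q where q: "Suc (length q) = length as" "set q \<subseteq> carrier R"
      "\<And>t. t \<in> carrier R \<Longrightarrow> eval as t = (t \<ominus> r) \<otimes> eval q t \<oplus> eval as r"
      "set q \<subseteq> {\<zero>} \<Longrightarrow> set (butlast as) \<subseteq> {\<zero>}"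
    using synthetic_division[OF Suc.prems(1) rc ne(1)] by blast
  have "set q \<subseteq> {\<zero>}"
  proof (rule Suc.hyps(1)[of q "T - {r}"])
    show "n = length q" using Suc.hyps(2) q(1) by simp
    show "length q \<le> card (T - {r})" using Suc.prems(2,4) q(1) r by (simp add: card_Diff_singleton)
    show "set q \<subseteq> carrier R" by (rule q(2))
    show "finite (T - {r})" "T - {r} \<subseteq> carrier R" using Suc.prems(2,3) by auto
    fix t assume t: "t \<in> T - {r}"
    then have tc: "t \<in> carrier R" using Suc.prems by blast
    have qc: "eval q t \<in> carrier R" using q(2) tc by (intro eval_in_carrier)
    have "(t \<ominus> r) \<otimes> eval q t = \<zero>"
      using q(3)[OF tc] Suc.prems(5)[OF r] Suc.prems(5)[of t] t tc rc qc by simp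
    moreover have "t \<ominus> r \<noteq> \<zero>" using t tc rc by simp
    ultimately show "eval q t = \<zero>" using tc rc qc integral minus_closed by blast
  qed
  then have bl: "set (butlast as) \<subseteq> {\<zero>}" by (rule q(4))
  have as: "as = butlast as @ [last as]" using ne by simp
  have l: "last as \<in> carrier R" using Suc.prems(1) last_in_set[OF ne(1)] by blast
  have rep0: "butlast as = replicate (length (butlast as)) \<zero>" using bl
    by (intro replicate_length_same[symmetric]) auto
  have "eval as r = eval (replicate (length (butlast as)) \<zero> @ [last as]) r" using as rep0 by metis
  also have "\<dots> = eval [last as] r" using l rc by (intro eval_replicate) auto
  also have "\<dots> = last as" using l by simp
  finally have "last as = \<zero>" using Suc.prems(5)[OF r] by simp
  then have "set (butlast as @ [last as]) \<subseteq> {\<zero>}" using bl by simp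
  then show ?case using as by simp
qed simp

lemma (in cring) eval_map2:
  assumes "length as = length bs" "set as \<subseteq> carrier R" "set bs \<subseteq> carrier R" "r \<in> carrier R" "x \<in> carrier R"
  shows "eval (map2 (\<lambda>a b. a \<ominus> r \<otimes> b) as bs) x = eval as x \<ominus> r \<otimes> eval bs x"
  using assms(1-3)
proof (induction as bs rule: list_induct2)
  case Nil
  then show ?case using assms(4) by (simp add: minus_eq)
next
  case (Cons a as b bs)
  have c: "a \<in> carrier R" "b \<in> carrier R" "eval as x \<in> carrier R" "eval bs x \<in> carrier R" "x [^] length bs \<in> carrier R"
    using Cons.prems assms(5) by (auto intro!: eval_in_carrier)
  have "(a \<ominus> r \<otimes> b) \<otimes> x [^] length bs \<oplus> (eval as x \<ominus> r \<otimes> eval bs x) =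
    (a \<otimes> x [^] length bs \<oplus> eval as x) \<ominus> r \<otimes> (b \<otimes> x [^] length bs \<oplus> eval bs x)"
    using c assms(4) by (elim rep_cases) (simp add: rep_hom algebra_simps)
  then show ?case using Cons by simp
qed

text \<open>Multiplication by \<open>g\<close> makes the list one entry too long, and the monic
  relation removes its leading entry again. Keeping the length fixed at the degree of the relation
  lets the list be compared with the number of conjugates later.\<close>

lemma (in domain) simple_extension_monic:
  assumes K: "subfield K R" and g: "g \<in> carrier R" and F: "set F \<subseteq> K" "F \<noteq> []" "eval (\<one> # F) g = \<zero>"
    and x: "x \<in> simple_extension K g"
  shows "\<exists>rs. set rs \<subseteq> K \<and> length rs = length F \<and> x = eval rs g"
  using x
proof (induction rule: simple_extension.induct)
  case zero
  have "eval (replicate (length F) \<zero> @ []) g = eval [] g"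
    by (rule eval_replicate) (use g in auto)
  then show ?case using subringE(2)[OF subfieldE(1)[OF K]]
    by (intro exI[of _ "replicate (length F) \<zero>"]) auto
next
  case (lin x k)
  note KE = subringE[OF subfieldE(1)[OF K]]
  obtain rs where rs: "set rs \<subseteq> K" "length rs = length F" "x = eval rs g" using lin.IH by blast
  then obtain r rs' where r: "rs = r # rs'" using F(2) by (cases rs) auto
  have c: "set (rs' @ [k]) \<subseteq> K" "r \<in> K" using rs r lin by auto
  have cR: "set (rs' @ [k]) \<subseteq> carrier R" "r \<in> carrier R" "set F \<subseteq> carrier R" "set rs \<subseteq> carrier R" "k \<in> carrier R"
    using c F(1) KE(1) rs(1) lin by auto
  have ec: "eval F g \<in> carrier R" "eval (rs' @ [k]) g \<in> carrier R"
    by (rule eval_in_carrier[OF cR(3) g], rule eval_in_carrier[OF cR(1) g])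
  have l: "length (rs' @ [k]) = length F" using rs r by simp
  have "g [^] length F \<oplus> eval F g = \<zero>" using F(3) g by simp
  then have gn: "g [^] length F = \<ominus> eval F g"
    using ec g by (intro minus_equality[symmetric]) auto
  have "x \<otimes> g \<oplus> k = eval (rs @ [k]) g" unfolding rs(3) eval_append_aux[OF cR(4,5) g] ..
  also have "\<dots> = r \<otimes> g [^] length F \<oplus> eval (rs' @ [k]) g" using r l by simp
  also have "\<dots> = eval (rs' @ [k]) g \<ominus> r \<otimes> eval F g"
    unfolding gn using ec cR(2) by (elim rep_cases) (simp add: rep_hom algebra_simps)
  also have "\<dots> = eval (map2 (\<lambda>a b. a \<ominus> r \<otimes> b) (rs' @ [k]) F) g"
    by (rule eval_map2[OF l cR(1,3,2) g, symmetric])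
  finally have "x \<otimes> g \<oplus> k = \<dots>" .
  moreover have "set (map2 (\<lambda>a b. a \<ominus> r \<otimes> b) (rs' @ [k]) F) \<subseteq> K"
  proof
    fix w assume "w \<in> set (map2 (\<lambda>a b. a \<ominus> r \<otimes> b) (rs' @ [k]) F)"
    then obtain a b where ab: "(a, b) \<in> set (zip (rs' @ [k]) F)" and w: "w = a \<ominus> r \<otimes> b" by auto
    have "a \<in> set (rs' @ [k])" "b \<in> set F" using set_zip_leftD[OF ab] set_zip_rightD[OF ab] .
    then have "a \<in> K" "b \<in> K" using c(1) F(1) by blast+
    then show "w \<in> K" unfolding w minus_eq by (intro KE(5-7) c(2))
  qed
  moreover have "length (map2 (\<lambda>a b. a \<ominus> r \<otimes> b) (rs' @ [k]) F) = length F" using l by simp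
  ultimately show ?case by blast
qed

section \<open>The local ring of a partially defined homomorphism and its prime ideal\<close>

context domain_localization
begin

context
  fixes F :: "('f, 'k) ring_scheme" and \<phi>
  assumes F: "field F" and hom: "\<phi> \<in> ring_hom R F"
begin

interpretation F: field F by (rule F)
interpretation \<phi>: ring_hom_cring R F \<phi> by (rule UnivPoly.ring_hom_cringI[OF is_cring F.is_cring hom])

lemma frac_dom_sub: "frac_dom F \<phi> \<subseteq> carrier Q"
  by (auto simp: frac_dom_def fr_closed)

lemma frac_dom_one_zero: "\<one>\<^bsub>Q\<^esub> \<in> frac_dom F \<phi>" "\<zero>\<^bsub>Q\<^esub> \<in> frac_dom F \<phi>"
  unfolding one_Q zero_Q by (simp_all add: frac_dom_base[OF F hom])

lemma frac_map_one_zero: "frac_map F \<phi> \<one>\<^bsub>Q\<^esub> = \<one>\<^bsub>F\<^esub>" "frac_map F \<phi> \<zero>\<^bsub>Q\<^esub> = \<zero>\<^bsub>F\<^esub>"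
  unfolding one_Q zero_Q by (simp_all add: frac_map_base[OF F hom])

lemma frac_dom_uminus: "x \<in> frac_dom F \<phi> \<Longrightarrow> \<ominus>\<^bsub>Q\<^esub> x \<in> frac_dom F \<phi>"
proof -
  assume "x \<in> frac_dom F \<phi>"
  then obtain a s where as: "a \<in> carrier R" "s \<in> S" "\<phi> s \<noteq> \<zero>\<^bsub>F\<^esub>" "x = fr a s"
    by (auto simp: frac_dom_def)
  have "fr (\<ominus> a) s \<oplus>\<^bsub>Q\<^esub> x = \<zero>\<^bsub>Q\<^esub>" using as by (simp add: fr_add_same l_neg fr_zero)
  then have "\<ominus>\<^bsub>Q\<^esub> x = fr (\<ominus> a) s" using as by (intro Q.minus_equality) (auto simp: fr_closed)
  then show ?thesis using as a_inv_closed[OF as(1)] unfolding frac_dom_def by blast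
qed

lemma subring_frac_dom: "subring (frac_dom F \<phi>) Q"
  by (rule Q.subringI)
    (auto simp: frac_dom_sub frac_dom_one_zero frac_dom_uminus frac_dom_add[OF F hom] frac_dom_mult[OF F hom])

lemma frac_map_uminus: "x \<in> frac_dom F \<phi> \<Longrightarrow> frac_map F \<phi> (\<ominus>\<^bsub>Q\<^esub> x) = \<ominus>\<^bsub>F\<^esub> frac_map F \<phi> x"
proof -
  assume x: "x \<in> frac_dom F \<phi>"
  have "\<ominus>\<^bsub>Q\<^esub> x \<oplus>\<^bsub>Q\<^esub> x = \<zero>\<^bsub>Q\<^esub>" using x frac_dom_sub by (intro Q.l_neg) auto
  then have "frac_map F \<phi> (\<ominus>\<^bsub>Q\<^esub> x) \<oplus>\<^bsub>F\<^esub> frac_map F \<phi> x = \<zero>\<^bsub>F\<^esub>"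
    using frac_map_add[OF F hom frac_dom_uminus[OF x] x] frac_map_one_zero(2) by simp
  then show ?thesis
    using frac_map_closed[OF F hom x x] frac_map_closed[OF F hom frac_dom_uminus[OF x] x] F.minus_equality by metis
qed

lemma frac_dom_pow: "x \<in> frac_dom F \<phi> \<Longrightarrow> x [^]\<^bsub>Q\<^esub> (k::nat) \<in> frac_dom F \<phi>"
  by (induction k) (simp_all add: frac_dom_one_zero frac_dom_mult[OF F hom])

lemma frac_map_pow: "x \<in> frac_dom F \<phi> \<Longrightarrow> frac_map F \<phi> (x [^]\<^bsub>Q\<^esub> (k::nat)) = frac_map F \<phi> x [^]\<^bsub>F\<^esub> k"
  by (induction k) (simp_all add: frac_map_one_zero frac_dom_pow frac_map_mult[OF F hom])

lemma prime_frac_ker: "Q.prime_of (frac_dom F \<phi>) {x \<in> frac_dom F \<phi>. frac_map F \<phi> x = \<zero>\<^bsub>F\<^esub>}"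
  unfolding Q.prime_of_def Q.ideal_of_def
  using frac_map_closed[OF F hom] frac_dom_one_zero
  by (auto simp: frac_map_one_zero F.integral_iff frac_dom_add[OF F hom] frac_dom_mult[OF F hom]
      frac_map_add[OF F hom] frac_map_mult[OF F hom])

lemma frac_map_inverse:
  assumes S: "S = carrier R - {\<zero>}" and x: "x \<in> frac_dom F \<phi>" "frac_map F \<phi> x \<noteq> \<zero>\<^bsub>F\<^esub>"
    and y: "y \<in> carrier Q" "x \<otimes>\<^bsub>Q\<^esub> y = \<one>\<^bsub>Q\<^esub>"
  shows "y \<in> frac_dom F \<phi>" "frac_map F \<phi> y = inv\<^bsub>F\<^esub> frac_map F \<phi> x"
proof -
  obtain a s where as: "a \<in> carrier R" "s \<in> S" "\<phi> s \<noteq> \<zero>\<^bsub>F\<^esub>" "x = fr a s"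
    using x(1) by (auto simp: frac_dom_def)
  have "frac_map F \<phi> x = \<phi> a \<otimes>\<^bsub>F\<^esub> inv\<^bsub>F\<^esub> \<phi> s" unfolding as(4) by (rule frac_map_fr[OF F hom as(1-3)])
  moreover have "inv\<^bsub>F\<^esub> \<phi> s \<in> carrier F" using as S_carr by (intro F.Units_inv_closed) (auto simp: F.field_Units)
  ultimately have \<phi>a: "\<phi> a \<noteq> \<zero>\<^bsub>F\<^esub>" using x(2) by auto
  then have aS: "a \<in> S" using as(1) S by auto
  have sR: "s \<in> carrier R" using as S_carr by blast
  have fc: "fr s a \<in> carrier Q" "fr a s \<in> carrier Q" using fr_closed sR aS as by auto
  have "fr s a = fr s a \<otimes>\<^bsub>Q\<^esub> (x \<otimes>\<^bsub>Q\<^esub> y)" using y fc by simp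
  also have "\<dots> = (fr s a \<otimes>\<^bsub>Q\<^esub> fr a s) \<otimes>\<^bsub>Q\<^esub> y" using y fc as(4) by (simp add: Q.m_assoc)
  also have "\<dots> = y" using fr_inverse[OF as(2) aS] y by simp
  finally have "fr s a = y" .
  then show yd: "y \<in> frac_dom F \<phi>" using aS sR \<phi>a unfolding frac_dom_def by blast
  have "frac_map F \<phi> x \<otimes>\<^bsub>F\<^esub> frac_map F \<phi> y = \<one>\<^bsub>F\<^esub>"
    using frac_map_mult[OF F hom x(1) yd] y(2) frac_map_one_zero(1) by simp
  then show "frac_map F \<phi> y = inv\<^bsub>F\<^esub> frac_map F \<phi> x"
    using frac_map_closed[OF F hom x(1) x(1)] frac_map_closed[OF F hom yd yd] by (metis F.comm_inv_char)
qed

end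

end

section \<open>The function field in four variables\<close>

locale fp_mpoly4 = fp_mpoly p 4 for p :: nat
begin

sublocale D: domain_localization M "carrier M - {\<zero>\<^bsub>M\<^esub>}"
  by (rule M.fraction_localization)

abbreviation L where "L \<equiv> D.Q"
abbreviation em where "em f \<equiv> D.fr f \<one>\<^bsub>M\<^esub>"

lemma L_eq: "L = fraction_field M" by (simp add: fraction_field_def)

sublocale L: field L unfolding L_eq by (rule M.fraction_field_field)

lemma em_hom: "em \<in> ring_hom M L" by (rule D.fr_hom)

lemma em_closed [simp]: "f \<in> carrier M \<Longrightarrow> em f \<in> carrier L"
  by (rule ring_hom_closed[OF em_hom])

lemma em_simps:
  "em \<zero>\<^bsub>M\<^esub> = \<zero>\<^bsub>L\<^esub>" "em \<one>\<^bsub>M\<^esub> = \<one>\<^bsub>L\<^esub>"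
  "f \<in> carrier M \<Longrightarrow> g \<in> carrier M \<Longrightarrow> em (f \<oplus>\<^bsub>M\<^esub> g) = em f \<oplus>\<^bsub>L\<^esub> em g"
  "f \<in> carrier M \<Longrightarrow> g \<in> carrier M \<Longrightarrow> em (f \<otimes>\<^bsub>M\<^esub> g) = em f \<otimes>\<^bsub>L\<^esub> em g"
  using D.fr_zero[OF D.S_one] D.one_Q ring_hom_add[OF em_hom] ring_hom_mult[OF em_hom] by auto

lemma em_eq_iff: "f \<in> carrier M \<Longrightarrow> g \<in> carrier M \<Longrightarrow> em f = em g \<longleftrightarrow> f = g"
  using D.S_one by (subst D.fr_eq_iff) auto

lemma em_eq_zero_iff: "f \<in> carrier M \<Longrightarrow> em f = \<zero>\<^bsub>L\<^esub> \<longleftrightarrow> f = \<zero>\<^bsub>M\<^esub>"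
  using em_eq_iff[of f "\<zero>\<^bsub>M\<^esub>"] em_simps(1) by simp

lemma L_cases:
  assumes "x \<in> carrier L"
  obtains f s where "f \<in> carrier M" "s \<in> carrier M" "s \<noteq> \<zero>\<^bsub>M\<^esub>" "x = D.fr f s" "x \<otimes>\<^bsub>L\<^esub> em s = em f"
proof -
  obtain f s where fs: "f \<in> carrier M" "s \<in> carrier M - {\<zero>\<^bsub>M\<^esub>}" "x = D.fr f s" using assms by (rule D.Q_cases)
  have "x \<otimes>\<^bsub>L\<^esub> em s = em f" using D.fr_decomp[OF fs(1,2)] fs(3) by simp
  then show ?thesis using that fs by blast
qed

lemma L_hom_unique:
  assumes h: "h \<in> ring_hom L L" "h' \<in> ring_hom L L" and eq: "\<And>i. i < 4 \<Longrightarrow> h (em (Var i)) = h' (em (Var i))"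
    and x: "x \<in> carrier L"
  shows "h x = h' x"
proof -
  have em: "h (em f) = h' (em f)" if "f \<in> carrier M" for f
    using mpoly_hom_unique[OF D.Q.ring_axioms ring_hom_trans[OF em_hom h(1)] ring_hom_trans[OF em_hom h(2)] _ that] eq
    by simp
  obtain f s where fs: "f \<in> carrier M" "s \<in> carrier M" "s \<noteq> \<zero>\<^bsub>M\<^esub>" "x \<otimes>\<^bsub>L\<^esub> em s = em f" using x by (rule L_cases)
  interpret h: ring_hom_cring L L h by (rule UnivPoly.ring_hom_cringI[OF D.Q.is_cring D.Q.is_cring h(1)])
  interpret h': ring_hom_cring L L h' by (rule UnivPoly.ring_hom_cringI[OF D.Q.is_cring D.Q.is_cring h(2)])
  have u: "em s \<in> Units L" using fs by (simp add: L.field_Units em_eq_zero_iff)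
  have ui: "inv\<^bsub>L\<^esub> em s \<in> carrier L" "em s \<otimes>\<^bsub>L\<^esub> inv\<^bsub>L\<^esub> em s = \<one>\<^bsub>L\<^esub>" using u by simp_all
  then have "h (em s) \<otimes>\<^bsub>L\<^esub> h (inv\<^bsub>L\<^esub> em s) = \<one>\<^bsub>L\<^esub>"
    using h.hom_mult[of "em s" "inv\<^bsub>L\<^esub> em s"] h.hom_one em_closed[OF fs(2)] by argo
  then have nz: "h (em s) \<noteq> \<zero>\<^bsub>L\<^esub>" using ui(1) D.Q.one_not_zero h.hom_closed by (metis D.Q.l_null)
  have "h x \<otimes>\<^bsub>L\<^esub> h (em s) = h' x \<otimes>\<^bsub>L\<^esub> h (em s)"
    using fs em x h.hom_mult[of x "em s"] h'.hom_mult[of x "em s"] by simp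
  then show ?thesis using nz x fs by (simp add: D.Q.m_rcancel)
qed

text \<open>Constants are indexed by all integers, so that they add without reduction; indices
  matter only modulo \<open>p\<close>.\<close>

definition kc :: "int \<Rightarrow> nat multiset \<Rightarrow> int" where "kc k = red (of_int k)"

lemma kc_props:
  "kc k \<in> carrier M" "kc 0 = \<zero>\<^bsub>M\<^esub>" "kc 1 = \<one>\<^bsub>M\<^esub>" "kc (k + l) = kc k \<oplus>\<^bsub>M\<^esub> kc l"
  "kc k = kc (k mod int p)" "kc k m = (if m = {#} then k mod int p else 0)"
proof -
  have val: "kc k m = (if m = {#} then k mod int p else 0)" for k m
    unfolding kc_def single_of_int[symmetric]
    by (auto simp: red_def lookup_single when_def simp del: single_of_int)
  then show "kc k m = (if m = {#} then k mod int p else 0)" .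
  show "kc k = kc (k mod int p)" by (simp add: val fun_eq_iff)
  have "of_int k \<in> zpolys" unfolding single_of_int[symmetric]
    by (auto simp: zpolys_def lookup_single when_def simp del: single_of_int)
  then show "kc k \<in> carrier M" unfolding kc_def by (rule red_in)
  show "kc 0 = \<zero>\<^bsub>M\<^esub>" "kc 1 = \<one>\<^bsub>M\<^esub>" "kc (k + l) = kc k \<oplus>\<^bsub>M\<^esub> kc l" by (simp_all add: kc_def red_hom)
qed

lemma kc_eq_zero_iff: "kc k = \<zero>\<^bsub>M\<^esub> \<longleftrightarrow> int p dvd k"
  by (auto simp: kc_props(6) M_zero fun_eq_iff dvd_eq_mod_eq_0)

definition kL :: "int \<Rightarrow> (((nat multiset \<Rightarrow> int) \<times> (nat multiset \<Rightarrow> int)) set)" where "kL k = em (kc k)"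

lemma kL_props:
  "kL k \<in> carrier L" "kL 0 = \<zero>\<^bsub>L\<^esub>" "kL 1 = \<one>\<^bsub>L\<^esub>" "kL (k + l) = kL k \<oplus>\<^bsub>L\<^esub> kL l" "kL k = kL (k mod int p)"
  "kL k = \<zero>\<^bsub>L\<^esub> \<longleftrightarrow> int p dvd k"
proof -
  show "kL k \<in> carrier L" unfolding kL_def by (rule em_closed[OF kc_props(1)])
  show "kL 0 = \<zero>\<^bsub>L\<^esub>" "kL 1 = \<one>\<^bsub>L\<^esub>" unfolding kL_def kc_props(2,3) em_simps(1,2) by (rule refl)+
  show "kL (k + l) = kL k \<oplus>\<^bsub>L\<^esub> kL l" unfolding kL_def kc_props(4) by (rule em_simps(3)[OF kc_props(1) kc_props(1)])
  show "kL k = kL (k mod int p)" unfolding kL_def by (rule arg_cong[OF kc_props(5)])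
  show "kL k = \<zero>\<^bsub>L\<^esub> \<longleftrightarrow> int p dvd k" unfolding kL_def em_eq_zero_iff[OF kc_props(1)] by (rule kc_eq_zero_iff)
qed

lemma L_char: "add_pow L (int p) \<one>\<^bsub>L\<^esub> = \<zero>\<^bsub>L\<^esub>"
proof -
  have "add_pow L (int k) \<one>\<^bsub>L\<^esub> = kL (int k)" for k
  proof (induction k)
    case (Suc k)
    have "add_pow L (int (Suc k)) \<one>\<^bsub>L\<^esub> = add_pow L (int k) \<one>\<^bsub>L\<^esub> \<oplus>\<^bsub>L\<^esub> \<one>\<^bsub>L\<^esub>"
      using D.Q.add.int_pow_mult[of "\<one>\<^bsub>L\<^esub>" "int k" 1] by (simp add: D.Q.add.int_pow_1 add.commute)
    also have "\<dots> = kL (int k + 1)" unfolding Suc kL_props(4) kL_props(3) ..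
    finally show ?case by (simp add: add.commute)
  qed (simp add: kL_props(2) D.Q.int_add_pow_zero)
  moreover have "kL (int p) = \<zero>\<^bsub>L\<^esub>" unfolding kL_props(6) by (rule dvd_refl)
  ultimately show ?thesis by (rule trans)
qed

lemmas L_frob = D.Q.frobenius_add[OF prime_p L_char]

lemma L_frob_minus:
  assumes "x \<in> carrier L" "y \<in> carrier L"
  shows "(x \<ominus>\<^bsub>L\<^esub> y) [^]\<^bsub>L\<^esub> p = x [^]\<^bsub>L\<^esub> p \<ominus>\<^bsub>L\<^esub> y [^]\<^bsub>L\<^esub> p"
proof -
  have "x = (x \<ominus>\<^bsub>L\<^esub> y) \<oplus>\<^bsub>L\<^esub> y" using assms by (elim D.Q.rep_cases) (simp add: D.Q.rep_hom)
  then have "x [^]\<^bsub>L\<^esub> p = (x \<ominus>\<^bsub>L\<^esub> y) [^]\<^bsub>L\<^esub> p \<oplus>\<^bsub>L\<^esub> y [^]\<^bsub>L\<^esub> p"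
    using L_frob[of "x \<ominus>\<^bsub>L\<^esub> y" y] assms by simp
  moreover have "A = (A \<oplus>\<^bsub>L\<^esub> B) \<ominus>\<^bsub>L\<^esub> B" if "A \<in> carrier L" "B \<in> carrier L" for A B
    using that by (elim D.Q.rep_cases) (simp add: D.Q.rep_hom)
  ultimately show ?thesis using assms by (metis D.Q.minus_closed D.Q.nat_pow_closed)
qed

lemma p_pos: "p > 0" using prime_p prime_gt_0_nat by blast

lemma kL_frob: "kL k [^]\<^bsub>L\<^esub> p = kL k"
proof -
  have "kL (int n) [^]\<^bsub>L\<^esub> p = kL (int n)" for n
  proof (induction n)
    case 0
    then show ?case using p_pos by (simp add: kL_props(2) D.Q.nat_pow_zero)
  next
    case (Suc n)
    have "kL (int n + 1) [^]\<^bsub>L\<^esub> p = kL (int n) [^]\<^bsub>L\<^esub> p \<oplus>\<^bsub>L\<^esub> \<one>\<^bsub>L\<^esub> [^]\<^bsub>L\<^esub> p"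
      unfolding kL_props(4) kL_props(3) by (rule L_frob) (simp_all add: kL_props(1))
    also have "\<dots> = kL (int n + 1)" unfolding Suc kL_props(4) kL_props(3) by simp
    finally show ?case by (simp add: add.commute)
  qed
  from this[of "nat (k mod int p)"] show ?thesis
    using p_pos kL_props(5)[of k] by simp
qed

definition ac where "ac = em (Var 0)"
definition aa where "aa = em (Var 1)"
definition ab where "ab = em (Var 2)"
definition ag where "ag = em (Var 3)"

lemma elem_closed [simp]: "ac \<in> carrier L" "aa \<in> carrier L" "ab \<in> carrier L" "ag \<in> carrier L"
  by (simp_all add: ac_def aa_def ab_def ag_def X_closed)

lemma Var_nz: "Var i \<noteq> \<zero>\<^bsub>M\<^esub>"
  by (auto simp: xpow_def M_zero fun_eq_iff)

lemma elem_nz: "ac \<noteq> \<zero>\<^bsub>L\<^esub>" "aa \<noteq> \<zero>\<^bsub>L\<^esub>" "ab \<noteq> \<zero>\<^bsub>L\<^esub>" "ag \<noteq> \<zero>\<^bsub>L\<^esub>"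
  by (simp_all add: ac_def aa_def ab_def ag_def em_eq_zero_iff X_closed Var_nz)

lemma L_unit: "x \<in> carrier L \<Longrightarrow> x \<noteq> \<zero>\<^bsub>L\<^esub> \<Longrightarrow> x \<in> Units L" by (simp add: L.field_Units)

lemma L_inv: "x \<in> carrier L \<Longrightarrow> x \<noteq> \<zero>\<^bsub>L\<^esub> \<Longrightarrow> inv\<^bsub>L\<^esub> x \<in> carrier L"
  "x \<in> carrier L \<Longrightarrow> x \<noteq> \<zero>\<^bsub>L\<^esub> \<Longrightarrow> x \<otimes>\<^bsub>L\<^esub> inv\<^bsub>L\<^esub> x = \<one>\<^bsub>L\<^esub>"
  using L_unit by auto

lemma L_pow_nz: "x \<in> carrier L \<Longrightarrow> x \<noteq> \<zero>\<^bsub>L\<^esub> \<Longrightarrow> x [^]\<^bsub>L\<^esub> (k::nat) \<noteq> \<zero>\<^bsub>L\<^esub>"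
  by (induction k) (auto simp: D.Q.integral_iff)

text \<open>The Moore determinant of \<open>a\<close> and \<open>b\<close>. It is the determinant of
  the system \<open>b h - a k = g\<close>, \<open>b^p h - a^p k = g^p\<close>, whose second equation
  is the first with the coefficients and \<open>g\<close>, but not \<open>h\<close> and
  \<open>k\<close>, raised to the power \<open>p\<close>; Cramer's rule gives the formulas for
  \<open>h\<close> and \<open>k\<close>.\<close>

definition Delta where "Delta = aa \<otimes>\<^bsub>L\<^esub> ab [^]\<^bsub>L\<^esub> p \<ominus>\<^bsub>L\<^esub> ab \<otimes>\<^bsub>L\<^esub> aa [^]\<^bsub>L\<^esub> p"

text \<open>The place \<open>res i\<close> of the field, defined on the local ring of the prime divisor of the \<open>i\<close>-th
  variable.\<close>

definition rho where "rho i = em \<circ> set_zero i"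
definition Oi where "Oi i = D.frac_dom L (rho i)"
definition res where "res i = D.frac_map L (rho i)"

lemma rho_hom: "rho i \<in> ring_hom M L"
  unfolding rho_def by (rule ring_hom_trans[OF set_zero_hom em_hom])

lemma Oi_subring: "subring (Oi i) L"
  unfolding Oi_def by (rule D.subring_frac_dom[OF L.field_axioms rho_hom])

lemmas Oi_closed = subringE(2,3,5,6,7)[OF Oi_subring]

lemma Oi_carr: "x \<in> Oi i \<Longrightarrow> x \<in> carrier L" using subringE(1)[OF Oi_subring] by blast

lemma Oi_minus: "x \<in> Oi i \<Longrightarrow> y \<in> Oi i \<Longrightarrow> x \<ominus>\<^bsub>L\<^esub> y \<in> Oi i"
  unfolding D.Q.minus_eq using Oi_closed by blast

lemma Oi_pow: "x \<in> Oi i \<Longrightarrow> x [^]\<^bsub>L\<^esub> (k::nat) \<in> Oi i"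
  by (induction k) (auto simp: Oi_closed)

lemma Oi_fr:
  "f \<in> carrier M \<Longrightarrow> s \<in> carrier M - {\<zero>\<^bsub>M\<^esub>} \<Longrightarrow> rho i s \<noteq> \<zero>\<^bsub>L\<^esub> \<Longrightarrow> D.fr f s \<in> Oi i"
  unfolding Oi_def D.frac_dom_def by blast

lemma Oi_em: "f \<in> carrier M \<Longrightarrow> em f \<in> Oi i"
  unfolding Oi_def by (rule D.frac_dom_base[OF L.field_axioms rho_hom])

lemma res_em: "f \<in> carrier M \<Longrightarrow> res i (em f) = em (set_zero i f)"
  unfolding res_def using D.frac_map_base[OF L.field_axioms rho_hom] by (simp add: rho_def)

lemma res_closed: "x \<in> Oi i \<Longrightarrow> res i x \<in> carrier L"
  unfolding Oi_def res_def by (rule D.frac_map_closed[OF L.field_axioms rho_hom])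

lemma res_simps:
  "res i \<one>\<^bsub>L\<^esub> = \<one>\<^bsub>L\<^esub>" "res i \<zero>\<^bsub>L\<^esub> = \<zero>\<^bsub>L\<^esub>"
  "x \<in> Oi i \<Longrightarrow> y \<in> Oi i \<Longrightarrow> res i (x \<oplus>\<^bsub>L\<^esub> y) = res i x \<oplus>\<^bsub>L\<^esub> res i y"
  "x \<in> Oi i \<Longrightarrow> y \<in> Oi i \<Longrightarrow> res i (x \<otimes>\<^bsub>L\<^esub> y) = res i x \<otimes>\<^bsub>L\<^esub> res i y"
  "x \<in> Oi i \<Longrightarrow> res i (\<ominus>\<^bsub>L\<^esub> x) = \<ominus>\<^bsub>L\<^esub> res i x"
  "x \<in> Oi i \<Longrightarrow> res i (x [^]\<^bsub>L\<^esub> (k::nat)) = res i x [^]\<^bsub>L\<^esub> k"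
  unfolding Oi_def res_def
  using D.frac_map_one_zero[OF L.field_axioms rho_hom] D.frac_map_add[OF L.field_axioms rho_hom]
    D.frac_map_mult[OF L.field_axioms rho_hom] D.frac_map_uminus[OF L.field_axioms rho_hom]
    D.frac_map_pow[OF L.field_axioms rho_hom] by blast+

lemma res_minus: "x \<in> Oi i \<Longrightarrow> y \<in> Oi i \<Longrightarrow> res i (x \<ominus>\<^bsub>L\<^esub> y) = res i x \<ominus>\<^bsub>L\<^esub> res i y"
  unfolding D.Q.minus_eq using res_simps(3,5) Oi_closed(3) by simp

lemma res_inv:
  assumes "x \<in> Oi i" "res i x \<noteq> \<zero>\<^bsub>L\<^esub>"
  shows "inv\<^bsub>L\<^esub> x \<in> Oi i" "res i (inv\<^bsub>L\<^esub> x) = inv\<^bsub>L\<^esub> res i x"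
proof -
  have "x \<noteq> \<zero>\<^bsub>L\<^esub>" using assms(2) res_simps(2) by auto
  then have 1: "inv\<^bsub>L\<^esub> x \<in> carrier L" "x \<otimes>\<^bsub>L\<^esub> inv\<^bsub>L\<^esub> x = \<one>\<^bsub>L\<^esub>" using L_inv Oi_carr[OF assms(1)] by auto
  show "inv\<^bsub>L\<^esub> x \<in> Oi i" "res i (inv\<^bsub>L\<^esub> x) = inv\<^bsub>L\<^esub> res i x"
    unfolding Oi_def res_def
    by (rule D.frac_map_inverse[OF L.field_axioms rho_hom refl assms[unfolded Oi_def res_def] 1])+
qed

definition mi where "mi i = {x \<in> Oi i. res i x = \<zero>\<^bsub>L\<^esub>}"

lemma mi_prime: "D.Q.prime_of (Oi i) (mi i)"
  unfolding mi_def Oi_def res_def by (rule D.prime_frac_ker[OF L.field_axioms rho_hom])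

text \<open>Taking powers of the variable out of numerator and denominator leaves two factors prime
  to it. Outside \<open>Oi i\<close> the denominator carries the higher power, so the inverse
  vanishes at the place.\<close>

lemma Oi_valuation:
  assumes i: "i < 4" and x: "x \<in> carrier L" "x \<notin> Oi i"
  shows "inv\<^bsub>L\<^esub> x \<in> mi i"
proof -
  obtain f s where fs: "f \<in> carrier M" "s \<in> carrier M" "s \<noteq> \<zero>\<^bsub>M\<^esub>" "x = D.fr f s" using x(1) by (rule L_cases)
  have X: "Var i \<in> carrier M" by (rule X_closed[OF i])
  have Xp: "Var i [^]\<^bsub>M\<^esub> (k::nat) \<in> carrier M - {\<zero>\<^bsub>M\<^esub>}" for k
    by (induction k) (use X Var_nz in \<open>auto simp: M.integral_iff\<close>)
  have "x \<noteq> \<zero>\<^bsub>L\<^esub>" using x(2) Oi_closed(1) by blast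
  then have f0: "f \<noteq> \<zero>\<^bsub>M\<^esub>" using fs D.fr_eq_zero_iff by auto
  obtain k f' where f': "f' \<in> carrier M" "f = Var i [^]\<^bsub>M\<^esub> (k::nat) \<otimes>\<^bsub>M\<^esub> f'" "set_zero i f' \<noteq> \<zero>\<^bsub>M\<^esub>"
    using factor_var_power[OF fs(1) f0 i] by blast
  obtain l s' where s': "s' \<in> carrier M" "s = Var i [^]\<^bsub>M\<^esub> (l::nat) \<otimes>\<^bsub>M\<^esub> s'" "set_zero i s' \<noteq> \<zero>\<^bsub>M\<^esub>"
    using factor_var_power[OF fs(2,3) i] by blast
  have f'S: "f' \<in> carrier M - {\<zero>\<^bsub>M\<^esub>}" and s'S: "s' \<in> carrier M - {\<zero>\<^bsub>M\<^esub>}"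
    using f' s' f0 fs(3) Xp[of k] Xp[of l] by (auto simp: M.integral_iff)
  have r: "rho i f' \<noteq> \<zero>\<^bsub>L\<^esub>" "rho i s' \<noteq> \<zero>\<^bsub>L\<^esub>"
    unfolding rho_def using f' s' set_zero_closed by (simp_all add: em_eq_zero_iff)
  have split: "D.fr (Var i [^]\<^bsub>M\<^esub> m \<otimes>\<^bsub>M\<^esub> v) (Var i [^]\<^bsub>M\<^esub> n \<otimes>\<^bsub>M\<^esub> w) = D.fr (Var i [^]\<^bsub>M\<^esub> (m - n) \<otimes>\<^bsub>M\<^esub> v) w"
    if "v \<in> carrier M" "w \<in> carrier M - {\<zero>\<^bsub>M\<^esub>}" "n \<le> m" for m n :: nat and v w
  proof (subst D.fr_eq_iff)
    have "Var i [^]\<^bsub>M\<^esub> m = Var i [^]\<^bsub>M\<^esub> (m - n) \<otimes>\<^bsub>M\<^esub> Var i [^]\<^bsub>M\<^esub> n" using X that(3) by (simp add: M.nat_pow_mult)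
    then show "Var i [^]\<^bsub>M\<^esub> m \<otimes>\<^bsub>M\<^esub> v \<otimes>\<^bsub>M\<^esub> w = Var i [^]\<^bsub>M\<^esub> (m - n) \<otimes>\<^bsub>M\<^esub> v \<otimes>\<^bsub>M\<^esub> (Var i [^]\<^bsub>M\<^esub> n \<otimes>\<^bsub>M\<^esub> w)"
      using that X by (simp add: M.m_ac)
  qed (use that X Xp[of n] in \<open>auto simp: M.integral_iff\<close>)
  have "\<not> l \<le> k"
  proof
    assume "l \<le> k"
    then have "x = D.fr (Var i [^]\<^bsub>M\<^esub> (k - l) \<otimes>\<^bsub>M\<^esub> f') s'" unfolding fs(4) f'(2) s'(2) using f' s'S by (intro split)
    then show False using x(2) Oi_fr[OF _ s'S r(2)] f'(1) X by simp
  qed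
  then have kl: "k < l" by simp
  have fS: "f \<in> carrier M - {\<zero>\<^bsub>M\<^esub>}" "s \<in> carrier M - {\<zero>\<^bsub>M\<^esub>}" using fs f0 by auto
  have xi: "x \<otimes>\<^bsub>L\<^esub> D.fr s f = \<one>\<^bsub>L\<^esub>" "D.fr s f \<in> carrier L"
    unfolding fs(4) using D.fr_inverse[OF fS] D.fr_closed fS by auto
  then have "inv\<^bsub>L\<^esub> x = D.fr s f" using x(1) by (intro D.Q.comm_inv_char) auto
  also have "\<dots> = D.fr (Var i [^]\<^bsub>M\<^esub> (l - k) \<otimes>\<^bsub>M\<^esub> s') f'"
    unfolding f'(2) s'(2) using s'(1) f'S kl by (intro split) auto
  finally have ix: "inv\<^bsub>L\<^esub> x = D.fr (Var i [^]\<^bsub>M\<^esub> (l - k) \<otimes>\<^bsub>M\<^esub> s') f'" .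
  have "l - k = Suc (l - k - 1)" using kl by simp
  then obtain j where j: "l - k = Suc j" by blast
  let ?n = "Var i [^]\<^bsub>M\<^esub> (l - k) \<otimes>\<^bsub>M\<^esub> s'"
  have nc: "?n \<in> carrier M" using X s' by simp
  have "?n = Var i \<otimes>\<^bsub>M\<^esub> (Var i [^]\<^bsub>M\<^esub> j \<otimes>\<^bsub>M\<^esub> s')" unfolding j using X s' by (simp add: M.m_ac)
  then have "set_zero i ?n = \<zero>\<^bsub>M\<^esub>" using set_zero_eq_zero_iff[OF nc i] X s' by blast
  then have "rho i ?n = \<zero>\<^bsub>L\<^esub>" by (simp add: rho_def em_simps)
  then have "res i (inv\<^bsub>L\<^esub> x) = \<zero>\<^bsub>L\<^esub>" unfolding ix res_def
    using D.frac_map_fr[OF L.field_axioms rho_hom nc f'S r(1)] L_inv(1)[OF _ r(1)] ring_hom_closed[OF rho_hom f'(1)]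
    by simp
  moreover have "inv\<^bsub>L\<^esub> x \<in> Oi i" unfolding ix by (rule Oi_fr[OF nc f'S r(1)])
  ultimately show ?thesis unfolding mi_def by blast
qed

end

section \<open>The elements \<open>h\<close>, \<open>k\<close>, \<open>u\<close> and their values at
  the places\<close>

context fp_mpoly4
begin

lemma res_Var: "i < 4 \<Longrightarrow> j < 4 \<Longrightarrow> res i (em (Var j)) = (if i = j then \<zero>\<^bsub>L\<^esub> else em (Var j))"
  by (simp add: res_em X_closed set_zero_X em_simps)

lemma mi_factor:
  assumes i: "i < 4" and x: "x \<in> mi i"
  obtains y where "y \<in> Oi i" "x = em (Var i) \<otimes>\<^bsub>L\<^esub> y"
proof -
  have "x \<in> Oi i" and r: "res i x = \<zero>\<^bsub>L\<^esub>" using x by (simp_all add: mi_def)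
  then obtain f s where fs: "f \<in> carrier M" "s \<in> carrier M - {\<zero>\<^bsub>M\<^esub>}" "rho i s \<noteq> \<zero>\<^bsub>L\<^esub>" "x = D.fr f s"
    unfolding Oi_def D.frac_dom_def by blast
  have rc: "rho i f \<in> carrier L" "rho i s \<in> carrier L" using ring_hom_closed[OF rho_hom] fs by auto
  have "rho i f \<otimes>\<^bsub>L\<^esub> inv\<^bsub>L\<^esub> rho i s = \<zero>\<^bsub>L\<^esub>"
    using r D.frac_map_fr[OF L.field_axioms rho_hom fs(1-3)] unfolding fs(4) res_def by simp
  then have "rho i f = \<zero>\<^bsub>L\<^esub>"
    using rc L_inv[OF rc(2) fs(3)] D.Q.one_not_zero by (metis D.Q.integral D.Q.r_null)
  then have "set_zero i f = \<zero>\<^bsub>M\<^esub>" using set_zero_closed[OF fs(1)] by (simp add: rho_def em_eq_zero_iff)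
  then obtain f' where f': "f' \<in> carrier M" "f = Var i \<otimes>\<^bsub>M\<^esub> f'" using set_zero_eq_zero_iff[OF fs(1) i] by blast
  have "D.fr (Var i) \<one>\<^bsub>M\<^esub> \<otimes>\<^bsub>L\<^esub> D.fr f' s = D.fr f s"
    using D.fr_mult[of "Var i" "\<one>\<^bsub>M\<^esub>" f' s] X_closed[OF i] fs f' D.S_one by simp
  then show ?thesis using that[OF Oi_fr[OF f'(1) fs(2,3)]] fs(4) by simp
qed

text \<open>The residue field of \<open>res i\<close> lies inside \<open>L\<close>, as the functions
  free of the \<open>i\<close>-th variable; these are the fixed points of the place.\<close>

definition fx where "fx i = {x \<in> Oi i. res i x = x}"

lemma fx_D: "x \<in> fx i \<Longrightarrow> x \<in> Oi i" "x \<in> fx i \<Longrightarrow> res i x = x" by (auto simp: fx_def)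

lemma fx_mult: "x \<in> fx i \<Longrightarrow> y \<in> fx i \<Longrightarrow> x \<otimes>\<^bsub>L\<^esub> y \<in> fx i"
  by (simp add: fx_def res_simps Oi_closed)

lemma fx_minus: "x \<in> fx i \<Longrightarrow> y \<in> fx i \<Longrightarrow> x \<ominus>\<^bsub>L\<^esub> y \<in> fx i"
  by (simp add: fx_def res_minus Oi_minus)

lemma fx_pow: "x \<in> fx i \<Longrightarrow> x [^]\<^bsub>L\<^esub> (k::nat) \<in> fx i"
  by (simp add: fx_def res_simps Oi_pow)

lemma fx_inv: "x \<in> fx i \<Longrightarrow> x \<noteq> \<zero>\<^bsub>L\<^esub> \<Longrightarrow> inv\<^bsub>L\<^esub> x \<in> fx i"
  using res_inv[of x i] by (simp add: fx_def)

lemma fx_Var: "i < 4 \<Longrightarrow> j < 4 \<Longrightarrow> i \<noteq> j \<Longrightarrow> em (Var j) \<in> fx i"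
  by (simp add: fx_def Oi_em X_closed res_Var)

lemma Delta_closed [simp]: "Delta \<in> carrier L" by (simp add: Delta_def)

lemma p_gt1: "p > 1" using prime_p prime_gt_1_nat by blast

text \<open>Supplies the exponent \<open>p - 1\<close> without subtraction.\<close>

lemma p_pred: "\<exists>n::nat. n > 0 \<and> (\<forall>x. x [^]\<^bsub>L\<^esub> p = x [^]\<^bsub>L\<^esub> n \<otimes>\<^bsub>L\<^esub> x)"
proof -
  obtain n where n: "p = Suc n" "n > 0" using p_gt1 by (cases p) auto
  have "x [^]\<^bsub>L\<^esub> p = x [^]\<^bsub>L\<^esub> n \<otimes>\<^bsub>L\<^esub> x" for x by (rule D.Q.nat_pow_Suc[of x n, folded n(1)])
  then show ?thesis using n(2) by blast
qed

text \<open>If the determinant vanished, cancelling \<open>a b\<close> would give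
  \<open>b^(p-1) = a^(p-1)\<close>; at the place \<open>a = 0\<close> the right side vanishes while
  \<open>b\<close> is its own residue.\<close>

lemma Delta_nz: "Delta \<noteq> \<zero>\<^bsub>L\<^esub>"
proof
  obtain n :: nat where n: "n > 0" "\<And>x. x [^]\<^bsub>L\<^esub> p = x [^]\<^bsub>L\<^esub> n \<otimes>\<^bsub>L\<^esub> x" using p_pred by blast
  assume "Delta = \<zero>\<^bsub>L\<^esub>"
  then have "aa \<otimes>\<^bsub>L\<^esub> ab [^]\<^bsub>L\<^esub> p = ab \<otimes>\<^bsub>L\<^esub> aa [^]\<^bsub>L\<^esub> p"
    unfolding Delta_def by (simp add: D.Q.r_right_minus_eq)
  then have "(aa \<otimes>\<^bsub>L\<^esub> ab) \<otimes>\<^bsub>L\<^esub> ab [^]\<^bsub>L\<^esub> n = (aa \<otimes>\<^bsub>L\<^esub> ab) \<otimes>\<^bsub>L\<^esub> aa [^]\<^bsub>L\<^esub> n" unfolding n(2) by (simp add: D.Q.m_ac)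
  then have e: "ab [^]\<^bsub>L\<^esub> n = aa [^]\<^bsub>L\<^esub> n"
    using D.Q.m_lcancel[of "aa \<otimes>\<^bsub>L\<^esub> ab" "ab [^]\<^bsub>L\<^esub> n" "aa [^]\<^bsub>L\<^esub> n"] elem_nz by (simp add: D.Q.integral_iff)
  have "ab \<in> fx 1" "aa \<in> Oi 1" unfolding ab_def aa_def by (simp_all add: fx_Var Oi_em X_closed)
  moreover have "res 1 aa = \<zero>\<^bsub>L\<^esub>" unfolding aa_def by (simp add: res_Var)
  ultimately have "ab [^]\<^bsub>L\<^esub> n = \<zero>\<^bsub>L\<^esub> [^]\<^bsub>L\<^esub> n"
    using arg_cong[OF e, of "res 1"] by (simp add: res_simps fx_D)
  then show False using n(1) L_pow_nz[of ab n] elem_nz by (simp add: D.Q.nat_pow_zero)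
qed

definition di where "di = inv\<^bsub>L\<^esub> Delta"
definition ia where "ia = inv\<^bsub>L\<^esub> (aa [^]\<^bsub>L\<^esub> p)"
definition ah where "ah = (aa \<otimes>\<^bsub>L\<^esub> ag [^]\<^bsub>L\<^esub> p \<ominus>\<^bsub>L\<^esub> aa [^]\<^bsub>L\<^esub> p \<otimes>\<^bsub>L\<^esub> ag) \<otimes>\<^bsub>L\<^esub> di"
definition ak where "ak = (ab \<otimes>\<^bsub>L\<^esub> ag [^]\<^bsub>L\<^esub> p \<ominus>\<^bsub>L\<^esub> ab [^]\<^bsub>L\<^esub> p \<otimes>\<^bsub>L\<^esub> ag) \<otimes>\<^bsub>L\<^esub> di"
definition au where "au = (ah [^]\<^bsub>L\<^esub> p \<ominus>\<^bsub>L\<^esub> ah) \<otimes>\<^bsub>L\<^esub> ia"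

lemma inverses: "di \<in> carrier L" "Delta \<otimes>\<^bsub>L\<^esub> di = \<one>\<^bsub>L\<^esub>" "ia \<in> carrier L" "aa [^]\<^bsub>L\<^esub> p \<otimes>\<^bsub>L\<^esub> ia = \<one>\<^bsub>L\<^esub>"
  unfolding di_def ia_def using L_inv[OF Delta_closed Delta_nz] L_inv[OF _ L_pow_nz[of aa p]] elem_nz by auto

lemma hk_closed [simp]: "ah \<in> carrier L" "ak \<in> carrier L" "au \<in> carrier L"
  using inverses by (simp_all add: ah_def ak_def au_def)

text \<open>Cramer's rule before the factor \<open>(x y' - y x') d\<close> is set to 1. The letters
  \<open>x', y', w\<close> stand for \<open>p\<close>-th powers but are kept independent, which
  makes both claims plain polynomial identities.\<close>

lemma combination:
  assumes "x \<in> carrier L" "y \<in> carrier L" "x' \<in> carrier L" "y' \<in> carrier L" "v \<in> carrier L" "w \<in> carrier L" "d \<in> carrier L"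
  shows "y \<otimes>\<^bsub>L\<^esub> ((x \<otimes>\<^bsub>L\<^esub> w \<ominus>\<^bsub>L\<^esub> x' \<otimes>\<^bsub>L\<^esub> v) \<otimes>\<^bsub>L\<^esub> d) \<ominus>\<^bsub>L\<^esub> x \<otimes>\<^bsub>L\<^esub> ((y \<otimes>\<^bsub>L\<^esub> w \<ominus>\<^bsub>L\<^esub> y' \<otimes>\<^bsub>L\<^esub> v) \<otimes>\<^bsub>L\<^esub> d) = ((x \<otimes>\<^bsub>L\<^esub> y' \<ominus>\<^bsub>L\<^esub> y \<otimes>\<^bsub>L\<^esub> x') \<otimes>\<^bsub>L\<^esub> d) \<otimes>\<^bsub>L\<^esub> v"
    "y' \<otimes>\<^bsub>L\<^esub> ((x \<otimes>\<^bsub>L\<^esub> w \<ominus>\<^bsub>L\<^esub> x' \<otimes>\<^bsub>L\<^esub> v) \<otimes>\<^bsub>L\<^esub> d) \<ominus>\<^bsub>L\<^esub> x' \<otimes>\<^bsub>L\<^esub> ((y \<otimes>\<^bsub>L\<^esub> w \<ominus>\<^bsub>L\<^esub> y' \<otimes>\<^bsub>L\<^esub> v) \<otimes>\<^bsub>L\<^esub> d) = ((x \<otimes>\<^bsub>L\<^esub> y' \<ominus>\<^bsub>L\<^esub> y \<otimes>\<^bsub>L\<^esub> x') \<otimes>\<^bsub>L\<^esub> d) \<otimes>\<^bsub>L\<^esub> w"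
  using assms by (elim D.Q.rep_cases; simp add: D.Q.rep_hom algebra_simps)+

lemma hk_relation:
  "ab \<otimes>\<^bsub>L\<^esub> ah \<ominus>\<^bsub>L\<^esub> aa \<otimes>\<^bsub>L\<^esub> ak = ag" "ab [^]\<^bsub>L\<^esub> p \<otimes>\<^bsub>L\<^esub> ah \<ominus>\<^bsub>L\<^esub> aa [^]\<^bsub>L\<^esub> p \<otimes>\<^bsub>L\<^esub> ak = ag [^]\<^bsub>L\<^esub> p"
  using combination[of aa ab "aa [^]\<^bsub>L\<^esub> p" "ab [^]\<^bsub>L\<^esub> p" ag "ag [^]\<^bsub>L\<^esub> p" di] inverses
  unfolding ah_def[symmetric] ak_def[symmetric] Delta_def[symmetric] by simp_all

text \<open>The \<open>p\<close>-th power of the first equation of \<open>hk_relation\<close> has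
  the same right side as the second equation. Subtracting gives
  \<open>b^p (h^p - h) = a^p (k^p - k)\<close>, so both quotients define the same
  \<open>u\<close>.\<close>

lemma au_relation:
  "aa [^]\<^bsub>L\<^esub> p \<otimes>\<^bsub>L\<^esub> au = ah [^]\<^bsub>L\<^esub> p \<ominus>\<^bsub>L\<^esub> ah" "ab [^]\<^bsub>L\<^esub> p \<otimes>\<^bsub>L\<^esub> au = ak [^]\<^bsub>L\<^esub> p \<ominus>\<^bsub>L\<^esub> ak"
proof -
  have c: "aa [^]\<^bsub>L\<^esub> p \<in> carrier L" "ab [^]\<^bsub>L\<^esub> p \<in> carrier L" "ah [^]\<^bsub>L\<^esub> p \<in> carrier L" "ak [^]\<^bsub>L\<^esub> p \<in> carrier L" by simp_all
  show 1: "aa [^]\<^bsub>L\<^esub> p \<otimes>\<^bsub>L\<^esub> au = ah [^]\<^bsub>L\<^esub> p \<ominus>\<^bsub>L\<^esub> ah"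
  proof -
    have "aa [^]\<^bsub>L\<^esub> p \<otimes>\<^bsub>L\<^esub> au = (aa [^]\<^bsub>L\<^esub> p \<otimes>\<^bsub>L\<^esub> ia) \<otimes>\<^bsub>L\<^esub> (ah [^]\<^bsub>L\<^esub> p \<ominus>\<^bsub>L\<^esub> ah)"
      unfolding au_def using inverses(3) by (simp add: D.Q.m_ac)
    then show ?thesis using inverses(4) by simp
  qed
  have "(ab \<otimes>\<^bsub>L\<^esub> ah \<ominus>\<^bsub>L\<^esub> aa \<otimes>\<^bsub>L\<^esub> ak) [^]\<^bsub>L\<^esub> p = ab [^]\<^bsub>L\<^esub> p \<otimes>\<^bsub>L\<^esub> ah [^]\<^bsub>L\<^esub> p \<ominus>\<^bsub>L\<^esub> aa [^]\<^bsub>L\<^esub> p \<otimes>\<^bsub>L\<^esub> ak [^]\<^bsub>L\<^esub> p"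
    using L_frob_minus[of "ab \<otimes>\<^bsub>L\<^esub> ah" "aa \<otimes>\<^bsub>L\<^esub> ak"] by (simp add: D.Q.nat_pow_distrib)
  then have "ab [^]\<^bsub>L\<^esub> p \<otimes>\<^bsub>L\<^esub> ah [^]\<^bsub>L\<^esub> p \<ominus>\<^bsub>L\<^esub> aa [^]\<^bsub>L\<^esub> p \<otimes>\<^bsub>L\<^esub> ak [^]\<^bsub>L\<^esub> p = ab [^]\<^bsub>L\<^esub> p \<otimes>\<^bsub>L\<^esub> ah \<ominus>\<^bsub>L\<^esub> aa [^]\<^bsub>L\<^esub> p \<otimes>\<^bsub>L\<^esub> ak"
    using hk_relation by simp
  moreover have "ab [^]\<^bsub>L\<^esub> p \<otimes>\<^bsub>L\<^esub> (ah [^]\<^bsub>L\<^esub> p \<ominus>\<^bsub>L\<^esub> ah) = aa [^]\<^bsub>L\<^esub> p \<otimes>\<^bsub>L\<^esub> (ak [^]\<^bsub>L\<^esub> p \<ominus>\<^bsub>L\<^esub> ak) \<oplus>\<^bsub>L\<^esub>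
      ((ab [^]\<^bsub>L\<^esub> p \<otimes>\<^bsub>L\<^esub> ah [^]\<^bsub>L\<^esub> p \<ominus>\<^bsub>L\<^esub> aa [^]\<^bsub>L\<^esub> p \<otimes>\<^bsub>L\<^esub> ak [^]\<^bsub>L\<^esub> p) \<ominus>\<^bsub>L\<^esub> (ab [^]\<^bsub>L\<^esub> p \<otimes>\<^bsub>L\<^esub> ah \<ominus>\<^bsub>L\<^esub> aa [^]\<^bsub>L\<^esub> p \<otimes>\<^bsub>L\<^esub> ak))"
    using c hk_closed(1,2) by (elim D.Q.rep_cases) (simp add: D.Q.rep_hom algebra_simps)
  ultimately have 2: "ab [^]\<^bsub>L\<^esub> p \<otimes>\<^bsub>L\<^esub> (ah [^]\<^bsub>L\<^esub> p \<ominus>\<^bsub>L\<^esub> ah) = aa [^]\<^bsub>L\<^esub> p \<otimes>\<^bsub>L\<^esub> (ak [^]\<^bsub>L\<^esub> p \<ominus>\<^bsub>L\<^esub> ak)"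
    by (simp add: D.Q.r_right_minus_eq)
  have "aa [^]\<^bsub>L\<^esub> p \<otimes>\<^bsub>L\<^esub> (ab [^]\<^bsub>L\<^esub> p \<otimes>\<^bsub>L\<^esub> au) = ab [^]\<^bsub>L\<^esub> p \<otimes>\<^bsub>L\<^esub> (aa [^]\<^bsub>L\<^esub> p \<otimes>\<^bsub>L\<^esub> au)" by (simp add: D.Q.m_ac)
  also have "\<dots> = aa [^]\<^bsub>L\<^esub> p \<otimes>\<^bsub>L\<^esub> (ak [^]\<^bsub>L\<^esub> p \<ominus>\<^bsub>L\<^esub> ak)" unfolding 1 by (rule 2)
  finally show "ab [^]\<^bsub>L\<^esub> p \<otimes>\<^bsub>L\<^esub> au = ak [^]\<^bsub>L\<^esub> p \<ominus>\<^bsub>L\<^esub> ak"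
    using D.Q.m_lcancel[of "aa [^]\<^bsub>L\<^esub> p"] L_pow_nz[of aa p] elem_nz by simp
qed

text \<open>None of these involves \<open>c\<close>; in particular \<open>u\<close> is its own
  residue at the \<open>c\<close>-adic place.\<close>

lemma fx0: "aa \<in> fx 0" "ab \<in> fx 0" "ag \<in> fx 0" "ah \<in> fx 0" "ak \<in> fx 0" "au \<in> fx 0"
proof -
  show 1: "aa \<in> fx 0" "ab \<in> fx 0" "ag \<in> fx 0" unfolding aa_def ab_def ag_def by (simp_all add: fx_Var)
  have "Delta \<in> fx 0" unfolding Delta_def by (intro fx_minus fx_mult fx_pow 1)
  then have di: "di \<in> fx 0" unfolding di_def by (rule fx_inv[OF _ Delta_nz])
  show h: "ah \<in> fx 0" "ak \<in> fx 0" unfolding ah_def ak_def by (intro fx_minus fx_mult fx_pow 1 di)+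
  have "ia \<in> fx 0" unfolding ia_def using elem_nz by (intro fx_inv fx_pow 1 L_pow_nz) auto
  then show "au \<in> fx 0" unfolding au_def by (intro fx_minus fx_mult fx_pow h)
qed

lemma fx3: "ac \<in> fx 3" "aa \<in> fx 3" "ab \<in> fx 3" "Delta \<in> fx 3" "di \<in> fx 3" "ia \<in> fx 3"
proof -
  show 1: "ac \<in> fx 3" "aa \<in> fx 3" "ab \<in> fx 3" unfolding ac_def aa_def ab_def by (simp_all add: fx_Var)
  show "Delta \<in> fx 3" unfolding Delta_def by (intro fx_minus fx_mult fx_pow 1)
  then show "di \<in> fx 3" unfolding di_def by (rule fx_inv[OF _ Delta_nz])
  show "ia \<in> fx 3" unfolding ia_def using elem_nz by (intro fx_inv fx_pow 1 L_pow_nz) auto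
qed

text \<open>Factor \<open>h = g h1\<close>, where \<open>h1\<close> has residue
  \<open>-a^p / \<Delta>\<close> at \<open>g = 0\<close>. In \<open>h^p - h\<close> the linear term
  dominates, so \<open>u = g u1\<close> where \<open>u1\<close> has residue
  \<open>1 / \<Delta>\<close>.\<close>

lemma au_order:
  obtains u1 where "u1 \<in> Oi 3" "au = ag \<otimes>\<^bsub>L\<^esub> u1" "res 3 u1 \<noteq> \<zero>\<^bsub>L\<^esub>"
proof -
  obtain n :: nat where n: "n > 0" "\<And>x. x [^]\<^bsub>L\<^esub> p = x [^]\<^bsub>L\<^esub> n \<otimes>\<^bsub>L\<^esub> x" using p_pred by blast
  define h1 where "h1 = (aa \<otimes>\<^bsub>L\<^esub> ag [^]\<^bsub>L\<^esub> n \<ominus>\<^bsub>L\<^esub> aa [^]\<^bsub>L\<^esub> p) \<otimes>\<^bsub>L\<^esub> di"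
  define u1 where "u1 = (ag [^]\<^bsub>L\<^esub> n \<otimes>\<^bsub>L\<^esub> h1 [^]\<^bsub>L\<^esub> p \<ominus>\<^bsub>L\<^esub> h1) \<otimes>\<^bsub>L\<^esub> ia"
  have g: "ag \<in> Oi 3" "res 3 ag = \<zero>\<^bsub>L\<^esub>" unfolding ag_def by (simp_all add: Oi_em X_closed res_Var)
  have gn: "ag [^]\<^bsub>L\<^esub> n \<in> Oi 3" "res 3 (ag [^]\<^bsub>L\<^esub> n) = \<zero>\<^bsub>L\<^esub>"
    using g n(1) by (simp_all add: Oi_pow res_simps D.Q.nat_pow_zero)
  have O: "aa \<in> Oi 3" "aa [^]\<^bsub>L\<^esub> p \<in> Oi 3" "di \<in> Oi 3" "ia \<in> Oi 3" using fx3 fx_pow[of aa 3 p] fx_D(1) by blast+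
  have R: "res 3 aa = aa" "res 3 (aa [^]\<^bsub>L\<^esub> p) = aa [^]\<^bsub>L\<^esub> p" "res 3 di = di" "res 3 ia = ia"
    using fx3 fx_pow[of aa 3 p] fx_D(2) by blast+
  have h1: "h1 \<in> Oi 3" unfolding h1_def using O gn by (intro Oi_closed Oi_minus)
  have rh1: "res 3 h1 = (\<zero>\<^bsub>L\<^esub> \<ominus>\<^bsub>L\<^esub> aa [^]\<^bsub>L\<^esub> p) \<otimes>\<^bsub>L\<^esub> di"
    unfolding h1_def using O R gn by (simp add: res_simps res_minus Oi_closed Oi_minus)
  have u1: "u1 \<in> Oi 3" unfolding u1_def by (intro Oi_closed(4) Oi_minus gn(1) Oi_pow[OF h1] h1 O(4))
  have h1c: "h1 \<in> carrier L" "ag [^]\<^bsub>L\<^esub> n \<in> carrier L" "aa [^]\<^bsub>L\<^esub> p \<in> carrier L" using Oi_carr[OF h1] by simp_all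
  have c: "ag \<in> carrier L" "aa \<in> carrier L" "di \<in> carrier L" "ia \<in> carrier L" using inverses by simp_all
  have "res 3 u1 = (\<zero>\<^bsub>L\<^esub> \<ominus>\<^bsub>L\<^esub> res 3 h1) \<otimes>\<^bsub>L\<^esub> ia"
    unfolding u1_def using O R gn h1 res_closed[OF h1] by (simp add: res_simps res_minus Oi_closed Oi_minus Oi_pow)
  also have "\<dots> = (aa [^]\<^bsub>L\<^esub> p \<otimes>\<^bsub>L\<^esub> ia) \<otimes>\<^bsub>L\<^esub> di"
    unfolding rh1 using c h1c(3) by (elim D.Q.rep_cases) (simp add: D.Q.rep_hom algebra_simps)
  finally have "res 3 u1 = di" using inverses by simp
  then have r: "res 3 u1 \<noteq> \<zero>\<^bsub>L\<^esub>" using inverses(1,2) D.Q.one_not_zero by auto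
  have h: "ah = ag \<otimes>\<^bsub>L\<^esub> h1"
    unfolding ah_def h1_def using c h1c(2,3) unfolding n(2)[of ag]
    by (elim D.Q.rep_cases) (simp add: D.Q.rep_hom algebra_simps)
  have hp: "h1 [^]\<^bsub>L\<^esub> p \<in> carrier L" using h1c by simp
  have "ah [^]\<^bsub>L\<^esub> p = (ag [^]\<^bsub>L\<^esub> n \<otimes>\<^bsub>L\<^esub> ag) \<otimes>\<^bsub>L\<^esub> h1 [^]\<^bsub>L\<^esub> p"
    unfolding h n(2)[of ag, symmetric] using c h1c by (simp add: D.Q.nat_pow_distrib)
  moreover have "((ag [^]\<^bsub>L\<^esub> n \<otimes>\<^bsub>L\<^esub> ag) \<otimes>\<^bsub>L\<^esub> h1 [^]\<^bsub>L\<^esub> p \<ominus>\<^bsub>L\<^esub> ag \<otimes>\<^bsub>L\<^esub> h1) \<otimes>\<^bsub>L\<^esub> ia = ag \<otimes>\<^bsub>L\<^esub> ((ag [^]\<^bsub>L\<^esub> n \<otimes>\<^bsub>L\<^esub> h1 [^]\<^bsub>L\<^esub> p \<ominus>\<^bsub>L\<^esub> h1) \<otimes>\<^bsub>L\<^esub> ia)"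
    using c h1c(1,2) hp by (elim D.Q.rep_cases) (simp add: D.Q.rep_hom algebra_simps)
  ultimately have "au = ag \<otimes>\<^bsub>L\<^esub> u1" unfolding au_def u1_def using h by simp
  then show ?thesis using that u1 r by blast
qed

lemma res_au: "au \<in> Oi 3" "res 3 au = \<zero>\<^bsub>L\<^esub>"
proof -
  obtain u1 where u1: "u1 \<in> Oi 3" "au = ag \<otimes>\<^bsub>L\<^esub> u1" by (rule au_order)
  have g: "ag \<in> Oi 3" "res 3 ag = \<zero>\<^bsub>L\<^esub>" unfolding ag_def by (simp_all add: Oi_em X_closed res_Var)
  show "au \<in> Oi 3" "res 3 au = \<zero>\<^bsub>L\<^esub>" unfolding u1(2) using u1(1) g res_closed[OF u1(1)] by (simp_all add: Oi_closed res_simps)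
qed

lemma au_nz: "au \<noteq> \<zero>\<^bsub>L\<^esub>"
proof
  obtain u1 where u1: "u1 \<in> Oi 3" "au = ag \<otimes>\<^bsub>L\<^esub> u1" "res 3 u1 \<noteq> \<zero>\<^bsub>L\<^esub>" by (rule au_order)
  assume "au = \<zero>\<^bsub>L\<^esub>"
  then have "u1 = \<zero>\<^bsub>L\<^esub>" using u1(2) Oi_carr[OF u1(1)] elem_nz by (simp add: D.Q.integral_iff)
  then show False using u1(3) res_simps(2) by simp
qed

text \<open>The order of a \<open>p\<close>-th power at \<open>g = 0\<close> is a multiple of
  \<open>p\<close>, that of \<open>u\<close> is 1. Concretely, a root is integral at the place and
  divisible by \<open>g\<close>, which would make the unit \<open>u1\<close> divisible by
  \<open>g^(p-1)\<close>.\<close>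

lemma au_no_root:
  assumes w: "w \<in> carrier L" shows "w [^]\<^bsub>L\<^esub> p \<noteq> au"
proof
  assume e: "w [^]\<^bsub>L\<^esub> p = au"
  obtain n :: nat where n: "n > 0" "\<And>x. x [^]\<^bsub>L\<^esub> p = x [^]\<^bsub>L\<^esub> n \<otimes>\<^bsub>L\<^esub> x" using p_pred by blast
  have wO: "w \<in> Oi 3"
  proof (rule ccontr)
    assume not: "w \<notin> Oi 3"
    have im: "inv\<^bsub>L\<^esub> w \<in> mi 3" by (rule Oi_valuation[OF _ w not]) simp
    then have iO: "inv\<^bsub>L\<^esub> w \<in> Oi 3" "res 3 (inv\<^bsub>L\<^esub> w) = \<zero>\<^bsub>L\<^esub>" by (simp_all add: mi_def)
    have "w \<noteq> \<zero>\<^bsub>L\<^esub>"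
    proof
      assume "w = \<zero>\<^bsub>L\<^esub>"
      then have "w [^]\<^bsub>L\<^esub> p = \<zero>\<^bsub>L\<^esub>" using p_pos by (simp add: D.Q.nat_pow_zero)
      then show False using e au_nz by simp
    qed
    then have "inv\<^bsub>L\<^esub> w \<otimes>\<^bsub>L\<^esub> w = \<one>\<^bsub>L\<^esub>" using L_inv[OF w] Oi_carr[OF iO(1)] w by (simp add: D.Q.m_comm)
    then have "(inv\<^bsub>L\<^esub> w) [^]\<^bsub>L\<^esub> p \<otimes>\<^bsub>L\<^esub> w [^]\<^bsub>L\<^esub> p = \<one>\<^bsub>L\<^esub>"
      using Oi_carr[OF iO(1)] w by (metis D.Q.nat_pow_distrib D.Q.nat_pow_one)
    then have "res 3 ((inv\<^bsub>L\<^esub> w) [^]\<^bsub>L\<^esub> p \<otimes>\<^bsub>L\<^esub> au) = \<one>\<^bsub>L\<^esub>" unfolding e by (simp add: res_simps)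
    then show False using iO res_au p_pos by (simp add: res_simps Oi_pow D.Q.nat_pow_zero)
  qed
  have "res 3 w [^]\<^bsub>L\<^esub> p = \<zero>\<^bsub>L\<^esub>" using res_simps(6)[OF wO, of p] e res_au by simp
  then have "res 3 w = \<zero>\<^bsub>L\<^esub>" using L_pow_nz[of "res 3 w" p] res_closed[OF wO] by blast
  then have "w \<in> mi 3" using wO by (simp add: mi_def)
  then obtain w' where w': "w' \<in> Oi 3" "w = ag \<otimes>\<^bsub>L\<^esub> w'" using mi_factor[of 3 w] unfolding ag_def by auto
  obtain u1 where u1: "u1 \<in> Oi 3" "au = ag \<otimes>\<^bsub>L\<^esub> u1" "res 3 u1 \<noteq> \<zero>\<^bsub>L\<^esub>" by (rule au_order)
  have c: "w' \<in> carrier L" "u1 \<in> carrier L" using Oi_carr w'(1) u1(1) by auto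
  have g: "ag \<in> Oi 3" "res 3 ag = \<zero>\<^bsub>L\<^esub>" unfolding ag_def by (simp_all add: Oi_em X_closed res_Var)
  have wp: "w' [^]\<^bsub>L\<^esub> p \<in> carrier L" using c by simp
  have "ag \<otimes>\<^bsub>L\<^esub> u1 = (ag [^]\<^bsub>L\<^esub> n \<otimes>\<^bsub>L\<^esub> ag) \<otimes>\<^bsub>L\<^esub> w' [^]\<^bsub>L\<^esub> p"
    using e c unfolding u1(2) w'(2) n(2)[of ag, symmetric] by (simp add: D.Q.nat_pow_distrib)
  then have "ag \<otimes>\<^bsub>L\<^esub> u1 = ag \<otimes>\<^bsub>L\<^esub> (ag [^]\<^bsub>L\<^esub> n \<otimes>\<^bsub>L\<^esub> w' [^]\<^bsub>L\<^esub> p)" using c wp by (simp add: D.Q.m_ac)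
  then have "u1 = ag [^]\<^bsub>L\<^esub> n \<otimes>\<^bsub>L\<^esub> w' [^]\<^bsub>L\<^esub> p" using D.Q.m_lcancel[of ag] elem_nz c by simp
  then have "res 3 u1 = \<zero>\<^bsub>L\<^esub> [^]\<^bsub>L\<^esub> n \<otimes>\<^bsub>L\<^esub> res 3 (w' [^]\<^bsub>L\<^esub> p)" using g w' by (simp add: res_simps Oi_pow)
  then show False using u1(3) n(1) res_closed[OF Oi_pow[OF w'(1)]] by (simp add: D.Q.nat_pow_zero)
qed

section \<open>The embedding of the base polynomial ring\<close>

definition gen :: "nat \<Rightarrow> ((nat multiset \<Rightarrow> int) \<times> (nat multiset \<Rightarrow> int)) set" where
  "gen k = (if k = 0 then ac else if k = 1 then ac [^]\<^bsub>L\<^esub> p \<otimes>\<^bsub>L\<^esub> aa else if k = 2 then ac [^]\<^bsub>L\<^esub> p \<otimes>\<^bsub>L\<^esub> ab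
    else if k = 3 then au else \<zero>\<^bsub>L\<^esub>)"

lemma gen_closed [simp]: "gen k \<in> carrier L" by (simp add: gen_def)

text \<open>\<open>M\<close> plays two roles: its variables are \<open>c, a, b, g\<close> in the
  construction of \<open>L\<close>, and here they stand for the generators \<open>c, y, z, u\<close>
  of the base ring. From index 4 on \<open>gen\<close> is zero, as evaluation requires a value at
  every index.\<close>

definition io where "io = D.Q.mpoly_eval gen"

lemma io_hom: "io \<in> ring_hom M L"
  unfolding io_def by (rule mpoly_eval_hom[OF D.Q.is_cring L_char gen_closed])

lemma io_closed [simp]: "f \<in> carrier M \<Longrightarrow> io f \<in> carrier L" by (rule ring_hom_closed[OF io_hom])

lemma io_Var: "io (Var i) = gen i"
  unfolding io_def by (rule mpoly_eval_X[OF D.Q.is_cring L_char gen_closed])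

lemma io_simps:
  "io \<zero>\<^bsub>M\<^esub> = \<zero>\<^bsub>L\<^esub>" "io \<one>\<^bsub>M\<^esub> = \<one>\<^bsub>L\<^esub>"
  "f \<in> carrier M \<Longrightarrow> g \<in> carrier M \<Longrightarrow> io (f \<oplus>\<^bsub>M\<^esub> g) = io f \<oplus>\<^bsub>L\<^esub> io g"
  "f \<in> carrier M \<Longrightarrow> g \<in> carrier M \<Longrightarrow> io (f \<otimes>\<^bsub>M\<^esub> g) = io f \<otimes>\<^bsub>L\<^esub> io g"
  using ring_hom_zero[OF io_hom M.ring_axioms D.Q.ring_axioms] ring_hom_one[OF io_hom]
    ring_hom_add[OF io_hom] ring_hom_mult[OF io_hom] by auto

lemma io_pow: "f \<in> carrier M \<Longrightarrow> io (f [^]\<^bsub>M\<^esub> (k::nat)) = io f [^]\<^bsub>L\<^esub> k"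
  by (induction k) (simp_all add: io_simps)

text \<open>Iterated \<open>set_zero\<close>. With an initial segment of the variables it cuts out
  the primes of the base ring, with a final segment it drives the proof of algebraic
  independence.\<close>

definition zeros :: "nat set \<Rightarrow> (nat multiset \<Rightarrow> int) \<Rightarrow> nat multiset \<Rightarrow> int" where
  "zeros A f = (\<lambda>m. if set_mset m \<inter> A = {} then f m else 0)"

lemma zeros_insert: "zeros (insert i A) f = set_zero i (zeros A f)"
  by (auto simp: zeros_def set_zero_def fun_eq_iff)

lemma zeros_hom: "finite A \<Longrightarrow> zeros A \<in> ring_hom M M"
proof (induction rule: finite_induct)
  case empty
  show ?case by (auto intro!: ring_hom_memI simp: zeros_def)
next
  case (insert i A)
  have "zeros (insert i A) = set_zero i \<circ> zeros A" by (simp add: fun_eq_iff zeros_insert)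
  then show ?case using ring_hom_trans[OF insert(3) set_zero_hom] by (simp only:)
qed

lemma zeros_closed: "finite A \<Longrightarrow> f \<in> carrier M \<Longrightarrow> zeros A f \<in> carrier M"
  by (rule ring_hom_closed[OF zeros_hom])

lemma zeros_simps:
  "finite A \<Longrightarrow> f \<in> carrier M \<Longrightarrow> g \<in> carrier M \<Longrightarrow> zeros A (f \<oplus>\<^bsub>M\<^esub> g) = zeros A f \<oplus>\<^bsub>M\<^esub> zeros A g"
  "finite A \<Longrightarrow> f \<in> carrier M \<Longrightarrow> g \<in> carrier M \<Longrightarrow> zeros A (f \<otimes>\<^bsub>M\<^esub> g) = zeros A f \<otimes>\<^bsub>M\<^esub> zeros A g"
  "finite A \<Longrightarrow> zeros A \<zero>\<^bsub>M\<^esub> = \<zero>\<^bsub>M\<^esub>" "finite A \<Longrightarrow> zeros A \<one>\<^bsub>M\<^esub> = \<one>\<^bsub>M\<^esub>"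
  "zeros A (Var i) = (if i \<in> A then \<zero>\<^bsub>M\<^esub> else Var i)"
  using ring_hom_add[OF zeros_hom] ring_hom_mult[OF zeros_hom]
    ring_hom_zero[OF zeros_hom M.ring_axioms M.ring_axioms] ring_hom_one[OF zeros_hom]
  by (auto simp: zeros_def xpow_def M_zero fun_eq_iff)

text \<open>Everything is multiplicative and additive in \<open>v\<close>, so the behaviour of the
  place on the generators decides. It is used with \<open>A' - A\<close> a single variable for
  injectivity of \<open>io\<close>, and with \<open>A' - A = {0, 1, 2}\<close> for the centre of the
  \<open>c\<close>-adic place.\<close>

lemma res_io:
  assumes fin: "finite A" "finite A'" and sub: "A \<subseteq> A'"
    and gO: "\<And>i. i < 4 \<Longrightarrow> i \<notin> A \<Longrightarrow> gen i \<in> Oi j"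
    and fixd: "\<And>i. i < 4 \<Longrightarrow> i \<notin> A' \<Longrightarrow> res j (gen i) = gen i"
    and zero: "\<And>i. i < 4 \<Longrightarrow> i \<in> A' \<Longrightarrow> i \<notin> A \<Longrightarrow> res j (gen i) = \<zero>\<^bsub>L\<^esub>"
    and v: "v \<in> carrier M"
  shows "io (zeros A v) \<in> Oi j \<and> res j (io (zeros A v)) = io (zeros A' v)"
  using v
proof (induction v rule: M_induct)
  case zero
  show ?case using fin by (simp add: zeros_simps io_simps Oi_closed res_simps)
next
  case one
  show ?case using fin by (simp add: zeros_simps io_simps Oi_closed res_simps)
next
  case (add f g)
  then show ?case using fin by (simp add: zeros_simps io_simps zeros_closed Oi_closed res_simps)
next
  case (var i f)
  have X: "Var i \<in> carrier M" by (rule X_closed[OF var(1)])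
  have f: "zeros A f \<in> carrier M" "zeros A' f \<in> carrier M" using fin var(2) zeros_closed by auto
  have V: "io (zeros A (Var i)) = (if i \<in> A then \<zero>\<^bsub>L\<^esub> else gen i)" for A
    by (simp add: zeros_simps(5) io_simps(1) io_Var)
  have "io (zeros A (Var i)) \<in> Oi j \<and> res j (io (zeros A (Var i))) = io (zeros A' (Var i))"
    unfolding V using sub gO[OF var(1)] fixd[OF var(1)] zero[OF var(1)] by (auto simp: Oi_closed res_simps)
  then show ?case using var(3) X f zeros_closed[OF fin(1) X] zeros_closed[OF fin(2) X] var(2) fin
    by (simp add: zeros_simps(2) io_simps(4) Oi_closed res_simps(4))
qed

text \<open>The generators are triangular with respect to the places: the \<open>j\<close>-th one
  vanishes at the divisor of the \<open>j\<close>-th variable, and the earlier ones do not involve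
  that variable.\<close>

lemma gen_places:
  "i < 4 \<Longrightarrow> i < j \<Longrightarrow> j < 4 \<Longrightarrow> gen i \<in> fx j" "j < 4 \<Longrightarrow> gen j \<in> Oi j" "j < 4 \<Longrightarrow> res j (gen j) = \<zero>\<^bsub>L\<^esub>" "j < 4 \<Longrightarrow> gen j \<noteq> \<zero>\<^bsub>L\<^esub>"
proof -
  have em: "em (Var i) \<in> fx j" if "i < 4" "j < 4" "i \<noteq> j" for i j using fx_Var that by auto
  have c: "ac \<in> fx 1" "ac \<in> fx 2" "ac \<in> fx 3" "aa \<in> fx 2" "aa \<in> fx 3" "ab \<in> fx 3" "aa \<in> fx 0" "ab \<in> fx 0" "ab \<in> fx 1"
    unfolding ac_def aa_def ab_def by (simp_all add: em)
  show "gen i \<in> fx j" if "i < 4" "i < j" "j < 4" 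
  proof -
    have "(i, j) \<in> {(0, 1), (0, 2), (0, 3), (1, 2), (1, 3), (2, 3)}" using that by auto
    then show ?thesis using c by (auto simp: gen_def intro!: fx_mult fx_pow)
  qed
  have r0: "ac \<in> Oi 0" "res 0 ac = \<zero>\<^bsub>L\<^esub>" "aa \<in> Oi 1" "res 1 aa = \<zero>\<^bsub>L\<^esub>" "ab \<in> Oi 2" "res 2 ab = \<zero>\<^bsub>L\<^esub>"
    unfolding ac_def aa_def ab_def by (simp_all add: Oi_em X_closed res_Var)
  have cp: "ac [^]\<^bsub>L\<^esub> p \<in> Oi 1" "ac [^]\<^bsub>L\<^esub> p \<in> Oi 2" "res 1 (ac [^]\<^bsub>L\<^esub> p) \<in> carrier L" "res 2 (ac [^]\<^bsub>L\<^esub> p) \<in> carrier L"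
    using c fx_pow[THEN fx_D(1)] fx_pow[THEN fx_D(2)] by auto
  have j: "j \<in> {0, 1, 2, 3}" if "j < 4" using that by auto
  show "gen j \<in> Oi j" if "j < 4" using j[OF that] r0 cp res_au by (auto simp: gen_def intro!: Oi_closed(4))
  show "res j (gen j) = \<zero>\<^bsub>L\<^esub>" if "j < 4" using j[OF that] r0 cp res_au by (auto simp: gen_def res_simps)
  show "gen j \<noteq> \<zero>\<^bsub>L\<^esub>" if "j < 4"
    using j[OF that] elem_nz au_nz L_pow_nz[of ac p] by (auto simp: gen_def D.Q.integral_iff)
qed

text \<open>Algebraic independence by induction on the number \<open>d\<close> of variables still
  present. Divide a relation by the highest power of its last variable and apply the place of that
  variable: the last generator goes to 0, the earlier ones stay, and a nontrivial relation with one
  variable fewer remains.\<close>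

lemma io_zeros_inj:
  "d \<le> 4 \<Longrightarrow> f \<in> carrier M \<Longrightarrow> io (zeros {d..<4} f) = \<zero>\<^bsub>L\<^esub> \<Longrightarrow> zeros {d..<4} f = \<zero>\<^bsub>M\<^esub>"
proof (induction d arbitrary: f)
  case 0
  let ?f = "zeros {0..<4} f"
  have fc: "?f \<in> carrier M" using 0 by (intro zeros_closed) auto
  have sup: "?f m = 0" if "m \<noteq> {#}" for m
  proof (cases "set_mset m \<subseteq> {..<4}")
    case True
    then have "set_mset m \<inter> {0..<4} = set_mset m" by auto
    then have "set_mset m \<inter> {0..<4} \<noteq> {}" using that by simp
    then show ?thesis unfolding zeros_def by simp
  next
    case False
    then have "f m = 0" using 0(2) unfolding carrier_M by blast
    then show ?thesis unfolding zeros_def by simp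
  qed
  show ?case
  proof (rule ccontr)
    \<comment> \<open>With all variables set to 0 a constant is left; if nonzero it is a unit and
      cannot be sent to 0.\<close>
    assume nz: "?f \<noteq> \<zero>\<^bsub>M\<^esub>"
    have r: "0 \<le> ?f {#}" "?f {#} < int p" using coeff_range[OF fc] by auto
    have e: "?f = kc (?f {#})"
    proof
      fix m show "?f m = kc (?f {#}) m" using sup[of m] r unfolding kc_props(6) by simp
    qed
    have "?f {#} \<noteq> 0" using nz e kc_props(2) by metis
    then obtain v where v: "v \<in> carrier M" "?f \<otimes>\<^bsub>M\<^esub> v = \<one>\<^bsub>M\<^esub>"
      using const_unit[of "?f {#}"] r e unfolding kc_def by auto
    have "io ?f \<otimes>\<^bsub>L\<^esub> io v = \<one>\<^bsub>L\<^esub>" using io_simps(2) io_simps(4)[OF fc v(1)] v(2) by simp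
    then show False using 0(3) v(1) by simp
  qed
next
  case (Suc d)
  let ?A = "{Suc d..<4}"
  have d: "d < 4" using Suc by simp
  have ins: "{d..<4} = insert d ?A" using d by auto
  show ?case
  proof (rule ccontr)
    assume nz: "zeros ?A f \<noteq> \<zero>\<^bsub>M\<^esub>"
    have wc: "zeros ?A f \<in> carrier M" using Suc by (intro zeros_closed) auto
    obtain k w where w: "w \<in> carrier M" "zeros ?A f = Var d [^]\<^bsub>M\<^esub> (k::nat) \<otimes>\<^bsub>M\<^esub> w" "set_zero d w \<noteq> \<zero>\<^bsub>M\<^esub>"
      using factor_var_power[OF wc nz d] by blast
    have X: "Var d \<in> carrier M" "Var d [^]\<^bsub>M\<^esub> k \<in> carrier M" using X_closed[OF d] by auto
    have Xnz: "Var d [^]\<^bsub>M\<^esub> k \<noteq> \<zero>\<^bsub>M\<^esub>" by (induction k) (use X Var_nz in \<open>auto simp: M.integral_iff\<close>)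
    have "zeros ?A (zeros ?A f) = zeros ?A f" by (simp add: zeros_def fun_eq_iff)
    moreover have "zeros ?A (Var d [^]\<^bsub>M\<^esub> n) = Var d [^]\<^bsub>M\<^esub> n" for n :: nat
      by (induction n) (use X in \<open>simp_all add: zeros_simps\<close>)
    ultimately have "Var d [^]\<^bsub>M\<^esub> k \<otimes>\<^bsub>M\<^esub> zeros ?A w = Var d [^]\<^bsub>M\<^esub> k \<otimes>\<^bsub>M\<^esub> w"
      unfolding w(2) using X w by (simp add: zeros_simps(2))
    then have zw: "zeros ?A w = w" using M.m_lcancel[OF Xnz X(2) zeros_closed[OF _ w(1)] w(1)] by simp
    have "gen d [^]\<^bsub>L\<^esub> k \<otimes>\<^bsub>L\<^esub> io w = \<zero>\<^bsub>L\<^esub>" using Suc(4) unfolding w(2) using X w by (simp add: io_simps io_pow io_Var)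
    then have "io w = \<zero>\<^bsub>L\<^esub>" using gen_places(4)[OF d] L_pow_nz[of "gen d" k] w by (simp add: D.Q.integral_iff)
    moreover have "res d (io (zeros ?A w)) = io (zeros {d..<4} w)"
    proof (rule res_io[THEN conjunct2])
      have low: "gen i \<in> Oi d" "res d (gen i) = gen i" if "i < d" for i
        using gen_places(1)[of i d] that d fx_D by auto
      fix i :: nat assume i: "i < 4"
      show "gen i \<in> Oi d" if "i \<notin> ?A"
      proof (cases "i = d")
        case False
        then show ?thesis using that i by (intro low) auto
      qed (use gen_places(2)[OF d] in simp)
      show "res d (gen i) = gen i" if "i \<notin> {d..<4}" using that i by (intro low) auto
      show "res d (gen i) = \<zero>\<^bsub>L\<^esub>" if "i \<in> {d..<4}" "i \<notin> ?A"
      proof -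
        have "i = d" using that by auto
        then show ?thesis using gen_places(3)[OF d] by simp
      qed
    qed (use w(1) in auto)
    ultimately have "io (zeros {d..<4} w) = \<zero>\<^bsub>L\<^esub>" unfolding zw by (simp add: res_simps)
    then have "zeros {d..<4} w = \<zero>\<^bsub>M\<^esub>" using Suc(1)[OF _ w(1)] d by simp
    then show False using w(3) unfolding ins zeros_insert zw by simp
  qed
qed

lemma io_inj: "f \<in> carrier M \<Longrightarrow> io f = \<zero>\<^bsub>L\<^esub> \<Longrightarrow> f = \<zero>\<^bsub>M\<^esub>"
  using io_zeros_inj[of 4 f] by (simp add: zeros_def)

lemma io_eq_iff: "f \<in> carrier M \<Longrightarrow> g \<in> carrier M \<Longrightarrow> io f = io g \<longleftrightarrow> f = g"
proof
  assume fg: "f \<in> carrier M" "g \<in> carrier M" "io f = io g"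
  have e: "f = f \<ominus>\<^bsub>M\<^esub> g \<oplus>\<^bsub>M\<^esub> g" using fg(1,2) by (elim M.rep_cases) (simp add: M.rep_hom)
  have "io f = io (f \<ominus>\<^bsub>M\<^esub> g) \<oplus>\<^bsub>L\<^esub> io g" using fg(1,2) by (subst e) (simp add: io_simps)
  then have "io (f \<ominus>\<^bsub>M\<^esub> g) = \<zero>\<^bsub>L\<^esub>" using fg D.Q.add.r_cancel_one[of "io g" "io (f \<ominus>\<^bsub>M\<^esub> g)"] D.Q.a_comm by simp
  then have "f \<ominus>\<^bsub>M\<^esub> g = \<zero>\<^bsub>M\<^esub>" using fg by (intro io_inj) auto
  then show "f = g" using e fg by simp
qed simp

text \<open>At \<open>c = 0\<close> the generators \<open>c\<close>, \<open>y\<close>,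
  \<open>z\<close> vanish because of the factor \<open>c\<close> in each, and \<open>u\<close>
  survives. So the divisor \<open>c = 0\<close> of \<open>L\<close> is centred at a prime of height
  three of the base.\<close>

lemma res0_io: "f \<in> carrier M \<Longrightarrow> io f \<in> Oi 0 \<and> res 0 (io f) = io (zeros {..<3} f)"
proof -
  assume f: "f \<in> carrier M"
  have "gen i \<in> Oi 0 \<and> res 0 (gen i) = (if i < 3 then \<zero>\<^bsub>L\<^esub> else gen i)" if "i < 4" for i
  proof -
    have "ac \<in> Oi 0" "res 0 ac = \<zero>\<^bsub>L\<^esub>" unfolding ac_def by (simp_all add: Oi_em X_closed res_Var)
    moreover have "i \<in> {0, 1, 2, 3}" using that by auto
    ultimately show ?thesis using fx0 fx_D p_pos
      by (auto simp: gen_def Oi_closed Oi_pow res_simps D.Q.nat_pow_zero)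
  qed
  then have "io (zeros {} f) \<in> Oi 0 \<and> res 0 (io (zeros {} f)) = io (zeros {..<3} f)"
    using f by (intro res_io) auto
  then show ?thesis by (simp add: zeros_def)
qed

end

section \<open>The translations\<close>

context fp_mpoly4
begin

text \<open>The indices are integers that matter only modulo \<open>p\<close>
  (\<open>shift_mod\<close>), so that inverse translations are given by negation.\<close>

definition shift_gen :: "int \<Rightarrow> int \<Rightarrow> nat \<Rightarrow> nat multiset \<Rightarrow> int" where
  "shift_gen i j k = (if k = 3 then Var 3 \<oplus>\<^bsub>M\<^esub> kc i \<otimes>\<^bsub>M\<^esub> Var 1 \<oplus>\<^bsub>M\<^esub> kc j \<otimes>\<^bsub>M\<^esub> Var 2 else if k < 3 then Var k else \<zero>\<^bsub>M\<^esub>)"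

lemma shift_gen_closed [simp]: "shift_gen i j k \<in> carrier M"
  by (simp add: shift_gen_def X_closed kc_props(1))

definition shift where "shift i j = M.mpoly_eval (shift_gen i j)"

lemma shift_hom: "shift i j \<in> ring_hom M M"
  unfolding shift_def by (rule mpoly_eval_hom[OF M.is_cring M_char shift_gen_closed])

lemma shift_closed [simp]: "f \<in> carrier M \<Longrightarrow> shift i j f \<in> carrier M"
  by (rule ring_hom_closed[OF shift_hom])

lemma shift_simps:
  "f \<in> carrier M \<Longrightarrow> g \<in> carrier M \<Longrightarrow> shift i j (f \<oplus>\<^bsub>M\<^esub> g) = shift i j f \<oplus>\<^bsub>M\<^esub> shift i j g"
  "f \<in> carrier M \<Longrightarrow> g \<in> carrier M \<Longrightarrow> shift i j (f \<otimes>\<^bsub>M\<^esub> g) = shift i j f \<otimes>\<^bsub>M\<^esub> shift i j g"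
  "shift i j \<zero>\<^bsub>M\<^esub> = \<zero>\<^bsub>M\<^esub>" "shift i j \<one>\<^bsub>M\<^esub> = \<one>\<^bsub>M\<^esub>" "shift i j (Var k) = shift_gen i j k"
proof -
  show "shift i j (Var k) = shift_gen i j k"
    unfolding shift_def by (rule mpoly_eval_X[OF M.is_cring M_char shift_gen_closed])
qed (rule ring_hom_add[OF shift_hom] ring_hom_mult[OF shift_hom] ring_hom_one[OF shift_hom]
    ring_hom_zero[OF shift_hom M.ring_axioms M.ring_axioms]; assumption)+

lemma hom_kc:
  assumes h: "h \<in> ring_hom M M" shows "h (kc k) = kc k"
proof -
  have "h (kc (int n)) = kc (int n)" for n
  proof (induction n)
    case 0
    then show ?case using ring_hom_zero[OF h M.ring_axioms M.ring_axioms] by (simp add: kc_props(2))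
  next
    case (Suc n)
    have "h (kc (1 + int n)) = h (kc 1) \<oplus>\<^bsub>M\<^esub> h (kc (int n))"
      unfolding kc_props(4) by (rule ring_hom_add[OF h kc_props(1) kc_props(1)])
    then show ?case using Suc ring_hom_one[OF h] by (simp add: kc_props(3,4))
  qed
  from this[of "nat (k mod int p)"] show ?thesis
    using p_pos kc_props(5)[of k] by simp
qed

lemma shift_comp:
  assumes f: "f \<in> carrier M" shows "shift i j (shift i' j' f) = shift (i + i') (j + j') f"
proof -
  have "(shift i j \<circ> shift i' j') f = shift (i + i') (j + j') f"
  proof (rule mpoly_hom_unique[OF M.ring_axioms ring_hom_trans[OF shift_hom shift_hom] shift_hom _ f])
    fix k :: nat assume k: "k < 4"
    have c: "Var 1 \<in> carrier M" "Var 2 \<in> carrier M" "Var 3 \<in> carrier M" "\<And>l. kc l \<in> carrier M"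
      by (simp_all add: X_closed kc_props(1))
    have "(Var 3 \<oplus>\<^bsub>M\<^esub> kc i \<otimes>\<^bsub>M\<^esub> Var 1 \<oplus>\<^bsub>M\<^esub> kc j \<otimes>\<^bsub>M\<^esub> Var 2) \<oplus>\<^bsub>M\<^esub> kc i' \<otimes>\<^bsub>M\<^esub> Var 1 \<oplus>\<^bsub>M\<^esub> kc j' \<otimes>\<^bsub>M\<^esub> Var 2 =
      Var 3 \<oplus>\<^bsub>M\<^esub> (kc i \<oplus>\<^bsub>M\<^esub> kc i') \<otimes>\<^bsub>M\<^esub> Var 1 \<oplus>\<^bsub>M\<^esub> (kc j \<oplus>\<^bsub>M\<^esub> kc j') \<otimes>\<^bsub>M\<^esub> Var 2"
      using c(1-3) c(4)[of i] c(4)[of i'] c(4)[of j] c(4)[of j']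
      by (elim M.rep_cases) (simp add: M.rep_hom algebra_simps)
    then show "(shift i j \<circ> shift i' j') (Var k) = shift (i + i') (j + j') (Var k)"
      using k c by (simp add: shift_simps shift_gen_def hom_kc[OF shift_hom] kc_props(4))
  qed
  then show ?thesis by simp
qed

lemma shift_zero: "f \<in> carrier M \<Longrightarrow> shift 0 0 f = f"
proof -
  assume f: "f \<in> carrier M"
  have "shift 0 0 f = id f"
  proof (rule mpoly_hom_unique[OF M.ring_axioms shift_hom _ _ f])
    show "id \<in> ring_hom M M" by (rule ring_hom_memI) auto
    fix k :: nat assume "k < 4"
    then show "shift 0 0 (Var k) = id (Var k)"
      by (cases "k = 3") (simp_all add: shift_simps shift_gen_def kc_props(2) X_closed)
  qed
  then show ?thesis by simp
qed

lemma shift_inj: "f \<in> carrier M \<Longrightarrow> shift i j f = \<zero>\<^bsub>M\<^esub> \<Longrightarrow> f = \<zero>\<^bsub>M\<^esub>"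
  using shift_comp[of f "- i" "- j" i j] shift_zero[of f] by (simp add: shift_simps)

lemma shift_mod: "shift (i mod int p) (j mod int p) = shift i j"
  unfolding shift_def shift_gen_def kc_props(5)[symmetric] ..

text \<open>The translations neither move \<open>c\<close> nor introduce it, so they commute with
  setting \<open>c = 0\<close>; this makes the \<open>c\<close>-adic place invariant under the
  group.\<close>

lemma shift_set_zero: "f \<in> carrier M \<Longrightarrow> set_zero 0 (shift i j f) = shift i j (set_zero 0 f)"
proof -
  assume f: "f \<in> carrier M"
  have "(set_zero 0 \<circ> shift i j) f = (shift i j \<circ> set_zero 0) f"
  proof (rule mpoly_hom_unique[OF M.ring_axioms ring_hom_trans[OF shift_hom set_zero_hom] ring_hom_trans[OF set_zero_hom shift_hom] _ f])
    fix k :: nat assume k: "k < 4"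
    have c: "Var 1 \<in> carrier M" "Var 2 \<in> carrier M" "Var 3 \<in> carrier M" "\<And>l. kc l \<in> carrier M"
      by (simp_all add: X_closed kc_props(1))
    show "(set_zero 0 \<circ> shift i j) (Var k) = (shift i j \<circ> set_zero 0) (Var k)"
      using k c by (auto simp: shift_simps shift_gen_def hom_kc[OF set_zero_hom] set_zero_X
        ring_hom_add[OF set_zero_hom] ring_hom_mult[OF set_zero_hom])
  qed
  then show ?thesis by simp
qed

definition sg where "sg i j = D.frac_map L (em \<circ> shift i j)"

lemma em_shift_hom: "em \<circ> shift i j \<in> ring_hom M L"
  by (rule ring_hom_trans[OF shift_hom em_hom])

lemma em_shift_nz: "s \<in> carrier M - {\<zero>\<^bsub>M\<^esub>} \<Longrightarrow> (em \<circ> shift i j) s \<noteq> \<zero>\<^bsub>L\<^esub>"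
  using shift_inj[of s i j] by (auto simp: em_eq_zero_iff)

lemma sg_hom: "sg i j \<in> ring_hom L L"
  unfolding sg_def by (rule D.frac_map_hom[OF L.field_axioms em_shift_hom em_shift_nz])

lemma sg_em: "f \<in> carrier M \<Longrightarrow> sg i j (em f) = em (shift i j f)"
  unfolding sg_def using D.frac_map_base[OF L.field_axioms em_shift_hom] by simp

lemma sg_closed [simp]: "x \<in> carrier L \<Longrightarrow> sg i j x \<in> carrier L" by (rule ring_hom_closed[OF sg_hom])

lemma sg_simps:
  "x \<in> carrier L \<Longrightarrow> y \<in> carrier L \<Longrightarrow> sg i j (x \<oplus>\<^bsub>L\<^esub> y) = sg i j x \<oplus>\<^bsub>L\<^esub> sg i j y"
  "x \<in> carrier L \<Longrightarrow> y \<in> carrier L \<Longrightarrow> sg i j (x \<otimes>\<^bsub>L\<^esub> y) = sg i j x \<otimes>\<^bsub>L\<^esub> sg i j y"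
  "x \<in> carrier L \<Longrightarrow> y \<in> carrier L \<Longrightarrow> sg i j (x \<ominus>\<^bsub>L\<^esub> y) = sg i j x \<ominus>\<^bsub>L\<^esub> sg i j y"
  "x \<in> carrier L \<Longrightarrow> sg i j (x [^]\<^bsub>L\<^esub> (n::nat)) = sg i j x [^]\<^bsub>L\<^esub> n"
  "x \<in> carrier L \<Longrightarrow> x \<noteq> \<zero>\<^bsub>L\<^esub> \<Longrightarrow> sg i j (inv\<^bsub>L\<^esub> x) = inv\<^bsub>L\<^esub> (sg i j x)"
  "sg i j \<zero>\<^bsub>L\<^esub> = \<zero>\<^bsub>L\<^esub>" "sg i j \<one>\<^bsub>L\<^esub> = \<one>\<^bsub>L\<^esub>"
proof -
  interpret h: ring_hom_cring L L "sg i j" by (rule UnivPoly.ring_hom_cringI[OF D.Q.is_cring D.Q.is_cring sg_hom])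
  show "sg i j \<zero>\<^bsub>L\<^esub> = \<zero>\<^bsub>L\<^esub>" "sg i j \<one>\<^bsub>L\<^esub> = \<one>\<^bsub>L\<^esub>" by simp_all
  show "sg i j (x \<oplus>\<^bsub>L\<^esub> y) = sg i j x \<oplus>\<^bsub>L\<^esub> sg i j y" "sg i j (x \<otimes>\<^bsub>L\<^esub> y) = sg i j x \<otimes>\<^bsub>L\<^esub> sg i j y"
    "sg i j (x \<ominus>\<^bsub>L\<^esub> y) = sg i j x \<ominus>\<^bsub>L\<^esub> sg i j y" if "x \<in> carrier L" "y \<in> carrier L"
    using that by (simp_all add: D.Q.minus_eq)
  show "sg i j (x [^]\<^bsub>L\<^esub> n) = sg i j x [^]\<^bsub>L\<^esub> n" if "x \<in> carrier L" using that by (induction n) simp_all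
  show "sg i j (inv\<^bsub>L\<^esub> x) = inv\<^bsub>L\<^esub> (sg i j x)" if x: "x \<in> carrier L" "x \<noteq> \<zero>\<^bsub>L\<^esub>"
  proof -
    have "sg i j x \<otimes>\<^bsub>L\<^esub> sg i j (inv\<^bsub>L\<^esub> x) = \<one>\<^bsub>L\<^esub>" using L_inv[OF x] h.hom_mult[OF x(1), of "inv\<^bsub>L\<^esub> x"] by simp
    then show ?thesis using x L_inv[OF x] by (intro D.Q.comm_inv_char[symmetric]) auto
  qed
qed

lemma sg_basic: "sg i j ac = ac" "sg i j aa = aa" "sg i j ab = ab" "sg i j ag = ag \<oplus>\<^bsub>L\<^esub> kL i \<otimes>\<^bsub>L\<^esub> aa \<oplus>\<^bsub>L\<^esub> kL j \<otimes>\<^bsub>L\<^esub> ab"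
proof -
  have c: "Var 0 \<in> carrier M" "Var 1 \<in> carrier M" "Var 2 \<in> carrier M" "Var 3 \<in> carrier M" "\<And>l. kc l \<in> carrier M"
    by (simp_all add: X_closed kc_props(1))
  show "sg i j ac = ac" "sg i j aa = aa" "sg i j ab = ab"
    unfolding ac_def aa_def ab_def using c by (simp_all add: sg_em shift_simps shift_gen_def)
  show "sg i j ag = ag \<oplus>\<^bsub>L\<^esub> kL i \<otimes>\<^bsub>L\<^esub> aa \<oplus>\<^bsub>L\<^esub> kL j \<otimes>\<^bsub>L\<^esub> ab"
    unfolding aa_def ab_def ag_def kL_def using c by (simp add: sg_em shift_simps shift_gen_def em_simps)
qed

lemma sg_comp: "x \<in> carrier L \<Longrightarrow> sg i j (sg i' j' x) = sg (i + i') (j + j') x"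
proof -
  assume x: "x \<in> carrier L"
  have "(sg i j \<circ> sg i' j') x = sg (i + i') (j + j') x"
    by (rule L_hom_unique[OF ring_hom_trans[OF sg_hom sg_hom] sg_hom _ x])
      (simp add: sg_em X_closed shift_comp)
  then show ?thesis by simp
qed

lemma sg_zero: "x \<in> carrier L \<Longrightarrow> sg 0 0 x = x"
proof -
  assume x: "x \<in> carrier L"
  have "id \<in> ring_hom L L" by (rule ring_hom_memI) auto
  from L_hom_unique[OF sg_hom this _ x] show ?thesis by (simp add: sg_em X_closed shift_zero)
qed

lemma sg_mod: "sg (i mod int p) (j mod int p) = sg i j"
  unfolding sg_def shift_mod ..

text \<open>Since the constants are fixed by Frobenius, \<open>g^p\<close> is translated by
  \<open>i a^p + j b^p\<close> when \<open>g\<close> is translated by \<open>i a + j b\<close>. In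
  each numerator of Cramer's rule one of the two terms cancels and the other gives a multiple of the
  determinant.\<close>

lemma translate:
  assumes "x \<in> carrier L" "y \<in> carrier L" "x' \<in> carrier L" "y' \<in> carrier L" "v \<in> carrier L" "w \<in> carrier L" "d \<in> carrier L"
    "k \<in> carrier L" "l \<in> carrier L"
  shows "(x \<otimes>\<^bsub>L\<^esub> (w \<oplus>\<^bsub>L\<^esub> k \<otimes>\<^bsub>L\<^esub> x' \<oplus>\<^bsub>L\<^esub> l \<otimes>\<^bsub>L\<^esub> y') \<ominus>\<^bsub>L\<^esub> x' \<otimes>\<^bsub>L\<^esub> (v \<oplus>\<^bsub>L\<^esub> k \<otimes>\<^bsub>L\<^esub> x \<oplus>\<^bsub>L\<^esub> l \<otimes>\<^bsub>L\<^esub> y)) \<otimes>\<^bsub>L\<^esub> d =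
      (x \<otimes>\<^bsub>L\<^esub> w \<ominus>\<^bsub>L\<^esub> x' \<otimes>\<^bsub>L\<^esub> v) \<otimes>\<^bsub>L\<^esub> d \<oplus>\<^bsub>L\<^esub> l \<otimes>\<^bsub>L\<^esub> ((x \<otimes>\<^bsub>L\<^esub> y' \<ominus>\<^bsub>L\<^esub> y \<otimes>\<^bsub>L\<^esub> x') \<otimes>\<^bsub>L\<^esub> d)"
    "(y \<otimes>\<^bsub>L\<^esub> (w \<oplus>\<^bsub>L\<^esub> k \<otimes>\<^bsub>L\<^esub> x' \<oplus>\<^bsub>L\<^esub> l \<otimes>\<^bsub>L\<^esub> y') \<ominus>\<^bsub>L\<^esub> y' \<otimes>\<^bsub>L\<^esub> (v \<oplus>\<^bsub>L\<^esub> k \<otimes>\<^bsub>L\<^esub> x \<oplus>\<^bsub>L\<^esub> l \<otimes>\<^bsub>L\<^esub> y)) \<otimes>\<^bsub>L\<^esub> d =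
      (y \<otimes>\<^bsub>L\<^esub> w \<ominus>\<^bsub>L\<^esub> y' \<otimes>\<^bsub>L\<^esub> v) \<otimes>\<^bsub>L\<^esub> d \<ominus>\<^bsub>L\<^esub> k \<otimes>\<^bsub>L\<^esub> ((x \<otimes>\<^bsub>L\<^esub> y' \<ominus>\<^bsub>L\<^esub> y \<otimes>\<^bsub>L\<^esub> x') \<otimes>\<^bsub>L\<^esub> d)"
  using assms by (elim D.Q.rep_cases; simp add: D.Q.rep_hom algebra_simps)+

lemma sg_hk: "sg i j ah = ah \<oplus>\<^bsub>L\<^esub> kL j" "sg i j ak = ak \<ominus>\<^bsub>L\<^esub> kL i" "sg i j au = au"
proof -
  have di: "sg i j di = di" and ia: "sg i j ia = ia"
    unfolding di_def ia_def Delta_def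
    using Delta_nz[unfolded Delta_def] L_pow_nz[of aa p] elem_nz by (simp_all add: sg_simps sg_basic)
  have gp: "(ag \<oplus>\<^bsub>L\<^esub> kL i \<otimes>\<^bsub>L\<^esub> aa \<oplus>\<^bsub>L\<^esub> kL j \<otimes>\<^bsub>L\<^esub> ab) [^]\<^bsub>L\<^esub> p = ag [^]\<^bsub>L\<^esub> p \<oplus>\<^bsub>L\<^esub> kL i \<otimes>\<^bsub>L\<^esub> aa [^]\<^bsub>L\<^esub> p \<oplus>\<^bsub>L\<^esub> kL j \<otimes>\<^bsub>L\<^esub> ab [^]\<^bsub>L\<^esub> p"
    by (simp add: L_frob kL_props(1) D.Q.nat_pow_distrib kL_frob)
  note t = translate[of aa ab "aa [^]\<^bsub>L\<^esub> p" "ab [^]\<^bsub>L\<^esub> p" ag "ag [^]\<^bsub>L\<^esub> p" di "kL i" "kL j"]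
  show h: "sg i j ah = ah \<oplus>\<^bsub>L\<^esub> kL j"
    unfolding ah_def using t(1) inverses di unfolding Delta_def[symmetric]
    by (simp add: sg_simps sg_basic gp kL_props(1))
  show k: "sg i j ak = ak \<ominus>\<^bsub>L\<^esub> kL i"
    unfolding ak_def using t(2) inverses di unfolding Delta_def[symmetric]
    by (simp add: sg_simps sg_basic gp kL_props(1))
  have "(ah \<oplus>\<^bsub>L\<^esub> kL j) [^]\<^bsub>L\<^esub> p = ah [^]\<^bsub>L\<^esub> p \<oplus>\<^bsub>L\<^esub> kL j" by (simp add: L_frob kL_props(1) kL_frob)
  moreover have "(ah [^]\<^bsub>L\<^esub> p \<oplus>\<^bsub>L\<^esub> kL j) \<ominus>\<^bsub>L\<^esub> (ah \<oplus>\<^bsub>L\<^esub> kL j) = ah [^]\<^bsub>L\<^esub> p \<ominus>\<^bsub>L\<^esub> ah"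
    using hk_closed(1) D.Q.nat_pow_closed[OF hk_closed(1), of p] kL_props(1)[of j]
    by (elim D.Q.rep_cases) (simp add: D.Q.rep_hom algebra_simps)
  ultimately show "sg i j au = au"
    unfolding au_def using ia inverses(3) by (simp add: sg_simps h)
qed

lemma sg_io: "f \<in> carrier M \<Longrightarrow> sg i j (io f) = io f"
proof -
  assume f: "f \<in> carrier M"
  have "(sg i j \<circ> io) f = io f"
    by (rule mpoly_hom_unique[OF D.Q.ring_axioms ring_hom_trans[OF io_hom sg_hom] io_hom _ f])
      (auto simp: io_Var gen_def sg_simps sg_basic sg_hk)
  then show ?thesis by simp
qed

lemma sg_place:
  assumes x: "x \<in> Oi 0" shows "sg i j x \<in> Oi 0" "sg i j x \<in> mi 0 \<Longrightarrow> x \<in> mi 0"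
proof -
  obtain f s where fs: "f \<in> carrier M" "s \<in> carrier M - {\<zero>\<^bsub>M\<^esub>}" "rho 0 s \<noteq> \<zero>\<^bsub>L\<^esub>" "x = D.fr f s"
    using x unfolding Oi_def D.frac_dom_def by blast
  have s: "shift i j s \<in> carrier M - {\<zero>\<^bsub>M\<^esub>}" using fs(2) shift_inj[of s i j] by auto
  have rho: "rho 0 (shift i j g) = \<zero>\<^bsub>L\<^esub> \<longleftrightarrow> rho 0 g = \<zero>\<^bsub>L\<^esub>" if g: "g \<in> carrier M" for g
    using shift_set_zero[OF g, of i j] shift_inj[of "set_zero 0 g" i j] set_zero_closed[OF g, of 0] g
    by (auto simp: rho_def em_eq_zero_iff shift_simps)
  have rs: "rho 0 (shift i j s) \<noteq> \<zero>\<^bsub>L\<^esub>" using rho fs by simp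
  have e: "D.fr (shift i j f) (shift i j s) \<otimes>\<^bsub>L\<^esub> em (shift i j s) = em (shift i j f)"
    using D.fr_decomp[of "shift i j f" "shift i j s"] fs(1) s by simp
  have "x \<otimes>\<^bsub>L\<^esub> em s = em f" using D.fr_decomp[of f s] fs by simp
  then have "sg i j x \<otimes>\<^bsub>L\<^esub> em (shift i j s) = em (shift i j f)"
    using sg_simps(2)[of x "em s" i j] Oi_carr[OF x] fs by (simp add: sg_em)
  then have sx: "sg i j x = D.fr (shift i j f) (shift i j s)"
    using e s Oi_carr[OF x] fs(1) D.fr_closed[of "shift i j f" "shift i j s"]
      D.Q.m_rcancel[of "em (shift i j s)" "sg i j x" "D.fr (shift i j f) (shift i j s)"]
    by (simp add: em_eq_zero_iff)
  show "sg i j x \<in> Oi 0" unfolding sx using fs(1) s rs by (intro Oi_fr) auto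
  have res: "res 0 (D.fr g t) = \<zero>\<^bsub>L\<^esub> \<longleftrightarrow> rho 0 g = \<zero>\<^bsub>L\<^esub>"
    if "g \<in> carrier M" "t \<in> carrier M - {\<zero>\<^bsub>M\<^esub>}" "rho 0 t \<noteq> \<zero>\<^bsub>L\<^esub>" for g t
  proof -
    have c: "rho 0 g \<in> carrier L" "rho 0 t \<in> carrier L" using ring_hom_closed[OF rho_hom] that by auto
    have nz: "inv\<^bsub>L\<^esub> (rho 0 t) \<noteq> \<zero>\<^bsub>L\<^esub>" using L_inv[OF c(2) that(3)] c D.Q.one_not_zero by auto
    show ?thesis using D.frac_map_fr[OF L.field_axioms rho_hom that] c L_inv(1)[OF c(2) that(3)] nz
      by (simp add: res_def D.Q.integral_iff)
  qed
  show "x \<in> mi 0" if "sg i j x \<in> mi 0"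
  proof -
    have "rho 0 f = \<zero>\<^bsub>L\<^esub>"
      using that res[OF shift_closed[OF fs(1)] s rs] rho[OF fs(1)] unfolding sx mi_def by simp
    then show ?thesis using x res[OF fs(1-3)] unfolding mi_def fs(4) by simp
  qed
qed

end

section \<open>The Galois group\<close>

lemma (in ring) eval_sparse:
  assumes "a \<in> carrier R" "set q \<subseteq> carrier R" "x \<in> carrier R"
  shows "eval (a # replicate n \<zero> @ q) x = a \<otimes> x [^] (n + length q) \<oplus> eval q x"
  using assms eval_replicate[OF assms(2,3)] by simp

context fp_mpoly4
begin

text \<open>The extension itself, as an endomorphism of \<open>L\<close> whose image
  \<open>K\<close> is the copy of the base field.\<close>

definition iot where "iot = D.frac_map L io"

lemma iot_hom: "iot \<in> ring_hom L L"
  unfolding iot_def using io_inj by (intro D.frac_map_hom[OF L.field_axioms io_hom]) auto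

lemma iot_em: "f \<in> carrier M \<Longrightarrow> iot (em f) = io f"
  unfolding iot_def by (rule D.frac_map_base[OF L.field_axioms io_hom])

lemma iot_closed [simp]: "x \<in> carrier L \<Longrightarrow> iot x \<in> carrier L" by (rule ring_hom_closed[OF iot_hom])

abbreviation K where "K \<equiv> iot ` carrier L"

lemma K_subfield: "subfield K L"
  using ring_hom_ring.img_is_subfield(2)[OF ring_hom_ringI2[OF D.Q.ring_axioms D.Q.ring_axioms iot_hom] L.carrier_is_subfield]
  by simp

lemmas K_closed = subringE(2,3,5,6,7)[OF subfieldE(1)[OF K_subfield]]

lemma K_carr: "x \<in> K \<Longrightarrow> x \<in> carrier L" using subfieldE(3)[OF K_subfield] by blast

lemma K_pow: "x \<in> K \<Longrightarrow> x [^]\<^bsub>L\<^esub> (n::nat) \<in> K" by (induction n) (auto intro: K_closed)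

lemma K_inv: "x \<in> K \<Longrightarrow> x \<noteq> \<zero>\<^bsub>L\<^esub> \<Longrightarrow> inv\<^bsub>L\<^esub> x \<in> K"
  using D.Q.subfield_m_inv(1)[OF K_subfield, of x] by blast

lemma K_minus: "x \<in> K \<Longrightarrow> y \<in> K \<Longrightarrow> x \<ominus>\<^bsub>L\<^esub> y \<in> K"
  unfolding D.Q.minus_eq by (intro K_closed)

lemma io_K: "f \<in> carrier M \<Longrightarrow> io f \<in> K"
  using iot_em by (metis em_closed imageI)

lemma K_gen: "i < 4 \<Longrightarrow> gen i \<in> K"
  using io_K[OF X_closed, of i] by (simp add: io_Var)

lemma K_elems: "ac \<in> K" "aa \<in> K" "ab \<in> K" "au \<in> K" "Delta \<in> K"
proof -
  show c: "ac \<in> K" and "au \<in> K" using K_gen[of 0] K_gen[of 3] by (simp_all add: gen_def)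
  have "x \<in> K" if "ac [^]\<^bsub>L\<^esub> p \<otimes>\<^bsub>L\<^esub> x \<in> K" "x \<in> carrier L" for x
    using D.Q.subfield_m_inv_simprule[OF K_subfield, of "ac [^]\<^bsub>L\<^esub> p" x] that K_pow[OF c, of p] L_pow_nz[of ac p] elem_nz by simp
  then show a: "aa \<in> K" and b: "ab \<in> K" using K_gen[of 1] K_gen[of 2] by (simp_all add: gen_def)
  show "Delta \<in> K" unfolding Delta_def by (intro K_minus K_closed K_pow a b)
qed

text \<open>\<open>g\<close> is a root of \<open>(a T\<^sup>p - a\<^sup>p T)\<^sup>p - \<Delta>\<^sup>p\<^sup>-\<^sup>1 (a T\<^sup>p - a\<^sup>p T) - \<Delta>\<^sup>p a\<^sup>p u\<close>.\<close>

lemma ag_monic_relation: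
  obtains F where "set F \<subseteq> K" "length F = p * p" "F \<noteq> []" "D.Q.eval (\<one>\<^bsub>L\<^esub> # F) ag = \<zero>\<^bsub>L\<^esub>"
proof -
  obtain n :: nat where n: "n > 0" "\<And>x. x [^]\<^bsub>L\<^esub> p = x [^]\<^bsub>L\<^esub> n \<otimes>\<^bsub>L\<^esub> x" using p_pred by blast
  define H where "H = aa \<otimes>\<^bsub>L\<^esub> ag [^]\<^bsub>L\<^esub> p \<ominus>\<^bsub>L\<^esub> aa [^]\<^bsub>L\<^esub> p \<otimes>\<^bsub>L\<^esub> ag"
  have H: "H = Delta \<otimes>\<^bsub>L\<^esub> ah"
  proof -
    have "H \<in> carrier L" by (simp add: H_def)
    then have "H \<otimes>\<^bsub>L\<^esub> (Delta \<otimes>\<^bsub>L\<^esub> di) = Delta \<otimes>\<^bsub>L\<^esub> (H \<otimes>\<^bsub>L\<^esub> di)" using inverses by (simp add: D.Q.m_ac)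
    then show ?thesis using \<open>H \<in> carrier L\<close> inverses unfolding ah_def H_def by simp
  qed
  have "H [^]\<^bsub>L\<^esub> p = Delta [^]\<^bsub>L\<^esub> p \<otimes>\<^bsub>L\<^esub> (ah \<oplus>\<^bsub>L\<^esub> aa [^]\<^bsub>L\<^esub> p \<otimes>\<^bsub>L\<^esub> au)"
  proof -
    have "ah [^]\<^bsub>L\<^esub> p = ah \<oplus>\<^bsub>L\<^esub> aa [^]\<^bsub>L\<^esub> p \<otimes>\<^bsub>L\<^esub> au"
      unfolding au_relation using hk_closed(1) D.Q.nat_pow_closed[OF hk_closed(1), of p]
      by (elim D.Q.rep_cases) (simp add: D.Q.rep_hom algebra_simps)
    then show ?thesis unfolding H by (simp add: D.Q.nat_pow_distrib)
  qed
  also have "\<dots> = Delta [^]\<^bsub>L\<^esub> n \<otimes>\<^bsub>L\<^esub> (Delta \<otimes>\<^bsub>L\<^esub> ah) \<oplus>\<^bsub>L\<^esub> Delta [^]\<^bsub>L\<^esub> p \<otimes>\<^bsub>L\<^esub> (aa [^]\<^bsub>L\<^esub> p \<otimes>\<^bsub>L\<^esub> au)"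
    unfolding n(2)[of Delta] by (simp add: D.Q.r_distr D.Q.m_assoc)
  finally have 1: "H [^]\<^bsub>L\<^esub> p = Delta [^]\<^bsub>L\<^esub> n \<otimes>\<^bsub>L\<^esub> H \<oplus>\<^bsub>L\<^esub> Delta [^]\<^bsub>L\<^esub> p \<otimes>\<^bsub>L\<^esub> (aa [^]\<^bsub>L\<^esub> p \<otimes>\<^bsub>L\<^esub> au)" unfolding H .
  have 2: "H [^]\<^bsub>L\<^esub> p = aa [^]\<^bsub>L\<^esub> p \<otimes>\<^bsub>L\<^esub> ag [^]\<^bsub>L\<^esub> (p * p) \<ominus>\<^bsub>L\<^esub> (aa [^]\<^bsub>L\<^esub> p) [^]\<^bsub>L\<^esub> p \<otimes>\<^bsub>L\<^esub> ag [^]\<^bsub>L\<^esub> p"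
    unfolding H_def by (simp add: L_frob_minus D.Q.nat_pow_distrib D.Q.nat_pow_pow)
  \<comment> \<open>The coefficients at \<open>T^p\<close>, \<open>T\<close> and 1 after division by
    the leading coefficient \<open>a^p\<close>.\<close>
  define c1 where "c1 = \<ominus>\<^bsub>L\<^esub> (((aa [^]\<^bsub>L\<^esub> p) [^]\<^bsub>L\<^esub> p \<oplus>\<^bsub>L\<^esub> Delta [^]\<^bsub>L\<^esub> n \<otimes>\<^bsub>L\<^esub> aa) \<otimes>\<^bsub>L\<^esub> ia)"
  define c2 where "c2 = Delta [^]\<^bsub>L\<^esub> n"
  define c3 where "c3 = \<ominus>\<^bsub>L\<^esub> (Delta [^]\<^bsub>L\<^esub> p \<otimes>\<^bsub>L\<^esub> au)"
  \<comment> \<open>The blocks of zeros fill the degrees strictly between \<open>p * p\<close> and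
    \<open>p\<close>, and strictly between \<open>p\<close> and 1; the second block is empty for
    \<open>p = 2\<close>.\<close>
  define F where "F = replicate (p * p - p - 1) \<zero>\<^bsub>L\<^esub> @ c1 # replicate (p - 2) \<zero>\<^bsub>L\<^esub> @ [c2, c3]"
  have pp: "p * p \<ge> p + 1" "p \<ge> 2" using p_gt1 mult_le_mono1[of 2 p p] by linarith+
  have iaK: "ia \<in> K" unfolding ia_def using K_elems elem_nz by (intro K_inv K_pow L_pow_nz) auto
  have cK: "c1 \<in> K" "c2 \<in> K" "c3 \<in> K" unfolding c1_def c2_def c3_def by (intro K_closed K_pow K_elems iaK)+
  note cL = cK[THEN K_carr]
  have "set F \<subseteq> K" unfolding F_def using cK K_closed(1) by auto
  moreover have "length F = p * p" unfolding F_def using pp by simp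
  moreover have "D.Q.eval (\<one>\<^bsub>L\<^esub> # F) ag = \<zero>\<^bsub>L\<^esub>"
  proof -
    let ?Q = "c1 # replicate (p - 2) \<zero>\<^bsub>L\<^esub> @ [c2, c3]"
    have len: "p * p - p - 1 + length ?Q = p * p" "p - 2 + length [c2, c3] = p" using pp by simp_all
    have "D.Q.eval ?Q ag = c1 \<otimes>\<^bsub>L\<^esub> ag [^]\<^bsub>L\<^esub> (p - 2 + length [c2, c3]) \<oplus>\<^bsub>L\<^esub> D.Q.eval [c2, c3] ag"
      by (rule D.Q.eval_sparse) (use cL in auto)
    moreover have "D.Q.eval (\<one>\<^bsub>L\<^esub> # F) ag = \<one>\<^bsub>L\<^esub> \<otimes>\<^bsub>L\<^esub> ag [^]\<^bsub>L\<^esub> (p * p - p - 1 + length ?Q) \<oplus>\<^bsub>L\<^esub> D.Q.eval ?Q ag"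
      unfolding F_def by (rule D.Q.eval_sparse) (use cL in auto)
    ultimately have "D.Q.eval (\<one>\<^bsub>L\<^esub> # F) ag = \<one>\<^bsub>L\<^esub> \<otimes>\<^bsub>L\<^esub> ag [^]\<^bsub>L\<^esub> (p * p) \<oplus>\<^bsub>L\<^esub> (c1 \<otimes>\<^bsub>L\<^esub> ag [^]\<^bsub>L\<^esub> p \<oplus>\<^bsub>L\<^esub> D.Q.eval [c2, c3] ag)"
      unfolding len by (simp only:)
    also have "\<dots> = ag [^]\<^bsub>L\<^esub> (p * p) \<oplus>\<^bsub>L\<^esub> (c1 \<otimes>\<^bsub>L\<^esub> ag [^]\<^bsub>L\<^esub> p \<oplus>\<^bsub>L\<^esub> (c2 \<otimes>\<^bsub>L\<^esub> ag \<oplus>\<^bsub>L\<^esub> c3))" using cL by simp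
    also have "\<dots> = \<zero>\<^bsub>L\<^esub>"
    proof -
      have c: "ag [^]\<^bsub>L\<^esub> (p * p) \<in> carrier L" "ag [^]\<^bsub>L\<^esub> p \<in> carrier L" "aa [^]\<^bsub>L\<^esub> p \<in> carrier L" "(aa [^]\<^bsub>L\<^esub> p) [^]\<^bsub>L\<^esub> p \<in> carrier L"
        "Delta [^]\<^bsub>L\<^esub> n \<in> carrier L" "Delta [^]\<^bsub>L\<^esub> p \<in> carrier L" "au \<in> carrier L" "ag \<in> carrier L" "aa \<in> carrier L" "ia \<in> carrier L"
        using inverses by simp_all
      \<comment> \<open>To be a polynomial identity, the equation treats \<open>ia\<close> as an
        independent element; the last summand compensates for that and vanishes once
        \<open>a^p ia = 1\<close> is used.\<close>
      have e: "ag [^]\<^bsub>L\<^esub> (p * p) \<oplus>\<^bsub>L\<^esub> (c1 \<otimes>\<^bsub>L\<^esub> ag [^]\<^bsub>L\<^esub> p \<oplus>\<^bsub>L\<^esub> (c2 \<otimes>\<^bsub>L\<^esub> ag \<oplus>\<^bsub>L\<^esub> c3)) =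
        ia \<otimes>\<^bsub>L\<^esub> ((aa [^]\<^bsub>L\<^esub> p \<otimes>\<^bsub>L\<^esub> ag [^]\<^bsub>L\<^esub> (p * p) \<ominus>\<^bsub>L\<^esub> (aa [^]\<^bsub>L\<^esub> p) [^]\<^bsub>L\<^esub> p \<otimes>\<^bsub>L\<^esub> ag [^]\<^bsub>L\<^esub> p) \<ominus>\<^bsub>L\<^esub> (Delta [^]\<^bsub>L\<^esub> n \<otimes>\<^bsub>L\<^esub> (aa \<otimes>\<^bsub>L\<^esub> ag [^]\<^bsub>L\<^esub> p \<ominus>\<^bsub>L\<^esub> aa [^]\<^bsub>L\<^esub> p \<otimes>\<^bsub>L\<^esub> ag) \<oplus>\<^bsub>L\<^esub> Delta [^]\<^bsub>L\<^esub> p \<otimes>\<^bsub>L\<^esub> (aa [^]\<^bsub>L\<^esub> p \<otimes>\<^bsub>L\<^esub> au)))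
        \<oplus>\<^bsub>L\<^esub> (\<one>\<^bsub>L\<^esub> \<ominus>\<^bsub>L\<^esub> aa [^]\<^bsub>L\<^esub> p \<otimes>\<^bsub>L\<^esub> ia) \<otimes>\<^bsub>L\<^esub> (ag [^]\<^bsub>L\<^esub> (p * p) \<oplus>\<^bsub>L\<^esub> Delta [^]\<^bsub>L\<^esub> n \<otimes>\<^bsub>L\<^esub> ag \<ominus>\<^bsub>L\<^esub> Delta [^]\<^bsub>L\<^esub> p \<otimes>\<^bsub>L\<^esub> au)"
        unfolding c1_def c2_def c3_def using c by (elim D.Q.rep_cases) (simp add: D.Q.rep_hom algebra_simps)
      have "ag [^]\<^bsub>L\<^esub> (p * p) \<oplus>\<^bsub>L\<^esub> (c1 \<otimes>\<^bsub>L\<^esub> ag [^]\<^bsub>L\<^esub> p \<oplus>\<^bsub>L\<^esub> (c2 \<otimes>\<^bsub>L\<^esub> ag \<oplus>\<^bsub>L\<^esub> c3)) =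
        ia \<otimes>\<^bsub>L\<^esub> (H [^]\<^bsub>L\<^esub> p \<ominus>\<^bsub>L\<^esub> H [^]\<^bsub>L\<^esub> p) \<oplus>\<^bsub>L\<^esub> (\<one>\<^bsub>L\<^esub> \<ominus>\<^bsub>L\<^esub> \<one>\<^bsub>L\<^esub>) \<otimes>\<^bsub>L\<^esub> (ag [^]\<^bsub>L\<^esub> (p * p) \<oplus>\<^bsub>L\<^esub> Delta [^]\<^bsub>L\<^esub> n \<otimes>\<^bsub>L\<^esub> ag \<ominus>\<^bsub>L\<^esub> Delta [^]\<^bsub>L\<^esub> p \<otimes>\<^bsub>L\<^esub> au)"
        unfolding e inverses(4) unfolding 2[symmetric] unfolding H_def[symmetric] unfolding 1[symmetric] ..
      also have "\<dots> = \<zero>\<^bsub>L\<^esub>" using c by (simp add: H_def D.Q.minus_eq D.Q.r_neg)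
      finally show ?thesis .
    qed
    finally show ?thesis .
  qed
  moreover have "F \<noteq> []" by (simp add: F_def)
  ultimately show ?thesis using that by blast
qed

lemma ag_algebraic: "(D.Q.algebraic over K) ag"
proof -
  obtain F where F: "set F \<subseteq> K" "D.Q.eval (\<one>\<^bsub>L\<^esub> # F) ag = \<zero>\<^bsub>L\<^esub>" by (rule ag_monic_relation)
  have "\<one>\<^bsub>L\<^esub> # F \<in> carrier (K[X]\<^bsub>L\<^esub>)"
    unfolding univ_poly_carrier[symmetric] polynomial_def using F(1) K_closed(2) D.Q.one_not_zero by simp
  then show ?thesis by (rule D.Q.algebraicI) (use F in simp_all)
qed

text \<open>The base field contains \<open>c\<close>, and \<open>a = y / c^p\<close> and
  \<open>b = z / c^p\<close>, so \<open>g\<close> is the only variable left to adjoin.\<close>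

lemma L_simple: "D.Q.simple_extension K ag = carrier L"
proof
  have gL: "ag \<in> carrier L" by simp
  let ?E = "D.Q.simple_extension K ag"
  show "?E \<subseteq> carrier L" by (rule D.Q.simple_extension_in_carrier[OF subfieldE(3)[OF K_subfield] gL])
  have E: "subfield ?E L" using D.Q.simple_extension_is_subfield[OF K_subfield gL] ag_algebraic by simp
  note Ec = subringE(2,3,5,6,7)[OF subfieldE(1)[OF E]]
  have KE: "x \<in> K \<Longrightarrow> x \<in> ?E" for x using D.Q.simple_extension_incl[OF subfieldE(3)[OF K_subfield] gL] by blast
  have gE: "ag \<in> ?E" by (rule D.Q.simple_extension_mem[OF subfieldE(1)[OF K_subfield] gL])
  have V: "em (Var i) \<in> ?E" if "i < 4" for i
  proof -
    have "i \<in> {0, 1, 2, 3}" using that by auto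
    then show ?thesis using K_elems[THEN KE] gE unfolding ac_def aa_def ab_def ag_def by auto
  qed
  have emE: "em f \<in> ?E" if "f \<in> carrier M" for f
    using that
  proof (induction f rule: M_induct)
    case (var i f)
    have "em (Var i \<otimes>\<^bsub>M\<^esub> f) = em (Var i) \<otimes>\<^bsub>L\<^esub> em f" by (rule em_simps(4)[OF X_closed[OF var(1)] var(2)])
    then show ?case using Ec(4)[OF V[OF var(1)] var(3)] by simp
  next
    case (add f g)
    have "em (f \<oplus>\<^bsub>M\<^esub> g) = em f \<oplus>\<^bsub>L\<^esub> em g" by (rule em_simps(3)[OF add(1,2)])
    then show ?case using Ec(5)[OF add(3,4)] by simp
  qed (simp_all only: em_simps(1,2) Ec(1,2))
  show "carrier L \<subseteq> ?E"
  proof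
    fix x assume x: "x \<in> carrier L"
    obtain f s where fs: "f \<in> carrier M" "s \<in> carrier M" "s \<noteq> \<zero>\<^bsub>M\<^esub>" "x \<otimes>\<^bsub>L\<^esub> em s = em f" using x by (rule L_cases)
    have "em s \<in> ?E - {\<zero>\<^bsub>L\<^esub>}" using emE[OF fs(2)] fs by (simp add: em_eq_zero_iff)
    moreover have "em s \<otimes>\<^bsub>L\<^esub> x \<in> ?E" using emE[OF fs(1)] fs(2,4) x by (simp add: D.Q.m_comm)
    ultimately show "x \<in> ?E" using D.Q.subfield_m_inv_simprule[OF E _ x] by blast
  qed
qed

lemma finite_dimension_L: "D.Q.finite_dimension K (carrier L)"
  using D.Q.finite_dimension_simple_extension[OF K_subfield, of ag] ag_algebraic unfolding L_simple by simp

lemma sg_K: "x \<in> K \<Longrightarrow> sg i j x = x"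
proof -
  assume "x \<in> K"
  then obtain y where y: "y \<in> carrier L" "x = iot y" by blast
  have "(sg i j \<circ> iot) y = iot y"
    by (rule L_hom_unique[OF ring_hom_trans[OF iot_hom sg_hom] iot_hom _ y(1)])
      (simp add: iot_em X_closed sg_io)
  then show ?thesis using y(2) by simp
qed

lemma kL_inj: "i \<in> {0..<int p} \<Longrightarrow> i' \<in> {0..<int p} \<Longrightarrow> kL i = kL i' \<Longrightarrow> i = i'"
proof -
  assume i: "i \<in> {0..<int p}" "i' \<in> {0..<int p}" and e: "kL i = kL i'"
  have "kL (i - i') \<oplus>\<^bsub>L\<^esub> kL i' = kL i" by (simp flip: kL_props(4))
  then have "kL (i - i') = \<zero>\<^bsub>L\<^esub>" unfolding e using kL_props(1) D.Q.add.r_cancel_one[of "kL i'" "kL (i - i')"] D.Q.a_comm by simp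
  then have "int p dvd i - i'" by (simp add: kL_props(6))
  then have "i mod int p = i' mod int p" by (simp add: mod_eq_dvd_iff)
  then show "i = i'" using i by simp
qed

lemma gal_eqI:
  assumes h: "h \<in> ring_hom L L" "\<And>x. x \<in> K \<Longrightarrow> h x = x" and h': "h' \<in> ring_hom L L" "\<And>x. x \<in> K \<Longrightarrow> h' x = x"
    and g: "h ag = h' ag" and x: "x \<in> carrier L"
  shows "h x = h' x"
proof (rule L_hom_unique[OF h(1) h'(1) _ x])
  fix k :: nat assume "k < 4"
  then have "k \<in> {0, 1, 2, 3}" by auto
  then show "h (em (Var k)) = h' (em (Var k))"
    using g h(2)[OF K_elems(1)] h(2)[OF K_elems(2)] h(2)[OF K_elems(3)]
      h'(2)[OF K_elems(1)] h'(2)[OF K_elems(2)] h'(2)[OF K_elems(3)]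
    unfolding ac_def aa_def ab_def ag_def by auto
qed

lemma sg_inj:
  assumes "i \<in> {0..<int p}" "j \<in> {0..<int p}" "i' \<in> {0..<int p}" "j' \<in> {0..<int p}" "sg i j ag = sg i' j' ag"
  shows "i = i' \<and> j = j'"
proof -
  have eq: "sg i j x = sg i' j' x" if "x \<in> carrier L" for x
    by (rule gal_eqI[OF sg_hom sg_K sg_hom sg_K assms(5) that])
  have "ah \<oplus>\<^bsub>L\<^esub> kL j = ah \<oplus>\<^bsub>L\<^esub> kL j'" using eq[OF hk_closed(1)] unfolding sg_hk .
  then have "kL j = kL j'" using kL_props(1) by (simp add: D.Q.add.l_cancel)
  moreover have "kL i = kL i'"
  proof -
    have e: "ak \<ominus>\<^bsub>L\<^esub> (ak \<ominus>\<^bsub>L\<^esub> kL v) = kL v" for v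
      using hk_closed(2) kL_props(1)[of v] by (elim D.Q.rep_cases) (simp add: D.Q.rep_hom)
    have "ak \<ominus>\<^bsub>L\<^esub> kL i = ak \<ominus>\<^bsub>L\<^esub> kL i'" using eq[OF hk_closed(2)] unfolding sg_hk .
    from arg_cong[OF this, of "\<lambda>t. ak \<ominus>\<^bsub>L\<^esub> t"] show ?thesis unfolding e .
  qed
  ultimately show ?thesis using assms kL_inj by blast
qed

abbreviation idx where "idx \<equiv> {0..<int p} \<times> {0..<int p}"

text \<open>Write \<open>x\<close> as a polynomial in \<open>g\<close> with \<open>p * p\<close>
  coefficients from \<open>K\<close>. All translations fix \<open>x\<close> and these coefficients,
  so the same polynomial takes the value \<open>x\<close> at the \<open>p * p\<close> distinct
  conjugates of \<open>g\<close> and must be constant.\<close>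

lemma fixed_in_K:
  assumes x: "x \<in> carrier L" and fixd: "\<And>i j. (i, j) \<in> idx \<Longrightarrow> sg i j x = x"
  shows "x \<in> K"
proof -
  obtain F where F: "set F \<subseteq> K" "length F = p * p" "F \<noteq> []" "D.Q.eval (\<one>\<^bsub>L\<^esub> # F) ag = \<zero>\<^bsub>L\<^esub>" by (rule ag_monic_relation)
  have "x \<in> D.Q.simple_extension K ag" unfolding L_simple by (rule x)
  then obtain rs where rs: "set rs \<subseteq> K" "length rs = length F" "x = D.Q.eval rs ag"
    using D.Q.simple_extension_monic[OF K_subfield _ F(1,3,4)] by auto
  obtain bs r where br: "rs = bs @ [r]" using rs(2) F(3) by (cases rs rule: rev_cases) auto
  have rsL: "set bs \<subseteq> carrier L" "r \<in> carrier L" using rs(1) K_carr unfolding br by auto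
  let ?T = "(\<lambda>(i, j). sg i j ag) ` idx"
  have inj: "inj_on (\<lambda>(i, j). sg i j ag) idx"
  proof (rule inj_onI)
    fix v w assume v: "v \<in> idx" and w: "w \<in> idx" and e: "(\<lambda>(i, j). sg i j ag) v = (\<lambda>(i, j). sg i j ag) w"
    obtain i j i' j' where vw: "v = (i, j)" "w = (i', j')" by (cases v, cases w)
    show "v = w" using sg_inj[of i j i' j'] v w e unfolding vw by simp
  qed
  \<comment> \<open>The polynomial minus \<open>x\<close>, with the constant coefficient last; its
    length equals the number of conjugates.\<close>
  have "set (bs @ [r \<ominus>\<^bsub>L\<^esub> x]) \<subseteq> {\<zero>\<^bsub>L\<^esub>}"
  proof (rule D.Q.too_many_roots)
    show "set (bs @ [r \<ominus>\<^bsub>L\<^esub> x]) \<subseteq> carrier L" using rsL x by auto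
    show "finite ?T" "?T \<subseteq> carrier L" by auto
    show "length (bs @ [r \<ominus>\<^bsub>L\<^esub> x]) \<le> card ?T"
      using rs(2) F(2) unfolding card_image[OF inj] br by simp
  next
    fix t assume "t \<in> ?T"
    then obtain i j where ij: "(i, j) \<in> idx" "t = sg i j ag" by auto
    have t: "t \<in> carrier L" unfolding ij(2) by simp
    interpret h: ring_hom_ring L L "sg i j" by (rule ring_hom_ringI2[OF D.Q.ring_axioms D.Q.ring_axioms sg_hom])
    have "D.Q.eval (map (sg i j) rs) t = sg i j x"
      unfolding rs(3) ij(2) using rs(1) K_carr by (intro h.eval_hom'[symmetric]) auto
    moreover have "map (sg i j) rs = rs" using rs(1) sg_K by (auto intro!: map_idI)
    ultimately have "D.Q.eval (bs @ [r]) t = x" using fixd[OF ij(1)] br by simp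
    moreover have "D.Q.eval (bs @ [r]) t = D.Q.eval bs t \<otimes>\<^bsub>L\<^esub> t \<oplus>\<^bsub>L\<^esub> r" by (rule D.Q.eval_append_aux[OF rsL t])
    moreover have "D.Q.eval (bs @ [r \<ominus>\<^bsub>L\<^esub> x]) t = D.Q.eval bs t \<otimes>\<^bsub>L\<^esub> t \<oplus>\<^bsub>L\<^esub> (r \<ominus>\<^bsub>L\<^esub> x)"
      by (rule D.Q.eval_append_aux[OF rsL(1) D.Q.minus_closed[OF rsL(2) x] t])
    moreover have "D.Q.eval bs t \<in> carrier L" using rsL t by (intro D.Q.eval_in_carrier)
    then have "D.Q.eval bs t \<otimes>\<^bsub>L\<^esub> t \<oplus>\<^bsub>L\<^esub> (r \<ominus>\<^bsub>L\<^esub> x) = (D.Q.eval bs t \<otimes>\<^bsub>L\<^esub> t \<oplus>\<^bsub>L\<^esub> r) \<ominus>\<^bsub>L\<^esub> x"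
      using rsL t x by (simp add: D.Q.minus_eq D.Q.a_assoc)
    ultimately show "D.Q.eval (bs @ [r \<ominus>\<^bsub>L\<^esub> x]) t = \<zero>\<^bsub>L\<^esub>" using x by (simp add: D.Q.r_right_minus_eq)
  qed
  then have "r \<ominus>\<^bsub>L\<^esub> x = \<zero>\<^bsub>L\<^esub>" by simp
  then have "r = x" using rsL x by (simp add: D.Q.r_right_minus_eq)
  moreover have "r \<in> K" using rs(1) unfolding br by simp
  ultimately show ?thesis by simp
qed

text \<open>The constants are already \<open>p\<close> distinct roots of \<open>T^p - T\<close>; one
  more root would be too many.\<close>

lemma artin_schreier_root:
  assumes e: "e \<in> carrier L" "e [^]\<^bsub>L\<^esub> p = e"
  shows "\<exists>j\<in>{0..<int p}. e = kL j"
proof (rule ccontr)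
  assume no: "\<not> (\<exists>j\<in>{0..<int p}. e = kL j)"
  let ?T = "insert e (kL ` {0..<int p})"
  let ?as = "\<one>\<^bsub>L\<^esub> # replicate (p - 2) \<zero>\<^bsub>L\<^esub> @ [\<ominus>\<^bsub>L\<^esub> \<one>\<^bsub>L\<^esub>, \<zero>\<^bsub>L\<^esub>]"
  have p2: "p \<ge> 2" using p_gt1 by simp
  have inj: "inj_on kL {0..<int p}" by (rule inj_onI) (rule kL_inj)
  have "set ?as \<subseteq> {\<zero>\<^bsub>L\<^esub>}"
  proof (rule D.Q.too_many_roots)
    show "set ?as \<subseteq> carrier L" by auto
    show "finite ?T" "?T \<subseteq> carrier L" using e kL_props(1) by auto
    have "e \<notin> kL ` {0..<int p}" using no by blast
    then have "card ?T = Suc p" using card_image[OF inj] by simp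
    then show "length ?as \<le> card ?T" using p2 by simp
  next
    fix t assume "t \<in> ?T"
    then have t: "t \<in> carrier L" "t [^]\<^bsub>L\<^esub> p = t" using e kL_props(1) kL_frob by blast+
    have "D.Q.eval ?as t = \<one>\<^bsub>L\<^esub> \<otimes>\<^bsub>L\<^esub> t [^]\<^bsub>L\<^esub> (p - 2 + length [\<ominus>\<^bsub>L\<^esub> \<one>\<^bsub>L\<^esub>, \<zero>\<^bsub>L\<^esub>]) \<oplus>\<^bsub>L\<^esub> D.Q.eval [\<ominus>\<^bsub>L\<^esub> \<one>\<^bsub>L\<^esub>, \<zero>\<^bsub>L\<^esub>] t"
      by (rule D.Q.eval_sparse) (use t(1) in auto)
    also have "p - 2 + length [\<ominus>\<^bsub>L\<^esub> \<one>\<^bsub>L\<^esub>, \<zero>\<^bsub>L\<^esub>] = p" using p2 by simp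
    also have "\<one>\<^bsub>L\<^esub> \<otimes>\<^bsub>L\<^esub> t [^]\<^bsub>L\<^esub> p \<oplus>\<^bsub>L\<^esub> D.Q.eval [\<ominus>\<^bsub>L\<^esub> \<one>\<^bsub>L\<^esub>, \<zero>\<^bsub>L\<^esub>] t = \<zero>\<^bsub>L\<^esub>" using t by (simp add: D.Q.l_minus D.Q.r_neg)
    finally show "D.Q.eval ?as t = \<zero>\<^bsub>L\<^esub>" .
  qed
  then show False using D.Q.one_not_zero by simp
qed

text \<open>The elements \<open>h\<close> and \<open>k\<close> are roots of Artin-Schreier equations
  over \<open>K\<close>, with right sides \<open>a^p u\<close> and \<open>b^p u\<close>, so an
  automorphism translates each by a constant. Because \<open>g = b h - a k\<close>, its effect on
  \<open>g\<close> is then that of a translation, and \<open>g\<close> generates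
  \<open>L\<close>.\<close>

lemma automorphism_eq_sg:
  assumes h: "h \<in> ring_hom L L" "\<And>x. x \<in> K \<Longrightarrow> h x = x"
  shows "\<exists>(i, j)\<in>idx. \<forall>x\<in>carrier L. h x = sg i j x"
proof -
  interpret h: ring_hom_cring L L h by (rule UnivPoly.ring_hom_cringI[OF D.Q.is_cring D.Q.is_cring h(1)])
  have root: "\<exists>j\<in>{0..<int p}. h v = v \<oplus>\<^bsub>L\<^esub> kL j" if v: "v \<in> carrier L" "v [^]\<^bsub>L\<^esub> p \<ominus>\<^bsub>L\<^esub> v \<in> K" for v
  proof -
    have hv: "h v \<in> carrier L" using v by simp
    have vp: "v [^]\<^bsub>L\<^esub> p \<in> carrier L" "h v [^]\<^bsub>L\<^esub> p \<in> carrier L" using v hv by simp_all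
    have "h (v [^]\<^bsub>L\<^esub> n) = h v [^]\<^bsub>L\<^esub> n" for n :: nat using v(1) by (induction n) simp_all
    then have "h (v [^]\<^bsub>L\<^esub> p \<ominus>\<^bsub>L\<^esub> v) = h v [^]\<^bsub>L\<^esub> p \<ominus>\<^bsub>L\<^esub> h v" using v by (simp add: D.Q.minus_eq)
    then have eq: "h v [^]\<^bsub>L\<^esub> p \<ominus>\<^bsub>L\<^esub> h v = v [^]\<^bsub>L\<^esub> p \<ominus>\<^bsub>L\<^esub> v" using h(2)[OF v(2)] by simp
    have "(h v \<ominus>\<^bsub>L\<^esub> v) [^]\<^bsub>L\<^esub> p = h v [^]\<^bsub>L\<^esub> p \<ominus>\<^bsub>L\<^esub> v [^]\<^bsub>L\<^esub> p" by (rule L_frob_minus[OF hv v(1)])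
    also have "\<dots> = (h v \<ominus>\<^bsub>L\<^esub> v) \<oplus>\<^bsub>L\<^esub> ((h v [^]\<^bsub>L\<^esub> p \<ominus>\<^bsub>L\<^esub> h v) \<ominus>\<^bsub>L\<^esub> (v [^]\<^bsub>L\<^esub> p \<ominus>\<^bsub>L\<^esub> v))"
      using hv v(1) vp by (elim D.Q.rep_cases) (simp add: D.Q.rep_hom algebra_simps)
    also have "\<dots> = h v \<ominus>\<^bsub>L\<^esub> v" unfolding eq using hv v(1) vp by (simp add: D.Q.minus_eq D.Q.r_neg)
    finally have "(h v \<ominus>\<^bsub>L\<^esub> v) [^]\<^bsub>L\<^esub> p = h v \<ominus>\<^bsub>L\<^esub> v" .
    then obtain j where j: "j \<in> {0..<int p}" "h v \<ominus>\<^bsub>L\<^esub> v = kL j" using artin_schreier_root[of "h v \<ominus>\<^bsub>L\<^esub> v"] hv v by auto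
    have "h v = v \<oplus>\<^bsub>L\<^esub> (h v \<ominus>\<^bsub>L\<^esub> v)" using hv v(1) by (elim D.Q.rep_cases) (simp add: D.Q.rep_hom)
    then show ?thesis using j by auto
  qed
  have "aa [^]\<^bsub>L\<^esub> p \<otimes>\<^bsub>L\<^esub> au \<in> K" "ab [^]\<^bsub>L\<^esub> p \<otimes>\<^bsub>L\<^esub> au \<in> K" by (intro K_closed K_pow K_elems)+
  then obtain j l where jl: "j \<in> {0..<int p}" "h ah = ah \<oplus>\<^bsub>L\<^esub> kL j" "l \<in> {0..<int p}" "h ak = ak \<oplus>\<^bsub>L\<^esub> kL l"
    using root[of ah] root[of ak] unfolding au_relation by auto
  \<comment> \<open>A translation by \<open>(i, j)\<close> moves \<open>k\<close> by
    \<open>-i\<close>, whence the sign.\<close>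
  define i where "i = (- l) mod int p"
  have i: "i \<in> {0..<int p}" unfolding i_def using p_pos by simp
  have kl: "kL l = \<ominus>\<^bsub>L\<^esub> kL i"
  proof -
    have "kL i = kL (- l)" unfolding i_def by (rule kL_props(5)[symmetric])
    moreover have "kL l \<oplus>\<^bsub>L\<^esub> kL (- l) = \<zero>\<^bsub>L\<^esub>" using kL_props(2) by (simp flip: kL_props(4))
    ultimately show ?thesis using kL_props(1) D.Q.minus_equality[of "kL l" "kL i"] by simp
  qed
  have "h ag = ab \<otimes>\<^bsub>L\<^esub> h ah \<ominus>\<^bsub>L\<^esub> aa \<otimes>\<^bsub>L\<^esub> h ak"
    using h(2)[OF K_elems(2)] h(2)[OF K_elems(3)] by (subst hk_relation(1)[symmetric]) (simp add: D.Q.minus_eq)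
  also have "\<dots> = (ab \<otimes>\<^bsub>L\<^esub> ah \<ominus>\<^bsub>L\<^esub> aa \<otimes>\<^bsub>L\<^esub> ak) \<oplus>\<^bsub>L\<^esub> kL i \<otimes>\<^bsub>L\<^esub> aa \<oplus>\<^bsub>L\<^esub> kL j \<otimes>\<^bsub>L\<^esub> ab"
    unfolding jl kl using elem_closed(2,3) hk_closed(1,2) kL_props(1)[of i] kL_props(1)[of j]
    by (elim D.Q.rep_cases) (simp add: D.Q.rep_hom algebra_simps)
  also have "\<dots> = sg i j ag" unfolding hk_relation sg_basic ..
  finally have gg: "h ag = sg i j ag" .
  have "h x = sg i j x" if "x \<in> carrier L" for x by (rule gal_eqI[OF h sg_hom sg_K gg that])
  then show ?thesis using i jl(1) by blast
qed

text \<open>\<open>Bij\<close> consists of extensional functions, so the automorphisms are cut down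
  to the carrier.\<close>

definition gal where "gal = (\<lambda>(i, j). restrict (sg i j) (carrier L))"

abbreviation G where "G \<equiv> galois_group L K"

lemma carrier_G: "carrier G = {h \<in> ring_hom L L \<inter> Bij (carrier L). \<forall>x\<in>K. h x = x}"
  by (simp add: galois_group_def)

lemma gal_in_G: "gal (i, j) \<in> carrier G"
proof -
  have 1: "restrict (sg i j) (carrier L) \<in> ring_hom L L"
    by (rule ring_hom_memI) (simp_all add: sg_simps)
  have 2: "bij_betw (restrict (sg i j) (carrier L)) (carrier L) (carrier L)"
    by (rule bij_betwI[where g = "sg (- i) (- j)"]) (simp_all add: sg_comp sg_zero)
  have 3: "restrict (sg i j) (carrier L) x = x" if "x \<in> K" for x using sg_K[OF that] K_carr[OF that] by simp
  have "gal (i, j) = restrict (sg i j) (carrier L)" by (simp add: gal_def)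
  then show ?thesis unfolding carrier_G Bij_def
    by (simp only:) (intro CollectI conjI IntI ballI 1 2 restrict_extensional 3)
qed

lemma fixed_field: "{x \<in> carrier L. \<forall>h\<in>carrier G. h x = x} = K"
proof
  show "K \<subseteq> {x \<in> carrier L. \<forall>h\<in>carrier G. h x = x}" unfolding carrier_G using K_carr by blast
  show "{x \<in> carrier L. \<forall>h\<in>carrier G. h x = x} \<subseteq> K"
  proof
    fix x assume x: "x \<in> {x \<in> carrier L. \<forall>h\<in>carrier G. h x = x}"
    have "sg i j x = x" for i j using x bspec[OF _ gal_in_G[of i j], of "\<lambda>h. h x = x"] by (simp add: gal_def)
    then show "x \<in> K" using x by (intro fixed_in_K) auto
  qed
qed

lemma galois_group_iso: "G \<cong> integer_mod_group p \<times>\<times> integer_mod_group p"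
proof -
  let ?Z = "integer_mod_group p \<times>\<times> integer_mod_group p"
  have Z: "group ?Z" by (intro DirProd_group) simp_all
  have cZ: "carrier ?Z = idx" using p_pos by (simp add: DirProd_def carrier_integer_mod_group)
  have "gal \<in> iso ?Z G"
  proof -
    have "gal \<in> hom ?Z G"
    proof (rule homI)
      show "gal x \<in> carrier G" for x :: "int \<times> int" using gal_in_G by (cases x) simp
      fix x y :: "int \<times> int"
      obtain i j i' j' where xy: "x = (i, j)" "y = (i', j')" by (cases x, cases y)
      have B: "gal x \<in> Bij (carrier L)" "gal y \<in> Bij (carrier L)" using gal_in_G unfolding xy carrier_G by blast+
      have "gal (x \<otimes>\<^bsub>?Z\<^esub> y) = compose (carrier L) (gal x) (gal y)"
      proof
        show "gal (x \<otimes>\<^bsub>?Z\<^esub> y) v = compose (carrier L) (gal x) (gal y) v" for v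
          unfolding xy by (cases "v \<in> carrier L") (simp_all add: gal_def compose_def sg_comp sg_mod)
      qed
      then show "gal (x \<otimes>\<^bsub>?Z\<^esub> y) = gal x \<otimes>\<^bsub>G\<^esub> gal y"
        using B by (simp add: galois_group_def BijGroup_def)
    qed
    moreover have "inj_on gal idx"
    proof (rule inj_onI)
      fix x y assume x: "x \<in> idx" and y: "y \<in> idx" and e: "gal x = gal y"
      obtain i j i' j' where xy: "x = (i, j)" "y = (i', j')" by (cases x, cases y)
      have "sg i j ag = sg i' j' ag" using fun_cong[OF e, of ag] by (simp add: xy gal_def)
      then show "x = y" using sg_inj[of i j i' j'] x y unfolding xy by simp
    qed
    moreover have "carrier G \<subseteq> gal ` idx"
    proof
      fix h assume h: "h \<in> carrier G"
      then have h': "h \<in> ring_hom L L" "\<And>x. x \<in> K \<Longrightarrow> h x = x" "h \<in> extensional (carrier L)"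
        unfolding carrier_G Bij_def by blast+
      obtain i j where ij: "(i, j) \<in> idx" "\<forall>x\<in>carrier L. h x = sg i j x" using automorphism_eq_sg[OF h'(1,2)] by blast
      have "h = gal (i, j)"
      proof
        show "h v = gal (i, j) v" for v
          using ij(2) extensional_arb[OF h'(3), of v] by (cases "v \<in> carrier L") (simp_all add: gal_def)
      qed
      then show "h \<in> gal ` idx" using ij(1) by blast
    qed
    moreover have "gal ` idx \<subseteq> carrier G" using gal_in_G by force
    ultimately show ?thesis unfolding iso_iff cZ by blast
  qed
  then have "?Z \<cong> G" by (rule is_isoI)
  then show ?thesis by (rule group.iso_sym[OF Z])
qed

lemma elementary_abelian: "elementary_abelian_extension_p2 p L L iot"
  unfolding elementary_abelian_extension_p2_def finite_galois_extension_def
  using L.field_axioms iot_hom finite_dimension_L fixed_field galois_group_iso by blast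

end

section \<open>The integral closure\<close>

context fp_mpoly4
begin

abbreviation R0 where "R0 \<equiv> io ` carrier M"

lemma R0_subring: "subring R0 L"
  by (rule ring_hom_ring.img_is_subring[OF ring_hom_ringI2[OF M.ring_axioms D.Q.ring_axioms io_hom] M.carrier_is_subring])

sublocale R0: field_subring L R0
  by (intro field_subring.intro field_subring_axioms.intro L.field_axioms R0_subring)

lemma gen_R0: "i < 4 \<Longrightarrow> gen i \<in> R0"
  using X_closed[of i] by (metis io_Var imageI)

lemmas R0_closed = subringE(2,3,5,6,7)[OF R0_subring]

lemma R0_pow: "x \<in> R0 \<Longrightarrow> x [^]\<^bsub>L\<^esub> (n::nat) \<in> R0" by (induction n) (auto intro: R0_closed)

text \<open>The copy in \<open>L\<close> of the ideal generated by the first \<open>k\<close>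
  variables; for \<open>k = 3\<close> it is \<open>(c, y, z)\<close>.\<close>

definition qk where "qk k = io ` {f \<in> carrier M. zeros {..<k} f = \<zero>\<^bsub>M\<^esub>}"

lemma qkE:
  assumes "x \<in> qk k" obtains f where "f \<in> carrier M" "x = io f" "zeros {..<k} f = \<zero>\<^bsub>M\<^esub>"
  using assms unfolding qk_def by (elim imageE CollectE conjE)

lemma io_qk: "f \<in> carrier M \<Longrightarrow> io f \<in> qk k \<longleftrightarrow> zeros {..<k} f = \<zero>\<^bsub>M\<^esub>"
  unfolding qk_def using io_eq_iff by auto

lemma qk_prime: "D.Q.prime_of R0 (qk k)"
  unfolding D.Q.prime_of_def D.Q.ideal_of_def
proof (intro conjI ballI)
  have fin: "finite {..<k}" by simp
  show "qk k \<subseteq> R0" unfolding qk_def by blast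
  show "\<zero>\<^bsub>L\<^esub> \<in> qk k" using io_qk[of "\<zero>\<^bsub>M\<^esub>" k] by (simp add: zeros_simps io_simps)
  show "x \<oplus>\<^bsub>L\<^esub> y \<in> qk k" if xq: "x \<in> qk k" and yq: "y \<in> qk k" for x y
  proof -
    obtain f where f: "f \<in> carrier M" "x = io f" "zeros {..<k} f = \<zero>\<^bsub>M\<^esub>" using xq by (rule qkE)
    obtain g where g: "g \<in> carrier M" "y = io g" "zeros {..<k} g = \<zero>\<^bsub>M\<^esub>" using yq by (rule qkE)
    note fg = f(1) g(1) f(2) g(2) f(3) g(3)
    have "zeros {..<k} (f \<oplus>\<^bsub>M\<^esub> g) = \<zero>\<^bsub>M\<^esub>" using fg by (simp add: zeros_simps)
    then show ?thesis using io_qk[of "f \<oplus>\<^bsub>M\<^esub> g" k] fg by (simp add: io_simps)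
  qed
  show "r \<otimes>\<^bsub>L\<^esub> x \<in> qk k" if rq: "r \<in> R0" and xq: "x \<in> qk k" for r x
  proof -
    obtain f where f: "r = io f" "f \<in> carrier M" using rq by (rule imageE)
    obtain g where g: "g \<in> carrier M" "x = io g" "zeros {..<k} g = \<zero>\<^bsub>M\<^esub>" using xq by (rule qkE)
    note fg = f(2) g(1) f(1) g(2,3)
    have "zeros {..<k} (f \<otimes>\<^bsub>M\<^esub> g) = \<zero>\<^bsub>M\<^esub>" using fg by (simp add: zeros_simps zeros_closed)
    then show ?thesis using io_qk[of "f \<otimes>\<^bsub>M\<^esub> g" k] fg by (simp add: io_simps)
  qed
  show "\<one>\<^bsub>L\<^esub> \<notin> qk k" using io_qk[of "\<one>\<^bsub>M\<^esub>" k] by (simp add: zeros_simps io_simps)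
next
  fix x y assume x: "x \<in> R0" and y: "y \<in> R0"
  obtain f where f: "x = io f" "f \<in> carrier M" using x by (rule imageE)
  obtain g where g: "y = io g" "g \<in> carrier M" using y by (rule imageE)
  note fg = f(2) g(2) f(1) g(1)
  have "zeros {..<k} f = \<zero>\<^bsub>M\<^esub> \<or> zeros {..<k} g = \<zero>\<^bsub>M\<^esub>" if "zeros {..<k} (f \<otimes>\<^bsub>M\<^esub> g) = \<zero>\<^bsub>M\<^esub>"
    using that fg zeros_closed[of "{..<k}"] by (simp add: zeros_simps M.integral_iff)
  then show "x \<otimes>\<^bsub>L\<^esub> y \<in> qk k \<longrightarrow> x \<in> qk k \<or> y \<in> qk k"
    unfolding fg(3,4) io_simps(4)[OF fg(1,2), symmetric] using io_qk fg(1,2) M.m_closed by simp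
qed

lemma qk_strict: "k < 4 \<Longrightarrow> qk k \<subset> qk (Suc k)"
proof -
  assume k: "k < 4"
  have "zeros {..<Suc k} f = \<zero>\<^bsub>M\<^esub>" if "zeros {..<k} f = \<zero>\<^bsub>M\<^esub>" for f
  proof -
    have "zeros {..<Suc k} f = set_zero k (zeros {..<k} f)" by (simp add: lessThan_Suc zeros_insert)
    then show ?thesis unfolding that using ring_hom_zero[OF set_zero_hom M.ring_axioms M.ring_axioms] by simp
  qed
  then have "qk k \<subseteq> qk (Suc k)" unfolding qk_def by blast
  moreover have "io (Var k) \<in> qk (Suc k)" "io (Var k) \<notin> qk k"
    using io_qk[OF X_closed[OF k]] Var_nz[of k] by (simp_all add: zeros_simps(5))
  ultimately show ?thesis by blast
qed

lemma qk_0: "qk 0 = {\<zero>\<^bsub>L\<^esub>}"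
proof -
  have "{f \<in> carrier M. zeros {..<0} f = \<zero>\<^bsub>M\<^esub>} = {\<zero>\<^bsub>M\<^esub>}" by (auto simp: zeros_def)
  then show ?thesis unfolding qk_def by (simp add: io_simps)
qed

lemma qk_3:
  assumes "x \<in> qk 3"
  shows "\<exists>r1\<in>R0. \<exists>r2\<in>R0. \<exists>r3\<in>R0. x = gen 0 \<otimes>\<^bsub>L\<^esub> r1 \<oplus>\<^bsub>L\<^esub> gen 1 \<otimes>\<^bsub>L\<^esub> r2 \<oplus>\<^bsub>L\<^esub> gen 2 \<otimes>\<^bsub>L\<^esub> r3"
proof -
  obtain f where f: "f \<in> carrier M" "x = io f" "zeros {..<3} f = \<zero>\<^bsub>M\<^esub>" using assms by (rule qkE)
  \<comment> \<open>The difference between \<open>f\<close> and its value at zero of the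
    \<open>i\<close>-th variable is divisible by that variable. Applied to the variables 0, 1, 2 in
    turn, it leaves \<open>f\<close> with all three set to zero.\<close>
  have split: "\<exists>g\<in>carrier M. f = Var i \<otimes>\<^bsub>M\<^esub> g \<oplus>\<^bsub>M\<^esub> set_zero i f" if f: "f \<in> carrier M" and i: "i < 4" for f i
  proof -
    have s: "set_zero i f \<in> carrier M" by (rule set_zero_closed[OF f])
    have "set_zero i (set_zero i f) = set_zero i f" by (simp add: set_zero_def fun_eq_iff)
    moreover have "f = (f \<ominus>\<^bsub>M\<^esub> set_zero i f) \<oplus>\<^bsub>M\<^esub> set_zero i f" using f s by (elim M.rep_cases) (simp add: M.rep_hom)
    moreover have "set_zero i f = set_zero i (f \<ominus>\<^bsub>M\<^esub> set_zero i f) \<oplus>\<^bsub>M\<^esub> set_zero i (set_zero i f)"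
      using ring_hom_add[OF set_zero_hom, of "f \<ominus>\<^bsub>M\<^esub> set_zero i f" "set_zero i f" i] f s calculation(2) by simp
    ultimately have "set_zero i (f \<ominus>\<^bsub>M\<^esub> set_zero i f) \<oplus>\<^bsub>M\<^esub> set_zero i f = set_zero i f" by simp
    then have "set_zero i (f \<ominus>\<^bsub>M\<^esub> set_zero i f) = \<zero>\<^bsub>M\<^esub>"
      using M.add.r_cancel_one[of "set_zero i f" "set_zero i (f \<ominus>\<^bsub>M\<^esub> set_zero i f)"] M.a_comm s f set_zero_closed by simp
    then obtain g where "g \<in> carrier M" "f \<ominus>\<^bsub>M\<^esub> set_zero i f = Var i \<otimes>\<^bsub>M\<^esub> g"
      using set_zero_eq_zero_iff[of "f \<ominus>\<^bsub>M\<^esub> set_zero i f" i] f s i by auto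
    then show ?thesis using \<open>f = (f \<ominus>\<^bsub>M\<^esub> set_zero i f) \<oplus>\<^bsub>M\<^esub> set_zero i f\<close> by auto
  qed
  let ?f1 = "set_zero 0 f" and ?f2 = "set_zero 1 (set_zero 0 f)"
  have c: "?f1 \<in> carrier M" "?f2 \<in> carrier M" using f(1) set_zero_closed by auto
  obtain g0 where g0: "g0 \<in> carrier M" "f = Var 0 \<otimes>\<^bsub>M\<^esub> g0 \<oplus>\<^bsub>M\<^esub> ?f1" using split[OF f(1), of 0] by auto
  obtain g1 where g1: "g1 \<in> carrier M" "?f1 = Var 1 \<otimes>\<^bsub>M\<^esub> g1 \<oplus>\<^bsub>M\<^esub> ?f2" using split[OF c(1), of 1] by auto
  obtain g2 where g2: "g2 \<in> carrier M" "?f2 = Var 2 \<otimes>\<^bsub>M\<^esub> g2 \<oplus>\<^bsub>M\<^esub> set_zero 2 ?f2" using split[OF c(2), of 2] by auto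
  have "set_zero 2 ?f2 = zeros {..<3} f"
  proof
    fix m :: "nat multiset"
    have "set_mset m \<inter> {..<3} = {} \<longleftrightarrow> 0 \<notin># m \<and> 1 \<notin># m \<and> 2 \<notin># m"
    proof
      assume "set_mset m \<inter> {..<3} = {}"
      then have "a \<notin># m" if "a < 3" for a using that by blast
      then show "0 \<notin># m \<and> 1 \<notin># m \<and> 2 \<notin># m" by simp
    next
      assume *: "0 \<notin># m \<and> 1 \<notin># m \<and> 2 \<notin># m"
      have "a = 0 \<or> a = 1 \<or> a = 2" if "a < 3" for a :: nat using that by linarith
      then show "set_mset m \<inter> {..<3} = {}" using * by blast
    qed
    then show "set_zero 2 ?f2 m = zeros {..<3} f m" by (auto simp: set_zero_def zeros_def)
  qed
  then have z: "set_zero 2 ?f2 = \<zero>\<^bsub>M\<^esub>" using f(3) by simp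
  have X: "Var i \<in> carrier M" if "i < 4" for i using X_closed that .
  have e2: "io ?f2 = gen 2 \<otimes>\<^bsub>L\<^esub> io g2"
    using arg_cong[OF g2(2), of io] X[of 2] g2(1) unfolding z by (simp add: io_simps io_Var)
  have e1: "io ?f1 = gen 1 \<otimes>\<^bsub>L\<^esub> io g1 \<oplus>\<^bsub>L\<^esub> gen 2 \<otimes>\<^bsub>L\<^esub> io g2"
    using arg_cong[OF g1(2), of io] X[of 1] g1(1) c unfolding e2[symmetric] by (simp add: io_simps io_Var)
  have "io f = gen 0 \<otimes>\<^bsub>L\<^esub> io g0 \<oplus>\<^bsub>L\<^esub> io ?f1"
    using arg_cong[OF g0(2), of io] X[of 0] g0(1) c by (simp add: io_simps io_Var)
  then have "x = gen 0 \<otimes>\<^bsub>L\<^esub> io g0 \<oplus>\<^bsub>L\<^esub> gen 1 \<otimes>\<^bsub>L\<^esub> io g1 \<oplus>\<^bsub>L\<^esub> gen 2 \<otimes>\<^bsub>L\<^esub> io g2"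
    unfolding f(2) e1 using g0(1) g1(1) g2(1) by (simp add: D.Q.a_assoc)
  then show ?thesis using g0(1) g1(1) g2(1) by blast
qed

lemma R0_place: "b \<in> R0 \<Longrightarrow> b \<in> Oi 0 \<and> (b \<in> mi 0 \<longleftrightarrow> b \<in> qk 3)"
proof -
  assume "b \<in> R0"
  then obtain f where f: "f \<in> carrier M" "b = io f" by blast
  have z: "zeros {..<3} f \<in> carrier M" using f(1) by (intro zeros_closed) auto
  have "io (zeros {..<3} f) = \<zero>\<^bsub>L\<^esub> \<longleftrightarrow> zeros {..<3} f = \<zero>\<^bsub>M\<^esub>" using io_inj[OF z] by (auto simp: io_simps)
  then show ?thesis unfolding mi_def using res0_io[OF f(1)] io_qk[OF f(1), of 3] f(2) by simp
qed

text \<open>Normality of the base ring. Integrality bounds the denominators of all powers of the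
  fraction \<open>io f / io s\<close>, and complete integral closedness of \<open>M\<close> turns
  this into divisibility of \<open>f\<close> by \<open>s\<close>.\<close>

lemma K_integral_in_R0:
  assumes x: "x \<in> carrier R0.A" "x \<in> K" shows "x \<in> R0"
proof -
  obtain w where w: "w \<in> carrier L" "x = iot w" using x(2) by blast
  obtain f s where fs: "f \<in> carrier M" "s \<in> carrier M" "s \<noteq> \<zero>\<^bsub>M\<^esub>" "w \<otimes>\<^bsub>L\<^esub> em s = em f" using w(1) by (rule L_cases)
  have xs: "io s \<otimes>\<^bsub>L\<^esub> x = io f"
    using arg_cong[OF fs(4), of iot] ring_hom_mult[OF iot_hom w(1), of "em s"] w fs by (simp add: iot_em D.Q.m_comm)
  have xL: "x \<in> carrier L" using w by simp
  have "\<exists>n::nat. \<forall>m::nat. io s [^]\<^bsub>L\<^esub> n \<otimes>\<^bsub>L\<^esub> x [^]\<^bsub>L\<^esub> m \<in> R0"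
    by (rule R0.integral_bounded_denominators[OF x(1)]) (unfold xs, rule imageI[OF fs(2)], rule imageI[OF fs(1)])
  then obtain n :: nat where n: "\<And>m::nat. io s [^]\<^bsub>L\<^esub> n \<otimes>\<^bsub>L\<^esub> x [^]\<^bsub>L\<^esub> m \<in> R0" by blast
  have "\<exists>g\<in>carrier M. f = s \<otimes>\<^bsub>M\<^esub> g"
  proof (rule M_completely_integrally_closed[OF fs(1,2)])
    show "s [^]\<^bsub>M\<^esub> n \<in> carrier M" using fs(2) by simp
    show "s [^]\<^bsub>M\<^esub> n \<noteq> \<zero>\<^bsub>M\<^esub>" by (induction n) (use fs in \<open>simp_all add: M.integral_iff\<close>)
    fix m :: nat
    obtain r where r': "io s [^]\<^bsub>L\<^esub> n \<otimes>\<^bsub>L\<^esub> x [^]\<^bsub>L\<^esub> m = io r" "r \<in> carrier M" using n[of m] by (rule imageE)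
    note r = r'(2,1)
    have "io (s [^]\<^bsub>M\<^esub> n \<otimes>\<^bsub>M\<^esub> f [^]\<^bsub>M\<^esub> m) = io (s [^]\<^bsub>M\<^esub> m \<otimes>\<^bsub>M\<^esub> r)"
    proof -
      have "io (s [^]\<^bsub>M\<^esub> n \<otimes>\<^bsub>M\<^esub> f [^]\<^bsub>M\<^esub> m) = io s [^]\<^bsub>L\<^esub> n \<otimes>\<^bsub>L\<^esub> (io s \<otimes>\<^bsub>L\<^esub> x) [^]\<^bsub>L\<^esub> m" using fs(1,2) by (simp add: io_simps(4) io_pow xs)
      also have "\<dots> = io s [^]\<^bsub>L\<^esub> m \<otimes>\<^bsub>L\<^esub> (io s [^]\<^bsub>L\<^esub> n \<otimes>\<^bsub>L\<^esub> x [^]\<^bsub>L\<^esub> m)" using fs(2) xL by (simp add: D.Q.nat_pow_distrib D.Q.m_ac)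
      also have "\<dots> = io (s [^]\<^bsub>M\<^esub> m \<otimes>\<^bsub>M\<^esub> r)" unfolding r(2) using fs(2) r(1) by (simp add: io_simps(4) io_pow)
      finally show ?thesis .
    qed
    then have "s [^]\<^bsub>M\<^esub> n \<otimes>\<^bsub>M\<^esub> f [^]\<^bsub>M\<^esub> m = s [^]\<^bsub>M\<^esub> m \<otimes>\<^bsub>M\<^esub> r" using io_eq_iff fs(1,2) r(1) by simp
    then show "\<exists>r\<in>carrier M. s [^]\<^bsub>M\<^esub> n \<otimes>\<^bsub>M\<^esub> f [^]\<^bsub>M\<^esub> m = s [^]\<^bsub>M\<^esub> m \<otimes>\<^bsub>M\<^esub> r" using r(1) by (rule bexI)
  qed
  then obtain g where g: "g \<in> carrier M" "f = s \<otimes>\<^bsub>M\<^esub> g" by blast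
  have "io s \<noteq> \<zero>\<^bsub>L\<^esub>" using io_inj fs by blast
  moreover have "io s \<otimes>\<^bsub>L\<^esub> x = io s \<otimes>\<^bsub>L\<^esub> io g" unfolding xs g(2) by (rule io_simps(4)[OF fs(2) g(1)])
  ultimately have "x = io g" using D.Q.m_lcancel[of "io s" x "io g"] fs(2) g(1) xL by simp
  then show ?thesis using g(1) by blast
qed

text \<open>The numerators satisfy \<open>X1^k f = X0^k g\<close> in \<open>M\<close>. Setting
  \<open>X0 = 0\<close> leaves \<open>X1^k\<close> unchanged, so one factor \<open>X0\<close> after
  another can be moved out of \<open>f\<close>.\<close>

lemma coprime_denominators:
  assumes x: "x \<in> carrier L" and c: "gen 0 [^]\<^bsub>L\<^esub> (k::nat) \<otimes>\<^bsub>L\<^esub> x \<in> R0" and y: "gen 1 [^]\<^bsub>L\<^esub> k \<otimes>\<^bsub>L\<^esub> x \<in> R0"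
  shows "x \<in> R0"
proof -
  obtain f where f: "gen 0 [^]\<^bsub>L\<^esub> k \<otimes>\<^bsub>L\<^esub> x = io f" "f \<in> carrier M" using c by (rule imageE)
  obtain g where g: "gen 1 [^]\<^bsub>L\<^esub> k \<otimes>\<^bsub>L\<^esub> x = io g" "g \<in> carrier M" using y by (rule imageE)
  note fg = f(2) g(2) f(1) g(1)
  have X: "Var 0 \<in> carrier M" "Var 1 \<in> carrier M" by (simp_all add: X_closed)
  have "io (Var 1 [^]\<^bsub>M\<^esub> k \<otimes>\<^bsub>M\<^esub> f) = gen 1 [^]\<^bsub>L\<^esub> k \<otimes>\<^bsub>L\<^esub> (gen 0 [^]\<^bsub>L\<^esub> k \<otimes>\<^bsub>L\<^esub> x)"
    using fg(1) X by (simp add: io_simps(4) io_pow io_Var fg(3))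
  also have "\<dots> = gen 0 [^]\<^bsub>L\<^esub> k \<otimes>\<^bsub>L\<^esub> (gen 1 [^]\<^bsub>L\<^esub> k \<otimes>\<^bsub>L\<^esub> x)" using x by (simp add: D.Q.m_lcomm)
  also have "\<dots> = io (Var 0 [^]\<^bsub>M\<^esub> k \<otimes>\<^bsub>M\<^esub> g)" unfolding fg(4) using fg(2) X by (simp add: io_simps(4) io_pow io_Var)
  finally have e: "Var 1 [^]\<^bsub>M\<^esub> k \<otimes>\<^bsub>M\<^esub> f = Var 0 [^]\<^bsub>M\<^esub> k \<otimes>\<^bsub>M\<^esub> g" using io_eq_iff fg X by simp
  have Y: "Var 1 [^]\<^bsub>M\<^esub> n \<in> carrier M" "Var 1 [^]\<^bsub>M\<^esub> n \<noteq> \<zero>\<^bsub>M\<^esub>" "set_zero 0 (Var 1 [^]\<^bsub>M\<^esub> n) = Var 1 [^]\<^bsub>M\<^esub> n" for n :: nat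
  proof -
    show "Var 1 [^]\<^bsub>M\<^esub> n \<in> carrier M" using X by simp
    show "Var 1 [^]\<^bsub>M\<^esub> n \<noteq> \<zero>\<^bsub>M\<^esub>" by (induction n) (use X Var_nz in \<open>simp_all add: M.integral_iff\<close>)
    show "set_zero 0 (Var 1 [^]\<^bsub>M\<^esub> n) = Var 1 [^]\<^bsub>M\<^esub> n"
    proof (induction n)
      case (Suc n)
      have "set_zero 0 (Var 1 [^]\<^bsub>M\<^esub> n \<otimes>\<^bsub>M\<^esub> Var 1) = set_zero 0 (Var 1 [^]\<^bsub>M\<^esub> n) \<otimes>\<^bsub>M\<^esub> set_zero 0 (Var 1)"
        using X by (intro ring_hom_mult[OF set_zero_hom]) simp_all
      then show ?case unfolding Suc M.nat_pow_Suc by (simp add: set_zero_X)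
    qed (use ring_hom_one[OF set_zero_hom] in simp)
  qed
  have "\<exists>h\<in>carrier M. f = Var 0 [^]\<^bsub>M\<^esub> l \<otimes>\<^bsub>M\<^esub> h" if "f \<in> carrier M" "g \<in> carrier M" "Var 1 [^]\<^bsub>M\<^esub> k \<otimes>\<^bsub>M\<^esub> f = Var 0 [^]\<^bsub>M\<^esub> l \<otimes>\<^bsub>M\<^esub> g"
    for f g and l :: nat
    using that
  proof (induction l arbitrary: f)
    case 0
    then show ?case by simp
  next
    case (Suc l)
    have r: "Var 0 [^]\<^bsub>M\<^esub> l \<otimes>\<^bsub>M\<^esub> g \<in> carrier M" using X Suc.prems by simp
    have e': "Var 1 [^]\<^bsub>M\<^esub> k \<otimes>\<^bsub>M\<^esub> f = Var 0 \<otimes>\<^bsub>M\<^esub> (Var 0 [^]\<^bsub>M\<^esub> l \<otimes>\<^bsub>M\<^esub> g)" using Suc.prems X by (simp add: M.m_ac)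
    have "set_zero 0 (Var 1 [^]\<^bsub>M\<^esub> k \<otimes>\<^bsub>M\<^esub> f) = \<zero>\<^bsub>M\<^esub>"
    proof (subst set_zero_eq_zero_iff)
      show "Var 1 [^]\<^bsub>M\<^esub> k \<otimes>\<^bsub>M\<^esub> f \<in> carrier M" by (rule M.m_closed[OF Y(1) Suc.prems(1)])
      show "\<exists>h\<in>carrier M. Var 1 [^]\<^bsub>M\<^esub> k \<otimes>\<^bsub>M\<^esub> f = Var 0 \<otimes>\<^bsub>M\<^esub> h" using e' r by (rule bexI)
    qed simp
    then have "Var 1 [^]\<^bsub>M\<^esub> k \<otimes>\<^bsub>M\<^esub> set_zero 0 f = \<zero>\<^bsub>M\<^esub>"
      using ring_hom_mult[OF set_zero_hom Y(1) Suc.prems(1), of 0 k] Y(3)[of k] by simp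
    then have "set_zero 0 f = \<zero>\<^bsub>M\<^esub>"
      using M.integral[OF _ Y(1) set_zero_closed[OF Suc.prems(1)]] Y(2) by blast
    then obtain h where h: "h \<in> carrier M" "f = Var 0 \<otimes>\<^bsub>M\<^esub> h" using set_zero_eq_zero_iff[OF Suc.prems(1), of 0] by auto
    have "Var 0 \<otimes>\<^bsub>M\<^esub> (Var 1 [^]\<^bsub>M\<^esub> k \<otimes>\<^bsub>M\<^esub> h) = Var 0 \<otimes>\<^bsub>M\<^esub> (Var 0 [^]\<^bsub>M\<^esub> l \<otimes>\<^bsub>M\<^esub> g)"
      using e' X h(1) Y(1)[of k] unfolding h(2) by (simp add: M.m_lcomm)
    then have "Var 1 [^]\<^bsub>M\<^esub> k \<otimes>\<^bsub>M\<^esub> h = Var 0 [^]\<^bsub>M\<^esub> l \<otimes>\<^bsub>M\<^esub> g"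
      using M.m_lcancel[of "Var 0" "Var 1 [^]\<^bsub>M\<^esub> k \<otimes>\<^bsub>M\<^esub> h" "Var 0 [^]\<^bsub>M\<^esub> l \<otimes>\<^bsub>M\<^esub> g"] Var_nz X h(1) r Y(1)[of k] by simp
    then obtain h' where h': "h' \<in> carrier M" "h = Var 0 [^]\<^bsub>M\<^esub> l \<otimes>\<^bsub>M\<^esub> h'" using Suc.IH[OF h(1) Suc.prems(2)] by auto
    have "f = Var 0 [^]\<^bsub>M\<^esub> Suc l \<otimes>\<^bsub>M\<^esub> h'" unfolding h(2) h'(2) using X h'(1) by (simp add: M.m_ac)
    then show ?case using h'(1) by (rule bexI)
  qed
  from this[OF fg(1,2) e]
  obtain h where h: "h \<in> carrier M" "f = Var 0 [^]\<^bsub>M\<^esub> k \<otimes>\<^bsub>M\<^esub> h" by blast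
  have "gen 0 [^]\<^bsub>L\<^esub> k \<otimes>\<^bsub>L\<^esub> x = gen 0 [^]\<^bsub>L\<^esub> k \<otimes>\<^bsub>L\<^esub> io h"
    unfolding fg(3) h(2) using h(1) X by (simp add: io_simps(4) io_pow io_Var)
  then have "x = io h"
    using D.Q.m_lcancel[of "gen 0 [^]\<^bsub>L\<^esub> k" x "io h"] L_pow_nz[of "gen 0" k] gen_places(4)[of 0] x h(1) by simp
  then show ?thesis using h(1) by blast
qed

lemma p_th_power_place:
  assumes s: "s \<in> Oi 0" and b: "b \<in> Oi 0" and e: "s [^]\<^bsub>L\<^esub> p \<otimes>\<^bsub>L\<^esub> au \<ominus>\<^bsub>L\<^esub> b [^]\<^bsub>L\<^esub> p \<in> mi 0"
  shows "s \<in> mi 0"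
proof (rule ccontr)
  assume "s \<notin> mi 0"
  then have nz: "res 0 s \<noteq> \<zero>\<^bsub>L\<^esub>" using s by (simp add: mi_def)
  have sc: "res 0 s \<in> carrier L" "res 0 b \<in> carrier L" using res_closed s b by auto
  have u: "au \<in> Oi 0" "res 0 au = au" using fx0(6) fx_D by auto
  have "res 0 (s [^]\<^bsub>L\<^esub> p \<otimes>\<^bsub>L\<^esub> au \<ominus>\<^bsub>L\<^esub> b [^]\<^bsub>L\<^esub> p) = res 0 s [^]\<^bsub>L\<^esub> p \<otimes>\<^bsub>L\<^esub> au \<ominus>\<^bsub>L\<^esub> res 0 b [^]\<^bsub>L\<^esub> p"
    using s b u by (simp add: res_minus res_simps Oi_closed Oi_pow)
  then have "res 0 s [^]\<^bsub>L\<^esub> p \<otimes>\<^bsub>L\<^esub> au \<ominus>\<^bsub>L\<^esub> res 0 b [^]\<^bsub>L\<^esub> p = \<zero>\<^bsub>L\<^esub>" using e by (simp add: mi_def)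
  then have "res 0 s [^]\<^bsub>L\<^esub> p \<otimes>\<^bsub>L\<^esub> au = res 0 b [^]\<^bsub>L\<^esub> p" using sc by (simp add: D.Q.r_right_minus_eq)
  moreover have "res 0 s [^]\<^bsub>L\<^esub> p \<otimes>\<^bsub>L\<^esub> (res 0 b \<otimes>\<^bsub>L\<^esub> inv\<^bsub>L\<^esub> res 0 s) [^]\<^bsub>L\<^esub> p = res 0 b [^]\<^bsub>L\<^esub> p"
  proof -
    have i: "inv\<^bsub>L\<^esub> res 0 s \<in> carrier L" "res 0 s \<otimes>\<^bsub>L\<^esub> inv\<^bsub>L\<^esub> res 0 s = \<one>\<^bsub>L\<^esub>" using L_inv[OF sc(1) nz] by auto
    have "res 0 s [^]\<^bsub>L\<^esub> p \<otimes>\<^bsub>L\<^esub> (res 0 b \<otimes>\<^bsub>L\<^esub> inv\<^bsub>L\<^esub> res 0 s) [^]\<^bsub>L\<^esub> p = ((res 0 s \<otimes>\<^bsub>L\<^esub> inv\<^bsub>L\<^esub> res 0 s) \<otimes>\<^bsub>L\<^esub> res 0 b) [^]\<^bsub>L\<^esub> p"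
      using sc i(1) by (simp add: D.Q.nat_pow_distrib[symmetric] D.Q.m_ac)
    then show ?thesis unfolding i(2) using sc by simp
  qed
  ultimately have "(res 0 b \<otimes>\<^bsub>L\<^esub> inv\<^bsub>L\<^esub> res 0 s) [^]\<^bsub>L\<^esub> p = au"
    using D.Q.m_lcancel[of "res 0 s [^]\<^bsub>L\<^esub> p" "(res 0 b \<otimes>\<^bsub>L\<^esub> inv\<^bsub>L\<^esub> res 0 s) [^]\<^bsub>L\<^esub> p" au] L_pow_nz[OF sc(1) nz, of p]
      sc L_inv(1)[OF sc(1) nz] by simp
  then show False using au_no_root sc L_inv(1)[OF sc(1) nz] by simp
qed

text \<open>The Artin-Schreier equation multiplied by \<open>c^(p*p)\<close>: the element
  \<open>c^p v\<close> is a root of \<open>T^p - c^(p*p-p) T - (c^p x)^p u\<close>, which is monic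
  over the base ring.\<close>

lemma scaled_root_integral:
  assumes v: "v \<in> carrier L" and x: "x \<in> carrier L" "ac [^]\<^bsub>L\<^esub> p \<otimes>\<^bsub>L\<^esub> x \<in> R0" and e: "x [^]\<^bsub>L\<^esub> p \<otimes>\<^bsub>L\<^esub> au = v [^]\<^bsub>L\<^esub> p \<ominus>\<^bsub>L\<^esub> v"
  shows "ac [^]\<^bsub>L\<^esub> p \<otimes>\<^bsub>L\<^esub> v \<in> carrier R0.A"
    "(ac [^]\<^bsub>L\<^esub> p \<otimes>\<^bsub>L\<^esub> v) [^]\<^bsub>L\<^esub> p = (ac [^]\<^bsub>L\<^esub> p \<otimes>\<^bsub>L\<^esub> x) [^]\<^bsub>L\<^esub> p \<otimes>\<^bsub>L\<^esub> au \<oplus>\<^bsub>L\<^esub> ac [^]\<^bsub>L\<^esub> (p * p - p) \<otimes>\<^bsub>L\<^esub> (ac [^]\<^bsub>L\<^esub> p \<otimes>\<^bsub>L\<^esub> v)"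
proof -
  let ?C = "ac [^]\<^bsub>L\<^esub> p" and ?N = "ac [^]\<^bsub>L\<^esub> (p * p - p)"
  have p2: "p \<ge> 2" using p_gt1 by simp
  have N: "?C [^]\<^bsub>L\<^esub> p = ?N \<otimes>\<^bsub>L\<^esub> ?C" using p2 by (simp add: D.Q.nat_pow_pow D.Q.nat_pow_mult)
  have ve: "v [^]\<^bsub>L\<^esub> p = v \<oplus>\<^bsub>L\<^esub> x [^]\<^bsub>L\<^esub> p \<otimes>\<^bsub>L\<^esub> au"
    unfolding e using v D.Q.nat_pow_closed[OF v, of p] by (elim D.Q.rep_cases) (simp add: D.Q.rep_hom algebra_simps)
  have "(?C \<otimes>\<^bsub>L\<^esub> v) [^]\<^bsub>L\<^esub> p = ?C [^]\<^bsub>L\<^esub> p \<otimes>\<^bsub>L\<^esub> v \<oplus>\<^bsub>L\<^esub> ?C [^]\<^bsub>L\<^esub> p \<otimes>\<^bsub>L\<^esub> (x [^]\<^bsub>L\<^esub> p \<otimes>\<^bsub>L\<^esub> au)"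
    using v x(1) by (simp add: D.Q.nat_pow_distrib ve D.Q.r_distr)
  also have "\<dots> = ?N \<otimes>\<^bsub>L\<^esub> (?C \<otimes>\<^bsub>L\<^esub> v) \<oplus>\<^bsub>L\<^esub> (?C \<otimes>\<^bsub>L\<^esub> x) [^]\<^bsub>L\<^esub> p \<otimes>\<^bsub>L\<^esub> au"
    using v x(1) by (simp add: D.Q.nat_pow_distrib D.Q.m_assoc[symmetric] N)
  finally show rel: "(?C \<otimes>\<^bsub>L\<^esub> v) [^]\<^bsub>L\<^esub> p = (?C \<otimes>\<^bsub>L\<^esub> x) [^]\<^bsub>L\<^esub> p \<otimes>\<^bsub>L\<^esub> au \<oplus>\<^bsub>L\<^esub> ?N \<otimes>\<^bsub>L\<^esub> (?C \<otimes>\<^bsub>L\<^esub> v)"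
    using v x(1) by (simp add: D.Q.a_comm)
  let ?w = "?C \<otimes>\<^bsub>L\<^esub> v" and ?r = "(?C \<otimes>\<^bsub>L\<^esub> x) [^]\<^bsub>L\<^esub> p \<otimes>\<^bsub>L\<^esub> au"
  have c: "?w \<in> carrier L" "?r \<in> carrier L" "?N \<in> carrier L" using v x(1) by simp_all
  have R: "?N \<in> R0" "?r \<in> R0" using gen_R0[of 0] gen_R0[of 3] x(2) by (auto simp: gen_def intro!: R0_closed(4) R0_pow)
  show "?w \<in> carrier R0.A"
  proof (rule R0.A_I[OF c(1)])
    let ?as = "replicate (p - 2) \<zero>\<^bsub>L\<^esub> @ [\<ominus>\<^bsub>L\<^esub> ?N, \<ominus>\<^bsub>L\<^esub> ?r]"
    show "set ?as \<subseteq> R0" using R R0_closed(1,3) by auto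
    have "D.Q.eval (\<one>\<^bsub>L\<^esub> # ?as) ?w = \<one>\<^bsub>L\<^esub> \<otimes>\<^bsub>L\<^esub> ?w [^]\<^bsub>L\<^esub> (p - 2 + length [\<ominus>\<^bsub>L\<^esub> ?N, \<ominus>\<^bsub>L\<^esub> ?r]) \<oplus>\<^bsub>L\<^esub> D.Q.eval [\<ominus>\<^bsub>L\<^esub> ?N, \<ominus>\<^bsub>L\<^esub> ?r] ?w"
      using c by (intro D.Q.eval_sparse) auto
    also have "p - 2 + length [\<ominus>\<^bsub>L\<^esub> ?N, \<ominus>\<^bsub>L\<^esub> ?r] = p" using p2 by simp
    also have "\<one>\<^bsub>L\<^esub> \<otimes>\<^bsub>L\<^esub> ?w [^]\<^bsub>L\<^esub> p = ?r \<oplus>\<^bsub>L\<^esub> ?N \<otimes>\<^bsub>L\<^esub> ?w" unfolding rel[symmetric] using c by simp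
    also have "D.Q.eval [\<ominus>\<^bsub>L\<^esub> ?N, \<ominus>\<^bsub>L\<^esub> ?r] ?w = (\<ominus>\<^bsub>L\<^esub> ?N) \<otimes>\<^bsub>L\<^esub> ?w \<oplus>\<^bsub>L\<^esub> (\<ominus>\<^bsub>L\<^esub> ?r)" using c by simp
    also have "(?r \<oplus>\<^bsub>L\<^esub> ?N \<otimes>\<^bsub>L\<^esub> ?w) \<oplus>\<^bsub>L\<^esub> ((\<ominus>\<^bsub>L\<^esub> ?N) \<otimes>\<^bsub>L\<^esub> ?w \<oplus>\<^bsub>L\<^esub> (\<ominus>\<^bsub>L\<^esub> ?r)) = \<zero>\<^bsub>L\<^esub>"
      using c by (elim D.Q.rep_cases) (simp add: D.Q.rep_hom algebra_simps)
    finally show "D.Q.eval (\<one>\<^bsub>L\<^esub> # ?as) ?w = \<zero>\<^bsub>L\<^esub>" .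
  qed
qed

definition al where "al = ac [^]\<^bsub>L\<^esub> p \<otimes>\<^bsub>L\<^esub> ah"
definition be where "be = ac [^]\<^bsub>L\<^esub> p \<otimes>\<^bsub>L\<^esub> ak"
text \<open>The exponents here and in \<open>de\<close> are dictated by the relations to be met:
  \<open>c \<gamma> = c^(2p) g\<close>, and
  \<open>c^p \<delta> = c^(p*p-p) \<alpha>\<close>.\<close>

definition ga where "ga = ac [^]\<^bsub>L\<^esub> (2 * p - 1) \<otimes>\<^bsub>L\<^esub> ag"
definition de where "de = ac [^]\<^bsub>L\<^esub> (p * p - 2 * p) \<otimes>\<^bsub>L\<^esub> al"

lemma integral_elements:
  "al \<in> carrier R0.A" "be \<in> carrier R0.A" "cring R0.A \<Longrightarrow> ga \<in> carrier R0.A" "cring R0.A \<Longrightarrow> de \<in> carrier R0.A"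
  "gen 2 \<otimes>\<^bsub>L\<^esub> al = gen 1 \<otimes>\<^bsub>L\<^esub> be \<oplus>\<^bsub>L\<^esub> gen 0 \<otimes>\<^bsub>L\<^esub> ga" "al [^]\<^bsub>L\<^esub> p = gen 1 [^]\<^bsub>L\<^esub> p \<otimes>\<^bsub>L\<^esub> au \<oplus>\<^bsub>L\<^esub> gen 0 [^]\<^bsub>L\<^esub> p \<otimes>\<^bsub>L\<^esub> de"
proof -
  let ?C = "ac [^]\<^bsub>L\<^esub> p" and ?N = "ac [^]\<^bsub>L\<^esub> (p * p - 2 * p)"
  have p2: "p \<ge> 2" using p_gt1 by simp
  have pp: "p * p \<ge> 2 * p" using p2 by simp
  have g: "gen 0 = ac" "gen 1 = ?C \<otimes>\<^bsub>L\<^esub> aa" "gen 2 = ?C \<otimes>\<^bsub>L\<^esub> ab" "gen 3 = au" by (simp_all add: gen_def)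
  have gR: "ac \<in> R0" "?C \<otimes>\<^bsub>L\<^esub> aa \<in> R0" "?C \<otimes>\<^bsub>L\<^esub> ab \<in> R0" using gen_R0[of 0] gen_R0[of 1] gen_R0[of 2] unfolding g by simp_all
  have C2: "ac \<otimes>\<^bsub>L\<^esub> ac [^]\<^bsub>L\<^esub> (2 * p - 1) = ?C \<otimes>\<^bsub>L\<^esub> ?C"
  proof -
    have "ac \<otimes>\<^bsub>L\<^esub> ac [^]\<^bsub>L\<^esub> (2 * p - 1) = ac [^]\<^bsub>L\<^esub> (1 + (2 * p - 1))" using D.Q.nat_pow_mult[of ac 1 "2 * p - 1"] by simp
    also have "1 + (2 * p - 1) = p + p" using p2 by simp
    finally show ?thesis by (simp add: D.Q.nat_pow_mult)
  qed
  have E: "(ac [^]\<^bsub>L\<^esub> (2 * p - 1)) [^]\<^bsub>L\<^esub> p = ?N \<otimes>\<^bsub>L\<^esub> (?C [^]\<^bsub>L\<^esub> p \<otimes>\<^bsub>L\<^esub> ?C)"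
  proof -
    have "(2 * p - 1) * p = (p * p - 2 * p) + (p * p + p)" using pp by (simp add: diff_mult_distrib)
    then show ?thesis by (simp add: D.Q.nat_pow_pow D.Q.nat_pow_mult)
  qed
  have NC: "ac [^]\<^bsub>L\<^esub> (p * p - p) = ?C \<otimes>\<^bsub>L\<^esub> ?N"
  proof -
    have "p * p - p = p + (p * p - 2 * p)" using pp by simp
    then show ?thesis by (simp add: D.Q.nat_pow_mult)
  qed
  show al: "al \<in> carrier R0.A" unfolding al_def by (rule scaled_root_integral(1)[OF _ _ gR(2) au_relation(1)]) simp_all
  show be: "be \<in> carrier R0.A" unfolding be_def by (rule scaled_root_integral(1)[OF _ _ gR(3) au_relation(2)]) simp_all
  have alL: "al \<in> carrier L" "be \<in> carrier L" using al be R0.A_carr by auto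
  show "al [^]\<^bsub>L\<^esub> p = gen 1 [^]\<^bsub>L\<^esub> p \<otimes>\<^bsub>L\<^esub> au \<oplus>\<^bsub>L\<^esub> gen 0 [^]\<^bsub>L\<^esub> p \<otimes>\<^bsub>L\<^esub> de"
    unfolding g de_def using scaled_root_integral(2)[OF _ _ gR(2) au_relation(1)] alL
    unfolding al_def[symmetric] NC by (simp add: D.Q.m_assoc)
  show "gen 2 \<otimes>\<^bsub>L\<^esub> al = gen 1 \<otimes>\<^bsub>L\<^esub> be \<oplus>\<^bsub>L\<^esub> gen 0 \<otimes>\<^bsub>L\<^esub> ga"
  proof -
    have "gen 0 \<otimes>\<^bsub>L\<^esub> ga = (ac \<otimes>\<^bsub>L\<^esub> ac [^]\<^bsub>L\<^esub> (2 * p - 1)) \<otimes>\<^bsub>L\<^esub> ag" unfolding g ga_def by (simp add: D.Q.m_assoc)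
    also have "\<dots> = (?C \<otimes>\<^bsub>L\<^esub> ?C) \<otimes>\<^bsub>L\<^esub> (ab \<otimes>\<^bsub>L\<^esub> ah \<ominus>\<^bsub>L\<^esub> aa \<otimes>\<^bsub>L\<^esub> ak)" unfolding C2 hk_relation ..
    finally have 1: "gen 0 \<otimes>\<^bsub>L\<^esub> ga = (?C \<otimes>\<^bsub>L\<^esub> ?C) \<otimes>\<^bsub>L\<^esub> (ab \<otimes>\<^bsub>L\<^esub> ah \<ominus>\<^bsub>L\<^esub> aa \<otimes>\<^bsub>L\<^esub> ak)" .
    have c: "?C \<in> carrier L" "ab \<in> carrier L" "aa \<in> carrier L" "ah \<in> carrier L" "ak \<in> carrier L" by simp_all
    show ?thesis unfolding 1 unfolding g al_def be_def using c
      by (elim D.Q.rep_cases) (simp add: D.Q.rep_hom algebra_simps)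
  qed
  show "de \<in> carrier R0.A" if cr: "cring R0.A"
    unfolding de_def by (rule subringE(6)[OF R0.subring_A[OF cr] R0.B_sub_A[OF R0_pow[OF gR(1)]] al])
  \<comment> \<open>It suffices that the \<open>p\<close>-th power is integral. By the second
    relation between \<open>h\<close> and \<open>k\<close> it equals
    \<open>c^(p*p-2p) (z^p \<alpha> - y^p \<beta>)\<close>.\<close>
  show "ga \<in> carrier R0.A" if cr: "cring R0.A"
  proof (rule R0.integral_root)
    note sA = subringE(5,6,7)[OF R0.subring_A[OF cr]]
    note R_A = gR[THEN R0_pow, THEN R0.B_sub_A]
    have c: "?C \<in> carrier L" "ab [^]\<^bsub>L\<^esub> p \<in> carrier L" "aa [^]\<^bsub>L\<^esub> p \<in> carrier L" "ah \<in> carrier L" "ak \<in> carrier L" "?C [^]\<^bsub>L\<^esub> p \<in> carrier L" "?N \<in> carrier L"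
      by simp_all
    have "ga [^]\<^bsub>L\<^esub> p = (?N \<otimes>\<^bsub>L\<^esub> (?C [^]\<^bsub>L\<^esub> p \<otimes>\<^bsub>L\<^esub> ?C)) \<otimes>\<^bsub>L\<^esub> (ab [^]\<^bsub>L\<^esub> p \<otimes>\<^bsub>L\<^esub> ah \<ominus>\<^bsub>L\<^esub> aa [^]\<^bsub>L\<^esub> p \<otimes>\<^bsub>L\<^esub> ak)"
      unfolding ga_def hk_relation E[symmetric] by (simp add: D.Q.nat_pow_distrib)
    also have "\<dots> = ?N \<otimes>\<^bsub>L\<^esub> ((?C [^]\<^bsub>L\<^esub> p \<otimes>\<^bsub>L\<^esub> ab [^]\<^bsub>L\<^esub> p) \<otimes>\<^bsub>L\<^esub> (?C \<otimes>\<^bsub>L\<^esub> ah) \<oplus>\<^bsub>L\<^esub> (\<ominus>\<^bsub>L\<^esub> (?C [^]\<^bsub>L\<^esub> p \<otimes>\<^bsub>L\<^esub> aa [^]\<^bsub>L\<^esub> p)) \<otimes>\<^bsub>L\<^esub> (?C \<otimes>\<^bsub>L\<^esub> ak))"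
      using c by (elim D.Q.rep_cases) (simp add: D.Q.rep_hom algebra_simps)
    also have "\<dots> = ?N \<otimes>\<^bsub>L\<^esub> ((?C \<otimes>\<^bsub>L\<^esub> ab) [^]\<^bsub>L\<^esub> p \<otimes>\<^bsub>L\<^esub> al \<oplus>\<^bsub>L\<^esub> (\<ominus>\<^bsub>L\<^esub> ((?C \<otimes>\<^bsub>L\<^esub> aa) [^]\<^bsub>L\<^esub> p)) \<otimes>\<^bsub>L\<^esub> be)"
      unfolding al_def be_def by (simp add: D.Q.nat_pow_distrib)
    also have "\<dots> \<in> carrier R0.A"
      by (rule sA(2)[OF R_A(1) sA(3)[OF sA(2)[OF R_A(3) al] sA(2)[OF sA(1)[OF R_A(2)] be]]])
    finally show "ga [^]\<^bsub>L\<^esub> p \<in> carrier R0.A" .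
    show "ga \<in> carrier L" by (simp add: ga_def)
  qed (rule p_pos)
qed

theorem integral_closure_not_CM: "\<not> cohen_macaulay_ring R0.A"
proof -
  interpret W: wild_cover L R0 p "Oi 0" "mi 0" idx "\<lambda>(i, j). sg i j" "gen 0" "gen 1" "gen 2" au al be ga de qk
  proof (rule wild_cover.intro[OF R0.field_subring_axioms wild_cover_axioms.intro])
    show "Factorial_Ring.prime p" by (rule prime_p)
    show "add_pow L (int p) \<one>\<^bsub>L\<^esub> = \<zero>\<^bsub>L\<^esub>" by (rule L_char)
    show "subring (Oi 0) L" by (rule Oi_subring)
    show "R0 \<subseteq> Oi 0" using R0_place by blast
    show "D.Q.prime_of (Oi 0) (mi 0)" by (rule mi_prime)
    show "inv\<^bsub>L\<^esub> x \<in> mi 0" if "x \<in> carrier L" "x \<notin> Oi 0" for x by (rule Oi_valuation[OF _ that]) simp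
    show "finite idx" by simp
    show "\<exists>i\<in>idx. \<forall>x\<in>carrier L. (case i of (i, j) \<Rightarrow> sg i j) x = x"
      by (rule bexI[of _ "(0, 0)"]) (use p_pos sg_zero in auto)
    show "(case i of (i, j) \<Rightarrow> sg i j) \<in> ring_hom L L" for i using sg_hom by (cases i) simp
    show "(case i of (i, j) \<Rightarrow> sg i j) b = b" if "b \<in> R0" for i b using sg_io that by (cases i) auto
    show "(case i of (i, j) \<Rightarrow> sg i j) x \<in> Oi 0" if "x \<in> Oi 0" for i x using sg_place(1)[OF that] by (cases i) simp
    show "x \<in> mi 0" if "x \<in> Oi 0" "(case i of (i, j) \<Rightarrow> sg i j) x \<in> mi 0" for i x
      using sg_place(2)[OF that(1)] that(2) by (cases i) simp
    show "\<exists>\<pi>. bij_betw \<pi> idx idx \<and> (\<forall>i\<in>idx. \<forall>x\<in>carrier L.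
        (case j of (i, j) \<Rightarrow> sg i j) ((case i of (i, j) \<Rightarrow> sg i j) x) = (case \<pi> i of (i, j) \<Rightarrow> sg i j) x)" for j
    proof (cases j)
      case (Pair a b)
      \<comment> \<open>Addition of \<open>(a, b)\<close> modulo \<open>p\<close>; it permutes the
        representatives, and the translations do not see the reduction.\<close>
      let ?\<pi> = "\<lambda>(i, j). ((a + i) mod int p, (b + j) mod int p)"
      have "bij_betw ?\<pi> idx idx"
      proof (rule bij_betwI[where g = "\<lambda>(i, j). ((i - a) mod int p, (j - b) mod int p)"])
        show "?\<pi> \<in> idx \<rightarrow> idx" using p_pos by auto
        show "(\<lambda>(i, j). ((i - a) mod int p, (j - b) mod int p)) \<in> idx \<rightarrow> idx" using p_pos by auto
        have 1: "((l + v) mod int p - l) mod int p = v" "(l + (v - l) mod int p) mod int p = v" if "v \<in> {0..<int p}" for l v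
          using that by (simp_all add: mod_simps)
        show "(\<lambda>(i, j). ((i - a) mod int p, (j - b) mod int p)) (?\<pi> x) = x" if "x \<in> idx" for x
          using that 1 by auto
        show "?\<pi> ((\<lambda>(i, j). ((i - a) mod int p, (j - b) mod int p)) x) = x" if "x \<in> idx" for x
          using that 1 by auto
      qed
      moreover have "\<forall>i\<in>idx. \<forall>x\<in>carrier L.
        (case j of (i, j) \<Rightarrow> sg i j) ((case i of (i, j) \<Rightarrow> sg i j) x) = (case ?\<pi> i of (i, j) \<Rightarrow> sg i j) x"
        unfolding Pair by (auto simp: sg_comp sg_mod)
      ultimately show ?thesis by blast
    qed
    show "x \<in> R0" if "x \<in> carrier R0.A" "\<And>i. i \<in> idx \<Longrightarrow> (case i of (i, j) \<Rightarrow> sg i j) x = x" for x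
      using that by (intro K_integral_in_R0 fixed_in_K R0.A_carr) auto
    show "x \<in> R0" if "x \<in> carrier L" "gen 0 [^]\<^bsub>L\<^esub> k \<otimes>\<^bsub>L\<^esub> x \<in> R0" "gen 1 [^]\<^bsub>L\<^esub> k \<otimes>\<^bsub>L\<^esub> x \<in> R0" for x and k :: nat
      by (rule coprime_denominators[OF that])
    show "D.Q.prime_of R0 (qk i)" for i by (rule qk_prime)
    show "qk i \<subset> qk (Suc i)" if "i < 3" for i using that by (intro qk_strict) simp
    show "qk 0 = {\<zero>\<^bsub>L\<^esub>}" by (rule qk_0)
    show "\<exists>r1\<in>R0. \<exists>r2\<in>R0. \<exists>r3\<in>R0. x = gen 0 \<otimes>\<^bsub>L\<^esub> r1 \<oplus>\<^bsub>L\<^esub> gen 1 \<otimes>\<^bsub>L\<^esub> r2 \<oplus>\<^bsub>L\<^esub> gen 2 \<otimes>\<^bsub>L\<^esub> r3" if "x \<in> qk 3" for x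
      by (rule qk_3[OF that])
    show "gen 0 \<in> qk 3" using io_qk[OF X_closed[of 0], of 3] by (simp add: io_Var zeros_simps(5))
    show "b \<in> mi 0 \<longleftrightarrow> b \<in> qk 3" if "b \<in> R0" for b using R0_place[OF that] by blast
    show "gen 0 \<in> R0" "gen 1 \<in> R0" "gen 2 \<in> R0" by (simp_all only: gen_R0)
    show "au \<in> R0" using gen_R0[of 3] by (simp add: gen_def)
    show "gen 0 \<noteq> \<zero>\<^bsub>L\<^esub>" "gen 1 \<noteq> \<zero>\<^bsub>L\<^esub>" using gen_places(4) by simp_all
    show "s \<in> mi 0" if "s \<in> Oi 0" "b \<in> Oi 0" "s [^]\<^bsub>L\<^esub> p \<otimes>\<^bsub>L\<^esub> au \<ominus>\<^bsub>L\<^esub> b [^]\<^bsub>L\<^esub> p \<in> mi 0" for s b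
      by (rule p_th_power_place[OF that])
  qed (rule integral_elements; assumption)+
  show ?thesis by (rule W.not_CM)
qed

end

theorem theorem2p2:
  fixes p :: nat
  assumes "Factorial_Ring.prime p"
  shows "\<exists>n (L :: (((nat multiset \<Rightarrow> int) \<times> (nat multiset \<Rightarrow> int)) set) ring) \<iota>.
    let R = mpoly_ring (residue_ring (int p)) n in
      elementary_abelian_extension_p2 p (fraction_field R) L \<iota> \<and>
      \<not> cohen_macaulay_ring (integral_closure L (\<iota> ` to_fraction_field R ` carrier R))"
proof -
  interpret fp_mpoly4 p by unfold_locales (rule assms)
  have "to_fraction_field M f = em f" for f by (simp add: to_fraction_field_def)
  \<comment> \<open>Under \<open>iot\<close> the canonical copy of the base ring in its fraction
    field becomes \<open>R0\<close>, over which the integral closure was formed.\<close>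
  then have "iot ` to_fraction_field M ` carrier M = R0" by (simp add: image_image iot_em)
  then show ?thesis
    using elementary_abelian integral_closure_not_CM unfolding Let_def L_eq[symmetric]
    by (intro exI[of _ 4] exI[of _ L] exI[of _ iot]) (simp add: L_eq)
qed

end
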